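(* If $X$ and $Y$ are objects of a semi-abelian category $\mathcal X$, then their bilinear product $X\otimes_{\mathcal X}Y$ is isomorphic to the quotient $(X\diamond Y)/N_{X,Y}$ of the cosmash product $X\diamond Y$ by the normal subobject $N_{X,Y}$. In other words, there is a short exact sequence $$0\to N_{X,Y}\to X\diamond Y\xrightarrow{\eta_{X,Y}}X\otimes_{\mathcal X}Y\to0.$$
   Context: A semi-abelian category is a pointed, Barr-exact, Bourn-protomodular category with finite coproducts. The cosmash product $X\diamond Y$ is the kernel $\iota_{X,Y}$ of the canonical morphism $X+Y\to X\times Y$; the ternary cosmash product $X\diamond Y\diamond Z$ is the kernel $\iota_{X,Y,Z}$ of the canonical morphism $X+Y+Z\to(X+Y)\times(X+Z)\times(Y+Z)$ whose components kill $Z$, $Y$, $X$ respectively. The commutator $[X,X,X]$ is the image of $X\diamond X\diamond X\to X+X+X\to X$ (the last arrow being the codiagonal). $X$ is two-nilpotent if $[X,X,X]=0$; the two-nilpotent objects form a full reflective subcategory $\mathsf{Nil}_2(\mathcal X)$, itself semi-abelian, with reflector $\mathrm{nil}_2(X)=X/[X,X,X]$. The bilinear product $X\otimes_{\mathcal X}Y$ is the cosmash product of $\mathrm{nil}_2(X)$ and $\mathrm{nil}_2(Y)$ computed in $\mathsf{Nil}_2(\mathcal X)$. The folding operations $S_{1,2}^{X,Y}\colon X\diamond Y\diamond Y\to X\diamond Y$ and $S_{2,1}^{X,Y}\colon X\diamond X\diamond Y\to X\diamond Y$ are the morphisms such that $\iota_{X,Y}\circ S_{1,2}^{X,Y}=(1_X+\nabla_Y)\circ\iota_{X,Y,Y}$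 and $\iota_{X,Y}\circ S_{2,1}^{X,Y}=(\nabla_X+1_Y)\circ\iota_{X,X,Y}$, where $\nabla$ denotes codiagonals. Their images are normal subobjects of $X\diamond Y$, and $N_{X,Y}$ is the join of these two images in $X\diamond Y$ (again a normal subobject). The morphism $\eta_{X,Y}$ is the one induced by the reflection unit $X+Y\to\mathrm{nil}_2(X+Y)$, where $\mathrm{nil}_2(X+Y)$ is the coproduct of $\mathrm{nil}_2(X)$ and $\mathrm{nil}_2(Y)$ in $\mathsf{Nil}_2(\mathcal X)$. *)

theory Defs
  imports Main
begin

section \<open>Categories\<close>

record ('o, 'a) category =
  Obj :: "'o set"
  Arr :: "'a set"
  Dom :: "'a \<Rightarrow> 'o"
  Cod :: "'a \<Rightarrow> 'o"
  Id :: "'o \<Rightarrow> 'a"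
  Comp :: "'a \<Rightarrow> 'a \<Rightarrow> 'a"  (infixr "\<cdot>\<index>" 70)

definition hom :: "('o, 'a) category \<Rightarrow> 'o \<Rightarrow> 'o \<Rightarrow> 'a set" where
  "hom C A B = {f \<in> Arr C. Dom C f = A \<and> Cod C f = B}"

text \<open>Composition is written in the usual order: \<open>g \<cdot> f\<close> is \<open>g\<close> after \<open>f\<close>. Its value is
  unspecified on pairs that are not composable.\<close>

locale category =
  fixes C :: "('o, 'a) category" (structure)
  assumes Dom_in_Obj: "f \<in> Arr C \<Longrightarrow> Dom C f \<in> Obj C"
    and Cod_in_Obj: "f \<in> Arr C \<Longrightarrow> Cod C f \<in> Obj C"
    and Id_in_hom: "A \<in> Obj C \<Longrightarrow> Id C A \<in> hom C A A"
    and Comp_in_hom: "f \<in> hom C A B \<Longrightarrow> g \<in> hom C B D \<Longrightarrow> g \<cdot> f \<in> hom C A D"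
    and Comp_assoc: "f \<in> hom C A B \<Longrightarrow> g \<in> hom C B D \<Longrightarrow> h \<in> hom C D E \<Longrightarrow>
      (h \<cdot> g) \<cdot> f = h \<cdot> (g \<cdot> f)"
    and Comp_Id: "f \<in> hom C A B \<Longrightarrow> f \<cdot> Id C A = f"
    and Id_Comp: "f \<in> hom C A B \<Longrightarrow> Id C B \<cdot> f = f"

definition is_iso :: "('o, 'a) category \<Rightarrow> 'a \<Rightarrow> bool" where
  "is_iso C f \<longleftrightarrow> f \<in> Arr C \<and>
    (\<exists>g \<in> hom C (Cod C f) (Dom C f).
      g \<cdot>\<^bsub>C\<^esub> f = Id C (Dom C f) \<and> f \<cdot>\<^bsub>C\<^esub> g = Id C (Cod C f))"

definition isomorphic :: "('o, 'a) category \<Rightarrow> 'o \<Rightarrow> 'o \<Rightarrow> bool" where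
  "isomorphic C A B \<longleftrightarrow> (\<exists>f \<in> hom C A B. is_iso C f)"

definition monic :: "('o, 'a) category \<Rightarrow> 'a \<Rightarrow> bool" where
  "monic C m \<longleftrightarrow> m \<in> Arr C \<and>
    (\<forall>T. \<forall>g \<in> hom C T (Dom C m). \<forall>h \<in> hom C T (Dom C m). m \<cdot>\<^bsub>C\<^esub> g = m \<cdot>\<^bsub>C\<^esub> h \<longrightarrow> g = h)"


section \<open>Limits and colimits\<close>

definition is_terminal :: "('o, 'a) category \<Rightarrow> 'o \<Rightarrow> bool" where
  "is_terminal C Z \<longleftrightarrow> Z \<in> Obj C \<and> (\<forall>A \<in> Obj C. \<exists>!f. f \<in> hom C A Z)"

definition is_initial :: "('o, 'a) category \<Rightarrow> 'o \<Rightarrow> bool" where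
  "is_initial C Z \<longleftrightarrow> Z \<in> Obj C \<and> (\<forall>A \<in> Obj C. \<exists>!f. f \<in> hom C Z A)"

definition is_zero :: "('o, 'a) category \<Rightarrow> 'o \<Rightarrow> bool" where
  "is_zero C Z \<longleftrightarrow> is_initial C Z \<and> is_terminal C Z"

definition is_product :: "('o, 'a) category \<Rightarrow> 'o \<Rightarrow> 'o \<Rightarrow> 'a \<Rightarrow> 'a \<Rightarrow> bool" where
  "is_product C A B p q \<longleftrightarrow> p \<in> hom C (Dom C p) A \<and> q \<in> hom C (Dom C p) B \<and>
    (\<forall>T. \<forall>f \<in> hom C T A. \<forall>g \<in> hom C T B.
      \<exists>!h. h \<in> hom C T (Dom C p) \<and> p \<cdot>\<^bsub>C\<^esub> h = f \<and> q \<cdot>\<^bsub>C\<^esub> h = g)"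

definition is_coproduct :: "('o, 'a) category \<Rightarrow> 'o \<Rightarrow> 'o \<Rightarrow> 'a \<Rightarrow> 'a \<Rightarrow> bool" where
  "is_coproduct C A B i j \<longleftrightarrow> i \<in> hom C A (Cod C i) \<and> j \<in> hom C B (Cod C i) \<and>
    (\<forall>T. \<forall>f \<in> hom C A T. \<forall>g \<in> hom C B T.
      \<exists>!h. h \<in> hom C (Cod C i) T \<and> h \<cdot>\<^bsub>C\<^esub> i = f \<and> h \<cdot>\<^bsub>C\<^esub> j = g)"

text \<open>\<open>is_pullback C f g p q\<close>: the square \<open>f \<cdot> p = g \<cdot> q\<close> is a pullback.\<close>

definition is_pullback :: "('o, 'a) category \<Rightarrow> 'a \<Rightarrow> 'a \<Rightarrow> 'a \<Rightarrow> 'a \<Rightarrow> bool" where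
  "is_pullback C f g p q \<longleftrightarrow> f \<in> Arr C \<and> g \<in> Arr C \<and> Cod C f = Cod C g \<and>
    p \<in> hom C (Dom C p) (Dom C f) \<and> q \<in> hom C (Dom C p) (Dom C g) \<and> f \<cdot>\<^bsub>C\<^esub> p = g \<cdot>\<^bsub>C\<^esub> q \<and>
    (\<forall>T. \<forall>a \<in> hom C T (Dom C f). \<forall>b \<in> hom C T (Dom C g). f \<cdot>\<^bsub>C\<^esub> a = g \<cdot>\<^bsub>C\<^esub> b \<longrightarrow>
      (\<exists>!h. h \<in> hom C T (Dom C p) \<and> p \<cdot>\<^bsub>C\<^esub> h = a \<and> q \<cdot>\<^bsub>C\<^esub> h = b))"

definition is_coequalizer :: "('o, 'a) category \<Rightarrow> 'a \<Rightarrow> 'a \<Rightarrow> 'a \<Rightarrow> bool" where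
  "is_coequalizer C f g q \<longleftrightarrow> f \<in> Arr C \<and> g \<in> hom C (Dom C f) (Cod C f) \<and>
    q \<in> hom C (Cod C f) (Cod C q) \<and> q \<cdot>\<^bsub>C\<^esub> f = q \<cdot>\<^bsub>C\<^esub> g \<and>
    (\<forall>T. \<forall>a \<in> hom C (Cod C f) T. a \<cdot>\<^bsub>C\<^esub> f = a \<cdot>\<^bsub>C\<^esub> g \<longrightarrow>
      (\<exists>!h. h \<in> hom C (Cod C q) T \<and> h \<cdot>\<^bsub>C\<^esub> q = a))"

definition regular_epi :: "('o, 'a) category \<Rightarrow> 'a \<Rightarrow> bool" where
  "regular_epi C q \<longleftrightarrow> (\<exists>f g. is_coequalizer C f g q)"


section \<open>Semi-abelian categories\<close>

definition pointed :: "('o, 'a) category \<Rightarrow> bool" where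
  "pointed C \<longleftrightarrow> (\<exists>Z. is_zero C Z)"

definition has_finite_coproducts :: "('o, 'a) category \<Rightarrow> bool" where
  "has_finite_coproducts C \<longleftrightarrow> (\<exists>Z. is_initial C Z) \<and>
    (\<forall>A \<in> Obj C. \<forall>B \<in> Obj C. \<exists>i j. is_coproduct C A B i j)"

text \<open>Finite limits are, as usual, given by a terminal object and pullbacks.\<close>

definition finitely_complete :: "('o, 'a) category \<Rightarrow> bool" where
  "finitely_complete C \<longleftrightarrow> (\<exists>Z. is_terminal C Z) \<and>
    (\<forall>f \<in> Arr C. \<forall>g \<in> Arr C. Cod C f = Cod C g \<longrightarrow> (\<exists>p q. is_pullback C f g p q))"

text \<open>The kernel pair of \<open>f\<close> is the pullback of \<open>f\<close> along itself.\<close>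

definition regular_category :: "('o, 'a) category \<Rightarrow> bool" where
  "regular_category C \<longleftrightarrow> finitely_complete C \<and>
    (\<forall>f p q. is_pullback C f f p q \<longrightarrow> (\<exists>e. is_coequalizer C p q e)) \<and>
    (\<forall>f g p q. is_pullback C f g p q \<longrightarrow> regular_epi C g \<longrightarrow> regular_epi C p)"

text \<open>In the last clause below, \<open>p\<close> and \<open>q\<close> are the projections of the object of composable
  pairs of the relation \<open>(d, e)\<close>.\<close>

definition equivalence_relation :: "('o, 'a) category \<Rightarrow> 'o \<Rightarrow> 'a \<Rightarrow> 'a \<Rightarrow> bool" where
  "equivalence_relation C X d e \<longleftrightarrow>
    d \<in> hom C (Dom C d) X \<and> e \<in> hom C (Dom C d) X \<and>
    (\<forall>T. \<forall>g \<in> hom C T (Dom C d). \<forall>h \<in> hom C T (Dom C d).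
      d \<cdot>\<^bsub>C\<^esub> g = d \<cdot>\<^bsub>C\<^esub> h \<longrightarrow> e \<cdot>\<^bsub>C\<^esub> g = e \<cdot>\<^bsub>C\<^esub> h \<longrightarrow> g = h) \<and>
    (\<exists>r \<in> hom C X (Dom C d). d \<cdot>\<^bsub>C\<^esub> r = Id C X \<and> e \<cdot>\<^bsub>C\<^esub> r = Id C X) \<and>
    (\<exists>s \<in> hom C (Dom C d) (Dom C d). d \<cdot>\<^bsub>C\<^esub> s = e \<and> e \<cdot>\<^bsub>C\<^esub> s = d) \<and>
    (\<forall>p q. is_pullback C e d p q \<longrightarrow>
      (\<exists>t \<in> hom C (Dom C p) (Dom C d). d \<cdot>\<^bsub>C\<^esub> t = d \<cdot>\<^bsub>C\<^esub> p \<and> e \<cdot>\<^bsub>C\<^esub> t = e \<cdot>\<^bsub>C\<^esub> q))"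

definition barr_exact :: "('o, 'a) category \<Rightarrow> bool" where
  "barr_exact C \<longleftrightarrow> regular_category C \<and>
    (\<forall>X d e. equivalence_relation C X d e \<longrightarrow> (\<exists>f. is_pullback C f f d e))"

text \<open>A point over \<open>B\<close> is a split epimorphism with codomain \<open>B\<close> together with a chosen section.
  Pulling back along \<open>v : E \<rightarrow> B\<close> is a functor from points over \<open>B\<close> to points over \<open>E\<close>;
  protomodularity says that all these change-of-base functors reflect isomorphisms. Below, \<open>h\<close> is
  the image under this functor of the morphism \<open>f\<close> from the point \<open>(p, s)\<close> to \<open>(p', s')\<close>.\<close>

definition is_point :: "('o, 'a) category \<Rightarrow> 'o \<Rightarrow> 'a \<Rightarrow> 'a \<Rightarrow> bool" where
  "is_point C B p s \<longleftrightarrow> p \<in> hom C (Dom C p) B \<and> s \<in> hom C B (Dom C p) \<and> p \<cdot>\<^bsub>C\<^esub> s = Id C B"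

definition protomodular :: "('o, 'a) category \<Rightarrow> bool" where
  "protomodular C \<longleftrightarrow>
    (\<forall>E B. \<forall>v \<in> hom C E B. \<forall>p s p' s' f a b a' b' h.
      is_point C B p s \<longrightarrow> is_point C B p' s' \<longrightarrow>
      f \<in> hom C (Dom C p) (Dom C p') \<longrightarrow> p' \<cdot>\<^bsub>C\<^esub> f = p \<longrightarrow> f \<cdot>\<^bsub>C\<^esub> s = s' \<longrightarrow>
      is_pullback C v p a b \<longrightarrow> is_pullback C v p' a' b' \<longrightarrow>
      h \<in> hom C (Dom C a) (Dom C a') \<longrightarrow> a' \<cdot>\<^bsub>C\<^esub> h = a \<longrightarrow> b' \<cdot>\<^bsub>C\<^esub> h = f \<cdot>\<^bsub>C\<^esub> b \<longrightarrow>
      is_iso C h \<longrightarrow> is_iso C f)"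

definition semi_abelian :: "('o, 'a) category \<Rightarrow> bool" where
  "semi_abelian C \<longleftrightarrow> category C \<and> pointed C \<and> barr_exact C \<and> protomodular C \<and>
    has_finite_coproducts C"


section \<open>Kernels, cokernels, images, joins\<close>

definition zero_arr :: "('o, 'a) category \<Rightarrow> 'o \<Rightarrow> 'o \<Rightarrow> 'a" where
  "zero_arr C A B = (THE f. \<exists>Z. is_zero C Z \<and> (\<exists>g \<in> hom C A Z. \<exists>h \<in> hom C Z B. f = h \<cdot>\<^bsub>C\<^esub> g))"

definition is_kernel :: "('o, 'a) category \<Rightarrow> 'a \<Rightarrow> 'a \<Rightarrow> bool" where
  "is_kernel C f k \<longleftrightarrow> f \<in> Arr C \<and> k \<in> hom C (Dom C k) (Dom C f) \<and>
    f \<cdot>\<^bsub>C\<^esub> k = zero_arr C (Dom C k) (Cod C f) \<and>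
    (\<forall>T. \<forall>g \<in> hom C T (Dom C f). f \<cdot>\<^bsub>C\<^esub> g = zero_arr C T (Cod C f) \<longrightarrow>
      (\<exists>!h. h \<in> hom C T (Dom C k) \<and> k \<cdot>\<^bsub>C\<^esub> h = g))"

definition is_cokernel :: "('o, 'a) category \<Rightarrow> 'a \<Rightarrow> 'a \<Rightarrow> bool" where
  "is_cokernel C f q \<longleftrightarrow> f \<in> Arr C \<and> q \<in> hom C (Cod C f) (Cod C q) \<and>
    q \<cdot>\<^bsub>C\<^esub> f = zero_arr C (Dom C f) (Cod C q) \<and>
    (\<forall>T. \<forall>g \<in> hom C (Cod C f) T. g \<cdot>\<^bsub>C\<^esub> f = zero_arr C (Dom C f) T \<longrightarrow>
      (\<exists>!h. h \<in> hom C (Cod C q) T \<and> h \<cdot>\<^bsub>C\<^esub> q = g))"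

definition short_exact :: "('o, 'a) category \<Rightarrow> 'a \<Rightarrow> 'a \<Rightarrow> bool" where
  "short_exact C k f \<longleftrightarrow> is_kernel C f k \<and> is_cokernel C k f"

text \<open>A subobject is represented by a monomorphism.\<close>

definition is_image :: "('o, 'a) category \<Rightarrow> 'a \<Rightarrow> 'a \<Rightarrow> bool" where
  "is_image C f m \<longleftrightarrow> monic C m \<and>
    (\<exists>e \<in> hom C (Dom C f) (Dom C m). regular_epi C e \<and> f = m \<cdot>\<^bsub>C\<^esub> e)"

definition sub_le :: "('o, 'a) category \<Rightarrow> 'a \<Rightarrow> 'a \<Rightarrow> bool" where
  "sub_le C m n \<longleftrightarrow> (\<exists>h \<in> hom C (Dom C m) (Dom C n). m = n \<cdot>\<^bsub>C\<^esub> h)"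

definition is_join :: "('o, 'a) category \<Rightarrow> 'a \<Rightarrow> 'a \<Rightarrow> 'a \<Rightarrow> bool" where
  "is_join C m n j \<longleftrightarrow> monic C j \<and> sub_le C m j \<and> sub_le C n j \<and>
    (\<forall>k. monic C k \<longrightarrow> sub_le C m k \<longrightarrow> sub_le C n k \<longrightarrow> sub_le C j k)"


section \<open>Chosen universal constructions\<close>

text \<open>From here on a representative of every universal construction is chosen once and for all.
  The ambient category \<open>C\<close> remains an explicit parameter, because the same constructions are
  also performed in the full subcategory of two-nilpotent objects, where the chosen
  representatives need not agree with those of \<open>C\<close>.\<close>

definition ker :: "('o, 'a) category \<Rightarrow> 'a \<Rightarrow> 'a" where
  "ker C f = (SOME k. is_kernel C f k)"

definition coker :: "('o, 'a) category \<Rightarrow> 'a \<Rightarrow> 'a" where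
  "coker C f = (SOME q. is_cokernel C f q)"

definition img :: "('o, 'a) category \<Rightarrow> 'a \<Rightarrow> 'a" where
  "img C f = (SOME m. is_image C f m)"

definition join :: "('o, 'a) category \<Rightarrow> 'a \<Rightarrow> 'a \<Rightarrow> 'a" where
  "join C m n = (SOME j. is_join C m n j)"

definition projs :: "('o, 'a) category \<Rightarrow> 'o \<Rightarrow> 'o \<Rightarrow> 'a \<times> 'a" where
  "projs C A B = (SOME pq. is_product C A B (fst pq) (snd pq))"

definition prd :: "('o, 'a) category \<Rightarrow> 'o \<Rightarrow> 'o \<Rightarrow> 'o" where
  "prd C A B = Dom C (fst (projs C A B))"

definition pair :: "('o, 'a) category \<Rightarrow> 'a \<Rightarrow> 'a \<Rightarrow> 'a" where
  "pair C f g = (THE h. h \<in> hom C (Dom C f) (prd C (Cod C f) (Cod C g)) \<and>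
    fst (projs C (Cod C f) (Cod C g)) \<cdot>\<^bsub>C\<^esub> h = f \<and> snd (projs C (Cod C f) (Cod C g)) \<cdot>\<^bsub>C\<^esub> h = g)"

definition injs :: "('o, 'a) category \<Rightarrow> 'o \<Rightarrow> 'o \<Rightarrow> 'a \<times> 'a" where
  "injs C A B = (SOME ij. is_coproduct C A B (fst ij) (snd ij))"

definition in1 :: "('o, 'a) category \<Rightarrow> 'o \<Rightarrow> 'o \<Rightarrow> 'a" where
  "in1 C A B = fst (injs C A B)"

definition in2 :: "('o, 'a) category \<Rightarrow> 'o \<Rightarrow> 'o \<Rightarrow> 'a" where
  "in2 C A B = snd (injs C A B)"

definition cop :: "('o, 'a) category \<Rightarrow> 'o \<Rightarrow> 'o \<Rightarrow> 'o" where
  "cop C A B = Cod C (in1 C A B)"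

definition copair :: "('o, 'a) category \<Rightarrow> 'a \<Rightarrow> 'a \<Rightarrow> 'a" where
  "copair C f g = (THE h. h \<in> hom C (cop C (Dom C f) (Dom C g)) (Cod C f) \<and>
    h \<cdot>\<^bsub>C\<^esub> in1 C (Dom C f) (Dom C g) = f \<and> h \<cdot>\<^bsub>C\<^esub> in2 C (Dom C f) (Dom C g) = g)"

text \<open>The ternary coproduct is \<open>(X + Y) + Z\<close>; \<open>copair3 C f g h\<close> is the morphism out of it with
  components \<open>f\<close>, \<open>g\<close> and \<open>h\<close>.\<close>

definition copair3 :: "('o, 'a) category \<Rightarrow> 'a \<Rightarrow> 'a \<Rightarrow> 'a \<Rightarrow> 'a" where
  "copair3 C f g h = copair C (copair C f g) h"


section \<open>Cosmash products\<close>

definition sum_to_prod :: "('o, 'a) category \<Rightarrow> 'o \<Rightarrow> 'o \<Rightarrow> 'a" where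
  "sum_to_prod C X Y =
    copair C (pair C (Id C X) (zero_arr C X Y)) (pair C (zero_arr C Y X) (Id C Y))"

definition cosmash_incl :: "('o, 'a) category \<Rightarrow> 'o \<Rightarrow> 'o \<Rightarrow> 'a" where
  "cosmash_incl C X Y = ker C (sum_to_prod C X Y)"

definition cosmash :: "('o, 'a) category \<Rightarrow> 'o \<Rightarrow> 'o \<Rightarrow> 'o" where
  "cosmash C X Y = Dom C (cosmash_incl C X Y)"

text \<open>The ternary product is \<open>((X + Y) \<times> (X + Z)) \<times> (Y + Z)\<close>; the three components below kill
  \<open>Z\<close>, \<open>Y\<close> and \<open>X\<close> respectively.\<close>

definition sum_to_prod3 :: "('o, 'a) category \<Rightarrow> 'o \<Rightarrow> 'o \<Rightarrow> 'o \<Rightarrow> 'a" where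
  "sum_to_prod3 C X Y Z =
    pair C
      (pair C
        (copair3 C (in1 C X Y) (in2 C X Y) (zero_arr C Z (cop C X Y)))
        (copair3 C (in1 C X Z) (zero_arr C Y (cop C X Z)) (in2 C X Z)))
      (copair3 C (zero_arr C X (cop C Y Z)) (in1 C Y Z) (in2 C Y Z))"

definition cosmash3_incl :: "('o, 'a) category \<Rightarrow> 'o \<Rightarrow> 'o \<Rightarrow> 'o \<Rightarrow> 'a" where
  "cosmash3_incl C X Y Z = ker C (sum_to_prod3 C X Y Z)"

definition cosmash3 :: "('o, 'a) category \<Rightarrow> 'o \<Rightarrow> 'o \<Rightarrow> 'o \<Rightarrow> 'o" where
  "cosmash3 C X Y Z = Dom C (cosmash3_incl C X Y Z)"


section \<open>Two-nilpotent objects\<close>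

text \<open>The inclusion of the ternary commutator \<open>[X, X, X]\<close> into \<open>X\<close>.\<close>

definition commutator3_incl :: "('o, 'a) category \<Rightarrow> 'o \<Rightarrow> 'a" where
  "commutator3_incl C X =
    img C (copair3 C (Id C X) (Id C X) (Id C X) \<cdot>\<^bsub>C\<^esub> cosmash3_incl C X X X)"

definition two_nilpotent :: "('o, 'a) category \<Rightarrow> 'o \<Rightarrow> bool" where
  "two_nilpotent C X \<longleftrightarrow> is_zero C (Dom C (commutator3_incl C X))"

definition Nil2 :: "('o, 'a) category \<Rightarrow> ('o, 'a) category" where
  "Nil2 C = C\<lparr>Obj := {X \<in> Obj C. two_nilpotent C X},
    Arr := {f \<in> Arr C. two_nilpotent C (Dom C f) \<and> two_nilpotent C (Cod C f)}\<rparr>"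

definition nil2_unit :: "('o, 'a) category \<Rightarrow> 'o \<Rightarrow> 'a" where
  "nil2_unit C X = coker C (commutator3_incl C X)"

definition nil2 :: "('o, 'a) category \<Rightarrow> 'o \<Rightarrow> 'o" where
  "nil2 C X = Cod C (nil2_unit C X)"

definition nil2_map :: "('o, 'a) category \<Rightarrow> 'a \<Rightarrow> 'a" where
  "nil2_map C f = (THE g. g \<in> hom C (nil2 C (Dom C f)) (nil2 C (Cod C f)) \<and>
    g \<cdot>\<^bsub>C\<^esub> nil2_unit C (Dom C f) = nil2_unit C (Cod C f) \<cdot>\<^bsub>C\<^esub> f)"


section \<open>The bilinear product and its presentation\<close>

definition bilinear_incl :: "('o, 'a) category \<Rightarrow> 'o \<Rightarrow> 'o \<Rightarrow> 'a" where
  "bilinear_incl C X Y = cosmash_incl (Nil2 C) (nil2 C X) (nil2 C Y)"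

definition bilinear_product :: "('o, 'a) category \<Rightarrow> 'o \<Rightarrow> 'o \<Rightarrow> 'o" where
  "bilinear_product C X Y = cosmash (Nil2 C) (nil2 C X) (nil2 C Y)"

text \<open>The folding operations. On \<open>(X + Y) + Y\<close> and \<open>(X + X) + Y\<close> respectively, the morphisms
  \<open>1\<^sub>X + \<nabla>\<^sub>Y\<close> and \<open>\<nabla>\<^sub>X + 1\<^sub>Y\<close> have components \<open>in1, in2, in2\<close> and
  \<open>in1, in1, in2\<close>.\<close>

definition fold12 :: "('o, 'a) category \<Rightarrow> 'o \<Rightarrow> 'o \<Rightarrow> 'a" where
  "fold12 C X Y = (THE s. s \<in> hom C (cosmash3 C X Y Y) (cosmash C X Y) \<and>
    cosmash_incl C X Y \<cdot>\<^bsub>C\<^esub> s =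
    copair3 C (in1 C X Y) (in2 C X Y) (in2 C X Y) \<cdot>\<^bsub>C\<^esub> cosmash3_incl C X Y Y)"

definition fold21 :: "('o, 'a) category \<Rightarrow> 'o \<Rightarrow> 'o \<Rightarrow> 'a" where
  "fold21 C X Y = (THE s. s \<in> hom C (cosmash3 C X X Y) (cosmash C X Y) \<and>
    cosmash_incl C X Y \<cdot>\<^bsub>C\<^esub> s =
    copair3 C (in1 C X Y) (in1 C X Y) (in2 C X Y) \<cdot>\<^bsub>C\<^esub> cosmash3_incl C X X Y)"

text \<open>The inclusion of \<open>N\<close> into the cosmash product of \<open>X\<close> and \<open>Y\<close>.\<close>

definition N_incl :: "('o, 'a) category \<Rightarrow> 'o \<Rightarrow> 'o \<Rightarrow> 'a" where
  "N_incl C X Y = join C (img C (fold12 C X Y)) (img C (fold21 C X Y))"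

text \<open>The identification of the chosen coproduct of \<open>nil2 X\<close> and \<open>nil2 Y\<close> in the subcategory of
  two-nilpotent objects with \<open>nil2 (X + Y)\<close>, whose coproduct injections are the reflections of
  those of \<open>X + Y\<close>. The morphism \<open>eta\<close> is the restriction of the unit
  \<open>X + Y \<rightarrow> nil2 (X + Y)\<close> to the cosmash products, under this identification.\<close>

definition nil2_coproduct :: "('o, 'a) category \<Rightarrow> 'o \<Rightarrow> 'o \<Rightarrow> 'a" where
  "nil2_coproduct C X Y = copair (Nil2 C) (nil2_map C (in1 C X Y)) (nil2_map C (in2 C X Y))"

definition eta :: "('o, 'a) category \<Rightarrow> 'o \<Rightarrow> 'o \<Rightarrow> 'a" where
  "eta C X Y = (THE e. e \<in> hom C (cosmash C X Y) (bilinear_product C X Y) \<and>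
    nil2_coproduct C X Y \<cdot>\<^bsub>C\<^esub> (bilinear_incl C X Y \<cdot>\<^bsub>C\<^esub> e) =
    nil2_unit C (cop C X Y) \<cdot>\<^bsub>C\<^esub> cosmash_incl C X Y)"

end

theory Submission
  imports Defs
begin

text \<open>
  Let \<open>S = X + Y\<close>. The images of the two folding operations are the subobjects \<open>[X, X, Y]\<close> and
  \<open>[X, Y, Y]\<close> of \<open>S\<close>. They are normal in \<open>S\<close>, being images of kernels under split epimorphisms, so
  their join is the kernel of a quotient \<open>q : S \<rightarrow> T\<close>. In \<open>T\<close> the objects \<open>[X, X, X]\<close> and
  \<open>[Y, Y, Y]\<close> are normal as well, because \<open>[X, X, Y]\<close> and \<open>[X, Y, Y]\<close> have been killed; dividing
  by them gives a two-nilpotent object, so that the composite factors through \<open>nil2 S\<close>. The last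
  quotient only divides out subobjects of \<open>X\<close> and of \<open>Y\<close> and hence is injective on the image of
  the cosmash product, which therefore meets \<open>[S, S, S]\<close> in \<open>N\<close> only. Conversely \<open>N\<close> is killed in
  \<open>nil2 S\<close>. Finally \<open>eta\<close> is a regular epimorphism because regular epimorphisms between objects
  with compatible commuting idempotents restrict to regular epimorphisms between the joint kernels
  of these idempotents.

  Arguments about subobjects use generalized elements \<open>w : U \<rightarrow> A\<close>: the element \<open>w\<close> lies in the
  subobject \<open>m\<close> iff \<open>sub_le C w m\<close>.
\<close>

section \<open>Categories with a zero object\<close>

text \<open>The obstacle is [S, S, S]: with S = X + Y it is the image of a cross-effect on a sum of
  three copies of X and three of Y. No formula for it is established; only arrows that might vanish
  on it are examined. To test such an arrow, the sixfold sum is cut by commuting idempotents that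
  kill single summands. Each of them may be assumed to act as zero or as the identity, and what
  remains is one test for each of the eight triples of summands X and Y. For this reason
  cross-effects are set up for sums over finite index sets.

  Protomodularity enters through one statement: a subobject that contains a section of a split
  epimorphism together with its kernel is everything. Monicity tests on kernels, the short five
  lemma, factorization through quotients and the Mal'tsev property all come from it. Effectiveness
  of equivalence relations is used once, to see that the image of a kernel under a regular
  epimorphism is a kernel.

  The chosen constructions of \<open>Nil2 C\<close> may differ from those of C, so the facts about
  chosen products and coproducts that both categories share are proved for pointed
  categories.\<close>

definition null :: "('o, 'a) category \<Rightarrow> 'a \<Rightarrow> bool" where
  "null C f \<longleftrightarrow> f \<in> Arr C \<and> f = zero_arr C (Dom C f) (Cod C f)"

context category begin

section \<open>Composition, monomorphisms, isomorphisms and generalized elements\<close>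

lemma in_hom [simp]: "f \<in> hom C A B \<longleftrightarrow> f \<in> Arr C \<and> Dom C f = A \<and> Cod C f = B"
  by (auto simp: hom_def)

lemma obj_simps [simp]:
  "f \<in> Arr C \<Longrightarrow> Dom C f \<in> Obj C" "f \<in> Arr C \<Longrightarrow> Cod C f \<in> Obj C"
  by (auto intro: Dom_in_Obj Cod_in_Obj)

lemma Id_simps [simp]:
  assumes "A \<in> Obj C"
  shows "Id C A \<in> Arr C" "Dom C (Id C A) = A" "Cod C (Id C A) = A"
  using Id_in_hom[OF assms] by auto

lemma comp_simps [simp]:
  assumes "f \<in> Arr C" "g \<in> Arr C" "Dom C g = Cod C f"
  shows "g \<cdot> f \<in> Arr C" "Dom C (g \<cdot> f) = Dom C f" "Cod C (g \<cdot> f) = Cod C g"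
  using Comp_in_hom[of f "Dom C f" "Cod C f" g "Cod C g"] assms by auto

lemma comp_assoc [simp]:
  assumes "f \<in> Arr C" "g \<in> Arr C" "h \<in> Arr C" "Dom C g = Cod C f" "Dom C h = Cod C g"
  shows "(h \<cdot> g) \<cdot> f = h \<cdot> (g \<cdot> f)"
  using Comp_assoc[of f "Dom C f" "Cod C f" g "Cod C g" h "Cod C h"] assms by auto

lemma comp_id [simp]: "f \<in> Arr C \<Longrightarrow> Dom C f = A \<Longrightarrow> f \<cdot> Id C A = f"
  using Comp_Id[of f "Dom C f" "Cod C f"] by auto

lemma id_comp [simp]: "f \<in> Arr C \<Longrightarrow> Cod C f = A \<Longrightarrow> Id C A \<cdot> f = f"
  using Id_Comp[of f "Dom C f" "Cod C f"] by auto

text \<open>Composites are kept nested to the right by \<open>comp_assoc\<close>, so the left side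
  of an equation for \<open>g \<cdot> f\<close> is hidden inside a longer chain. This form of
  associativity applies the equation there.\<close>

lemma comp_eq:
  assumes "g \<cdot> f = h" "f \<in> Arr C" "g \<in> Arr C" "Dom C g = Cod C f" "k \<in> Arr C" "Dom C f = Cod C k"
  shows "g \<cdot> (f \<cdot> k) = h \<cdot> k"
  using assms comp_assoc by metis

lemma monicD:
  assumes "monic C m" "m \<cdot> g = m \<cdot> h" "g \<in> Arr C" "h \<in> Arr C" "Dom C g = Dom C h"
    "Cod C g = Dom C m" "Cod C h = Dom C m"
  shows "g = h"
  using assms unfolding monic_def by auto

lemma monic_arr [simp]: "monic C m \<Longrightarrow> m \<in> Arr C"
  by (simp add: monic_def)

lemma monicI:
  assumes "m \<in> Arr C"
    and "\<And>g h. \<lbrakk>g \<in> Arr C; h \<in> Arr C; Dom C g = Dom C h; Cod C g = Dom C m; Cod C h = Dom C m;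
      m \<cdot> g = m \<cdot> h\<rbrakk> \<Longrightarrow> g = h"
  shows "monic C m"
  using assms unfolding monic_def by auto

lemma monic_comp:
  assumes "monic C m" "monic C n" "Dom C m = Cod C n"
  shows "monic C (m \<cdot> n)"
proof (rule monicI)
  show "m \<cdot> n \<in> Arr C" using assms by simp
next
  fix g h assume *: "g \<in> Arr C" "h \<in> Arr C" "Dom C g = Dom C h" "Cod C g = Dom C (m \<cdot> n)"
    "Cod C h = Dom C (m \<cdot> n)" "(m \<cdot> n) \<cdot> g = (m \<cdot> n) \<cdot> h"
  then have "m \<cdot> (n \<cdot> g) = m \<cdot> (n \<cdot> h)" using assms by simp
  then have "n \<cdot> g = n \<cdot> h" by (rule monicD[OF assms(1)]) (use * assms in simp_all)
  then show "g = h" by (rule monicD[OF assms(2)]) (use * assms in simp_all)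
qed

lemma split_monic:
  assumes "m \<in> Arr C" "r \<in> Arr C" "Dom C r = Cod C m" "r \<cdot> m = Id C (Dom C m)"
  shows "monic C m"
proof (rule monicI)
  fix g h assume *: "g \<in> Arr C" "h \<in> Arr C" "Dom C g = Dom C h" "Cod C g = Dom C m"
    "Cod C h = Dom C m" "m \<cdot> g = m \<cdot> h"
  show "g = h"
  proof -
    have "r \<cdot> (m \<cdot> g) = g" "r \<cdot> (m \<cdot> h) = h"
      using *(1-5) assms(1-3) by (simp_all add: comp_eq[OF assms(4)])
    then show ?thesis using *(6) by metis
  qed
qed (use assms in simp)

lemma iso_arr: "is_iso C f \<Longrightarrow> f \<in> Arr C"
  by (simp add: is_iso_def)

lemma isoE:
  assumes "is_iso C f"
  obtains g where "g \<in> Arr C" "Dom C g = Cod C f" "Cod C g = Dom C f"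
    "g \<cdot> f = Id C (Dom C f)" "f \<cdot> g = Id C (Cod C f)"
  using assms unfolding is_iso_def by auto

lemma isoI:
  assumes "f \<in> Arr C" "g \<in> Arr C" "Dom C g = Cod C f" "Cod C g = Dom C f"
    "g \<cdot> f = Id C (Dom C f)" "f \<cdot> g = Id C (Cod C f)"
  shows "is_iso C f"
  using assms unfolding is_iso_def by auto

lemma monic_split_epi_iso:
  assumes "monic C m" "s \<in> Arr C" "Cod C s = Dom C m" "m \<cdot> s = Id C (Cod C m)"
  shows "is_iso C m"
proof -
  have ds: "Dom C s = Cod C m"
    using arg_cong[OF assms(4), of "Dom C"] assms(1-3) by simp
  have "m \<cdot> (s \<cdot> m) = m \<cdot> Id C (Dom C m)"
    using comp_eq[OF assms(4), of m] assms ds by simp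
  then have "s \<cdot> m = Id C (Dom C m)"
    by (rule monicD[OF assms(1)]) (use assms ds in simp_all)
  then show ?thesis using isoI[of m s] assms ds by simp
qed

lemma sub_leI:
  assumes "k \<in> Arr C" "h \<in> Arr C" "Cod C h = Dom C k" "k \<cdot> h = w"
  shows "sub_le C w k"
  using assms unfolding sub_le_def by auto

lemma sub_leE:
  assumes "sub_le C w k"
  obtains h where "h \<in> Arr C" "Dom C h = Dom C w" "Cod C h = Dom C k" "k \<cdot> h = w"
  using assms unfolding sub_le_def by auto

lemma sub_le_refl: "k \<in> Arr C \<Longrightarrow> sub_le C k k"
  by (rule sub_leI[of _ "Id C (Dom C k)"]) auto

lemma sub_le_trans:
  assumes "sub_le C w k" "sub_le C k l" "l \<in> Arr C" "k \<in> Arr C"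
  shows "sub_le C w l"
proof -
  obtain h where h: "h \<in> Arr C" "Dom C h = Dom C w" "Cod C h = Dom C k" "k \<cdot> h = w"
    using assms(1) by (rule sub_leE)
  obtain h' where h': "h' \<in> Arr C" "Dom C h' = Dom C k" "Cod C h' = Dom C l" "l \<cdot> h' = k"
    using assms(2) by (rule sub_leE)
  show ?thesis
    by (rule sub_leI[of _ "h' \<cdot> h"]) (use h h' assms comp_eq[OF h'(4), of h] in simp_all)
qed

lemma sub_le_comp:
  assumes "sub_le C w k" "k \<in> Arr C" "v \<in> Arr C" "w \<in> Arr C" "Cod C v = Dom C w"
  shows "sub_le C (w \<cdot> v) k"
proof -
  obtain h where h: "h \<in> Arr C" "Dom C h = Dom C w" "Cod C h = Dom C k" "k \<cdot> h = w"
    using assms(1) by (rule sub_leE)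
  show ?thesis by (rule sub_leI[of _ "h \<cdot> v"]) (use h assms comp_eq[OF h(4), of v] in simp_all)
qed

lemma sub_le_iso:
  assumes "is_iso C k" "w \<in> Arr C" "Cod C w = Cod C k"
  shows "sub_le C w k"
proof -
  obtain g where g: "g \<in> Arr C" "Dom C g = Cod C k" "Cod C g = Dom C k" "k \<cdot> g = Id C (Cod C k)"
    using assms(1) by (elim isoE) auto
  show ?thesis
    by (rule sub_leI[of _ "g \<cdot> w"]) (use g iso_arr[OF assms(1)] assms comp_eq[OF g(4), of w] in simp_all)
qed

section \<open>Pullbacks, products and coproducts\<close>

lemma pullbackD:
  assumes "is_pullback C f g p q"
  shows "f \<in> Arr C" "g \<in> Arr C" "Cod C f = Cod C g" "p \<in> Arr C" "q \<in> Arr C" "Dom C q = Dom C p"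
    "Cod C p = Dom C f" "Cod C q = Dom C g" "f \<cdot> p = g \<cdot> q"
  using assms unfolding is_pullback_def by auto

lemma pullback_lift:
  assumes "is_pullback C f g p q" "a \<in> Arr C" "b \<in> Arr C" "Dom C a = Dom C b"
    "Cod C a = Dom C f" "Cod C b = Dom C g" "f \<cdot> a = g \<cdot> b"
  obtains h where "h \<in> Arr C" "Dom C h = Dom C a" "Cod C h = Dom C p" "p \<cdot> h = a" "q \<cdot> h = b"
proof -
  have "a \<in> hom C (Dom C a) (Dom C f)" "b \<in> hom C (Dom C a) (Dom C g)" using assms by auto
  then have "\<exists>!h. h \<in> hom C (Dom C a) (Dom C p) \<and> p \<cdot> h = a \<and> q \<cdot> h = b"
    using assms(1,7) unfolding is_pullback_def by blast
  then show ?thesis using that by auto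
qed

lemma pullback_unique:
  assumes "is_pullback C f g p q" "h \<in> Arr C" "h' \<in> Arr C" "Dom C h = Dom C h'"
    "Cod C h = Dom C p" "Cod C h' = Dom C p" "p \<cdot> h = p \<cdot> h'" "q \<cdot> h = q \<cdot> h'"
  shows "h = h'"
proof -
  note pb = pullbackD[OF assms(1)]
  have *: "p \<cdot> h \<in> hom C (Dom C h) (Dom C f)" "q \<cdot> h \<in> hom C (Dom C h) (Dom C g)"
    using pb assms by simp_all
  have "f \<cdot> (p \<cdot> h) = g \<cdot> (q \<cdot> h)" using pb assms comp_eq[OF pb(9), of h] by simp
  then have "\<exists>!k. k \<in> hom C (Dom C h) (Dom C p) \<and> p \<cdot> k = p \<cdot> h \<and> q \<cdot> k = q \<cdot> h"
    using * assms(1) unfolding is_pullback_def by blast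
  then show ?thesis using assms by auto
qed

lemma pullback_monic:
  assumes "is_pullback C f m p q" "monic C m"
  shows "monic C p"
proof (rule monicI)
  note pb = pullbackD[OF assms(1)]
  show "p \<in> Arr C" using pb by simp
  fix g h assume *: "g \<in> Arr C" "h \<in> Arr C" "Dom C g = Dom C h" "Cod C g = Dom C p"
    "Cod C h = Dom C p" "p \<cdot> g = p \<cdot> h"
  have "m \<cdot> (q \<cdot> g) = m \<cdot> (q \<cdot> h)"
    using pb(1-8) * by (simp add: comp_eq[OF pb(9)[symmetric]])
  then have "q \<cdot> g = q \<cdot> h" by (rule monicD[OF assms(2)]) (use * pb in simp_all)
  then show "g = h" using pullback_unique[OF assms(1)] * by blast
qed

text \<open>When \<open>m\<close> is a subobject, \<open>p\<close> is its inverse image along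
  \<open>f\<close>; subobjects defined by a condition on elements are built in this way
  below.\<close>

lemma pullback_sub_le:
  assumes "is_pullback C f m p q" "w \<in> Arr C" "Cod C w = Dom C f"
  shows "sub_le C w p \<longleftrightarrow> sub_le C (f \<cdot> w) m"
proof
  note pb = pullbackD[OF assms(1)]
  assume "sub_le C w p"
  then obtain h where h: "h \<in> Arr C" "Dom C h = Dom C w" "Cod C h = Dom C p" "p \<cdot> h = w"
    by (rule sub_leE)
  show "sub_le C (f \<cdot> w) m"
    by (rule sub_leI[of _ "q \<cdot> h"]) (use h pb(1-8) in \<open>simp_all add: comp_eq[OF pb(9)[symmetric]]\<close>)
next
  note pb = pullbackD[OF assms(1)]
  assume "sub_le C (f \<cdot> w) m"
  then obtain h where h: "h \<in> Arr C" "Dom C h = Dom C (f \<cdot> w)" "Cod C h = Dom C m" "m \<cdot> h = f \<cdot> w"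
    by (rule sub_leE)
  obtain l where "l \<in> Arr C" "Dom C l = Dom C w" "Cod C l = Dom C p" "p \<cdot> l = w"
    by (rule pullback_lift[OF assms(1), of w h]) (use h pb assms in simp_all)
  then show "sub_le C w p" using pb by (auto intro: sub_leI)
qed


lemma coproductD:
  assumes "is_coproduct C A B i j"
  shows "i \<in> Arr C" "j \<in> Arr C" "Dom C i = A" "Dom C j = B" "Cod C j = Cod C i"
    "A \<in> Obj C" "B \<in> Obj C"
  using assms obj_simps unfolding is_coproduct_def by auto

lemma coproduct_lift:
  assumes "is_coproduct C A B i j" "f \<in> hom C A T" "g \<in> hom C B T"
  obtains h where "h \<in> Arr C" "Dom C h = Cod C i" "Cod C h = T" "h \<cdot> i = f" "h \<cdot> j = g"
proof -
  have "\<exists>!h. h \<in> hom C (Cod C i) T \<and> h \<cdot> i = f \<and> h \<cdot> j = g"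
    using assms unfolding is_coproduct_def by blast
  then show ?thesis using that by auto
qed

lemma coproduct_unique:
  assumes "is_coproduct C A B i j" "h \<in> hom C (Cod C i) T" "h' \<in> hom C (Cod C i) T"
    "h \<cdot> i = h' \<cdot> i" "h \<cdot> j = h' \<cdot> j"
  shows "h = h'"
proof -
  note c = coproductD[OF assms(1)]
  have "h \<cdot> i \<in> hom C A T" "h \<cdot> j \<in> hom C B T" using c assms by auto
  then have "\<exists>!k. k \<in> hom C (Cod C i) T \<and> k \<cdot> i = h \<cdot> i \<and> k \<cdot> j = h \<cdot> j"
    using assms(1) unfolding is_coproduct_def by blast
  then show ?thesis using assms by auto
qed

lemma productD:
  assumes "is_product C A B p q"
  shows "p \<in> Arr C" "q \<in> Arr C" "Cod C p = A" "Cod C q = B" "Dom C q = Dom C p"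
    "A \<in> Obj C" "B \<in> Obj C"
  using assms obj_simps unfolding is_product_def by auto

lemma product_lift:
  assumes "is_product C A B p q" "f \<in> hom C T A" "g \<in> hom C T B"
  obtains h where "h \<in> Arr C" "Dom C h = T" "Cod C h = Dom C p" "p \<cdot> h = f" "q \<cdot> h = g"
proof -
  have "\<exists>!h. h \<in> hom C T (Dom C p) \<and> p \<cdot> h = f \<and> q \<cdot> h = g"
    using assms unfolding is_product_def by blast
  then show ?thesis using that by auto
qed

lemma product_unique:
  assumes "is_product C A B p q" "h \<in> hom C T (Dom C p)" "h' \<in> hom C T (Dom C p)"
    "p \<cdot> h = p \<cdot> h'" "q \<cdot> h = q \<cdot> h'"
  shows "h = h'"
proof -
  note c = productD[OF assms(1)]
  have "p \<cdot> h \<in> hom C T A" "q \<cdot> h \<in> hom C T B" using c assms by auto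
  then have "\<exists>!k. k \<in> hom C T (Dom C p) \<and> p \<cdot> k = p \<cdot> h \<and> q \<cdot> k = q \<cdot> h"
    using assms(1) unfolding is_product_def by blast
  then show ?thesis using assms by auto
qed

section \<open>Chosen products and coproducts\<close>

lemma in_coproduct:
  assumes "\<exists>i j. is_coproduct C A B i j"
  shows "is_coproduct C A B (in1 C A B) (in2 C A B)"
proof -
  have "\<exists>ij. is_coproduct C A B (fst ij) (snd ij)" using assms by auto
  from someI_ex[OF this] show ?thesis by (simp add: in1_def in2_def injs_def)
qed

lemma projs_product:
  assumes "\<exists>p q. is_product C A B p q"
  shows "is_product C A B (fst (projs C A B)) (snd (projs C A B))"
proof -
  have "\<exists>pq. is_product C A B (fst pq) (snd pq)" using assms by auto
  from someI_ex[OF this] show ?thesis by (simp add: projs_def)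
qed

lemma copair_props:
  assumes "\<exists>i j. is_coproduct C A B i j" "f \<in> hom C A T" "g \<in> hom C B T"
  shows "copair C f g \<in> hom C (cop C A B) T" "copair C f g \<cdot> in1 C A B = f"
    "copair C f g \<cdot> in2 C A B = g"
proof -
  note c = in_coproduct[OF assms(1)]
  have "\<exists>!h. h \<in> hom C (cop C A B) T \<and> h \<cdot> in1 C A B = f \<and> h \<cdot> in2 C A B = g"
    using c assms(2,3) unfolding is_coproduct_def cop_def by blast
  from theI'[OF this] show "copair C f g \<in> hom C (cop C A B) T" "copair C f g \<cdot> in1 C A B = f"
    "copair C f g \<cdot> in2 C A B = g"
    using assms(2,3) by (auto simp: copair_def)
qed

lemma pair_props:
  assumes "\<exists>p q. is_product C A B p q" "f \<in> hom C T A" "g \<in> hom C T B"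
  shows "pair C f g \<in> hom C T (prd C A B)" "fst (projs C A B) \<cdot> pair C f g = f"
    "snd (projs C A B) \<cdot> pair C f g = g"
proof -
  note c = projs_product[OF assms(1)]
  have "\<exists>!h. h \<in> hom C T (prd C A B) \<and> fst (projs C A B) \<cdot> h = f \<and> snd (projs C A B) \<cdot> h = g"
    using c assms(2,3) unfolding is_product_def prd_def by blast
  from theI'[OF this] show "pair C f g \<in> hom C T (prd C A B)" "fst (projs C A B) \<cdot> pair C f g = f"
    "snd (projs C A B) \<cdot> pair C f g = g"
    using assms(2,3) by (auto simp: pair_def)
qed

end

locale pointed_category = category +
  assumes pointed: "pointed C"
begin

text \<open>The description in \<open>zero_arr\<close> is definite: factorizations through two zero
  objects agree, because they are compared along the unique arrow between these objects.\<close>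

lemma zero_arr_eq:
  assumes "is_zero C Z" "g \<in> hom C A Z" "h \<in> hom C Z B"
  shows "zero_arr C A B = h \<cdot> g"
  unfolding zero_arr_def
proof (rule the_equality)
  show "\<exists>Z. is_zero C Z \<and> (\<exists>g'\<in>hom C A Z. \<exists>h'\<in>hom C Z B. h \<cdot> g = h' \<cdot> g')"
    using assms by blast
next
  fix f assume "\<exists>Z. is_zero C Z \<and> (\<exists>g\<in>hom C A Z. \<exists>h\<in>hom C Z B. f = h \<cdot> g)"
  then obtain Z' g' h' where z: "is_zero C Z'" "g' \<in> hom C A Z'" "h' \<in> hom C Z' B" "f = h' \<cdot> g'"
    by blast
  have obj: "A \<in> Obj C" "B \<in> Obj C" "Z \<in> Obj C" "Z' \<in> Obj C"
    using z assms obj_simps by auto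
  obtain t where t: "t \<in> hom C Z' Z"
    using assms(1) obj unfolding is_zero_def is_terminal_def by metis
  have "t \<cdot> g' = g"
    using assms(1,2) obj t z unfolding is_zero_def is_terminal_def by (metis Comp_in_hom)
  moreover have "h \<cdot> t = h'"
    using z assms(3) obj t unfolding is_zero_def is_initial_def by (metis Comp_in_hom)
  ultimately show "f = h \<cdot> g"
    using z(4) t z assms Comp_assoc by metis
qed

lemma zero_exists:
  obtains Z where "is_zero C Z" "Z \<in> Obj C"
  using pointed unfolding pointed_def is_zero_def is_initial_def by blast

lemma zero_factor:
  assumes "A \<in> Obj C" "B \<in> Obj C"
  obtains Z g h where "is_zero C Z" "g \<in> hom C A Z" "h \<in> hom C Z B" "zero_arr C A B = h \<cdot> g"
proof -
  obtain Z where Z: "is_zero C Z" "Z \<in> Obj C" by (rule zero_exists)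
  obtain g where g: "g \<in> hom C A Z" using Z assms unfolding is_zero_def is_terminal_def by metis
  obtain h where h: "h \<in> hom C Z B" using Z assms unfolding is_zero_def is_initial_def by metis
  show ?thesis using that[OF Z(1) g h zero_arr_eq[OF Z(1) g h]] .
qed

lemma zero_simps [simp]:
  assumes "A \<in> Obj C" "B \<in> Obj C"
  shows "zero_arr C A B \<in> Arr C" "Dom C (zero_arr C A B) = A" "Cod C (zero_arr C A B) = B"
proof -
  obtain Z g h where *: "is_zero C Z" "g \<in> hom C A Z" "h \<in> hom C Z B" "zero_arr C A B = h \<cdot> g"
    using zero_factor[OF assms] .
  then show "zero_arr C A B \<in> Arr C" "Dom C (zero_arr C A B) = A" "Cod C (zero_arr C A B) = B"
    by auto
qed

lemma comp_zero [simp]: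
  assumes "f \<in> Arr C" "A \<in> Obj C" "Dom C f = B"
  shows "f \<cdot> zero_arr C A B = zero_arr C A (Cod C f)"
proof -
  have "B \<in> Obj C" using assms by auto
  then obtain Z g h where *: "is_zero C Z" "g \<in> hom C A Z" "h \<in> hom C Z B" "zero_arr C A B = h \<cdot> g"
    using zero_factor[OF assms(2)] by blast
  have "zero_arr C A (Cod C f) = (f \<cdot> h) \<cdot> g" by (rule zero_arr_eq) (use * assms in auto)
  then show ?thesis using * assms by auto
qed

lemma zero_comp [simp]:
  assumes "f \<in> Arr C" "B \<in> Obj C" "Cod C f = A"
  shows "zero_arr C A B \<cdot> f = zero_arr C (Dom C f) B"
proof -
  have "A \<in> Obj C" using assms by auto
  then obtain Z g h where *: "is_zero C Z" "g \<in> hom C A Z" "h \<in> hom C Z B" "zero_arr C A B = h \<cdot> g"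
    using zero_factor[OF _ assms(2)] by blast
  have "zero_arr C (Dom C f) B = h \<cdot> (g \<cdot> f)" by (rule zero_arr_eq) (use * assms in auto)
  then show ?thesis using * assms by auto
qed

lemma null_eq: "null C f \<Longrightarrow> Dom C f = A \<Longrightarrow> Cod C f = B \<Longrightarrow> f = zero_arr C A B"
  by (simp add: null_def)

lemma null_zero [simp]: "A \<in> Obj C \<Longrightarrow> B \<in> Obj C \<Longrightarrow> null C (zero_arr C A B)"
  by (simp add: null_def)

lemma null_comp [simp]:
  assumes "null C f" "g \<in> Arr C" "Dom C g = Cod C f"
  shows "null C (g \<cdot> f)"
  using assms by (metis null_def comp_zero comp_simps obj_simps)

lemma null_precomp:
  assumes "null C f" "g \<in> Arr C" "Cod C g = Dom C f"
  shows "null C (f \<cdot> g)"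
  using assms by (metis null_def zero_comp comp_simps obj_simps)

lemma null_monic:
  assumes "monic C m" "null C (m \<cdot> f)" "f \<in> Arr C" "Dom C m = Cod C f"
  shows "null C f"
proof -
  have "m \<cdot> f = zero_arr C (Dom C f) (Cod C m)" using assms by (auto intro: null_eq)
  also have "\<dots> = m \<cdot> zero_arr C (Dom C f) (Cod C f)" using assms by simp
  finally have "f = zero_arr C (Dom C f) (Cod C f)"
    by (rule monicD[OF assms(1)]) (use assms in simp_all)
  then show ?thesis using assms by (simp add: null_def)
qed

lemma null_null_eq:
  "null C f \<Longrightarrow> null C g \<Longrightarrow> Dom C f = Dom C g \<Longrightarrow> Cod C f = Cod C g \<Longrightarrow> f = g"
  by (simp add: null_def)

lemma kernelD:
  assumes "is_kernel C f k"
  shows "f \<in> Arr C" "monic C k" "k \<in> Arr C" "Cod C k = Dom C f" "null C (f \<cdot> k)"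
proof -
  show *: "f \<in> Arr C" "k \<in> Arr C" "Cod C k = Dom C f"
    using assms unfolding is_kernel_def by auto
  have "f \<cdot> k = zero_arr C (Dom C k) (Cod C f)" using assms unfolding is_kernel_def by auto
  then show n: "null C (f \<cdot> k)" using * by simp
  show "monic C k"
  proof (rule monicI)
    fix g h assume a: "g \<in> Arr C" "h \<in> Arr C" "Dom C g = Dom C h" "Cod C g = Dom C k"
      "Cod C h = Dom C k" "k \<cdot> g = k \<cdot> h"
    have "f \<cdot> (k \<cdot> g) = zero_arr C (Dom C g) (Cod C f)"
      using null_precomp[OF n, of g] * a by (simp add: null_def)
    then have "\<exists>!l. l \<in> hom C (Dom C g) (Dom C k) \<and> k \<cdot> l = k \<cdot> g"
      using assms a * unfolding is_kernel_def by (metis comp_simps in_hom)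
    then show "g = h" using a by auto
  qed (rule *)
qed

lemma kernel_sub_le:
  assumes "is_kernel C f k" "w \<in> Arr C" "Cod C w = Dom C f"
  shows "sub_le C w k \<longleftrightarrow> null C (f \<cdot> w)"
proof
  note k = kernelD[OF assms(1)]
  assume "sub_le C w k"
  then obtain h where h: "h \<in> Arr C" "Dom C h = Dom C w" "Cod C h = Dom C k" "k \<cdot> h = w"
    by (rule sub_leE)
  have "null C ((f \<cdot> k) \<cdot> h)" by (rule null_precomp) (use k h in simp_all)
  then show "null C (f \<cdot> w)" using h k by simp
next
  note k = kernelD[OF assms(1)]
  assume "null C (f \<cdot> w)"
  then have "f \<cdot> w = zero_arr C (Dom C w) (Cod C f)" using k assms by (auto intro: null_eq)
  then show "sub_le C w k"
    using assms unfolding is_kernel_def sub_le_def by (metis in_hom)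
qed

text \<open>A kernel is recognized by the generalized elements that it contains; uniqueness of the
  factorization is supplied by monicity.\<close>

lemma kernelI:
  assumes "f \<in> Arr C" "monic C k" "Cod C k = Dom C f"
    "\<And>w. w \<in> Arr C \<Longrightarrow> Cod C w = Dom C f \<Longrightarrow> sub_le C w k \<longleftrightarrow> null C (f \<cdot> w)"
  shows "is_kernel C f k"
  unfolding is_kernel_def
proof (intro conjI allI ballI impI)
  have "null C (f \<cdot> k)" using assms(4)[of k] assms sub_le_refl by simp
  then show "f \<cdot> k = zero_arr C (Dom C k) (Cod C f)" using assms by (auto intro: null_eq)
next
  fix T g assume g: "g \<in> hom C T (Dom C f)" "f \<cdot> g = zero_arr C T (Cod C f)"
  then have "null C (f \<cdot> g)" using assms by auto
  then have "sub_le C g k" using assms(4)[of g] g by simp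
  then obtain h where h: "h \<in> Arr C" "Dom C h = Dom C g" "Cod C h = Dom C k" "k \<cdot> h = g"
    by (rule sub_leE)
  show "\<exists>!h. h \<in> hom C T (Dom C k) \<and> k \<cdot> h = g"
  proof (rule ex1I[of _ h])
    fix h' assume "h' \<in> hom C T (Dom C k) \<and> k \<cdot> h' = g"
    then show "h' = h" using monicD[OF assms(2), of h' h] h g by simp
  qed (use h g in simp)
qed (use assms in simp_all)

end

section \<open>Consequences of protomodularity\<close>

text \<open>Extremal epimorphisms. In a semi-abelian category they are the regular ones
  (\<open>regular_epi_cover\<close>, \<open>cover_regular_epi\<close>), but composition,
  cancellation and orthogonality to monomorphisms have short proofs in this form.\<close>

definition cover :: "('o, 'a) category \<Rightarrow> 'a \<Rightarrow> bool" where
  "cover C f \<longleftrightarrow> f \<in> Arr C \<and> (\<forall>m. monic C m \<longrightarrow> Cod C m = Cod C f \<longrightarrow> sub_le C f m \<longrightarrow> is_iso C m)"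

locale semi_abelian_category = pointed_category +
  assumes barr_exact: "barr_exact C"
    and protomodular: "protomodular C"
    and finite_coproducts: "has_finite_coproducts C"
begin

section \<open>Finite limits from pullbacks and a zero object\<close>

lemma pullback_exists:
  assumes "f \<in> Arr C" "g \<in> Arr C" "Cod C f = Cod C g"
  obtains p q where "is_pullback C f g p q"
  using assms barr_exact unfolding barr_exact_def regular_category_def finitely_complete_def by blast

lemma coproduct_exists: "A \<in> Obj C \<Longrightarrow> B \<in> Obj C \<Longrightarrow> \<exists>i j. is_coproduct C A B i j"
  using finite_coproducts unfolding has_finite_coproducts_def by blast

lemma product_exists:
  assumes "A \<in> Obj C" "B \<in> Obj C"
  shows "\<exists>p q. is_product C A B p q"
proof -
  obtain Z where Z: "is_zero C Z" "Z \<in> Obj C" by (rule zero_exists)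
  let ?f = "zero_arr C A Z" and ?g = "zero_arr C B Z"
  obtain p q where pb: "is_pullback C ?f ?g p q"
    by (rule pullback_exists[of ?f ?g]) (use assms Z in auto)
  note pbD = pullbackD[OF pb]
  have "is_product C A B p q"
    unfolding is_product_def
  proof (intro conjI allI ballI)
    fix T f g assume fg: "f \<in> hom C T A" "g \<in> hom C T B"
    obtain h where h: "h \<in> Arr C" "Dom C h = Dom C f" "Cod C h = Dom C p" "p \<cdot> h = f" "q \<cdot> h = g"
      by (rule pullback_lift[OF pb, of f g]) (use fg assms Z in auto)
    show "\<exists>!h. h \<in> hom C T (Dom C p) \<and> p \<cdot> h = f \<and> q \<cdot> h = g"
    proof (rule ex1I[of _ h])
      fix h' assume "h' \<in> hom C T (Dom C p) \<and> p \<cdot> h' = f \<and> q \<cdot> h' = g"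
      then show "h' = h"
        using h fg pullback_unique[OF pb, of h' h] by simp
    qed (use h fg in auto)
  qed (use pbD assms Z in auto)
  then show ?thesis by blast
qed

text \<open>The equalizer is the pullback of the graphs \<open>h1\<close> of \<open>f\<close> and
  \<open>h2\<close> of \<open>g\<close>. Its two projections coincide because the first component of
  both graphs is the identity.\<close>

lemma equalizer_exists:
  assumes "f \<in> Arr C" "g \<in> Arr C" "Dom C f = Dom C g" "Cod C f = Cod C g"
  obtains k where "monic C k" "Cod C k = Dom C f"
    "\<And>w. w \<in> Arr C \<Longrightarrow> Cod C w = Dom C f \<Longrightarrow> sub_le C w k \<longleftrightarrow> f \<cdot> w = g \<cdot> w"
proof -
  define A B where "A = Dom C f" and "B = Cod C f"
  have AB: "A \<in> Obj C" "B \<in> Obj C" "Dom C f = A" "Dom C g = A" "Cod C f = B" "Cod C g = B"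
    using assms by (auto simp: A_def B_def)
  obtain p1 p2 where prod: "is_product C A B p1 p2" using product_exists AB by blast
  note pD = productD[OF prod]
  obtain h1 where h1: "h1 \<in> Arr C" "Dom C h1 = A" "Cod C h1 = Dom C p1" "p1 \<cdot> h1 = Id C A" "p2 \<cdot> h1 = f"
    by (rule product_lift[OF prod, of "Id C A" A f]) (use AB assms in auto)
  obtain h2 where h2: "h2 \<in> Arr C" "Dom C h2 = A" "Cod C h2 = Dom C p1" "p1 \<cdot> h2 = Id C A" "p2 \<cdot> h2 = g"
    by (rule product_lift[OF prod, of "Id C A" A g]) (use AB assms in auto)
  obtain p q where pb: "is_pullback C h1 h2 p q"
    by (rule pullback_exists[of h1 h2]) (use h1 h2 in auto)
  note pbD = pullbackD[OF pb]
  have eqs: "p1 \<cdot> (h1 \<cdot> w) = w" "p2 \<cdot> (h1 \<cdot> w) = f \<cdot> w" "p1 \<cdot> (h2 \<cdot> w) = w" "p2 \<cdot> (h2 \<cdot> w) = g \<cdot> w"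
    if "w \<in> Arr C" "Cod C w = A" for w
    using that h1(1-3) h2(1-3) pD
    by (simp_all add: comp_eq[OF h1(4)] comp_eq[OF h2(4)] comp_eq[OF h1(5)] comp_eq[OF h2(5)])
  have pq: "p = q"
  proof -
    have "p1 \<cdot> (h1 \<cdot> p) = p1 \<cdot> (h2 \<cdot> q)" using pbD(9) by metis
    then show ?thesis using eqs[of p] eqs[of q] pbD h1 h2 by metis
  qed
  have fp: "f \<cdot> p = g \<cdot> p"
  proof -
    have "p2 \<cdot> (h1 \<cdot> p) = p2 \<cdot> (h2 \<cdot> p)" using pbD(9) pq by metis
    then show ?thesis using eqs[of p] pbD h1 by metis
  qed
  have mon: "monic C p"
  proof (rule monicI)
    fix a b assume "a \<in> Arr C" "b \<in> Arr C" "Dom C a = Dom C b" "Cod C a = Dom C p" "Cod C b = Dom C p" "p \<cdot> a = p \<cdot> b"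
    then show "a = b" using pullback_unique[OF pb, of a b] pq by simp
  qed (use pbD in simp)
  have cp: "Cod C p = A" using pbD h1 by simp
  have "sub_le C w p \<longleftrightarrow> f \<cdot> w = g \<cdot> w" if w: "w \<in> Arr C" "Cod C w = A" for w
  proof
    assume "sub_le C w p"
    then obtain h where h: "h \<in> Arr C" "Dom C h = Dom C w" "Cod C h = Dom C p" "p \<cdot> h = w"
      by (rule sub_leE)
    have "f \<cdot> (p \<cdot> h) = g \<cdot> (p \<cdot> h)"
      using h(1-3) mon cp AB assms(1,2) by (simp add: comp_eq[OF fp])
    then show "f \<cdot> w = g \<cdot> w" using h by simp
  next
    assume e: "f \<cdot> w = g \<cdot> w"
    have hw: "h1 \<cdot> w = h2 \<cdot> w"
      by (rule product_unique[OF prod, of _ "Dom C w"]) (use eqs[OF w] e h1(1-3) h2(1-3) w in simp_all)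
    obtain h where "h \<in> Arr C" "Dom C h = Dom C w" "Cod C h = Dom C p" "p \<cdot> h = w"
      by (rule pullback_lift[OF pb, of w w]) (use hw h1 h2 w in auto)
    then show "sub_le C w p" using mon by (auto intro: sub_leI)
  qed
  then show ?thesis using that[OF mon] cp AB by simp
qed

lemma kernel_exists:
  assumes "f \<in> Arr C"
  obtains k where "is_kernel C f k"
proof -
  define g where "g = zero_arr C (Dom C f) (Cod C f)"
  have g: "g \<in> Arr C" "Dom C g = Dom C f" "Cod C g = Cod C f" using assms by (auto simp: g_def)
  obtain k where k: "monic C k" "Cod C k = Dom C f"
    "\<And>w. w \<in> Arr C \<Longrightarrow> Cod C w = Dom C f \<Longrightarrow> sub_le C w k \<longleftrightarrow> f \<cdot> w = g \<cdot> w"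
    using equalizer_exists[of f g] g assms by auto
  have "is_kernel C f k"
  proof (rule kernelI)
    fix w assume w: "w \<in> Arr C" "Cod C w = Dom C f"
    have "g \<cdot> w = zero_arr C (Dom C w) (Cod C f)" using w assms unfolding g_def by simp
    then show "sub_le C w k \<longleftrightarrow> null C (f \<cdot> w)"
      using k(3)[OF w] w assms by (auto simp: null_def)
  qed (use k assms in auto)
  then show ?thesis by (rule that)
qed

text \<open>Elements of a cross-effect are described by several equations at once; this supplies the
  subobject of all their solutions, as an intersection of equalizers.\<close>

lemma joint_equalizer_exists:
  assumes "finite L" "A \<in> Obj C"
    "\<And>f g. (f, g) \<in> L \<Longrightarrow> f \<in> Arr C \<and> g \<in> Arr C \<and> Dom C f = A \<and> Dom C g = A \<and> Cod C f = Cod C g"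
  obtains k where "monic C k" "Cod C k = A"
    "\<And>w. w \<in> Arr C \<Longrightarrow> Cod C w = A \<Longrightarrow> sub_le C w k \<longleftrightarrow> (\<forall>(f, g) \<in> L. f \<cdot> w = g \<cdot> w)"
proof -
  have "\<exists>k. monic C k \<and> Cod C k = A \<and>
    (\<forall>w. w \<in> Arr C \<longrightarrow> Cod C w = A \<longrightarrow> sub_le C w k \<longleftrightarrow> (\<forall>(f, g) \<in> L. f \<cdot> w = g \<cdot> w))"
    using assms(1,3)
  proof (induction L rule: finite_induct)
    case empty
    have "is_iso C (Id C A)" using assms(2) by (intro isoI[of _ "Id C A"]) auto
    moreover have "monic C (Id C A)" using assms(2) by (intro split_monic[of _ "Id C A"]) auto
    ultimately show ?case using assms(2) sub_le_iso by (intro exI[of _ "Id C A"]) auto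
  next
    case (insert x L)
    obtain f g where x: "x = (f, g)" by (cases x)
    have fg: "f \<in> Arr C" "g \<in> Arr C" "Dom C f = A" "Dom C g = A" "Cod C f = Cod C g"
      using insert.prems[of f g] x by auto
    obtain k where k: "monic C k" "Cod C k = A"
      "\<And>w. w \<in> Arr C \<Longrightarrow> Cod C w = A \<Longrightarrow> sub_le C w k \<longleftrightarrow> (\<forall>(f, g) \<in> L. f \<cdot> w = g \<cdot> w)"
      using insert.IH insert.prems by auto
    obtain l where l: "monic C l" "Cod C l = A"
      "\<And>w. w \<in> Arr C \<Longrightarrow> Cod C w = A \<Longrightarrow> sub_le C w l \<longleftrightarrow> f \<cdot> w = g \<cdot> w"
      using equalizer_exists[of f g] fg by auto
    obtain p q where pb: "is_pullback C k l p q"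
      by (rule pullback_exists[of k l]) (use k l in auto)
    note pbD = pullbackD[OF pb]
    have mp: "monic C (k \<cdot> p)"
      using pullback_monic[OF pb l(1)] k(1) pbD by (intro monic_comp) auto
    have "sub_le C w (k \<cdot> p) \<longleftrightarrow> sub_le C w k \<and> sub_le C w l" if w: "w \<in> Arr C" "Cod C w = A" for w
    proof
      assume "sub_le C w (k \<cdot> p)"
      then show "sub_le C w k \<and> sub_le C w l"
        using sub_le_trans[of w "k \<cdot> p" k] sub_le_trans[of w "k \<cdot> p" l] mp k(1) l(1) pbD
          sub_leI[of k p] sub_leI[of l q] by simp
    next
      assume "sub_le C w k \<and> sub_le C w l"
      then obtain h h' where h: "h \<in> Arr C" "Dom C h = Dom C w" "Cod C h = Dom C k" "k \<cdot> h = w"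
        "h' \<in> Arr C" "Dom C h' = Dom C w" "Cod C h' = Dom C l" "l \<cdot> h' = w"
        by (metis sub_leE)
      obtain t where t: "t \<in> Arr C" "Dom C t = Dom C h" "Cod C t = Dom C p" "p \<cdot> t = h"
        by (rule pullback_lift[OF pb, of h h']) (use h in auto)
      show "sub_le C w (k \<cdot> p)"
        by (rule sub_leI[of _ t]) (use t h(1-4) pbD(1-8) in simp_all)
    qed
    then show ?case using x mp k l pbD by (intro exI[of _ "k \<cdot> p"]) auto
  qed
  then show ?thesis using that by blast
qed

text \<open>Change of base along the arrow from the zero object turns a split epimorphism into its
  kernel. Since \<open>m\<close> contains the section it is a morphism of points, and since it
  contains the kernel of \<open>p\<close> it becomes invertible after this change of base;
  protomodularity then makes \<open>m\<close> invertible. Every later appeal to protomodularity goes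
  through this lemma.\<close>

lemma point_iso:
  assumes p: "p \<in> Arr C" "s \<in> Arr C" "Dom C s = Cod C p" "Cod C s = Dom C p" "p \<cdot> s = Id C (Cod C p)"
    and m: "monic C m" "Cod C m = Dom C p" "sub_le C s m"
    and ker: "\<And>w. w \<in> Arr C \<Longrightarrow> Cod C w = Dom C p \<Longrightarrow> null C (p \<cdot> w) \<Longrightarrow> sub_le C w m"
  shows "is_iso C m"
proof -
  obtain s' where s': "s' \<in> Arr C" "Dom C s' = Dom C s" "Cod C s' = Dom C m" "m \<cdot> s' = s"
    using m(3) by (rule sub_leE)
  obtain Z where Z: "is_zero C Z" "Z \<in> Obj C" by (rule zero_exists)
  define B where "B = Cod C p"
  have B: "B \<in> Obj C" "Cod C p = B" using p by (auto simp: B_def)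
  define v where "v = zero_arr C Z B"
  have v: "v \<in> Arr C" "Dom C v = Z" "Cod C v = B" "null C v" using Z B by (auto simp: v_def)
  have pm: "p \<cdot> m \<in> Arr C" "Dom C (p \<cdot> m) = Dom C m" "Cod C (p \<cdot> m) = B" using p m B by auto
  obtain a b where ab: "is_pullback C v (p \<cdot> m) a b"
    by (rule pullback_exists[of v "p \<cdot> m"]) (use v pm in auto)
  obtain a' b' where ab': "is_pullback C v p a' b'"
    by (rule pullback_exists[of v p]) (use v B p in auto)
  note abD = pullbackD[OF ab] and abD' = pullbackD[OF ab']
  have vab: "v \<cdot> a = p \<cdot> (m \<cdot> b)" using abD(9) abD p m pm by simp
  obtain h where h: "h \<in> Arr C" "Dom C h = Dom C a" "Cod C h = Dom C a'" "a' \<cdot> h = a" "b' \<cdot> h = m \<cdot> b"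
    by (rule pullback_lift[OF ab', of a "m \<cdot> b"]) (use vab abD pm m v in auto)
  have "null C (p \<cdot> b')" using abD' null_precomp[OF v(4), of a'] by simp
  then have "sub_le C b' m" by (intro ker) (use abD' in auto)
  then obtain t where t: "t \<in> Arr C" "Dom C t = Dom C b'" "Cod C t = Dom C m" "m \<cdot> t = b'"
    by (rule sub_leE)
  obtain u where u: "u \<in> Arr C" "Dom C u = Dom C a'" "Cod C u = Dom C a" "a \<cdot> u = a'" "b \<cdot> u = t"
    by (rule pullback_lift[OF ab, of a' t]) (use abD' t pm m p in auto)
  have hu: "h \<cdot> u = Id C (Dom C a')"
  proof (rule pullback_unique[OF ab'])
    show "a' \<cdot> (h \<cdot> u) = a' \<cdot> Id C (Dom C a')"
      using u h(1-3) abD' by (simp add: comp_eq[OF h(4)])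
    show "b' \<cdot> (h \<cdot> u) = b' \<cdot> Id C (Dom C a')"
      using u h(1-3) abD' t abD pm m by (simp add: comp_eq[OF h(5)])
  qed (use u h abD'(1-8) abD(1-8) pm in simp_all)
  have uh: "u \<cdot> h = Id C (Dom C a)"
  proof (rule pullback_unique[OF ab])
    show "a \<cdot> (u \<cdot> h) = a \<cdot> Id C (Dom C a)"
      using u(1-3) h abD by (simp add: comp_eq[OF u(4)])
    have "m \<cdot> (t \<cdot> h) = m \<cdot> b"
      using t(1-3) h(1-3,5) abD'(4-7) m(1) by (simp add: comp_eq[OF t(4)])
    then have "t \<cdot> h = b"
      by (rule monicD[OF m(1)]) (use t h abD abD' pm in auto)
    then show "b \<cdot> (u \<cdot> h) = b \<cdot> Id C (Dom C a)"
      using u(1-3) h abD by (simp add: comp_eq[OF u(5)])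
  qed (use u h abD'(1-8) abD(1-8) pm in simp_all)
  have "is_iso C h" by (rule isoI[of _ u]) (use u h hu uh in auto)
  moreover have "is_point C B (p \<cdot> m) s'"
    unfolding is_point_def using s' pm p m B by simp
  moreover have "is_point C B p s" unfolding is_point_def using p B by simp
  moreover have "m \<in> hom C (Dom C (p \<cdot> m)) (Dom C p)" using m pm by simp
  moreover have "v \<in> hom C Z B" using v by simp
  moreover have "h \<in> hom C (Dom C a) (Dom C a')" using h by simp
  ultimately show ?thesis
    using protomodular[unfolded protomodular_def] ab ab' h(4,5) s'(4) by blast
qed

text \<open>The equalizer of \<open>f\<close> and \<open>g\<close> contains both the section and the
  kernel, so \<open>point_iso\<close> applies to it.\<close>

lemma point_joint_epi:
  assumes p: "p \<in> Arr C" "s \<in> Arr C" "Dom C s = Cod C p" "Cod C s = Dom C p" "p \<cdot> s = Id C (Cod C p)"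
    and fg: "f \<in> Arr C" "g \<in> Arr C" "Dom C f = Dom C p" "Dom C g = Dom C p" "Cod C f = Cod C g"
    and "f \<cdot> s = g \<cdot> s"
    and ker: "\<And>w. w \<in> Arr C \<Longrightarrow> Cod C w = Dom C p \<Longrightarrow> null C (p \<cdot> w) \<Longrightarrow> f \<cdot> w = g \<cdot> w"
  shows "f = g"
proof -
  obtain k where k: "monic C k" "Cod C k = Dom C p"
    "\<And>w. w \<in> Arr C \<Longrightarrow> Cod C w = Dom C p \<Longrightarrow> sub_le C w k \<longleftrightarrow> f \<cdot> w = g \<cdot> w"
    using equalizer_exists[of f g] fg by auto
  have "is_iso C k"
    by (rule point_iso[OF p k(1,2)]) (use k(3) assms in auto)
  then have "sub_le C (Id C (Dom C p)) k" using k p by (intro sub_le_iso) auto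
  then show ?thesis using k(3)[of "Id C (Dom C p)"] fg p by simp
qed

text \<open>The section \<open>s\<close> is the subobject of fixed points, that is, the equalizer of
  \<open>e\<close> and the identity.\<close>

lemma split_idempotent:
  assumes "e \<in> Arr C" "Dom C e = A" "Cod C e = A" "e \<cdot> e = e"
  obtains p s where "p \<in> Arr C" "s \<in> Arr C" "Dom C p = A" "Dom C s = Cod C p" "Cod C s = A"
    "p \<cdot> s = Id C (Cod C p)" "s \<cdot> p = e" "monic C s"
proof -
  have A: "A \<in> Obj C" using assms by auto
  obtain s where s: "monic C s" "Cod C s = A"
    "\<And>w. w \<in> Arr C \<Longrightarrow> Cod C w = A \<Longrightarrow> sub_le C w s \<longleftrightarrow> e \<cdot> w = Id C A \<cdot> w"
    using equalizer_exists[of e "Id C A"] assms A by auto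
  have "sub_le C e s" using s(3)[of e] assms by simp
  then obtain p where p: "p \<in> Arr C" "Dom C p = A" "Cod C p = Dom C s" "s \<cdot> p = e"
    using assms by (auto elim: sub_leE)
  have "e \<cdot> s = s" using s(3)[of s] s sub_le_refl by simp
  have "s \<cdot> (p \<cdot> s) = s \<cdot> Id C (Dom C s)"
    using p(1-3) s(1,2) \<open>e \<cdot> s = s\<close> by (simp add: comp_eq[OF p(4)])
  then have "p \<cdot> s = Id C (Dom C s)" by (rule monicD[OF s(1)]) (use p s in simp_all)
  then show ?thesis using that[of p s] p s by simp
qed

text \<open>The fixed points and the kernel of an idempotent jointly generate the object. This
  version of \<open>point_joint_epi\<close> serves the endomorphisms \<open>kill\<close>, whose
  splittings need not be named.\<close>

lemma idempotent_joint_epi: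
  assumes e: "e \<in> Arr C" "Dom C e = A" "Cod C e = A" "e \<cdot> e = e"
    and fg: "f \<in> Arr C" "g \<in> Arr C" "Dom C f = A" "Dom C g = A" "Cod C f = Cod C g"
    and "f \<cdot> e = g \<cdot> e"
    and ker: "\<And>w. w \<in> Arr C \<Longrightarrow> Cod C w = A \<Longrightarrow> null C (e \<cdot> w) \<Longrightarrow> f \<cdot> w = g \<cdot> w"
  shows "f = g"
proof -
  obtain p s where ps: "p \<in> Arr C" "s \<in> Arr C" "Dom C p = A" "Dom C s = Cod C p" "Cod C s = A"
    "p \<cdot> s = Id C (Cod C p)" "s \<cdot> p = e" "monic C s"
    using split_idempotent[OF e] .
  show ?thesis
  proof (rule point_joint_epi[of p s])
    have "f \<cdot> (s \<cdot> (p \<cdot> s)) = f \<cdot> (e \<cdot> s)" "g \<cdot> (s \<cdot> (p \<cdot> s)) = g \<cdot> (e \<cdot> s)"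
      using ps(1-5) fg by (simp_all add: comp_eq[OF ps(7)])
    moreover have "f \<cdot> (e \<cdot> s) = g \<cdot> (e \<cdot> s)"
      using ps(1-5) fg e by (simp add: comp_eq[OF assms(10)])
    ultimately show "f \<cdot> s = g \<cdot> s" using ps by simp
  next
    fix w assume w: "w \<in> Arr C" "Cod C w = Dom C p" "null C (p \<cdot> w)"
    have "null C (s \<cdot> (p \<cdot> w))" using w ps by simp
    then have "null C (e \<cdot> w)" using w ps(1-5) by (simp add: comp_eq[OF ps(7)])
    then show "f \<cdot> w = g \<cdot> w" using w ps by (intro ker) auto
  qed (use ps fg in auto)
qed

text \<open>The projections of the kernel pair agree on the diagonal. They also agree on the kernel
  of the first one, because there the hypothesis forces the second one to vanish. Hence they are
  equal.\<close>

lemma monic_if_kernel_null: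
  assumes "m \<in> Arr C"
    and ker: "\<And>w. w \<in> Arr C \<Longrightarrow> Cod C w = Dom C m \<Longrightarrow> null C (m \<cdot> w) \<Longrightarrow> null C w"
  shows "monic C m"
proof -
  define A where "A = Dom C m"
  have A: "A \<in> Obj C" "Dom C m = A" using assms by (auto simp: A_def)
  obtain p q where pb: "is_pullback C m m p q" using pullback_exists assms by metis
  note pbD = pullbackD[OF pb]
  obtain d where d: "d \<in> Arr C" "Dom C d = A" "Cod C d = Dom C p" "p \<cdot> d = Id C A" "q \<cdot> d = Id C A"
    by (rule pullback_lift[OF pb, of "Id C A" "Id C A"]) (use assms A in auto)
  have "p = q"
  proof (rule point_joint_epi[of p d])
    fix w assume w: "w \<in> Arr C" "Cod C w = Dom C p" "null C (p \<cdot> w)"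
    have "null C (m \<cdot> (p \<cdot> w))" using w pbD by simp
    then have "null C (m \<cdot> (q \<cdot> w))" using w pbD(1-8) by (simp add: comp_eq[OF pbD(9)])
    then have "null C (q \<cdot> w)" using ker[of "q \<cdot> w"] w pbD(1-8) by simp
    then show "p \<cdot> w = q \<cdot> w" using w pbD by (intro null_null_eq) auto
  qed (use d pbD A in auto)
  show ?thesis
  proof (rule monicI)
    fix g h assume *: "g \<in> Arr C" "h \<in> Arr C" "Dom C g = Dom C h" "Cod C g = Dom C m"
      "Cod C h = Dom C m" "m \<cdot> g = m \<cdot> h"
    obtain t where "p \<cdot> t = g" "q \<cdot> t = h"
      by (rule pullback_lift[OF pb, of g h]) (use * in auto)
    then show "g = h" using \<open>p = q\<close> by simp
  qed (rule assms)
qed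

end

section \<open>Regular epimorphisms\<close>

context semi_abelian_category begin

section \<open>Extremal epimorphisms\<close>

lemma cover_arr [simp]: "cover C f \<Longrightarrow> f \<in> Arr C"
  by (simp add: cover_def)

lemma cover_iso: "cover C f \<Longrightarrow> monic C m \<Longrightarrow> Cod C m = Cod C f \<Longrightarrow> sub_le C f m \<Longrightarrow> is_iso C m"
  by (simp add: cover_def)

lemma cover_monic_iso: "cover C f \<Longrightarrow> monic C f \<Longrightarrow> is_iso C f"
  by (rule cover_iso) (auto intro: sub_le_refl)

lemma coequalizerD:
  assumes "is_coequalizer C f g e"
  shows "f \<in> Arr C" "g \<in> Arr C" "Dom C g = Dom C f" "Cod C g = Cod C f" "e \<in> Arr C"
    "Dom C e = Cod C f" "e \<cdot> f = e \<cdot> g"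
  using assms unfolding is_coequalizer_def by auto

lemma coequalizer_lift:
  assumes "is_coequalizer C f g e" "a \<in> Arr C" "Dom C a = Cod C f" "a \<cdot> f = a \<cdot> g"
  obtains h where "h \<in> Arr C" "Dom C h = Cod C e" "Cod C h = Cod C a" "h \<cdot> e = a"
proof -
  have "\<exists>!h. h \<in> hom C (Cod C e) (Cod C a) \<and> h \<cdot> e = a"
    using assms unfolding is_coequalizer_def by simp
  then show ?thesis using that by auto
qed

lemma coequalizer_unique:
  assumes "is_coequalizer C f g e" "h \<in> Arr C" "h' \<in> Arr C" "Dom C h = Cod C e" "Dom C h' = Cod C e"
    "Cod C h = Cod C h'" "h \<cdot> e = h' \<cdot> e"
  shows "h = h'"
proof -
  note cD = coequalizerD[OF assms(1)]
  have "h \<cdot> e \<in> hom C (Cod C f) (Cod C h)" "(h \<cdot> e) \<cdot> f = (h \<cdot> e) \<cdot> g"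
    using cD(1-6) assms(2-6) by (simp_all add: cD(7))
  then have "\<exists>!k. k \<in> hom C (Cod C e) (Cod C h) \<and> k \<cdot> e = h \<cdot> e"
    using assms(1) unfolding is_coequalizer_def by blast
  then show ?thesis using assms(2-7) by (metis in_hom)
qed

lemma regular_epi_cover:
  assumes "regular_epi C e"
  shows "cover C e"
  unfolding cover_def
proof (intro conjI allI impI)
  obtain f g where co: "is_coequalizer C f g e" using assms unfolding regular_epi_def by blast
  note cD = coequalizerD[OF co]
  show "e \<in> Arr C" by (rule cD)
  fix m assume m: "monic C m" "Cod C m = Cod C e" "sub_le C e m"
  obtain h where h: "h \<in> Arr C" "Dom C h = Dom C e" "Cod C h = Dom C m" "m \<cdot> h = e"
    using m(3) by (rule sub_leE)
  have "m \<cdot> (h \<cdot> f) = m \<cdot> (h \<cdot> g)"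
    using m(1,2) h(1-3) cD(1-6) by (simp add: comp_eq[OF h(4)] cD(7))
  then have "h \<cdot> f = h \<cdot> g"
    by (rule monicD[OF m(1)]) (use h(1-3) cD in simp_all)
  then obtain t where t: "t \<in> Arr C" "Dom C t = Cod C e" "Cod C t = Cod C h" "t \<cdot> e = h"
    using coequalizer_lift[OF co, of h] h cD by metis
  have "m \<cdot> t = Id C (Cod C m)"
    by (rule coequalizer_unique[OF co]) (use t(1-3) m h(1-3) cD t(4) h(4) in simp_all)
  then show "is_iso C m" using monic_split_epi_iso[of m t] m t h by simp
qed

lemma cover_epi:
  assumes "cover C e" "f \<in> Arr C" "g \<in> Arr C" "Dom C f = Cod C e" "Dom C g = Cod C e"
    "Cod C f = Cod C g" "f \<cdot> e = g \<cdot> e"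
  shows "f = g"
proof -
  obtain k where k: "monic C k" "Cod C k = Dom C f"
    "\<And>w. w \<in> Arr C \<Longrightarrow> Cod C w = Dom C f \<Longrightarrow> sub_le C w k \<longleftrightarrow> f \<cdot> w = g \<cdot> w"
    using equalizer_exists[of f g] assms by metis
  have "is_iso C k" by (rule cover_iso[OF assms(1)]) (use k assms in simp_all)
  then have "sub_le C (Id C (Cod C e)) k"
    by (rule sub_le_iso) (use k assms in simp_all)
  then show ?thesis using k(3)[of "Id C (Cod C e)"] assms by simp
qed

lemma cover_orth:
  assumes "cover C e" "monic C m" "b \<in> Arr C" "Dom C b = Cod C e" "Cod C b = Cod C m"
    "sub_le C (b \<cdot> e) m"
  shows "sub_le C b m"
proof -
  obtain p q where pb: "is_pullback C b m p q" by (rule pullback_exists[of b m]) (use assms in simp_all)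
  note pbD = pullbackD[OF pb]
  have "sub_le C e p" using pullback_sub_le[OF pb, of e] assms by simp
  then have "is_iso C p"
    by (rule cover_iso[OF assms(1) pullback_monic[OF pb assms(2)], rotated]) (use pbD assms in simp)
  then have "sub_le C (Id C (Dom C b)) p"
    by (rule sub_le_iso) (use pbD assms in simp_all)
  then show ?thesis using pullback_sub_le[OF pb, of "Id C (Dom C b)"] assms by simp
qed

lemma coverI:
  assumes "f \<in> Arr C"
    "\<And>m. monic C m \<Longrightarrow> Cod C m = Cod C f \<Longrightarrow> sub_le C f m \<Longrightarrow> sub_le C (Id C (Cod C f)) m"
  shows "cover C f"
  unfolding cover_def
proof (intro conjI allI impI)
  fix m assume m: "monic C m" "Cod C m = Cod C f" "sub_le C f m"
  obtain t where "t \<in> Arr C" "Dom C t = Dom C (Id C (Cod C f))" "Cod C t = Dom C m" "m \<cdot> t = Id C (Cod C f)"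
    using assms(2)[OF m] by (rule sub_leE)
  then show "is_iso C m" using monic_split_epi_iso[of m t] m by simp
qed (rule assms)

lemma coverD:
  assumes "cover C f" "monic C m" "Cod C m = Cod C f" "sub_le C f m"
    "w \<in> Arr C" "Cod C w = Cod C f"
  shows "sub_le C w m"
  by (rule sub_le_iso[OF cover_iso[OF assms(1-4)]]) (use assms in simp_all)

lemma cover_comp:
  assumes "cover C g" "cover C f" "Dom C g = Cod C f"
  shows "cover C (g \<cdot> f)"
proof (rule coverI)
  fix m assume m: "monic C m" "Cod C m = Cod C (g \<cdot> f)" "sub_le C (g \<cdot> f) m"
  have "sub_le C g m" by (rule cover_orth[OF assms(2)]) (use m assms in simp_all)
  then show "sub_le C (Id C (Cod C (g \<cdot> f))) m"
    by (rule coverD[OF assms(1) m(1), rotated]) (use m assms in simp_all)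
qed (use assms in simp)

lemma cover_right:
  assumes "cover C (g \<cdot> f)" "g \<in> Arr C" "f \<in> Arr C" "Dom C g = Cod C f"
  shows "cover C g"
proof (rule coverI)
  fix m assume m: "monic C m" "Cod C m = Cod C g" "sub_le C g m"
  have "sub_le C (g \<cdot> f) m" by (rule sub_le_comp) (use m assms in simp_all)
  then show "sub_le C (Id C (Cod C g)) m"
    by (rule coverD[OF assms(1) m(1), rotated]) (use m assms in simp_all)
qed (use assms in simp)

lemma split_epi_cover:
  assumes "g \<in> Arr C" "s \<in> Arr C" "Dom C g = Cod C s" "g \<cdot> s = Id C (Cod C g)"
  shows "cover C g"
proof (rule coverI)
  fix m assume m: "monic C m" "Cod C m = Cod C g" "sub_le C g m"
  have "sub_le C (g \<cdot> s) m" by (rule sub_le_comp) (use m assms in simp_all)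
  then show "sub_le C (Id C (Cod C g)) m" using assms by simp
qed (use assms in simp)

lemma iso_cover: "is_iso C g \<Longrightarrow> cover C g"
  using isoE[of g] split_epi_cover[of g] iso_arr[of g] by metis

lemma null_cover:
  assumes "cover C e" "null C (f \<cdot> e)" "f \<in> Arr C" "Dom C f = Cod C e"
  shows "null C f"
proof -
  have "f \<cdot> e = zero_arr C (Dom C e) (Cod C f)" using null_eq[OF assms(2)] assms by simp
  then have "f = zero_arr C (Dom C f) (Cod C f)"
    using cover_epi[OF assms(1), of f "zero_arr C (Dom C f) (Cod C f)"] assms by simp
  then show ?thesis using assms by (simp add: null_def)
qed

text \<open>The coequalizer \<open>e\<close> of the kernel pair gives the first factor. An element
  killed by \<open>m\<close> lifts along \<open>e\<close>, after restriction along a cover, to an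
  element killed by \<open>f\<close>; the kernel pair relates this element to zero, so
  \<open>e\<close> kills it. Thus \<open>m\<close> is monic by
  \<open>monic_if_kernel_null\<close>.\<close>

lemma image_exists:
  assumes "f \<in> Arr C"
  obtains e m where "regular_epi C e" "monic C m" "e \<in> Arr C" "Dom C e = Dom C f" "Cod C e = Dom C m"
    "Cod C m = Cod C f" "m \<cdot> e = f"
proof -
  obtain p q where pb: "is_pullback C f f p q" using pullback_exists assms by metis
  note pbD = pullbackD[OF pb]
  obtain e where co: "is_coequalizer C p q e"
    using pb barr_exact unfolding barr_exact_def regular_category_def by blast
  note cD = coequalizerD[OF co]
  have re: "regular_epi C e" using co unfolding regular_epi_def by blast
  obtain m where m: "m \<in> Arr C" "Dom C m = Cod C e" "Cod C m = Cod C f" "m \<cdot> e = f"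
    by (rule coequalizer_lift[OF co, of f]) (use pbD assms in simp_all)
  have "monic C m"
  proof (rule monic_if_kernel_null)
    fix w assume w: "w \<in> Arr C" "Cod C w = Dom C m" "null C (m \<cdot> w)"
    obtain a b where ab: "is_pullback C w e a b"
      by (rule pullback_exists[of w e]) (use w m cD in simp_all)
    note abD = pullbackD[OF ab]
    have "regular_epi C a"
      using ab re barr_exact unfolding barr_exact_def regular_category_def by blast
    then have ca: "cover C a" by (rule regular_epi_cover)
    define z where "z = zero_arr C (Dom C b) (Dom C f)"
    have z: "z \<in> Arr C" "Dom C z = Dom C b" "Cod C z = Dom C f" "null C z"
      using abD assms by (simp_all add: z_def)
    have "null C ((m \<cdot> w) \<cdot> a)" by (rule null_precomp) (use w m abD in simp_all)
    then have "null C (m \<cdot> (e \<cdot> b))" using w(1,2) m(1,2) abD by simp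
    then have n1: "null C (f \<cdot> b)" using m(1-3) cD abD(1-8) by (simp add: comp_eq[OF m(4)])
    have "f \<cdot> b = f \<cdot> z"
      by (rule null_null_eq[OF n1]) (use z assms abD cD pbD in simp_all)
    then obtain t where t: "t \<in> Arr C" "Dom C t = Dom C b" "Cod C t = Dom C p" "p \<cdot> t = b" "q \<cdot> t = z"
      using pullback_lift[OF pb, of b z] z abD cD pbD by metis
    have "e \<cdot> (p \<cdot> t) = e \<cdot> (q \<cdot> t)" using t(1-3) cD(1-6) pbD(1-8) by (simp add: comp_eq[OF cD(7)])
    then have "null C (e \<cdot> b)" using t z cD pbD null_comp by simp
    then have "null C (w \<cdot> a)" using abD by simp
    then show "null C w" using null_cover[OF ca, of w] abD w by simp
  qed (rule m)
  then show ?thesis using that[OF re] m cD pbD by simp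
qed

lemma cover_regular_epi:
  assumes "cover C f"
  shows "regular_epi C f"
proof -
  obtain e m where em: "regular_epi C e" "monic C m" "e \<in> Arr C" "Dom C e = Dom C f"
    "Cod C e = Dom C m" "Cod C m = Cod C f" "m \<cdot> e = f"
    using image_exists[OF cover_arr[OF assms]] .
  have "is_iso C m"
    by (rule cover_iso[OF assms]) (use em sub_leI[of m e f] in simp_all)
  then obtain n where n: "n \<in> Arr C" "Dom C n = Cod C m" "Cod C n = Dom C m"
    "n \<cdot> m = Id C (Dom C m)" "m \<cdot> n = Id C (Cod C m)" by (rule isoE)
  obtain a b where co: "is_coequalizer C a b e" using em unfolding regular_epi_def by blast
  note cD = coequalizerD[OF co]
  have "is_coequalizer C a b f"
    unfolding is_coequalizer_def
  proof (intro conjI allI ballI impI)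
    have "m \<cdot> (e \<cdot> a) = m \<cdot> (e \<cdot> b)" by (simp add: cD(7))
    then show "f \<cdot> a = f \<cdot> b" using em(2-6) cD(1-6) by (simp add: comp_eq[OF em(7)])
    fix T g assume g: "g \<in> hom C (Cod C a) T" "g \<cdot> a = g \<cdot> b"
    then obtain h where h: "h \<in> Arr C" "Dom C h = Cod C e" "Cod C h = T" "h \<cdot> e = g"
      using coequalizer_lift[OF co, of g] by auto
    have "n \<cdot> f = e"
    proof -
      have "n \<cdot> (m \<cdot> e) = e" using n(1-3) em(2-6) by (simp add: comp_eq[OF n(4)])
      then show ?thesis using em by simp
    qed
    show "\<exists>!h. h \<in> hom C (Cod C f) T \<and> h \<cdot> f = g"
    proof (rule ex1I[of _ "h \<cdot> n"])
      show "h \<cdot> n \<in> hom C (Cod C f) T \<and> (h \<cdot> n) \<cdot> f = g"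
        using h n(1-3) em(2-6) \<open>n \<cdot> f = e\<close> assms by simp
      fix h' assume h': "h' \<in> hom C (Cod C f) T \<and> h' \<cdot> f = g"
      show "h' = h \<cdot> n"
      proof (rule cover_epi[OF assms])
        show "h' \<cdot> f = (h \<cdot> n) \<cdot> f" using h h' n(1-3) em(2-6) \<open>n \<cdot> f = e\<close> assms by simp
      qed (use h h' n(1-3) em(2-6) in simp_all)
    qed
  qed (use cD em assms in simp_all)
  then show ?thesis unfolding regular_epi_def by blast
qed

lemma cover_pullback:
  assumes "is_pullback C f g p q" "cover C g"
  shows "cover C p"
  using assms cover_regular_epi regular_epi_cover barr_exact
  unfolding barr_exact_def regular_category_def by blast

text \<open>The substitute for choosing a preimage: lifting is possible after the domain of the
  generalized element has been replaced by a cover of it.\<close>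

lemma cover_lift:
  assumes "cover C g" "b \<in> Arr C" "Cod C b = Cod C g"
  obtains c a where "cover C c" "Cod C c = Dom C b" "a \<in> Arr C" "Dom C a = Dom C c" "Cod C a = Dom C g"
    "g \<cdot> a = b \<cdot> c"
proof -
  obtain c a where pb: "is_pullback C b g c a"
    by (rule pullback_exists[of b g]) (use assms in simp_all)
  show ?thesis using that[OF cover_pullback[OF pb assms(1)]] pullbackD[OF pb] by metis
qed

text \<open>The short five lemma for a subobject \<open>i\<close>. Base change of \<open>p\<close>
  along \<open>p \<cdot> i\<close> yields the split epimorphism \<open>b\<close>, and
  \<open>point_iso\<close> shows that the inverse image \<open>m\<close> of \<open>i\<close> along
  the cover \<open>a\<close> is everything. So \<open>a\<close> factors through \<open>i\<close>,
  and \<open>i\<close> is a cover as well as a monomorphism.\<close>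

lemma short_five:
  assumes i: "monic C i" and p: "p \<in> Arr C" "Dom C p = Cod C i" "cover C (p \<cdot> i)"
    and ker: "\<And>w. w \<in> Arr C \<Longrightarrow> Cod C w = Dom C p \<Longrightarrow> null C (p \<cdot> w) \<Longrightarrow> sub_le C w i"
  shows "is_iso C i"
proof -
  have ia: "i \<in> Arr C" using i by simp
  obtain a b where pb: "is_pullback C p (p \<cdot> i) a b"
    by (rule pullback_exists[of p "p \<cdot> i"]) (use p ia in simp_all)
  note pbD = pullbackD[OF pb]
  have ca: "cover C a" by (rule cover_pullback[OF pb p(3)])
  have ab: "p \<cdot> a = p \<cdot> (i \<cdot> b)" using pbD p ia by simp
  have tb: "a \<in> Arr C" "b \<in> Arr C" "Dom C b = Dom C a" "Cod C a = Dom C p" "Cod C b = Dom C i"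
    using pbD p ia by simp_all
  obtain s where s: "s \<in> Arr C" "Dom C s = Dom C i" "Cod C s = Dom C a" "a \<cdot> s = i" "b \<cdot> s = Id C (Dom C i)"
    by (rule pullback_lift[OF pb, of i "Id C (Dom C i)"]) (use p ia in simp_all)
  obtain m r where pb2: "is_pullback C a i m r"
    by (rule pullback_exists[of a i]) (use tb p ia in simp_all)
  note pb2D = pullbackD[OF pb2]
  have "is_iso C m"
  proof (rule point_iso[of b s])
    show "monic C m" by (rule pullback_monic[OF pb2 i])
    show "sub_le C s m" using pullback_sub_le[OF pb2, of s] s sub_le_refl[OF ia] by simp
  next
    fix w assume w: "w \<in> Arr C" "Cod C w = Dom C b" "null C (b \<cdot> w)"
    have "null C (p \<cdot> (i \<cdot> (b \<cdot> w)))" using w tb ia p by simp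
    then have "null C (p \<cdot> (a \<cdot> w))" using w tb ia p by (simp add: comp_eq[OF ab])
    then have "sub_le C (a \<cdot> w) i" using ker[of "a \<cdot> w"] w tb by simp
    then show "sub_le C w m" using pullback_sub_le[OF pb2, of w] w tb by simp
  qed (use s tb pb2D in simp_all)
  then have "sub_le C (Id C (Dom C a)) m" by (rule sub_le_iso) (use pb2D in simp_all)
  then have "sub_le C a i" using pullback_sub_le[OF pb2, of "Id C (Dom C a)"] tb by simp
  then obtain t where "t \<in> Arr C" "Dom C t = Dom C a" "Cod C t = Dom C i" "i \<cdot> t = a" by (rule sub_leE)
  then have "cover C i" using cover_right[of i t] ca ia by simp
  then show ?thesis using i by (rule cover_monic_iso)
qed

text \<open>Covers are normal epimorphisms. By \<open>point_joint_epi\<close>, applied to the first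
  projection of the kernel pair of \<open>q\<close> and the diagonal, \<open>g\<close> identifies
  the two projections. As a regular epimorphism \<open>q\<close> is the coequalizer of some pair of
  arrows, and that pair factors through the kernel pair.\<close>

lemma cover_factor:
  assumes q: "cover C q" and g: "g \<in> Arr C" "Dom C g = Dom C q"
    and ker: "\<And>w. w \<in> Arr C \<Longrightarrow> Cod C w = Dom C q \<Longrightarrow> null C (q \<cdot> w) \<Longrightarrow> null C (g \<cdot> w)"
  obtains h where "h \<in> Arr C" "Dom C h = Cod C q" "Cod C h = Cod C g" "h \<cdot> q = g"
proof -
  define A where "A = Dom C q"
  have A: "A \<in> Obj C" "Dom C q = A" "q \<in> Arr C" using q by (auto simp: A_def)
  obtain r1 r2 where pb: "is_pullback C q q r1 r2"
    by (rule pullback_exists[of q q]) (use q in simp_all)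
  note pbD = pullbackD[OF pb]
  obtain d where d: "d \<in> Arr C" "Dom C d = A" "Cod C d = Dom C r1" "r1 \<cdot> d = Id C A" "r2 \<cdot> d = Id C A"
    by (rule pullback_lift[OF pb, of "Id C A" "Id C A"]) (use A in simp_all)
  have gr: "g \<cdot> r1 = g \<cdot> r2"
  proof (rule point_joint_epi[of r1 d])
    show "(g \<cdot> r1) \<cdot> d = (g \<cdot> r2) \<cdot> d" using d A g pbD(1-8) by simp
    fix w assume w: "w \<in> Arr C" "Cod C w = Dom C r1" "null C (r1 \<cdot> w)"
    have "null C (q \<cdot> (r1 \<cdot> w))" using w pbD by simp
    then have "null C (q \<cdot> (r2 \<cdot> w))" using w pbD(1-8) by (simp add: comp_eq[OF pbD(9)])
    then have n2: "null C (g \<cdot> (r2 \<cdot> w))" using ker[of "r2 \<cdot> w"] w pbD(1-8) by simp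
    have n1: "null C (g \<cdot> (r1 \<cdot> w))" using w pbD(1-8) g by simp
    show "(g \<cdot> r1) \<cdot> w = (g \<cdot> r2) \<cdot> w" using null_null_eq[OF n1 n2] w pbD(1-8) g by simp
  qed (use d A g pbD in simp_all)
  obtain a b where co: "is_coequalizer C a b q"
    using cover_regular_epi[OF q] unfolding regular_epi_def by blast
  note cD = coequalizerD[OF co]
  obtain t where t: "t \<in> Arr C" "Dom C t = Dom C a" "Cod C t = Dom C r1" "r1 \<cdot> t = a" "r2 \<cdot> t = b"
    by (rule pullback_lift[OF pb, of a b]) (use cD in simp_all)
  have "g \<cdot> (r1 \<cdot> t) = g \<cdot> (r2 \<cdot> t)" using t(1-3) g pbD(1-8) by (simp add: comp_eq[OF gr])
  then have "g \<cdot> a = g \<cdot> b" using t by simp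
  then show ?thesis using coequalizer_lift[OF co, of g] that cD g by metis
qed

lemma cover_cokernel:
  assumes "cover C q" "is_kernel C q k"
  shows "is_cokernel C k q"
  unfolding is_cokernel_def
proof (intro conjI allI ballI impI)
  note kD = kernelD[OF assms(2)]
  show "q \<cdot> k = zero_arr C (Dom C k) (Cod C q)" using null_eq[OF kD(5)] kD by simp
  fix T g assume g: "g \<in> hom C (Cod C k) T" "g \<cdot> k = zero_arr C (Dom C k) T"
  have gk: "null C (g \<cdot> k)" using g kD by auto
  have ker: "null C (g \<cdot> w)" if w: "w \<in> Arr C" "Cod C w = Dom C q" "null C (q \<cdot> w)" for w
  proof -
    have "sub_le C w k" using kernel_sub_le[OF assms(2)] w by simp
    then obtain h where h: "h \<in> Arr C" "Dom C h = Dom C w" "Cod C h = Dom C k" "k \<cdot> h = w"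
      by (rule sub_leE)
    have "null C ((g \<cdot> k) \<cdot> h)" by (rule null_precomp[OF gk]) (use h(1-3) g(1) kD in simp_all)
    then show ?thesis using h g(1) kD by simp
  qed
  obtain h where h: "h \<in> Arr C" "Dom C h = Cod C q" "Cod C h = Cod C g" "h \<cdot> q = g"
    by (rule cover_factor[OF assms(1), of g]) (use g kD ker in simp_all)
  show "\<exists>!h. h \<in> hom C (Cod C q) T \<and> h \<cdot> q = g"
  proof (rule ex1I[of _ h])
    fix h' assume "h' \<in> hom C (Cod C q) T \<and> h' \<cdot> q = g"
    then show "h' = h" using h g cover_epi[OF assms(1), of h' h] by simp
  qed (use h g in simp)
qed (use kernelD[OF assms(2)] in simp_all)

end

section \<open>Idempotents\<close>

definition idempotent_on :: "('o, 'a) category \<Rightarrow> 'o \<Rightarrow> 'a \<Rightarrow> bool" where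
  "idempotent_on C A e \<longleftrightarrow> e \<in> Arr C \<and> Dom C e = A \<and> Cod C e = A \<and> e \<cdot>\<^bsub>C\<^esub> e = e"

context semi_abelian_category begin

text \<open>Let \<open>g\<close> be the arrow that \<open>f\<close> induces between the split images
  of \<open>e\<close> and \<open>e'\<close>. The comparison \<open>j\<close> from \<open>A\<close>
  to the pullback of \<open>p'\<close> along \<open>g\<close> is a cover, by the short five lemma
  for its image. Since \<open>e'\<close> kills \<open>w\<close>, the pair of \<open>w\<close> and
  zero is an element of this pullback; a local lift of it along \<open>j\<close> lies over
  \<open>w\<close> and is killed by \<open>e\<close>.\<close>

lemma lift_through_kernel:
  assumes f: "cover C f" "Dom C f = A" "Cod C f = A'"
    and e: "idempotent_on C A e" and e': "idempotent_on C A' e'" and fe: "f \<cdot> e = e' \<cdot> f"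
    and w: "w \<in> Arr C" "Cod C w = A'" "null C (e' \<cdot> w)"
  obtains c a where "cover C c" "Cod C c = Dom C w" "a \<in> Arr C" "Dom C a = Dom C c" "Cod C a = A"
    "f \<cdot> a = w \<cdot> c" "null C (e \<cdot> a)"
proof -
  note eD = e[unfolded idempotent_on_def] and eD' = e'[unfolded idempotent_on_def]
  have fa: "f \<in> Arr C" using f by simp
  obtain p s where ps: "p \<in> Arr C" "s \<in> Arr C" "Dom C p = A" "Dom C s = Cod C p" "Cod C s = A"
    "p \<cdot> s = Id C (Cod C p)" "s \<cdot> p = e" "monic C s"
    using split_idempotent[of e A] eD by metis
  obtain p' s' where ps': "p' \<in> Arr C" "s' \<in> Arr C" "Dom C p' = A'" "Dom C s' = Cod C p'" "Cod C s' = A'"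
    "p' \<cdot> s' = Id C (Cod C p')" "s' \<cdot> p' = e'" "monic C s'"
    using split_idempotent[of e' A'] eD' by metis
  define g where "g = p' \<cdot> (f \<cdot> s)"
  have g: "g \<in> Arr C" "Dom C g = Cod C p" "Cod C g = Cod C p'"
    using ps(1-5) ps'(1-5) f fa by (simp_all add: g_def)
  have fs: "f \<cdot> s = s' \<cdot> g"
  proof -
    have "s' \<cdot> g = e' \<cdot> (f \<cdot> s)"
      using ps(1-5) ps'(1-5) f fa by (simp add: g_def comp_eq[OF ps'(7)])
    also have "\<dots> = f \<cdot> (e \<cdot> s)" using ps(1-5) f fa eD eD' by (simp add: comp_eq[OF fe[symmetric]])
    also have "e \<cdot> s = s \<cdot> (p \<cdot> s)" using ps(1-5) by (simp add: comp_eq[OF ps(7)])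
    also have "\<dots> = s" using ps by simp
    finally show ?thesis ..
  qed
  have pf: "p' \<cdot> f = g \<cdot> p"
  proof -
    have "s' \<cdot> (g \<cdot> p) = f \<cdot> e"
      using g ps(1-5) ps'(1-5) f fa ps(7) by (simp add: comp_eq[OF fs[symmetric]])
    also have "\<dots> = s' \<cdot> (p' \<cdot> f)"
      using ps'(1-5) f fa fe by (simp add: comp_eq[OF ps'(7)])
    finally show ?thesis
      by (rule monicD[OF ps'(8), symmetric]) (use g ps(1-5) ps'(1-5) f fa in simp_all)
  qed
  obtain x y where pb: "is_pullback C p' g x y"
    by (rule pullback_exists[of p' g]) (use g ps' in simp_all)
  note pbD = pullbackD[OF pb]
  have xy: "x \<in> Arr C" "y \<in> Arr C" "Dom C y = Dom C x" "Cod C x = A'" "Cod C y = Cod C p"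
    using pbD g ps' by simp_all
  obtain j where j: "j \<in> Arr C" "Dom C j = A" "Cod C j = Dom C x" "x \<cdot> j = f" "y \<cdot> j = p"
    by (rule pullback_lift[OF pb, of f p]) (use pf f fa ps ps' g in simp_all)
  obtain \<epsilon> i where im: "regular_epi C \<epsilon>" "monic C i" "\<epsilon> \<in> Arr C" "Dom C \<epsilon> = Dom C j" "Cod C \<epsilon> = Dom C i"
    "Cod C i = Cod C j" "i \<cdot> \<epsilon> = j"
    using image_exists[OF j(1)] .
  have ia: "i \<in> Arr C" using im by simp
  have "is_iso C i"
  proof (rule short_five[of i x])
    have "x \<cdot> (i \<cdot> \<epsilon>) = f" using im(7) j(4) by simp
    then have "cover C ((x \<cdot> i) \<cdot> \<epsilon>)" using im(3-6) ia xy j(1-3) f by simp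
    then show "cover C (x \<cdot> i)" by (rule cover_right) (use im(3-6) ia xy j(1-3) in simp_all)
    fix w assume w: "w \<in> Arr C" "Cod C w = Dom C x" "null C (x \<cdot> w)"
    \<comment> \<open>An element of the kernel of \<open>x\<close> is determined by its component
      along \<open>y\<close>, and the section \<open>s\<close> turns this component into a preimage
      under \<open>j\<close>.\<close>
    define a where "a = s \<cdot> (y \<cdot> w)"
    have a: "a \<in> Arr C" "Dom C a = Dom C w" "Cod C a = A" using w ps xy by (simp_all add: a_def)
    have "j \<cdot> a = w"
    proof (rule pullback_unique[OF pb])
      have "f \<cdot> a = s' \<cdot> (g \<cdot> (y \<cdot> w))"
        unfolding a_def using w(1,2) ps(1-5) ps'(1-5) xy g f fa by (simp add: comp_eq[OF fs])
      also have "g \<cdot> (y \<cdot> w) = p' \<cdot> (x \<cdot> w)"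
        using w(1,2) pbD(1-8) by (simp add: comp_eq[OF pbD(9)])
      finally have "f \<cdot> a = s' \<cdot> (p' \<cdot> (x \<cdot> w))" .
      then have "null C (f \<cdot> a)" using w xy ps' by simp
      then have "f \<cdot> a = x \<cdot> w" by (rule null_null_eq) (use a f fa w xy in simp_all)
      then show "x \<cdot> (j \<cdot> a) = x \<cdot> w" using a xy j(1-3) by (simp add: comp_eq[OF j(4)])
      have "p \<cdot> a = y \<cdot> w" unfolding a_def using w(1,2) ps(1-5) xy by (simp add: comp_eq[OF ps(6)])
      then show "y \<cdot> (j \<cdot> a) = y \<cdot> w" using a xy j(1-3) by (simp add: comp_eq[OF j(5)])
    qed (use a j w in simp_all)
    then have "i \<cdot> (\<epsilon> \<cdot> a) = w" using a im(3-6) ia j(1-3) by (simp add: comp_eq[OF im(7)])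
    then show "sub_le C w i" by (intro sub_leI[of i "\<epsilon> \<cdot> a"]) (use a im(3-6) ia j(1-3) in simp_all)
  qed (use im xy j in simp_all)
  then have cj: "cover C j"
    using cover_comp[OF iso_cover regular_epi_cover[OF im(1)], of i] im by simp
  define z where "z = zero_arr C (Dom C w) (Cod C p)"
  have z: "z \<in> Arr C" "Dom C z = Dom C w" "Cod C z = Cod C p" "null C z"
    using w ps by (simp_all add: z_def)
  have "null C (s' \<cdot> (p' \<cdot> w))" using w ps'(1-5) by (simp add: comp_eq[OF ps'(7)])
  then have "null C (p' \<cdot> w)" by (rule null_monic[OF ps'(8)]) (use w ps' in simp_all)
  then have "p' \<cdot> w = g \<cdot> z" by (rule null_null_eq) (use w ps' g z in simp_all)
  then obtain w' where w': "w' \<in> Arr C" "Dom C w' = Dom C w" "Cod C w' = Dom C x" "x \<cdot> w' = w" "y \<cdot> w' = z"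
    using pullback_lift[OF pb, of w z] w z ps' g by metis
  obtain c a where ca: "cover C c" "Cod C c = Dom C w'" "a \<in> Arr C" "Dom C a = Dom C c" "Cod C a = Dom C j"
    "j \<cdot> a = w' \<cdot> c"
    by (rule cover_lift[OF cj, of w']) (use w' j in simp_all)
  have cc: "c \<in> Arr C" using ca by simp
  have "x \<cdot> (j \<cdot> a) = x \<cdot> (w' \<cdot> c)" "y \<cdot> (j \<cdot> a) = y \<cdot> (w' \<cdot> c)" using ca(6) by simp_all
  then have fa': "f \<cdot> a = w \<cdot> c" and pa: "p \<cdot> a = z \<cdot> c"
    using xy j(1-3) ca(2-5) cc w'(1-3)
    by (simp_all add: comp_eq[OF j(4)] comp_eq[OF j(5)] comp_eq[OF w'(4)] comp_eq[OF w'(5)])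
  have "null C (z \<cdot> c)" by (rule null_precomp) (use z ca w' in simp_all)
  then have "null C (s \<cdot> (p \<cdot> a))" unfolding pa by (rule null_comp) (use z cc ca w' ps in simp_all)
  then have "null C (e \<cdot> a)" using ps(1-5) ca(3-5) j by (simp add: comp_eq[OF ps(7)])
  then show ?thesis using that[of c a] ca fa' j w' by simp
qed

text \<open>The induction restricts everything to the kernel of the first idempotent.\<close>

lemma lift_through_kernels:
  assumes "cover C f"
    and "\<And>e e'. (e, e') \<in> set es \<Longrightarrow>
      idempotent_on C (Dom C f) e \<and> idempotent_on C (Cod C f) e' \<and> f \<cdot> e = e' \<cdot> f"
    and "\<And>e e' d d'. (e, e') \<in> set es \<Longrightarrow> (d, d') \<in> set es \<Longrightarrow> e \<cdot> d = d \<cdot> e \<and> e' \<cdot> d' = d' \<cdot> e'"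
    and "w \<in> Arr C" "Cod C w = Cod C f"
    and "\<And>e e'. (e, e') \<in> set es \<Longrightarrow> null C (e' \<cdot> w)"
  shows "\<exists>c a. cover C c \<and> Cod C c = Dom C w \<and> a \<in> Arr C \<and> Dom C a = Dom C c \<and> Cod C a = Dom C f \<and>
    f \<cdot> a = w \<cdot> c \<and> (\<forall>(e, e') \<in> set es. null C (e \<cdot> a))"
  using assms
proof (induction es arbitrary: f w rule: measure_induct_rule[where f = length])
  case (less es0)
  show ?case
  proof (cases es0)
    case Nil
    obtain c a where "cover C c" "Cod C c = Dom C w" "a \<in> Arr C" "Dom C a = Dom C c" "Cod C a = Dom C f"
      "f \<cdot> a = w \<cdot> c"
      using cover_lift[OF less.prems(1), of w] less.prems by metis
    then show ?thesis using Nil by auto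
  next
    case (Cons x es)
    note prems = less.prems[unfolded Cons]
    obtain d d' where x: "x = (d, d')" by (cases x)
    have idem: "idempotent_on C (Dom C f) e" "idempotent_on C (Cod C f) e'" "f \<cdot> e = e' \<cdot> f"
      "e \<in> Arr C" "Dom C e = Dom C f" "Cod C e = Dom C f" "e' \<in> Arr C" "Dom C e' = Cod C f" "Cod C e' = Cod C f"
      "d \<cdot> e = e \<cdot> d" "d' \<cdot> e' = e' \<cdot> d'" "e \<cdot> e = e" "e' \<cdot> e' = e'"
      if "(e, e') \<in> set (x # es)" for e e'
      using prems(2)[OF that] prems(3)[OF _ that, of d d'] x by (simp_all add: idempotent_on_def)
    have xin: "(d, d') \<in> set (x # es)" using x by simp
    note dD = idem[OF xin]
    have fa: "f \<in> Arr C" using prems(1) by simp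
    note w = prems(4,5)
    obtain k where k: "is_kernel C d k" using kernel_exists dD by metis
    obtain k' where k': "is_kernel C d' k'" using kernel_exists dD by metis
    note kD = kernelD[OF k] and kD' = kernelD[OF k']
    have kc: "k \<in> Arr C" "Cod C k = Dom C f" "k' \<in> Arr C" "Cod C k' = Cod C f" using kD kD' dD by simp_all
    have "null C (f \<cdot> (d \<cdot> k))" using kD fa kc dD(4-6) by simp
    then have "null C (d' \<cdot> (f \<cdot> k))" using fa kc dD(4-9) by (simp add: comp_eq[OF dD(3)])
    then have "sub_le C (f \<cdot> k) k'" using kernel_sub_le[OF k', of "f \<cdot> k"] fa kc dD by simp
    then obtain f1 where "f1 \<in> Arr C" "Dom C f1 = Dom C (f \<cdot> k)" "Cod C f1 = Dom C k'" "k' \<cdot> f1 = f \<cdot> k"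
      by (rule sub_leE)
    then have f1: "f1 \<in> Arr C" "Dom C f1 = Dom C k" "Cod C f1 = Dom C k'" "k' \<cdot> f1 = f \<cdot> k"
      using fa kc by simp_all
    \<comment> \<open>The case of one idempotent, applied to the inclusion \<open>k'\<close> itself,
      lifts the whole kernel of \<open>d'\<close> after a cover.\<close>
    have cf1: "cover C f1"
    proof -
      obtain c a where ca: "cover C c" "Cod C c = Dom C k'" "a \<in> Arr C" "Dom C a = Dom C c" "Cod C a = Dom C f"
        "f \<cdot> a = k' \<cdot> c" "null C (d \<cdot> a)"
        by (rule lift_through_kernel[OF prems(1) refl refl dD(1-3), of k']) (use kc kD' in simp_all)
      then obtain b where b: "b \<in> Arr C" "Dom C b = Dom C a" "Cod C b = Dom C k" "k \<cdot> b = a"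
        using kernel_sub_le[OF k, of a] dD by (auto elim: sub_leE)
      have "k' \<cdot> (f1 \<cdot> b) = f \<cdot> (k \<cdot> b)" using f1(1-3) kc b(1-3) fa by (simp add: comp_eq[OF f1(4)])
      also have "\<dots> = k' \<cdot> c" using b(4) ca(6) by simp
      finally have "f1 \<cdot> b = c"
        by (rule monicD[OF kD'(2)]) (use f1 b ca in simp_all)
      then show ?thesis using cover_right[of f1 b] ca(1) f1 b by simp
    qed
    \<comment> \<open>The remaining idempotents commute with \<open>d\<close> and \<open>d'\<close>
      and hence preserve the two kernels.\<close>
    have restr: "\<exists>r r'. (r \<in> Arr C \<and> Dom C r = Dom C k \<and> Cod C r = Dom C k \<and> k \<cdot> r = e \<cdot> k) \<and>
        (r' \<in> Arr C \<and> Dom C r' = Dom C k' \<and> Cod C r' = Dom C k' \<and> k' \<cdot> r' = e' \<cdot> k')"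
      if e: "(e, e') \<in> set es" for e e'
    proof -
      have e1: "(e, e') \<in> set (x # es)" using e by simp
      note eD = idem[OF e1]
      have "null C (e \<cdot> (d \<cdot> k))" "null C (e' \<cdot> (d' \<cdot> k'))" using kD kD' eD(4-9) kc dD(4-9) by simp_all
      then have "null C (d \<cdot> (e \<cdot> k))" "null C (d' \<cdot> (e' \<cdot> k'))"
        using kc eD(4-9) dD(4-9) by (simp_all add: comp_eq[OF eD(10)] comp_eq[OF eD(11)])
      then have "sub_le C (e \<cdot> k) k" "sub_le C (e' \<cdot> k') k'"
        using kernel_sub_le[OF k, of "e \<cdot> k"] kernel_sub_le[OF k', of "e' \<cdot> k'"] kc eD(4-9) dD(4-9) by simp_all
      then show ?thesis using kc eD(4-9) by (fastforce elim!: sub_leE)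
    qed
    define R where "R e = (SOME r. r \<in> Arr C \<and> Dom C r = Dom C k \<and> Cod C r = Dom C k \<and> k \<cdot> r = e \<cdot> k)" for e
    define R' where "R' e = (SOME r. r \<in> Arr C \<and> Dom C r = Dom C k' \<and> Cod C r = Dom C k' \<and> k' \<cdot> r = e \<cdot> k')" for e
    have R: "R e \<in> Arr C" "Dom C (R e) = Dom C k" "Cod C (R e) = Dom C k" "k \<cdot> R e = e \<cdot> k"
      "R' e' \<in> Arr C" "Dom C (R' e') = Dom C k'" "Cod C (R' e') = Dom C k'" "k' \<cdot> R' e' = e' \<cdot> k'"
      if "(e, e') \<in> set es" for e e'
    proof -
      have "\<exists>r. r \<in> Arr C \<and> Dom C r = Dom C k \<and> Cod C r = Dom C k \<and> k \<cdot> r = e \<cdot> k"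
        and "\<exists>r. r \<in> Arr C \<and> Dom C r = Dom C k' \<and> Cod C r = Dom C k' \<and> k' \<cdot> r = e' \<cdot> k'"
        using restr[OF that] by blast+
      from someI_ex[OF this(1)] someI_ex[OF this(2)]
      show "R e \<in> Arr C" "Dom C (R e) = Dom C k" "Cod C (R e) = Dom C k" "k \<cdot> R e = e \<cdot> k"
        "R' e' \<in> Arr C" "Dom C (R' e') = Dom C k'" "Cod C (R' e') = Dom C k'" "k' \<cdot> R' e' = e' \<cdot> k'"
        unfolding R_def R'_def by simp_all
    qed
    have comm: "k \<cdot> (R e \<cdot> R e1) = e \<cdot> (e1 \<cdot> k)" "k' \<cdot> (R' e' \<cdot> R' e1') = e' \<cdot> (e1' \<cdot> k')"
      if "(e, e') \<in> set es" "(e1, e1') \<in> set es" for e e' e1 e1'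
    proof -
      note r = R[OF that(1)] and r1 = R[OF that(2)]
      have "(e, e') \<in> set (x # es)" using that by simp
      note eD = idem(4-9)[OF this]
      show "k \<cdot> (R e \<cdot> R e1) = e \<cdot> (e1 \<cdot> k)"
        using kc r(1-3) r1(1-4) eD by (simp add: comp_eq[OF r(4)])
      show "k' \<cdot> (R' e' \<cdot> R' e1') = e' \<cdot> (e1' \<cdot> k')"
        using kc r(5-7) r1(5-8) eD by (simp add: comp_eq[OF r(8)])
    qed
    let ?es = "map (\<lambda>(e, e'). (R e, R' e')) es"
    have "null C (d' \<cdot> w)" by (rule prems(6)[OF xin])
    then obtain w1 where w1: "w1 \<in> Arr C" "Dom C w1 = Dom C w" "Cod C w1 = Dom C k'" "k' \<cdot> w1 = w"
      using kernel_sub_le[OF k', of w] dD w by (auto elim: sub_leE)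
    have es: "(\<exists>e e'. (e, e') \<in> set es \<and> r = R e \<and> r' = R' e')" if "(r, r') \<in> set ?es" for r r'
      using that by auto
    have "\<exists>c a. cover C c \<and> Cod C c = Dom C w1 \<and> a \<in> Arr C \<and> Dom C a = Dom C c \<and> Cod C a = Dom C f1 \<and>
      f1 \<cdot> a = w1 \<cdot> c \<and> (\<forall>(e, e') \<in> set ?es. null C (e \<cdot> a))"
    proof (rule less.IH)
      show "length ?es < length es0" using Cons by simp
      show "cover C f1" by (rule cf1)
      show "w1 \<in> Arr C" "Cod C w1 = Cod C f1" using w1 f1 by simp_all
    next
      fix r r' assume "(r, r') \<in> set ?es"
      then obtain e e' where e: "(e, e') \<in> set es" "r = R e" "r' = R' e'" using es by blast
      note rD = R[OF e(1)]
      have "(e, e') \<in> set (x # es)" using e by simp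
      note eD = idem[OF this]
      have "k \<cdot> (R e \<cdot> R e) = k \<cdot> R e" "k' \<cdot> (R' e' \<cdot> R' e') = k' \<cdot> R' e'"
        using comm[OF e(1) e(1)] rD eD(4-9) kc by (simp_all add: comp_eq[OF eD(12)] comp_eq[OF eD(13)])
      then have "R e \<cdot> R e = R e" "R' e' \<cdot> R' e' = R' e'"
        using monicD[OF kD(2), of "R e \<cdot> R e" "R e"] monicD[OF kD'(2), of "R' e' \<cdot> R' e'" "R' e'"] rD
        by simp_all
      moreover have "f1 \<cdot> R e = R' e' \<cdot> f1"
      proof -
        have "k' \<cdot> (f1 \<cdot> R e) = f \<cdot> (e \<cdot> k)" using f1(1-3) kc rD fa by (simp add: comp_eq[OF f1(4)])
        also have "\<dots> = e' \<cdot> (k' \<cdot> f1)" using f1 eD(4-9) kc fa by (simp add: comp_eq[OF eD(3)])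
        also have "\<dots> = k' \<cdot> (R' e' \<cdot> f1)" using f1(1-3) kc eD(4-9) rD(1-7) by (simp add: comp_eq[OF rD(8)])
        finally show ?thesis by (rule monicD[OF kD'(2)]) (use f1 rD in simp_all)
      qed
      ultimately show "idempotent_on C (Dom C f1) r \<and> idempotent_on C (Cod C f1) r' \<and> f1 \<cdot> r = r' \<cdot> f1"
        using rD f1 e by (simp add: idempotent_on_def)
      have "null C (e' \<cdot> w)" by (rule prems(6)[of e]) (use e in simp)
      then have "null C (k' \<cdot> (R' e' \<cdot> w1))"
        using rD(5-7) w1 kc eD(4-9) by (simp add: comp_eq[OF rD(8)])
      then show "null C (r' \<cdot> w1)" unfolding e by (rule null_monic[OF kD'(2)]) (use rD w1 in simp_all)
    next
      fix r r' q q' assume "(r, r') \<in> set ?es" "(q, q') \<in> set ?es"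
      then obtain e e' d d' where e: "(e, e') \<in> set es" "r = R e" "r' = R' e'"
        "(d, d') \<in> set es" "q = R d" "q' = R' d'" using es by metis
      note rD = R[OF e(1)] and qD = R[OF e(4)]
      have in2: "(e, e') \<in> set (x # es)" "(d, d') \<in> set (x # es)" using e by simp_all
      note eD = idem(4-9)[OF in2(1)] and dD = idem(4-9)[OF in2(2)]
      have ed: "e \<cdot> d = d \<cdot> e" "e' \<cdot> d' = d' \<cdot> e'" using prems(3)[OF in2] by simp_all
      have "k \<cdot> (R e \<cdot> R d) = k \<cdot> (R d \<cdot> R e)" "k' \<cdot> (R' e' \<cdot> R' d') = k' \<cdot> (R' d' \<cdot> R' e')"
        unfolding comm[OF e(1,4)] comm[OF e(4,1)]
        using eD dD kc by (simp_all add: comp_eq[OF ed(1)] comp_eq[OF ed(2)])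
      then show "r \<cdot> q = q \<cdot> r \<and> r' \<cdot> q' = q' \<cdot> r'" unfolding e
        using monicD[OF kD(2), of "R e \<cdot> R d" "R d \<cdot> R e"]
          monicD[OF kD'(2), of "R' e' \<cdot> R' d'" "R' d' \<cdot> R' e'"] rD qD
        by simp
    qed
    then obtain c a where ca: "cover C c" "Cod C c = Dom C w1" "a \<in> Arr C" "Dom C a = Dom C c"
      "Cod C a = Dom C f1" "f1 \<cdot> a = w1 \<cdot> c" "\<And>e e'. (e, e') \<in> set es \<Longrightarrow> null C (R e \<cdot> a)"
      by fastforce
    have cc: "c \<in> Arr C" using ca by simp
    have "f \<cdot> (k \<cdot> a) = k' \<cdot> (f1 \<cdot> a)" using f1(1-3) kc ca(3-5) fa by (simp add: comp_eq[OF f1(4)])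
    also have "\<dots> = w \<cdot> c" unfolding ca(6) using w1(1-3) kc ca(2) cc by (simp add: comp_eq[OF w1(4)])
    finally have 1: "f \<cdot> (k \<cdot> a) = w \<cdot> c" .
    have "null C ((d \<cdot> k) \<cdot> a)" by (rule null_precomp[OF kD(5)]) (use kD ca f1 in simp_all)
    then have 2: "null C (d \<cdot> (k \<cdot> a))" using kD ca f1 by simp
    have 3: "null C (e \<cdot> (k \<cdot> a))" if e: "(e, e') \<in> set es" for e e'
    proof -
      have "null C (k \<cdot> (R e \<cdot> a))" by (rule null_comp[OF ca(7)[OF e]]) (use R[OF e] kc ca f1 in simp_all)
      moreover have "(e, e') \<in> set (x # es)" using e by simp
      note idem(4-9)[OF this]
      ultimately show ?thesis using R(1-3)[OF e] kc ca(3-5) f1(2) by (simp add: comp_eq[OF R(4)[OF e]])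
    qed
    show ?thesis
      by (rule exI[of _ c], rule exI[of _ "k \<cdot> a"]) (use 1 2 3 ca kc w1 f1 x Cons in auto)
  qed
qed

text \<open>The equations \<open>L\<close> cut out a subobject on which \<open>d\<close> acts; protomodularity says that this
  subobject is generated by the kernel and the fixed points of \<open>d\<close>.\<close>

lemma idempotent_decomposition:
  assumes P: "P \<in> Obj C" and d: "idempotent_on C P d" and L: "finite L"
    "\<And>a b. (a, b) \<in> L \<Longrightarrow> a \<in> hom C P P \<and> b \<in> hom C P P \<and> a \<cdot> d = d \<cdot> a \<and> b \<cdot> d = d \<cdot> b"
    and fg: "f \<in> hom C P T" "g \<in> hom C P T"
    and ker: "\<And>w. w \<in> Arr C \<Longrightarrow> Cod C w = P \<Longrightarrow> (\<forall>(a, b) \<in> L. a \<cdot> w = b \<cdot> w) \<Longrightarrow>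
      null C (d \<cdot> w) \<Longrightarrow> f \<cdot> w = g \<cdot> w"
    and fixed: "\<And>w. w \<in> Arr C \<Longrightarrow> Cod C w = P \<Longrightarrow> (\<forall>(a, b) \<in> L. a \<cdot> w = b \<cdot> w) \<Longrightarrow>
      d \<cdot> w = w \<Longrightarrow> f \<cdot> w = g \<cdot> w"
    and w: "w \<in> Arr C" "Cod C w = P" "\<forall>(a, b) \<in> L. a \<cdot> w = b \<cdot> w"
  shows "f \<cdot> w = g \<cdot> w"
proof -
  note dD = d[unfolded idempotent_on_def]
  obtain k where k: "monic C k" "Cod C k = P"
    "\<And>w. w \<in> Arr C \<Longrightarrow> Cod C w = P \<Longrightarrow> sub_le C w k \<longleftrightarrow> (\<forall>(a, b) \<in> L. a \<cdot> w = b \<cdot> w)"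
    by (rule joint_equalizer_exists[OF L(1) P]) (use L(2) in auto)
  have ka: "k \<in> Arr C" using k by simp
  have kL: "a \<cdot> k = b \<cdot> k" if "(a, b) \<in> L" for a b
    using k(3)[OF ka k(2)] sub_le_refl[OF ka] that by auto
  have sat: "\<forall>(a, b) \<in> L. a \<cdot> (d \<cdot> w) = b \<cdot> (d \<cdot> w)"
    if w: "w \<in> Arr C" "Cod C w = P" "\<forall>(a, b) \<in> L. a \<cdot> w = b \<cdot> w" for w
  proof safe
    fix a b assume ab: "(a, b) \<in> L"
    note l = L(2)[OF ab]
    have l1: "a \<cdot> d = d \<cdot> a" "b \<cdot> d = d \<cdot> b" using l by simp_all
    have lt: "a \<in> Arr C" "Dom C a = P" "Cod C a = P" "b \<in> Arr C" "Dom C b = P" "Cod C b = P" using l by auto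
    have "a \<cdot> (d \<cdot> w) = d \<cdot> (a \<cdot> w)" "b \<cdot> (d \<cdot> w) = d \<cdot> (b \<cdot> w)"
      using w lt dD by (simp_all add: comp_eq[OF l1(1)] comp_eq[OF l1(2)])
    then show "a \<cdot> (d \<cdot> w) = b \<cdot> (d \<cdot> w)" using w ab by auto
  qed
  have satk: "\<forall>(a, b) \<in> L. a \<cdot> (k \<cdot> v) = b \<cdot> (k \<cdot> v)" if v: "v \<in> Arr C" "Cod C v = Dom C k" for v
    using k(3)[of "k \<cdot> v"] sub_leI[of k v "k \<cdot> v"] v ka k(2) by simp
  \<comment> \<open>As \<open>d\<close> commutes with the arrows in \<open>L\<close>, it maps the
    solution subobject \<open>k\<close> into itself; \<open>e\<close> is the restricted idempotent,
    to which \<open>idempotent_joint_epi\<close> applies.\<close>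
  have "sub_le C (d \<cdot> k) k" using k(3)[of "d \<cdot> k"] sat[OF ka k(2)] kL ka k dD by auto
  then obtain e where "e \<in> Arr C" "Dom C e = Dom C (d \<cdot> k)" "Cod C e = Dom C k" "k \<cdot> e = d \<cdot> k"
    by (rule sub_leE)
  then have e: "e \<in> Arr C" "Dom C e = Dom C k" "Cod C e = Dom C k" "k \<cdot> e = d \<cdot> k"
    using ka k dD by simp_all
  have dd: "d \<cdot> d = d" using dD by simp
  have dt: "d \<in> Arr C" "Dom C d = P" "Cod C d = P" using dD by simp_all
  have "k \<cdot> (e \<cdot> e) = k \<cdot> e" using e ka k(2) dt by (simp add: comp_eq[OF e(4)] comp_eq[OF dd])
  then have ee: "e \<cdot> e = e" by (rule monicD[OF k(1)]) (use e in simp_all)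
  have ft: "f \<in> Arr C" "Dom C f = P" "Cod C f = T" "g \<in> Arr C" "Dom C g = P" "Cod C g = T"
    using fg by auto
  have fk: "f \<cdot> k = g \<cdot> k"
  proof (rule idempotent_joint_epi[OF e(1-3) ee])
    have "f \<cdot> (d \<cdot> k) = g \<cdot> (d \<cdot> k)"
    proof (rule fixed)
      show "\<forall>(a, b)\<in>L. a \<cdot> (d \<cdot> k) = b \<cdot> (d \<cdot> k)" by (rule sat) (use ka k kL in auto)
      show "d \<cdot> (d \<cdot> k) = d \<cdot> k" using dt ka k(2) by (simp add: comp_eq[OF dd])
    qed (use dt ka k in simp_all)
    then show "(f \<cdot> k) \<cdot> e = (g \<cdot> k) \<cdot> e" using e ft ka k(2) by simp
    fix v assume v: "v \<in> Arr C" "Cod C v = Dom C k" "null C (e \<cdot> v)"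
    have "null C (k \<cdot> (e \<cdot> v))" using v e ka by simp
    then have "null C (d \<cdot> (k \<cdot> v))" using v(1,2) e(1-3) ka k(2) dt by (simp add: comp_eq[OF e(4)])
    then have "f \<cdot> (k \<cdot> v) = g \<cdot> (k \<cdot> v)" using ker[of "k \<cdot> v"] satk[OF v(1,2)] v ka k by simp
    then show "(f \<cdot> k) \<cdot> v = (g \<cdot> k) \<cdot> v" using v ft ka k(2) by simp
  qed (use ft ka k in simp_all)
  obtain h where h: "h \<in> Arr C" "Dom C h = Dom C w" "Cod C h = Dom C k" "k \<cdot> h = w"
    using k(3)[OF w(1,2)] w(3) by (auto elim: sub_leE)
  have "f \<cdot> (k \<cdot> h) = g \<cdot> (k \<cdot> h)" using h(1-3) ka k(2) ft by (simp add: comp_eq[OF fk])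
  then show ?thesis using h by simp
qed

end

section \<open>Normal images and their joins\<close>

text \<open>The image of \<open>f\<close> is a kernel. The image factorization is spelled out, so
  that the notion does not depend on the chosen \<open>img\<close>.\<close>

definition normal_image :: "('o, 'a) category \<Rightarrow> 'a \<Rightarrow> bool" where
  "normal_image C f \<longleftrightarrow> (\<exists>c m e. cover C c \<and> is_kernel C c m \<and> cover C e \<and> Cod C e = Dom C m \<and> m \<cdot>\<^bsub>C\<^esub> e = f)"

context semi_abelian_category begin

text \<open>The Mal'tsev property. Consider triples with \<open>e \<cdot> x1 = e \<cdot> x2\<close>
  and \<open>d \<cdot> x2 = d \<cdot> x3\<close>. Projection to the last two components is split by
  repeating \<open>x2\<close> in the first place. The subobject \<open>m\<close> of those triples
  for which the required \<open>t\<close> exists contains this section, with \<open>t\<close> equal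
  to \<open>x3\<close>, and the kernel of the projection, where \<open>x2\<close> and
  \<open>x3\<close> vanish, with \<open>t\<close> equal to \<open>x1\<close>. So
  \<open>point_iso\<close> applies.\<close>

lemma difunctional:
  assumes d: "d \<in> Arr C" "e \<in> Arr C" "Dom C e = Dom C d" "Cod C d = X" "Cod C e = X"
    and jm: "\<And>g h. \<lbrakk>g \<in> Arr C; h \<in> Arr C; Dom C g = Dom C h; Cod C g = Dom C d; Cod C h = Dom C d;
      d \<cdot> g = d \<cdot> h; e \<cdot> g = e \<cdot> h\<rbrakk> \<Longrightarrow> g = h"
    and x: "x1 \<in> Arr C" "x2 \<in> Arr C" "x3 \<in> Arr C" "Dom C x1 = U" "Dom C x2 = U" "Dom C x3 = U"
      "Cod C x1 = Dom C d" "Cod C x2 = Dom C d" "Cod C x3 = Dom C d"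
    and eqs: "e \<cdot> x1 = e \<cdot> x2" "d \<cdot> x2 = d \<cdot> x3"
  shows "\<exists>t. t \<in> Arr C \<and> Dom C t = U \<and> Cod C t = Dom C d \<and> d \<cdot> t = d \<cdot> x1 \<and> e \<cdot> t = e \<cdot> x3"
proof -
  have X: "X \<in> Obj C" using d by auto
  obtain \<rho>1 \<rho>2 where pb: "is_pullback C d d \<rho>1 \<rho>2" using pullback_exists d by metis
  note pbD = pullbackD[OF pb]
  define E' where "E' = Dom C \<rho>1"
  have E': "E' \<in> Obj C" "Dom C \<rho>1 = E'" using pbD by (auto simp: E'_def)
  have er: "e \<cdot> \<rho>1 \<in> Arr C" "Dom C (e \<cdot> \<rho>1) = E'" "Cod C (e \<cdot> \<rho>1) = X" using pbD d E' by simp_all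
  obtain \<pi>1 \<pi>2 where pb2: "is_pullback C e (e \<cdot> \<rho>1) \<pi>1 \<pi>2"
    by (rule pullback_exists[of e "e \<cdot> \<rho>1"]) (use er d in simp_all)
  note pb2D = pullbackD[OF pb2]
  have \<pi>: "\<pi>1 \<in> Arr C" "\<pi>2 \<in> Arr C" "Dom C \<pi>2 = Dom C \<pi>1" "Cod C \<pi>1 = Dom C d" "Cod C \<pi>2 = E'"
    and e\<pi>: "e \<cdot> \<pi>1 = e \<cdot> (\<rho>1 \<cdot> \<pi>2)"
    using pb2D er d E' pbD by simp_all
  obtain p1 p2 where prod: "is_product C X X p1 p2" using product_exists X by blast
  note pD = productD[OF prod]
  obtain n where n: "n \<in> Arr C" "Dom C n = Dom C d" "Cod C n = Dom C p1" "p1 \<cdot> n = d" "p2 \<cdot> n = e"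
    by (rule product_lift[OF prod, of d "Dom C d" e]) (use d in simp_all)
  have mn: "monic C n"
  proof (rule monicI)
    fix g h assume *: "g \<in> Arr C" "h \<in> Arr C" "Dom C g = Dom C h" "Cod C g = Dom C n" "Cod C h = Dom C n" "n \<cdot> g = n \<cdot> h"
    have "p1 \<cdot> (n \<cdot> g) = p1 \<cdot> (n \<cdot> h)" "p2 \<cdot> (n \<cdot> g) = p2 \<cdot> (n \<cdot> h)" using *(6) by simp_all
    then have "d \<cdot> g = d \<cdot> h" "e \<cdot> g = e \<cdot> h"
      using *(1-5) n(1-3) pD by (simp_all add: comp_eq[OF n(4)] comp_eq[OF n(5)])
    then show "g = h" using jm[of g h] * n by simp
  qed (use n in simp)
  have sub: "sub_le C w n \<longleftrightarrow> (\<exists>t. t \<in> Arr C \<and> Dom C t = Dom C w \<and> Cod C t = Dom C d \<and> d \<cdot> t = p1 \<cdot> w \<and> e \<cdot> t = p2 \<cdot> w)"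
    if w: "w \<in> Arr C" "Cod C w = Dom C p1" for w
  proof
    assume "sub_le C w n"
    then obtain t where t: "t \<in> Arr C" "Dom C t = Dom C w" "Cod C t = Dom C n" "n \<cdot> t = w" by (rule sub_leE)
    have "p1 \<cdot> (n \<cdot> t) = d \<cdot> t" "p2 \<cdot> (n \<cdot> t) = e \<cdot> t"
      using t(1-3) n(1-3) pD by (simp_all add: comp_eq[OF n(4)] comp_eq[OF n(5)])
    then show "\<exists>t. t \<in> Arr C \<and> Dom C t = Dom C w \<and> Cod C t = Dom C d \<and> d \<cdot> t = p1 \<cdot> w \<and> e \<cdot> t = p2 \<cdot> w"
      using t n by (intro exI[of _ t]) simp
  next
    assume "\<exists>t. t \<in> Arr C \<and> Dom C t = Dom C w \<and> Cod C t = Dom C d \<and> d \<cdot> t = p1 \<cdot> w \<and> e \<cdot> t = p2 \<cdot> w"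
    then obtain t where t: "t \<in> Arr C" "Dom C t = Dom C w" "Cod C t = Dom C d" "d \<cdot> t = p1 \<cdot> w" "e \<cdot> t = p2 \<cdot> w"
      by blast
    have "p1 \<cdot> (n \<cdot> t) = p1 \<cdot> w" "p2 \<cdot> (n \<cdot> t) = p2 \<cdot> w"
      using t n(1-3) pD by (simp_all add: comp_eq[OF n(4)] comp_eq[OF n(5)])
    then have "n \<cdot> t = w"
      by (intro product_unique[OF prod, of "n \<cdot> t" "Dom C w" w]) (use t(1-3) n(1-3) w in simp_all)
    then show "sub_le C w n" using sub_leI[of n t w] t n by simp
  qed
  obtain q where q: "q \<in> Arr C" "Dom C q = Dom C \<pi>1" "Cod C q = Dom C p1" "p1 \<cdot> q = d \<cdot> \<pi>1" "p2 \<cdot> q = e \<cdot> (\<rho>2 \<cdot> \<pi>2)"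
    by (rule product_lift[OF prod, of "d \<cdot> \<pi>1" "Dom C \<pi>1" "e \<cdot> (\<rho>2 \<cdot> \<pi>2)"]) (use d \<pi> pbD E' in simp_all)
  obtain m r where pb3: "is_pullback C q n m r"
    by (rule pullback_exists[of q n]) (use q n in simp_all)
  note pb3D = pullbackD[OF pb3]
  have subm: "sub_le C w m \<longleftrightarrow> (\<exists>t. t \<in> Arr C \<and> Dom C t = Dom C w \<and> Cod C t = Dom C d \<and>
      d \<cdot> t = d \<cdot> (\<pi>1 \<cdot> w) \<and> e \<cdot> t = e \<cdot> (\<rho>2 \<cdot> (\<pi>2 \<cdot> w)))" if w: "w \<in> Arr C" "Cod C w = Dom C \<pi>1" for w
  proof -
    have "p1 \<cdot> (q \<cdot> w) = d \<cdot> (\<pi>1 \<cdot> w)" "p2 \<cdot> (q \<cdot> w) = e \<cdot> (\<rho>2 \<cdot> (\<pi>2 \<cdot> w))"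
      using w q(1-3) d \<pi> pbD(1-8) E' pD by (simp_all add: comp_eq[OF q(4)] comp_eq[OF q(5)])
    then show ?thesis using pullback_sub_le[OF pb3, of w] sub[of "q \<cdot> w"] w q by simp
  qed
  obtain s where s: "s \<in> Arr C" "Dom C s = E'" "Cod C s = Dom C \<pi>1" "\<pi>1 \<cdot> s = \<rho>1" "\<pi>2 \<cdot> s = Id C E'"
    by (rule pullback_lift[OF pb2, of \<rho>1 "Id C E'"]) (use E' er pbD d in simp_all)
  have "is_iso C m"
  proof (rule point_iso[of \<pi>2 s])
    show "monic C m" by (rule pullback_monic[OF pb3 mn])
    show "sub_le C s m"
      unfolding subm[OF s(1,3)] by (rule exI[of _ \<rho>2]) (use s pbD E' in simp)
    fix w assume w: "w \<in> Arr C" "Cod C w = Dom C \<pi>2" "null C (\<pi>2 \<cdot> w)"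
    have w2: "Cod C w = Dom C \<pi>1" using w \<pi> by simp
    have n1: "null C (e \<cdot> (\<rho>1 \<cdot> (\<pi>2 \<cdot> w)))" and n2: "null C (e \<cdot> (\<rho>2 \<cdot> (\<pi>2 \<cdot> w)))"
      using w \<pi> pbD(1-8) d E' by simp_all
    have "e \<cdot> (\<pi>1 \<cdot> w) = e \<cdot> (\<rho>1 \<cdot> (\<pi>2 \<cdot> w))" using w(1,2) \<pi> pbD(1-8) d E' by (simp add: comp_eq[OF e\<pi>])
    also have "\<dots> = e \<cdot> (\<rho>2 \<cdot> (\<pi>2 \<cdot> w))" by (rule null_null_eq[OF n1 n2]) (use w \<pi> pbD(1-8) d E' in simp_all)
    finally show "sub_le C w m"
      unfolding subm[OF w(1) w2] by (intro exI[of _ "\<pi>1 \<cdot> w"]) (use w \<pi> in simp)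
  qed (use \<pi> s pb3D q in simp_all)
  then have all: "sub_le C w m" if "w \<in> Arr C" "Cod C w = Dom C \<pi>1" for w
    by (rule sub_le_iso) (use that pb3D q in simp_all)
  obtain \<xi> where \<xi>: "\<xi> \<in> Arr C" "Dom C \<xi> = U" "Cod C \<xi> = E'" "\<rho>1 \<cdot> \<xi> = x2" "\<rho>2 \<cdot> \<xi> = x3"
    using pullback_lift[OF pb, of x2 x3] x eqs E' by metis
  obtain w where w: "w \<in> Arr C" "Dom C w = U" "Cod C w = Dom C \<pi>1" "\<pi>1 \<cdot> w = x1" "\<pi>2 \<cdot> w = \<xi>"
  proof (rule pullback_lift[OF pb2, of x1 \<xi>])
    show "e \<cdot> x1 = (e \<cdot> \<rho>1) \<cdot> \<xi>" using eqs \<xi> d pbD E' by simp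
  qed (use x \<xi> er d in simp_all)
  show ?thesis using all[OF w(1,3)] unfolding subm[OF w(1,3)] w(2,4,5) \<xi>(5) .
qed

text \<open>Symmetry is difunctionality for \<open>r \<cdot> e\<close>, the identity and
  \<open>r \<cdot> d\<close>; transitivity is difunctionality for \<open>p\<close>,
  \<open>r \<cdot> (e \<cdot> p)\<close> and \<open>q\<close>.\<close>

lemma reflexive_relation_equivalence:
  assumes d: "d \<in> Arr C" "e \<in> Arr C" "Dom C e = Dom C d" "Cod C d = X" "Cod C e = X"
    and jm: "\<And>g h. \<lbrakk>g \<in> Arr C; h \<in> Arr C; Dom C g = Dom C h; Cod C g = Dom C d; Cod C h = Dom C d;
      d \<cdot> g = d \<cdot> h; e \<cdot> g = e \<cdot> h\<rbrakk> \<Longrightarrow> g = h"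
    and r: "r \<in> Arr C" "Dom C r = X" "Cod C r = Dom C d" "d \<cdot> r = Id C X" "e \<cdot> r = Id C X"
  shows "equivalence_relation C X d e"
  unfolding equivalence_relation_def
proof (intro conjI allI ballI impI)
  have X: "X \<in> Obj C" "Dom C d \<in> Obj C" using d by auto
  note dif = difunctional[OF d jm]
  show "d \<in> hom C (Dom C d) X" "e \<in> hom C (Dom C d) X" using d by simp_all
  show "\<exists>r\<in>hom C X (Dom C d). d \<cdot> r = Id C X \<and> e \<cdot> r = Id C X" using r by auto
  show "g = h" if "g \<in> hom C T (Dom C d)" "h \<in> hom C T (Dom C d)" "d \<cdot> g = d \<cdot> h" "e \<cdot> g = e \<cdot> h" for T g h
    using jm[of g h] that by simp
  have rd: "d \<cdot> (r \<cdot> k) = k" "e \<cdot> (r \<cdot> k) = k" if "k \<in> Arr C" "Cod C k = X" for k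
    using that r(1-3) d by (simp_all add: comp_eq[OF r(4)] comp_eq[OF r(5)])
  have "\<exists>t. t \<in> Arr C \<and> Dom C t = Dom C d \<and> Cod C t = Dom C d \<and> d \<cdot> t = d \<cdot> (r \<cdot> e) \<and> e \<cdot> t = e \<cdot> (r \<cdot> d)"
    by (rule dif[of _ "Id C (Dom C d)"]) (use d X r(1-3) rd in simp_all)
  then show "\<exists>s\<in>hom C (Dom C d) (Dom C d). d \<cdot> s = e \<and> e \<cdot> s = d"
    using rd d by auto
  fix p q assume pb: "is_pullback C e d p q"
  note pbD = pullbackD[OF pb]
  have "\<exists>t. t \<in> Arr C \<and> Dom C t = Dom C p \<and> Cod C t = Dom C d \<and> d \<cdot> t = d \<cdot> p \<and> e \<cdot> t = e \<cdot> q"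
    by (rule dif[of _ "r \<cdot> (e \<cdot> p)"]) (use d X r(1-3) rd pbD in simp_all)
  then show "\<exists>t\<in>hom C (Dom C p) (Dom C d). d \<cdot> t = d \<cdot> p \<and> e \<cdot> t = e \<cdot> q" by auto
qed

text \<open>The image of the kernel pair of \<open>g\<close> under \<open>q \<times> q\<close> is a reflexive relation, hence
  effective; its normalization is the image of \<open>q \<cdot> k\<close>.\<close>

lemma normal_image_cover_kernel:
  assumes k: "is_kernel C g k" and q: "cover C q" "Dom C q = Dom C g"
  shows "normal_image C (q \<cdot> k)"
proof -
  note kD = kernelD[OF k]
  define A B where "A = Dom C g" and "B = Cod C q"
  have AB: "A \<in> Obj C" "B \<in> Obj C" "Dom C g = A" "Dom C q = A" "Cod C q = B" "q \<in> Arr C" "Cod C k = A"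
    using kD q by (auto simp: A_def B_def)
  obtain r1 r2 where pb: "is_pullback C g g r1 r2" using pullback_exists kD by metis
  note pbD = pullbackD[OF pb]
  have rt: "r1 \<in> Arr C" "r2 \<in> Arr C" "Dom C r2 = Dom C r1" "Cod C r1 = A" "Cod C r2 = A"
    using pbD AB by simp_all
  obtain \<delta> where \<delta>: "\<delta> \<in> Arr C" "Dom C \<delta> = A" "Cod C \<delta> = Dom C r1" "r1 \<cdot> \<delta> = Id C A" "r2 \<cdot> \<delta> = Id C A"
    by (rule pullback_lift[OF pb, of "Id C A" "Id C A"]) (use AB kD in simp_all)
  obtain p1 p2 where prod: "is_product C B B p1 p2" using product_exists AB by blast
  note pD = productD[OF prod]
  obtain h where h: "h \<in> Arr C" "Dom C h = Dom C r1" "Cod C h = Dom C p1" "p1 \<cdot> h = q \<cdot> r1" "p2 \<cdot> h = q \<cdot> r2"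
    by (rule product_lift[OF prod, of "q \<cdot> r1" "Dom C r1" "q \<cdot> r2"]) (use AB rt in simp_all)
  obtain \<epsilon> n where im: "regular_epi C \<epsilon>" "monic C n" "\<epsilon> \<in> Arr C" "Dom C \<epsilon> = Dom C h" "Cod C \<epsilon> = Dom C n"
    "Cod C n = Cod C h" "n \<cdot> \<epsilon> = h"
    using image_exists[OF h(1)] .
  have \<epsilon>: "cover C \<epsilon>" using regular_epi_cover im by blast
  have na: "n \<in> Arr C" "Cod C n = Dom C p1" using im h by simp_all
  define d e where "d = p1 \<cdot> n" and "e = p2 \<cdot> n"
  have de: "d \<in> Arr C" "e \<in> Arr C" "Dom C d = Dom C n" "Dom C e = Dom C n" "Cod C d = B" "Cod C e = B"
    using na pD by (simp_all add: d_def e_def)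
  have de\<epsilon>: "d \<cdot> \<epsilon> = q \<cdot> r1" "e \<cdot> \<epsilon> = q \<cdot> r2"
    using na pD im(3-6) h(2,3) by (simp_all add: d_def e_def im(7) h(4,5))
  have jm: "x = y" if "x \<in> Arr C" "y \<in> Arr C" "Dom C x = Dom C y" "Cod C x = Dom C d" "Cod C y = Dom C d"
      "d \<cdot> x = d \<cdot> y" "e \<cdot> x = e \<cdot> y" for x y
  proof -
    have "n \<cdot> x = n \<cdot> y"
      by (rule product_unique[OF prod, of _ "Dom C x"]) (use that na pD de in \<open>simp_all add: d_def e_def\<close>)
    then show ?thesis by (rule monicD[OF im(2)]) (use that de in simp_all)
  qed
  obtain diag where diag: "diag \<in> Arr C" "Dom C diag = B" "Cod C diag = Dom C p1" "p1 \<cdot> diag = Id C B" "p2 \<cdot> diag = Id C B"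
    by (rule product_lift[OF prod, of "Id C B" B "Id C B"]) (use AB in simp_all)
  have dq: "diag \<cdot> q = h \<cdot> \<delta>"
  proof (rule product_unique[OF prod])
    show "p1 \<cdot> (diag \<cdot> q) = p1 \<cdot> (h \<cdot> \<delta>)" "p2 \<cdot> (diag \<cdot> q) = p2 \<cdot> (h \<cdot> \<delta>)"
      using diag(1-3) AB h(1-3) \<delta> rt pD
      by (simp_all add: comp_eq[OF diag(4)] comp_eq[OF diag(5)] comp_eq[OF h(4)] comp_eq[OF h(5)])
  qed (use diag AB h \<delta> in simp_all)
  have "sub_le C (diag \<cdot> q) n"
    by (rule sub_leI[of _ "\<epsilon> \<cdot> \<delta>"])
      (use im(3-6) na h(1-3) \<delta>(1-3) in \<open>simp_all add: dq comp_eq[OF im(7)]\<close>)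
  then have "sub_le C diag n" by (rule cover_orth[OF q(1) im(2), rotated 3]) (use diag AB na in simp_all)
  then obtain r where r: "r \<in> Arr C" "Dom C r = B" "Cod C r = Dom C n" "n \<cdot> r = diag"
    using diag by (auto elim: sub_leE)
  have dr: "d \<cdot> r = Id C B" "e \<cdot> r = Id C B"
    using r na pD diag by (simp_all add: d_def e_def)
  have "equivalence_relation C B d e"
    by (rule reflexive_relation_equivalence[of d e B r]) (use de jm r dr in simp_all)
  \<comment> \<open>By exactness the relation is the kernel pair of some \<open>c0\<close>. The
    cover \<open>c\<close> onto the image of \<open>c0\<close> replaces it below, as both have the
    same kernel.\<close>
  then obtain c0 where c0: "is_pullback C c0 c0 d e"
    using barr_exact unfolding barr_exact_def by blast
  note c0D = pullbackD[OF c0]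
  obtain c i where ci: "regular_epi C c" "monic C i" "c \<in> Arr C" "Dom C c = Dom C c0" "Cod C c = Dom C i"
    "Cod C i = Cod C c0" "i \<cdot> c = c0"
    using image_exists[OF c0D(1)] .
  have cc: "cover C c" using regular_epi_cover ci by blast
  have dc: "Dom C c0 = B" using c0D de by simp
  have null_c: "null C (c \<cdot> w)" if "w \<in> Arr C" "Cod C w = B" "null C (c0 \<cdot> w)" for w
  proof (rule null_monic[OF ci(2)])
    show "null C (i \<cdot> (c \<cdot> w))" using that ci(2-6) dc by (simp add: comp_eq[OF ci(7)])
  qed (use that ci dc in simp_all)
  obtain m where m: "is_kernel C c m" using kernel_exists ci by metis
  note mD = kernelD[OF m]
  have mt: "m \<in> Arr C" "Cod C m = B" using mD ci dc by simp_all
  \<comment> \<open>The pair of zero and \<open>k\<close> is an element of the kernel pair of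
    \<open>g\<close>, so zero and \<open>q \<cdot> k\<close> are related and \<open>c\<close> kills
    \<open>q \<cdot> k\<close>.\<close>
  define z where "z = zero_arr C (Dom C k) A"
  have z: "z \<in> Arr C" "Dom C z = Dom C k" "Cod C z = A" "null C z"
    using kD AB by (simp_all add: z_def)
  have "g \<cdot> z = g \<cdot> k" by (rule null_null_eq) (use z kD AB in simp_all)
  then obtain t where t: "t \<in> Arr C" "Dom C t = Dom C k" "Cod C t = Dom C r1" "r1 \<cdot> t = z" "r2 \<cdot> t = k"
    using pullback_lift[OF pb, of z k] z kD AB by metis
  have "c0 \<cdot> (q \<cdot> k) = c0 \<cdot> (e \<cdot> (\<epsilon> \<cdot> t))"
    using t im(3-6) de AB rt h(2,3) by (simp add: comp_eq[OF de\<epsilon>(2)])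
  also have "\<dots> = c0 \<cdot> (d \<cdot> (\<epsilon> \<cdot> t))"
    using c0D(1-8) t(1-3) im(3-6) h(2,3) de by (simp add: comp_eq[OF c0D(9)])
  also have "d \<cdot> (\<epsilon> \<cdot> t) = q \<cdot> z"
    using t im(3-6) de AB rt h(2,3) by (simp add: comp_eq[OF de\<epsilon>(1)])
  finally have "null C (c0 \<cdot> (q \<cdot> k))" using z AB c0D dc by simp
  then have "null C (c \<cdot> (q \<cdot> k))" using null_c[of "q \<cdot> k"] AB kD by simp
  then have "sub_le C (q \<cdot> k) m" using kernel_sub_le[OF m, of "q \<cdot> k"] AB kD ci dc by simp
  then obtain f where f: "f \<in> Arr C" "Dom C f = Dom C k" "Cod C f = Dom C m" "m \<cdot> f = q \<cdot> k"
    using AB kD by (auto elim: sub_leE)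
  \<comment> \<open>Conversely, zero and \<open>m\<close> are related. That the first component is
    zero means that the idempotent \<open>r \<cdot> d\<close> kills this element of the relation. It
    therefore lifts to an element of the kernel pair of \<open>g\<close> with first component zero,
    whose second component lies in the kernel of \<open>g\<close>.\<close>
  have cf: "cover C f"
  proof -
    define z' where "z' = zero_arr C (Dom C m) B"
    have z': "z' \<in> Arr C" "Dom C z' = Dom C m" "Cod C z' = B" "null C z'"
      using mD AB by (simp_all add: z'_def)
    have "null C (i \<cdot> (c \<cdot> m))" using mD ci by simp
    then have "null C (c0 \<cdot> m)" using ci(2-6) mt dc by (simp add: comp_eq[OF ci(7)])
    then have "c0 \<cdot> z' = c0 \<cdot> m" by (intro null_null_eq) (use z' mt c0D dc in simp_all)
    then obtain t' where t': "t' \<in> Arr C" "Dom C t' = Dom C m" "Cod C t' = Dom C n" "d \<cdot> t' = z'" "e \<cdot> t' = m"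
      using pullback_lift[OF c0, of z' m] z' mt dc de by metis
    have rd\<epsilon>: "\<epsilon> \<cdot> (\<delta> \<cdot> r1) = (r \<cdot> d) \<cdot> \<epsilon>"
    proof (rule monicD[OF im(2)])
      have "n \<cdot> (\<epsilon> \<cdot> (\<delta> \<cdot> r1)) = diag \<cdot> (q \<cdot> r1)"
        using im(3-6) na h(1-3) \<delta>(1-3) rt diag(1-3) AB by (simp add: comp_eq[OF im(7)] comp_eq[OF dq])
      also have "\<dots> = n \<cdot> ((r \<cdot> d) \<cdot> \<epsilon>)"
        using r(1-3) de im(3-6) na h(2,3) AB rt by (simp add: comp_eq[OF r(4)] de\<epsilon>)
      finally show "n \<cdot> (\<epsilon> \<cdot> (\<delta> \<cdot> r1)) = n \<cdot> ((r \<cdot> d) \<cdot> \<epsilon>)" .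
    qed (use im(3-6) na h(1-3) \<delta>(1-3) rt r de in simp_all)
    have id1: "idempotent_on C (Dom C r1) (\<delta> \<cdot> r1)" "idempotent_on C (Dom C n) (r \<cdot> d)"
      using \<delta>(1-3) rt r(1-3) de AB
      by (simp_all add: idempotent_on_def comp_eq[OF \<delta>(4)] comp_eq[OF dr(1)])
    have "null C ((r \<cdot> d) \<cdot> t')" using r de t' z' by simp
    then obtain \<kappa> a where a: "cover C \<kappa>" "Cod C \<kappa> = Dom C t'" "a \<in> Arr C" "Dom C a = Dom C \<kappa>" "Cod C a = Dom C r1"
      "\<epsilon> \<cdot> a = t' \<cdot> \<kappa>" "null C ((\<delta> \<cdot> r1) \<cdot> a)"
      using lift_through_kernel[OF \<epsilon> _ _ id1 rd\<epsilon>, of t'] im(3-5) h(2) t'(1-3) by metis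
    have \<kappa>: "\<kappa> \<in> Arr C" using a by simp
    have "null C (r1 \<cdot> ((\<delta> \<cdot> r1) \<cdot> a))" by (rule null_comp[OF a(7)]) (use a rt \<delta>(1-3) in simp_all)
    then have "null C (r1 \<cdot> a)" using a(3-5) rt \<delta>(1-3) AB by (simp add: comp_eq[OF \<delta>(4)])
    then have "null C (g \<cdot> (r1 \<cdot> a))" using rt a AB kD by simp
    then have "null C (g \<cdot> (r2 \<cdot> a))" using a(3-5) pbD(1-8) by (simp add: comp_eq[OF pbD(9)])
    then have "sub_le C (r2 \<cdot> a) k" using kernel_sub_le[OF k, of "r2 \<cdot> a"] a rt AB by simp
    then obtain s where s: "s \<in> Arr C" "Dom C s = Dom C a" "Cod C s = Dom C k" "k \<cdot> s = r2 \<cdot> a"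
      using a rt by (auto elim: sub_leE)
    have "m \<cdot> (f \<cdot> s) = q \<cdot> (k \<cdot> s)" using f(1-3) mt s(1-3) AB kD by (simp add: comp_eq[OF f(4)])
    also have "\<dots> = q \<cdot> (r2 \<cdot> a)" using s(4) by simp
    also have "\<dots> = e \<cdot> (\<epsilon> \<cdot> a)" using a(3-5) rt AB im(3-6) h(2) de by (simp add: comp_eq[OF de\<epsilon>(2)])
    also have "\<dots> = e \<cdot> (t' \<cdot> \<kappa>)" using a(6) by simp
    also have "\<dots> = m \<cdot> \<kappa>" using t'(1-3) \<kappa> a(2) de by (simp add: comp_eq[OF t'(5)])
    finally have "f \<cdot> s = \<kappa>" by (rule monicD[OF mD(2)]) (use f(1-3) s(1-3) a(1-5) \<kappa> t'(2) in simp_all)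
    then show ?thesis using cover_right[of f s] a(1) f s by simp
  qed
  show ?thesis unfolding normal_image_def using cc m cf f by blast
qed

text \<open>The quotient is formed in two stages: \<open>q1\<close> divides by the first image, and
  \<open>q2\<close> by the image of the second one under \<open>q1\<close>, which is normal by
  \<open>normal_image_cover_kernel\<close>. For minimality \<open>q1\<close> is restricted to the
  kernel of \<open>q\<close>. The kernel of this restriction lies in the first image and hence in
  \<open>M\<close>, while the second image, also in \<open>M\<close>, already covers its codomain;
  by the short five lemma \<open>M\<close> contains the kernel of \<open>q\<close>.\<close>

lemma normal_image_join:
  assumes "normal_image C f1" "normal_image C f2" "Cod C f1 = A" "Cod C f2 = A"
  obtains q where "cover C q" "Dom C q = A" "null C (q \<cdot> f1)" "null C (q \<cdot> f2)"
    "\<And>m w. monic C m \<Longrightarrow> Cod C m = A \<Longrightarrow> sub_le C f1 m \<Longrightarrow> sub_le C f2 m \<Longrightarrow>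
      w \<in> Arr C \<Longrightarrow> Cod C w = A \<Longrightarrow> null C (q \<cdot> w) \<Longrightarrow> sub_le C w m"
proof -
  obtain q1 m1 e1 where 1: "cover C q1" "is_kernel C q1 m1" "cover C e1" "Cod C e1 = Dom C m1" "m1 \<cdot> e1 = f1"
    using assms(1) unfolding normal_image_def by blast
  obtain q0 m2 e2 where 2: "cover C q0" "is_kernel C q0 m2" "cover C e2" "Cod C e2 = Dom C m2" "m2 \<cdot> e2 = f2"
    using assms(2) unfolding normal_image_def by blast
  note m1D = kernelD[OF 1(2)] and m2D = kernelD[OF 2(2)]
  have t: "q1 \<in> Arr C" "q0 \<in> Arr C" "e1 \<in> Arr C" "e2 \<in> Arr C" using 1 2 by simp_all
  have A: "Cod C m1 = A" "Cod C m2 = A" "Dom C q1 = A" "Dom C q0 = A"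
    using assms(3,4) 1 2 m1D m2D t by auto
  obtain q2 n e where 3: "cover C q2" "is_kernel C q2 n" "cover C e" "Cod C e = Dom C n" "n \<cdot> e = q1 \<cdot> m2"
    using normal_image_cover_kernel[OF 2(2) 1(1)] A unfolding normal_image_def by auto
  note nD = kernelD[OF 3(2)]
  have t3: "q2 \<in> Arr C" "e \<in> Arr C" using 3 by simp_all
  have "Cod C (n \<cdot> e) = Cod C (q1 \<cdot> m2)" "Dom C (n \<cdot> e) = Dom C (q1 \<cdot> m2)" using 3(5) by simp_all
  then have t4: "Cod C n = Cod C q1" "Dom C q2 = Cod C q1" "Dom C e = Dom C m2"
    using nD(3,4) t t3 3(4) m2D(3) A by simp_all
  define q where "q = q2 \<cdot> q1"
  have q: "cover C q" unfolding q_def by (rule cover_comp) (use 1 3 t4 in simp_all)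
  have qt: "q \<in> Arr C" "Dom C q = A" using q t t3 t4 A by (simp_all add: q_def)
  have "null C ((q1 \<cdot> m1) \<cdot> e1)" by (rule null_precomp[OF m1D(5)]) (use m1D t 1 in simp_all)
  then have "null C (q1 \<cdot> f1)" using 1 m1D t by simp
  moreover have "f1 \<in> Arr C" using 1 m1D t by auto
  ultimately have nq1: "null C (q \<cdot> f1)" using t t3 t4 A assms(3) by (simp add: q_def)
  have "null C (q2 \<cdot> (n \<cdot> e))" using null_precomp[OF nD(5), of e] nD t3 3(4) by simp
  then have "null C (q2 \<cdot> (q1 \<cdot> m2))" using 3 by simp
  then have "null C ((q2 \<cdot> (q1 \<cdot> m2)) \<cdot> e2)" by (rule null_precomp) (use t t4 t3 A m2D 2 in simp_all)
  moreover have "f2 \<in> Arr C" using 2 m2D t by auto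
  ultimately have nq2: "null C (q \<cdot> f2)" using t t3 t4 A m2D 2 assms(4) by (simp add: q_def)
  have "sub_le C w M" if M: "monic C M" "Cod C M = A" "sub_le C f1 M" "sub_le C f2 M"
    and w: "w \<in> Arr C" "Cod C w = A" "null C (q \<cdot> w)" for M w
  proof -
    obtain k where k: "is_kernel C q k" using kernel_exists qt by metis
    note kD = kernelD[OF k]
    have kt: "k \<in> Arr C" "Cod C k = A" using kD qt by simp_all
    obtain i j where pb: "is_pullback C k M i j"
      by (rule pullback_exists[of k M]) (use M kt in simp_all)
    note pbD = pullbackD[OF pb]
    have mi: "monic C i" by (rule pullback_monic[OF pb M(1)])
    have it: "i \<in> Arr C" "Cod C i = Dom C k" using pbD by simp_all
    have "null C (q2 \<cdot> (q1 \<cdot> k))" using kD(5) kt t t3 t4 A by (simp add: q_def)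
    then have "sub_le C (q1 \<cdot> k) n" using kernel_sub_le[OF 3(2), of "q1 \<cdot> k"] kt t t4 A by simp
    then obtain u where u: "u \<in> Arr C" "Dom C u = Dom C k" "Cod C u = Dom C n" "n \<cdot> u = q1 \<cdot> k"
      using kt t A by (auto elim: sub_leE)
    have f2t: "f2 \<in> Arr C" "Dom C f2 = Dom C e2" using 2 m2D t by auto
    have "sub_le C f2 k" using kernel_sub_le[OF k, of f2] nq2 f2t assms(4) qt by simp
    then obtain b where b: "b \<in> Arr C" "Dom C b = Dom C f2" "Cod C b = Dom C k" "k \<cdot> b = f2" by (rule sub_leE)
    have "sub_le C b i" using pullback_sub_le[OF pb, of b] b M(4) by simp
    then obtain b' where b': "b' \<in> Arr C" "Dom C b' = Dom C b" "Cod C b' = Dom C i" "i \<cdot> b' = b" by (rule sub_leE)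
    have "n \<cdot> (u \<cdot> b) = n \<cdot> (e \<cdot> e2)"
    proof -
      have "n \<cdot> (u \<cdot> b) = q1 \<cdot> f2" using u(1-3) b nD(3) kt t A by (simp add: comp_eq[OF u(4)])
      also have "\<dots> = n \<cdot> (e \<cdot> e2)" using t t3 t4 nD(3) 3(4) 2(4) m2D(3) A by (simp add: comp_eq[OF 3(5)] flip: 2(5))
      finally show ?thesis .
    qed
    then have ub: "u \<cdot> b = e \<cdot> e2"
      by (rule monicD[OF nD(2)]) (use u b f2t t t3 t4 2(4) 3(4) in simp_all)
    have "cover C (e \<cdot> e2)" by (rule cover_comp) (use 2 3 t4 in simp_all)
    then have "cover C ((u \<cdot> i) \<cdot> b')" using ub u b' it by simp
    then have cui: "cover C (u \<cdot> i)" by (rule cover_right) (use u b' it in simp_all)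
    have "is_iso C i"
    proof (rule short_five[OF mi _ _ cui])
      fix v assume v: "v \<in> Arr C" "Cod C v = Dom C u" "null C (u \<cdot> v)"
      have "null C (n \<cdot> (u \<cdot> v))" using v u nD by simp
      then have "null C (q1 \<cdot> (k \<cdot> v))" using v(1,2) u(1-3) nD(3) kt t A by (simp add: comp_eq[OF u(4)])
      then have "sub_le C (k \<cdot> v) m1" using kernel_sub_le[OF 1(2), of "k \<cdot> v"] v u kt A by simp
      moreover have "sub_le C m1 M" by (rule cover_orth[OF 1(3) M(1)]) (use 1 m1D M A in simp_all)
      ultimately have "sub_le C (k \<cdot> v) M" using sub_le_trans[of "k \<cdot> v" m1 M] M(1) m1D by simp
      then show "sub_le C v i" using pullback_sub_le[OF pb, of v] v u by simp
    qed (use u it in simp_all)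
    then have "sub_le C (Id C (Dom C k)) i" by (rule sub_le_iso) (use it kt in simp_all)
    then have "sub_le C k M" using pullback_sub_le[OF pb, of "Id C (Dom C k)"] kt by simp
    moreover have "sub_le C w k" using kernel_sub_le[OF k, of w] w qt by simp
    ultimately show ?thesis using sub_le_trans[of w k M] kt M by simp
  qed
  then show ?thesis using that q qt nq1 nq2 by blast
qed

end

section \<open>Coproducts of families and cross-effects\<close>

text \<open>Injections are given as a function on an index set, so that blocks of summands can be
  killed, merged and reindexed. Only the values on \<open>I\<close> matter.\<close>

definition is_sum :: "('o, 'a) category \<Rightarrow> 'i set \<Rightarrow> ('i \<Rightarrow> 'o) \<Rightarrow> ('i \<Rightarrow> 'a) \<Rightarrow> 'o \<Rightarrow> bool" where
  "is_sum C I Ob u P \<longleftrightarrow> P \<in> Obj C \<and> (\<forall>i \<in> I. u i \<in> hom C (Ob i) P) \<and>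
    (\<forall>T f. T \<in> Obj C \<longrightarrow> (\<forall>i \<in> I. f i \<in> hom C (Ob i) T) \<longrightarrow>
      (\<exists>!h. h \<in> hom C P T \<and> (\<forall>i \<in> I. h \<cdot>\<^bsub>C\<^esub> u i = f i)))"

definition cotuple :: "('o, 'a) category \<Rightarrow> 'i set \<Rightarrow> ('i \<Rightarrow> 'a) \<Rightarrow> 'o \<Rightarrow> 'o \<Rightarrow> ('i \<Rightarrow> 'a) \<Rightarrow> 'a" where
  "cotuple C I u P T f = (THE h. h \<in> hom C P T \<and> (\<forall>i \<in> I. h \<cdot>\<^bsub>C\<^esub> u i = f i))"

text \<open>This is the retraction onto the summands outside \<open>J\<close>, encoded as an
  idempotent endomorphism: for different \<open>J\<close> all of them act on the same object, and
  they commute.\<close>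

definition kill :: "('o, 'a) category \<Rightarrow> 'i set \<Rightarrow> ('i \<Rightarrow> 'o) \<Rightarrow> ('i \<Rightarrow> 'a) \<Rightarrow> 'o \<Rightarrow> 'i set \<Rightarrow> 'a" where
  "kill C I Ob u P J = cotuple C I u P P (\<lambda>i. if i \<in> J then zero_arr C (Ob i) P else u i)"

text \<open>The cross-effect at the objects \<open>Ob i\<close> is the joint kernel of the \<open>kill {i}\<close>; for three
  objects it is the ternary cosmash product.\<close>

definition cross_null :: "('o, 'a) category \<Rightarrow> 'i set \<Rightarrow> ('i \<Rightarrow> 'o) \<Rightarrow> ('i \<Rightarrow> 'a) \<Rightarrow> 'o \<Rightarrow> bool" where
  "cross_null C I Ob f T \<longleftrightarrow> T \<in> Obj C \<and> (\<forall>i \<in> I. f i \<in> hom C (Ob i) T) \<and>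
    (\<exists>u P. is_sum C I Ob u P \<and>
      (\<forall>w \<in> Arr C. Cod C w = P \<longrightarrow> (\<forall>i \<in> I. null C (kill C I Ob u P {i} \<cdot>\<^bsub>C\<^esub> w)) \<longrightarrow>
        null C (cotuple C I u P T f \<cdot>\<^bsub>C\<^esub> w)))"

context pointed_category begin

section \<open>Calculus of sums, killed summands and cross-effects\<close>

lemma sum_obj: "is_sum C I Ob u P \<Longrightarrow> P \<in> Obj C"
  by (simp add: is_sum_def)

lemma sum_in: "is_sum C I Ob u P \<Longrightarrow> i \<in> I \<Longrightarrow> u i \<in> Arr C \<and> Dom C (u i) = Ob i \<and> Cod C (u i) = P"
  by (simp add: is_sum_def)

lemma sum_comp_obj: "is_sum C I Ob u P \<Longrightarrow> i \<in> I \<Longrightarrow> Ob i \<in> Obj C"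
  using sum_in[of I Ob u P i] obj_simps(1)[of "u i"] by simp

lemma sum_unique:
  assumes "is_sum C I Ob u P" "h \<in> hom C P T" "h' \<in> hom C P T" "\<And>i. i \<in> I \<Longrightarrow> h \<cdot> u i = h' \<cdot> u i"
  shows "h = h'"
proof -
  have "T \<in> Obj C" using assms(2) by auto
  moreover have "\<forall>i \<in> I. h \<cdot> u i \<in> hom C (Ob i) T" using sum_in[OF assms(1)] assms(2) by auto
  ultimately have "\<exists>!k. k \<in> hom C P T \<and> (\<forall>i \<in> I. k \<cdot> u i = h \<cdot> u i)"
    using assms(1) unfolding is_sum_def by (elim conjE allE[where x = T] allE[where x = "\<lambda>i. h \<cdot> u i"]) blast
  then show ?thesis using assms(2-4) by (metis (no_types, lifting))
qed

lemma cotuple_props: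
  assumes "is_sum C I Ob u P" "T \<in> Obj C" "\<forall>i \<in> I. f i \<in> hom C (Ob i) T"
  shows "cotuple C I u P T f \<in> hom C P T" "i \<in> I \<Longrightarrow> cotuple C I u P T f \<cdot> u i = f i"
proof -
  have "\<exists>!h. h \<in> hom C P T \<and> (\<forall>i \<in> I. h \<cdot> u i = f i)"
    using assms unfolding is_sum_def by blast
  from theI'[OF this] show "cotuple C I u P T f \<in> hom C P T" "i \<in> I \<Longrightarrow> cotuple C I u P T f \<cdot> u i = f i"
    unfolding cotuple_def by blast+
qed

lemma cotuple_eq:
  assumes "is_sum C I Ob u P" "h \<in> hom C P T" "\<And>i. i \<in> I \<Longrightarrow> h \<cdot> u i = f i"
  shows "cotuple C I u P T f = h"
proof -
  have T: "T \<in> Obj C" using assms(2) by auto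
  have f: "\<forall>i \<in> I. f i \<in> hom C (Ob i) T"
    using assms(2) assms(3)[symmetric] sum_in[OF assms(1)] by simp
  show ?thesis
    by (rule sum_unique[OF assms(1) cotuple_props(1)[OF assms(1) T f] assms(2)])
      (use assms(3) cotuple_props(2)[OF assms(1) T f] in simp)
qed

lemma kill_props:
  assumes "is_sum C I Ob u P"
  shows "kill C I Ob u P J \<in> Arr C" "Dom C (kill C I Ob u P J) = P" "Cod C (kill C I Ob u P J) = P"
    and "i \<in> I \<Longrightarrow> kill C I Ob u P J \<cdot> u i = (if i \<in> J then zero_arr C (Ob i) P else u i)"
proof -
  have *: "\<forall>i \<in> I. (if i \<in> J then zero_arr C (Ob i) P else u i) \<in> hom C (Ob i) P"
    using sum_in[OF assms] sum_obj[OF assms] sum_comp_obj[OF assms] by simp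
  show "kill C I Ob u P J \<in> Arr C" "Dom C (kill C I Ob u P J) = P" "Cod C (kill C I Ob u P J) = P"
    using cotuple_props(1)[OF assms sum_obj[OF assms] *] unfolding kill_def by auto
  show "i \<in> I \<Longrightarrow> kill C I Ob u P J \<cdot> u i = (if i \<in> J then zero_arr C (Ob i) P else u i)"
    using cotuple_props(2)[OF assms sum_obj[OF assms] *] unfolding kill_def by auto
qed

lemma kill_eqI:
  assumes "is_sum C I Ob u P" "h \<in> hom C P P"
    "\<And>i. i \<in> I \<Longrightarrow> h \<cdot> u i = (if i \<in> J then zero_arr C (Ob i) P else u i)"
  shows "kill C I Ob u P J = h"
  unfolding kill_def using assms by (rule cotuple_eq)

lemma kill_kill:
  assumes "is_sum C I Ob u P"
  shows "kill C I Ob u P J \<cdot> kill C I Ob u P K = kill C I Ob u P (J \<union> K)"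
proof (rule sum_unique[OF assms])
  note k = kill_props[OF assms]
  show "kill C I Ob u P J \<cdot> kill C I Ob u P K \<in> hom C P P" "kill C I Ob u P (J \<union> K) \<in> hom C P P"
    using k by simp_all
  fix i assume i: "i \<in> I"
  note u = sum_in[OF assms i] and o = sum_comp_obj[OF assms i] sum_obj[OF assms]
  show "(kill C I Ob u P J \<cdot> kill C I Ob u P K) \<cdot> u i = kill C I Ob u P (J \<union> K) \<cdot> u i"
    using u o k(1-3) k(4)[OF i] by (cases "i \<in> K") simp_all
qed

lemma kill_idempotent: "is_sum C I Ob u P \<Longrightarrow> idempotent_on C P (kill C I Ob u P J)"
  using kill_props[of I Ob u P] kill_kill[of I Ob u P J J] by (simp add: idempotent_on_def)

lemma kill_commute:
  "is_sum C I Ob u P \<Longrightarrow> kill C I Ob u P J \<cdot> kill C I Ob u P K = kill C I Ob u P K \<cdot> kill C I Ob u P J"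
  using kill_kill[of I Ob u P J K] kill_kill[of I Ob u P K J] by (simp add: Un_commute)

lemma kill_null_mono:
  assumes "is_sum C I Ob u P" "null C (kill C I Ob u P J \<cdot> w)" "w \<in> Arr C" "Cod C w = P" "J \<subseteq> K"
  shows "null C (kill C I Ob u P K \<cdot> w)"
proof -
  note k = kill_props[OF assms(1)]
  have "null C (kill C I Ob u P K \<cdot> (kill C I Ob u P J \<cdot> w))" using k assms by simp
  moreover have "kill C I Ob u P K \<cdot> kill C I Ob u P J = kill C I Ob u P K"
    using kill_kill[OF assms(1), of K J] assms(5) by (simp add: Un_absorb2)
  ultimately show ?thesis using k(1-3) assms(3,4) by (simp add: comp_eq)
qed

lemma kill_empty: "is_sum C I Ob u P \<Longrightarrow> kill C I Ob u P {} = Id C P"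
  by (rule kill_eqI) (simp_all add: sum_obj sum_in)

lemma kill_fixed:
  assumes s: "is_sum C I Ob u P" and w: "w \<in> Arr C" "Cod C w = P" and "finite J"
    and "\<And>j. j \<in> J \<Longrightarrow> kill C I Ob u P {j} \<cdot> w = w"
  shows "kill C I Ob u P J \<cdot> w = w"
  using assms(4,5)
proof (induction J rule: finite_induct)
  case empty
  then show ?case using kill_empty[OF s] w by simp
next
  case (insert j J)
  have "kill C I Ob u P (insert j J) = kill C I Ob u P {j} \<cdot> kill C I Ob u P J"
    using kill_kill[OF s, of "{j}" J] by simp
  then show ?case using insert kill_props[OF s] w by simp
qed

lemma cross_nullI:
  assumes s: "is_sum C I Ob u P" and \<phi>: "\<phi> \<in> hom C P T" "\<And>i. i \<in> I \<Longrightarrow> \<phi> \<cdot> u i = f i"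
    and "\<And>w. w \<in> Arr C \<Longrightarrow> Cod C w = P \<Longrightarrow> (\<And>i. i \<in> I \<Longrightarrow> null C (kill C I Ob u P {i} \<cdot> w)) \<Longrightarrow>
      null C (\<phi> \<cdot> w)"
  shows "cross_null C I Ob f T"
proof -
  have "f i \<in> hom C (Ob i) T" if "i \<in> I" for i
    using \<phi>(2)[OF that, symmetric] \<phi>(1) sum_in[OF s that] by simp
  moreover have "cotuple C I u P T f = \<phi>" by (rule cotuple_eq[OF s \<phi>])
  moreover have "T \<in> Obj C" using \<phi>(1) by auto
  moreover have "\<forall>w \<in> Arr C. Cod C w = P \<longrightarrow> (\<forall>i \<in> I. null C (kill C I Ob u P {i} \<cdot> w)) \<longrightarrow>
      null C (cotuple C I u P T f \<cdot> w)"
    using assms(4) calculation(2) by simp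
  ultimately show ?thesis unfolding cross_null_def using s by blast
qed

lemma cross_null_cong:
  assumes "cross_null C I Ob f T" "\<And>i. i \<in> I \<Longrightarrow> Ob i = Ob' i" "\<And>i. i \<in> I \<Longrightarrow> f i = f' i"
  shows "cross_null C I Ob' f' T"
proof -
  obtain u P where s: "is_sum C I Ob u P"
    and z: "\<forall>w \<in> Arr C. Cod C w = P \<longrightarrow> (\<forall>i \<in> I. null C (kill C I Ob u P {i} \<cdot> w)) \<longrightarrow>
        null C (cotuple C I u P T f \<cdot> w)"
    using assms(1) unfolding cross_null_def by blast
  have s': "is_sum C I Ob' u P" using s assms(2) unfolding is_sum_def by simp
  have T: "T \<in> Obj C" and f: "\<forall>i \<in> I. f i \<in> hom C (Ob i) T"
    using assms(1) unfolding cross_null_def by blast+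
  note c = cotuple_props[OF s T f]
  have k: "kill C I Ob' u P J = kill C I Ob u P J" for J
    by (rule kill_eqI[OF s']) (use kill_props[OF s] assms(2) in auto)
  show ?thesis
    by (rule cross_nullI[OF s' c(1)]) (use c(2) assms(3) z k in auto)
qed

text \<open>Folding an arbitrary family along \<open>\<gamma>\<close> maps elements killed by each fibre of \<open>\<gamma>\<close> into the
  cross-effect of the target family.\<close>

lemma cross_null_grouping:
  assumes s: "is_sum C I Ob u P" and cn: "cross_null C I' Ob' f' T"
    and \<phi>: "\<phi> \<in> hom C P T" "\<And>i. i \<in> I \<Longrightarrow> \<phi> \<cdot> u i = f' (\<gamma> i) \<cdot> g i"
    and g: "\<And>i. i \<in> I \<Longrightarrow> \<gamma> i \<in> I'" "\<And>i. i \<in> I \<Longrightarrow> g i \<in> hom C (Ob i) (Ob' (\<gamma> i))"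
    and w: "w \<in> Arr C" "Cod C w = P" "\<And>j. j \<in> I' \<Longrightarrow> null C (kill C I Ob u P {i \<in> I. \<gamma> i = j} \<cdot> w)"
  shows "null C (\<phi> \<cdot> w)"
proof -
  obtain u' P' where s': "is_sum C I' Ob' u' P'"
    and z: "\<And>w. \<lbrakk>w \<in> Arr C; Cod C w = P'; \<forall>i \<in> I'. null C (kill C I' Ob' u' P' {i} \<cdot> w)\<rbrakk> \<Longrightarrow>
        null C (cotuple C I' u' P' T f' \<cdot> w)"
    using cn unfolding cross_null_def by blast
  have T: "T \<in> Obj C" and f': "\<forall>i \<in> I'. f' i \<in> hom C (Ob' i) T"
    using cn unfolding cross_null_def by blast+
  note c = cotuple_props[OF s' T f']
  define \<psi> where "\<psi> = cotuple C I' u' P' T f'"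
  have \<psi>: "\<psi> \<in> Arr C" "Dom C \<psi> = P'" "Cod C \<psi> = T" using c(1) by (simp_all add: \<psi>_def)
  have h: "\<forall>i \<in> I. u' (\<gamma> i) \<cdot> g i \<in> hom C (Ob i) P'"
    using sum_in[OF s' g(1)] g(2) by simp
  note t = cotuple_props[OF s sum_obj[OF s'] h]
  define \<theta> where "\<theta> = cotuple C I u P P' (\<lambda>i. u' (\<gamma> i) \<cdot> g i)"
  have \<theta>: "\<theta> \<in> Arr C" "Dom C \<theta> = P" "Cod C \<theta> = P'" "\<And>i. i \<in> I \<Longrightarrow> \<theta> \<cdot> u i = u' (\<gamma> i) \<cdot> g i"
    using t by (simp_all add: \<theta>_def)
  have \<phi>\<theta>: "\<phi> = \<psi> \<cdot> \<theta>"
  proof (rule sum_unique[OF s \<phi>(1)])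
    fix i assume i: "i \<in> I"
    have "\<psi> \<cdot> u' (\<gamma> i) = f' (\<gamma> i)" using c(2)[OF g(1)[OF i]] by (simp add: \<psi>_def)
    then show "\<phi> \<cdot> u i = (\<psi> \<cdot> \<theta>) \<cdot> u i"
      using \<theta> \<psi> sum_in[OF s i] sum_in[OF s' g(1)[OF i]] g(2)[OF i] \<phi>(2)[OF i] i by (simp add: comp_eq)
  qed (use \<psi> \<theta> in simp)
  have k\<theta>: "kill C I' Ob' u' P' {j} \<cdot> \<theta> = \<theta> \<cdot> kill C I Ob u P {i \<in> I. \<gamma> i = j}" for j
  proof (rule sum_unique[OF s, of _ P'])
    note k = kill_props[OF s] and k' = kill_props[OF s']
    show "kill C I' Ob' u' P' {j} \<cdot> \<theta> \<in> hom C P P'" "\<theta> \<cdot> kill C I Ob u P {i \<in> I. \<gamma> i = j} \<in> hom C P P'"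
      using k k' \<theta> by simp_all
    fix i assume i: "i \<in> I"
    note u = sum_in[OF s i] and u' = sum_in[OF s' g(1)[OF i]] and gi = g(2)[OF i]
      and o = sum_obj[OF s] sum_obj[OF s'] sum_comp_obj[OF s i] sum_comp_obj[OF s' g(1)[OF i]]
    have "(kill C I' Ob' u' P' {j} \<cdot> \<theta>) \<cdot> u i = (kill C I' Ob' u' P' {j} \<cdot> u' (\<gamma> i)) \<cdot> g i"
      using k'(1-3) \<theta> u u' gi i by simp
    also have "\<dots> = (if \<gamma> i = j then zero_arr C (Ob i) P' else u' (\<gamma> i) \<cdot> g i)"
      unfolding k'(4)[OF g(1)[OF i]] using gi o by simp
    also have "\<dots> = \<theta> \<cdot> (kill C I Ob u P {i \<in> I. \<gamma> i = j} \<cdot> u i)"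
      unfolding k(4)[OF i] using \<theta> o i by simp
    finally show "(kill C I' Ob' u' P' {j} \<cdot> \<theta>) \<cdot> u i = (\<theta> \<cdot> kill C I Ob u P {i \<in> I. \<gamma> i = j}) \<cdot> u i"
      using k(1-3) \<theta> u by simp
  qed
  have "null C (\<psi> \<cdot> (\<theta> \<cdot> w))"
    unfolding \<psi>_def
  proof (rule z)
    show "\<forall>j\<in>I'. null C (kill C I' Ob' u' P' {j} \<cdot> \<theta> \<cdot> w)"
    proof
      fix j assume j: "j \<in> I'"
      have "null C (\<theta> \<cdot> (kill C I Ob u P {i \<in> I. \<gamma> i = j} \<cdot> w))"
        using w(3)[OF j] \<theta> kill_props[OF s] w by simp
      then show "null C (kill C I' Ob' u' P' {j} \<cdot> \<theta> \<cdot> w)"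
        using kill_props(1-3)[OF s] kill_props(1-3)[OF s'] \<theta>(1-3) w(1,2) by (simp add: comp_eq[OF k\<theta>])
    qed
  qed (use \<theta> w in simp_all)
  then show ?thesis using \<phi>\<theta> \<psi> \<theta> w by simp
qed

lemma cross_null_post:
  assumes "cross_null C I Ob f T" "q \<in> hom C T T'"
  shows "cross_null C I Ob (\<lambda>i. q \<cdot> f i) T'"
proof -
  obtain u P where s: "is_sum C I Ob u P"
    and z: "\<forall>w \<in> Arr C. Cod C w = P \<longrightarrow> (\<forall>i \<in> I. null C (kill C I Ob u P {i} \<cdot> w)) \<longrightarrow>
        null C (cotuple C I u P T f \<cdot> w)"
    using assms(1) unfolding cross_null_def by blast
  have T: "T \<in> Obj C" and f: "\<forall>i \<in> I. f i \<in> hom C (Ob i) T"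
    using assms(1) unfolding cross_null_def by blast+
  note c = cotuple_props[OF s T f]
  show ?thesis
  proof (rule cross_nullI[OF s])
    show "q \<cdot> cotuple C I u P T f \<in> hom C P T'" using c assms(2) by simp
    show "(q \<cdot> cotuple C I u P T f) \<cdot> u i = q \<cdot> f i" if "i \<in> I" for i
      using c assms(2) that sum_in[OF s that] by simp
    show "null C ((q \<cdot> cotuple C I u P T f) \<cdot> w)"
      if "w \<in> Arr C" "Cod C w = P" "\<And>i. i \<in> I \<Longrightarrow> null C (kill C I Ob u P {i} \<cdot> w)" for w
      using that z c(1) assms(2) by simp
  qed
qed

lemma sum_insert:
  assumes s: "is_sum C I Ob u P" and i: "i \<notin> I" and co: "is_coproduct C P B a b"
    and Ob': "\<And>k. k \<in> I \<Longrightarrow> Ob' k = Ob k" "Ob' i = B"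
    and u': "\<And>k. k \<in> I \<Longrightarrow> u' k = a \<cdot> u k" "u' i = b"
  shows "is_sum C (insert i I) Ob' u' (Cod C a)"
proof -
  note cD = coproductD[OF co]
  have ut: "u' k \<in> hom C (Ob' k) (Cod C a)" if "k \<in> insert i I" for k
    using that sum_in[OF s, of k] cD u' Ob' by auto
  have "\<exists>!h. h \<in> hom C (Cod C a) T \<and> (\<forall>k \<in> insert i I. h \<cdot> u' k = f k)"
    if T: "T \<in> Obj C" and f: "\<forall>k \<in> insert i I. f k \<in> hom C (Ob' k) T" for T f
  proof -
    have f1: "\<forall>k \<in> I. f k \<in> hom C (Ob k) T" using f Ob' by auto
    note c = cotuple_props[OF s T f1]
    obtain h where h: "h \<in> Arr C" "Dom C h = Cod C a" "Cod C h = T" "h \<cdot> a = cotuple C I u P T f" "h \<cdot> b = f i"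
      by (rule coproduct_lift[OF co c(1), of "f i"]) (use f Ob' in auto)
    show ?thesis
    proof (rule ex1I[of _ h])
      have "h \<cdot> (a \<cdot> u k) = f k" if "k \<in> I" for k
        using h(1-3) cD sum_in[OF s that] c(2)[OF that] by (simp add: comp_eq[OF h(4)])
      then show "h \<in> hom C (Cod C a) T \<and> (\<forall>k \<in> insert i I. h \<cdot> u' k = f k)"
        using h u' by auto
      fix h' assume h': "h' \<in> hom C (Cod C a) T \<and> (\<forall>k \<in> insert i I. h' \<cdot> u' k = f k)"
      have "h' \<cdot> a = h \<cdot> a"
      proof (rule sum_unique[OF s, of _ T])
        fix k assume k: "k \<in> I"
        have "h' \<cdot> (a \<cdot> u k) = f k" using h' k u' by auto
        moreover have "h \<cdot> (a \<cdot> u k) = f k"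
          using h(1-3) cD sum_in[OF s k] c(2)[OF k] by (simp add: comp_eq[OF h(4)])
        ultimately show "(h' \<cdot> a) \<cdot> u k = (h \<cdot> a) \<cdot> u k"
          using h(1-3) h' cD sum_in[OF s k] by simp
      qed (use h(1-3) h' cD in simp_all)
      moreover have "h' \<cdot> b = h \<cdot> b" using h' h u' by auto
      ultimately show "h' = h"
        by (intro coproduct_unique[OF co, of h' T h]) (use h(1-3) h' in simp_all)
    qed
  qed
  then show ?thesis using ut cD by (auto simp: is_sum_def simp del: in_hom)
qed

lemma coproduct_sum:
  assumes co: "is_coproduct C A B a b"
  shows "is_sum C {..<2::nat} ((!) [A, B]) ((!) [a, b]) (Cod C a)"
proof -
  note cD = coproductD[OF co]
  have "is_sum C {0::nat} (\<lambda>_. A) (\<lambda>_. Id C A) A"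
    unfolding is_sum_def
  proof (intro conjI allI impI ballI)
    fix T f assume "\<forall>i\<in>{0::nat}. f i \<in> hom C A T"
    then show "\<exists>!h. h \<in> hom C A T \<and> (\<forall>i\<in>{0::nat}. h \<cdot> Id C A = f i)"
      by (intro ex1I[of _ "f 0"]) auto
  qed (use cD in simp_all)
  then have "is_sum C (insert 1 {0::nat}) ((!) [A, B]) ((!) [a, b]) (Cod C a)"
    by (rule sum_insert[OF _ _ co]) (use cD in simp_all)
  moreover have "insert 1 {0::nat} = {..<2}" by auto
  ultimately show ?thesis by simp
qed

lemma coproduct_sum3:
  assumes co: "is_coproduct C A B a b" and co': "is_coproduct C (Cod C a) D a' b'"
  shows "is_sum C {..<3::nat} ((!) [A, B, D]) ((!) [a' \<cdot> a, a' \<cdot> b, b']) (Cod C a')"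
proof -
  have 2: "k = 0 \<or> k = 1" if "k < 2" for k :: nat using that by auto
  have "is_sum C (insert 2 {..<2::nat}) ((!) [A, B, D]) ((!) [a' \<cdot> a, a' \<cdot> b, b']) (Cod C a')"
    by (rule sum_insert[OF coproduct_sum[OF co] _ co']) (auto dest: 2)
  moreover have "insert 2 {..<2::nat} = {..<3}" by auto
  ultimately show ?thesis by simp
qed

text \<open>The index set becomes a grid: its rows are the copies of \<open>S\<close>, and its
  columns are the types of summand of \<open>S\<close>.\<close>

lemma sum_of_sums:
  assumes s: "is_sum C I (\<lambda>_. S) v P" and s': "is_sum C J Z s S"
  shows "is_sum C (I \<times> J) (\<lambda>(t, b). Z b) (\<lambda>(t, b). v t \<cdot> s b) P"
proof -
  have ut: "v t \<cdot> s b \<in> hom C (Z b) P" if "t \<in> I" "b \<in> J" for t b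
    using sum_in[OF s that(1)] sum_in[OF s' that(2)] by simp
  have "\<exists>!h. h \<in> hom C P T \<and> (\<forall>i \<in> I \<times> J. h \<cdot> (case i of (t, b) \<Rightarrow> v t \<cdot> s b) = f i)"
    if T: "T \<in> Obj C" and f: "\<forall>i \<in> I \<times> J. f i \<in> hom C (case i of (t, b) \<Rightarrow> Z b) T" for T f
  proof -
    have f1: "f (t, b) \<in> hom C (Z b) T" if "t \<in> I" "b \<in> J" for t b using f that by auto
    let ?g = "\<lambda>t. cotuple C J s S T (\<lambda>b. f (t, b))"
    have g: "?g t \<in> hom C S T" "\<And>b. b \<in> J \<Longrightarrow> ?g t \<cdot> s b = f (t, b)" if "t \<in> I" for t
    proof -
      have *: "\<forall>b \<in> J. f (t, b) \<in> hom C (Z b) T" using f1[OF that] by blast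
      show "?g t \<in> hom C S T" "\<And>b. b \<in> J \<Longrightarrow> ?g t \<cdot> s b = f (t, b)"
        using cotuple_props[OF s' T *] by blast+
    qed
    then have g1: "\<forall>t \<in> I. ?g t \<in> hom C S T" by blast
    note c = cotuple_props[OF s T g1]
    show ?thesis
    proof (rule ex1I[of _ "cotuple C I v P T ?g"])
      show "cotuple C I v P T ?g \<in> hom C P T \<and> (\<forall>i \<in> I \<times> J. cotuple C I v P T ?g \<cdot> (case i of (t, b) \<Rightarrow> v t \<cdot> s b) = f i)"
      proof (intro conjI ballI)
        fix i assume "i \<in> I \<times> J"
        then obtain t b where i: "i = (t, b)" "t \<in> I" "b \<in> J" by auto
        show "cotuple C I v P T ?g \<cdot> (case i of (t, b) \<Rightarrow> v t \<cdot> s b) = f i"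
          using i c(1) sum_in[OF s i(2)] sum_in[OF s' i(3)] g(2)[OF i(2,3)]
          by (simp add: comp_eq[OF c(2)])
      qed (rule c(1))
      fix h assume h: "h \<in> hom C P T \<and> (\<forall>i \<in> I \<times> J. h \<cdot> (case i of (t, b) \<Rightarrow> v t \<cdot> s b) = f i)"
      show "h = cotuple C I v P T ?g"
      proof (rule sum_unique[OF s _ c(1)])
        fix t assume t: "t \<in> I"
        show "h \<cdot> v t = cotuple C I v P T ?g \<cdot> v t"
          unfolding c(2)[OF t]
        proof (rule sum_unique[OF s' _ g(1)[OF t]])
          fix b assume b: "b \<in> J"
          have "h \<cdot> (v t \<cdot> s b) = f (t, b)" using h t b by auto
          then show "(h \<cdot> v t) \<cdot> s b = ?g t \<cdot> s b"
            using h sum_in[OF s t] sum_in[OF s' b] g(2)[OF t b] by simp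
        qed (use h sum_in[OF s t] in simp)
      qed (use h in simp)
    qed
  qed
  then show ?thesis using ut sum_obj[OF s] by (auto simp: is_sum_def simp del: in_hom)
qed

lemma kill_sum_of_sums:
  assumes s: "is_sum C I (\<lambda>_. S) v P" and s': "is_sum C J Z s S"
  shows "kill C (I \<times> J) (\<lambda>(t, b). Z b) (\<lambda>(t, b). v t \<cdot> s b) P ({t} \<times> J) = kill C I (\<lambda>_. S) v P {t}"
proof (rule kill_eqI[OF sum_of_sums[OF s s']])
  note k = kill_props[OF s]
  show "kill C I (\<lambda>_. S) v P {t} \<in> hom C P P" using k by simp
  fix i assume "i \<in> I \<times> J"
  then obtain r b where i: "i = (r, b)" "r \<in> I" "b \<in> J" by auto
  note o = sum_in[OF s i(2)] sum_in[OF s' i(3)] sum_obj[OF s] sum_obj[OF s']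
  show "kill C I (\<lambda>_. S) v P {t} \<cdot> (case i of (t, b) \<Rightarrow> v t \<cdot> s b) =
    (if i \<in> {t} \<times> J then zero_arr C (case i of (t, b) \<Rightarrow> Z b) P else case i of (t, b) \<Rightarrow> v t \<cdot> s b)"
    using i o k(1-3) by (simp add: comp_eq[OF k(4)[OF i(2)]])
qed

end

context semi_abelian_category begin

section \<open>Finite sums and splitting along killed summands\<close>

lemma sum_exists:
  assumes "finite I" "\<And>i. i \<in> I \<Longrightarrow> Ob i \<in> Obj C"
  shows "\<exists>u P. is_sum C I Ob u P"
  using assms
proof (induction I rule: finite_induct)
  case empty
  obtain Z where Z: "is_zero C Z" "Z \<in> Obj C" by (rule zero_exists)
  then have "is_sum C {} Ob undefined Z"
    unfolding is_sum_def is_zero_def is_initial_def by auto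
  then show ?case by blast
next
  case (insert i I)
  then obtain u P where s: "is_sum C I Ob u P" by auto
  obtain a b where co: "is_coproduct C P (Ob i) a b"
    using coproduct_exists[OF sum_obj[OF s], of "Ob i"] insert.prems by auto
  have "is_sum C (insert i I) Ob (\<lambda>k. if k = i then b else a \<cdot> u k) (Cod C a)"
    by (rule sum_insert[OF s insert.hyps(2) co]) (use insert.hyps in auto)
  then show ?case by blast
qed

text \<open>This is grouping along a bijection, whose fibres are single indices.\<close>

lemma cross_null_reindex:
  assumes "cross_null C I Ob f T" "finite J" "\<pi> ` J = I" "inj_on \<pi> J"
  shows "cross_null C J (Ob \<circ> \<pi>) (f \<circ> \<pi>) T"
proof -
  have T: "T \<in> Obj C" and f: "\<forall>i \<in> I. f i \<in> hom C (Ob i) T"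
    using assms(1) unfolding cross_null_def by blast+
  have o: "\<And>i. i \<in> I \<Longrightarrow> Ob i \<in> Obj C" using f obj_simps(1) by fastforce
  obtain u P where s: "is_sum C J (Ob \<circ> \<pi>) u P"
    using sum_exists[OF assms(2), of "Ob \<circ> \<pi>"] o assms(3) by auto
  have f': "\<forall>i \<in> J. (f \<circ> \<pi>) i \<in> hom C ((Ob \<circ> \<pi>) i) T" using f assms(3) by fastforce
  note c = cotuple_props[OF s T f']
  show ?thesis
  proof (rule cross_nullI[OF s c])
    fix w assume w: "w \<in> Arr C" "Cod C w = P" "\<And>i. i \<in> J \<Longrightarrow> null C (kill C J (Ob \<circ> \<pi>) u P {i} \<cdot> w)"
    show "null C (cotuple C J u P T (f \<circ> \<pi>) \<cdot> w)"
    proof (rule cross_null_grouping[OF s assms(1) c(1), of \<pi> "\<lambda>i. Id C (Ob (\<pi> i))"])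
      fix i assume i: "i \<in> J"
      then have pi: "\<pi> i \<in> I" using assms(3) by auto
      show "\<pi> i \<in> I" by (rule pi)
      show "Id C (Ob (\<pi> i)) \<in> hom C ((Ob \<circ> \<pi>) i) (Ob (\<pi> i))" using o[OF pi] by simp
      show "cotuple C J u P T (f \<circ> \<pi>) \<cdot> u i = f (\<pi> i) \<cdot> Id C (Ob (\<pi> i))"
        using c(2)[OF i] f pi by (simp add: comp_def)
    next
      fix j assume "j \<in> I"
      then obtain i where i: "i \<in> J" "j = \<pi> i" using assms(3) by auto
      then have "{i \<in> J. \<pi> i = j} = {i}" using assms(4) by (auto simp: inj_on_def)
      then show "null C (kill C J (Ob \<circ> \<pi>) u P {i \<in> J. \<pi> i = j} \<cdot> w)" using w(3)[OF i(1)] by simp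
    qed (rule w(1,2))+
  qed
qed

lemma kill_split:
  assumes s: "is_sum C I Ob u P" and fin: "finite \<J>" "finite F"
    and fg: "f \<in> hom C P T" "g \<in> hom C P T"
    and ker: "\<And>w. w \<in> Arr C \<Longrightarrow> Cod C w = P \<Longrightarrow> (\<And>J. J \<in> \<J> \<Longrightarrow> null C (kill C I Ob u P J \<cdot> w)) \<Longrightarrow>
      (\<And>i. i \<in> F \<Longrightarrow> kill C I Ob u P {i} \<cdot> w = w) \<Longrightarrow> null C (kill C I Ob u P {d} \<cdot> w) \<Longrightarrow> f \<cdot> w = g \<cdot> w"
    and fixed: "\<And>w. w \<in> Arr C \<Longrightarrow> Cod C w = P \<Longrightarrow> (\<And>J. J \<in> \<J> \<Longrightarrow> null C (kill C I Ob u P J \<cdot> w)) \<Longrightarrow>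
      (\<And>i. i \<in> F \<Longrightarrow> kill C I Ob u P {i} \<cdot> w = w) \<Longrightarrow> kill C I Ob u P {d} \<cdot> w = w \<Longrightarrow> f \<cdot> w = g \<cdot> w"
    and w: "w \<in> Arr C" "Cod C w = P" "\<And>J. J \<in> \<J> \<Longrightarrow> null C (kill C I Ob u P J \<cdot> w)"
      "\<And>i. i \<in> F \<Longrightarrow> kill C I Ob u P {i} \<cdot> w = w"
  shows "f \<cdot> w = g \<cdot> w"
proof -
  note k = kill_props[OF s] and P = sum_obj[OF s]
  \<comment> \<open>To be killed is to be equalized with the zero arrow, and to be fixed is to be
    equalized with the identity; in this form both conditions are equations that
    \<open>idempotent_decomposition\<close> accepts.\<close>
  define L where "L = (\<lambda>J. (kill C I Ob u P J, zero_arr C P P)) ` \<J> \<union> (\<lambda>i. (kill C I Ob u P {i}, Id C P)) ` F"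
  have L: "(\<forall>(a, b) \<in> L. a \<cdot> w = b \<cdot> w) \<longleftrightarrow>
      (\<forall>J \<in> \<J>. null C (kill C I Ob u P J \<cdot> w)) \<and> (\<forall>i \<in> F. kill C I Ob u P {i} \<cdot> w = w)"
    if w: "w \<in> Arr C" "Cod C w = P" for w
    using w k(1-3) P by (simp add: L_def ball_Un null_def)
  show ?thesis
  proof (rule idempotent_decomposition[OF P kill_idempotent[OF s, of "{d}"] _ _ fg])
    show "finite L" using fin by (simp add: L_def)
    show "a \<in> hom C P P \<and> b \<in> hom C P P \<and> a \<cdot> kill C I Ob u P {d} = kill C I Ob u P {d} \<cdot> a \<and>
      b \<cdot> kill C I Ob u P {d} = kill C I Ob u P {d} \<cdot> b" if "(a, b) \<in> L" for a b
      using that k P kill_commute[OF s] by (auto simp: L_def)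
  next
    fix v assume v: "v \<in> Arr C" "Cod C v = P" "\<forall>(a, b) \<in> L. a \<cdot> v = b \<cdot> v" "null C (kill C I Ob u P {d} \<cdot> v)"
    show "f \<cdot> v = g \<cdot> v" by (rule ker) (use v L[OF v(1,2)] in blast)+
  next
    fix v assume v: "v \<in> Arr C" "Cod C v = P" "\<forall>(a, b) \<in> L. a \<cdot> v = b \<cdot> v" "kill C I Ob u P {d} \<cdot> v = v"
    show "f \<cdot> v = g \<cdot> v" by (rule fixed) (use v L[OF v(1,2)] in blast)+
  next
    show "\<forall>(a, b) \<in> L. a \<cdot> w = b \<cdot> w" using L[OF w(1,2)] w(3,4) by blast
  qed (rule w)+
qed

text \<open>The replacement for expanding an element into its cross-effect components. An element
  does not decompose as such, but an equation between two arrows may be tested on elements for which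
  each index in \<open>D\<close> is either killed (\<open>K\<close>) or fixed (\<open>F\<close>),
  because the two kinds generate jointly.\<close>

lemma kill_split_all:
  assumes s: "is_sum C I Ob u P" and fg: "f \<in> hom C P T" "g \<in> hom C P T" and D: "finite D" "finite \<J>"
    and H: "\<And>K F w. K \<union> F = D \<Longrightarrow> w \<in> Arr C \<Longrightarrow> Cod C w = P \<Longrightarrow>
      (\<And>J. J \<in> \<J> \<Longrightarrow> null C (kill C I Ob u P J \<cdot> w)) \<Longrightarrow>
      (\<And>i. i \<in> K \<Longrightarrow> null C (kill C I Ob u P {i} \<cdot> w)) \<Longrightarrow>
      (\<And>i. i \<in> F \<Longrightarrow> kill C I Ob u P {i} \<cdot> w = w) \<Longrightarrow> f \<cdot> w = g \<cdot> w"
    and w: "w \<in> Arr C" "Cod C w = P" "\<And>J. J \<in> \<J> \<Longrightarrow> null C (kill C I Ob u P J \<cdot> w)"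
  shows "f \<cdot> w = g \<cdot> w"
proof -
  define base where "base \<J> F w \<longleftrightarrow> w \<in> Arr C \<and> Cod C w = P \<and> (\<forall>J \<in> \<J>. null C (kill C I Ob u P J \<cdot> w)) \<and>
    (\<forall>i \<in> F. kill C I Ob u P {i} \<cdot> w = w)" for \<J> F w
  \<comment> \<open>The induction has to generalize over \<open>\<J>\<close> and \<open>F0\<close>:
    once the fate of an index is decided, the index is recorded in one of them.\<close>
  have "\<forall>\<J> F0. finite \<J> \<longrightarrow> finite F0 \<longrightarrow>
     (\<forall>K F w. K \<union> F = D \<longrightarrow> base \<J> F0 w \<longrightarrow> (\<forall>i \<in> K. null C (kill C I Ob u P {i} \<cdot> w)) \<longrightarrow>
        (\<forall>i \<in> F. kill C I Ob u P {i} \<cdot> w = w) \<longrightarrow> f \<cdot> w = g \<cdot> w) \<longrightarrow>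
     (\<forall>w. base \<J> F0 w \<longrightarrow> f \<cdot> w = g \<cdot> w)"
    using D(1)
  proof (induction D rule: finite_induct)
    case empty
    then show ?case by simp
  next
    case (insert d D)
    show ?case
    proof (intro allI impI)
      fix \<J> F0 w
      assume fin: "finite \<J>" "finite F0" and w: "base \<J> F0 w"
        and H: "\<forall>K F w. K \<union> F = insert d D \<longrightarrow> base \<J> F0 w \<longrightarrow> (\<forall>i \<in> K. null C (kill C I Ob u P {i} \<cdot> w)) \<longrightarrow>
        (\<forall>i \<in> F. kill C I Ob u P {i} \<cdot> w = w) \<longrightarrow> f \<cdot> w = g \<cdot> w"
      show "f \<cdot> w = g \<cdot> w"
      proof (rule kill_split[OF s fin fg, where d = d and w = w])
        fix w assume w: "w \<in> Arr C" "Cod C w = P" "\<And>J. J \<in> \<J> \<Longrightarrow> null C (kill C I Ob u P J \<cdot> w)"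
          "\<And>i. i \<in> F0 \<Longrightarrow> kill C I Ob u P {i} \<cdot> w = w" "null C (kill C I Ob u P {d} \<cdot> w)"
        show "f \<cdot> w = g \<cdot> w"
        proof (rule insert.IH[rule_format, of "insert {d} \<J>" F0])
          fix K F v assume v: "K \<union> F = D" "base (insert {d} \<J>) F0 v" "\<And>i. i \<in> K \<Longrightarrow> null C (kill C I Ob u P {i} \<cdot> v)"
            "\<And>i. i \<in> F \<Longrightarrow> kill C I Ob u P {i} \<cdot> v = v"
          show "f \<cdot> v = g \<cdot> v"
            by (rule H[rule_format, of "insert d K" F]) (use v in \<open>auto simp: base_def\<close>)
        qed (use fin w in \<open>auto simp: base_def\<close>)
      next
        fix w assume w: "w \<in> Arr C" "Cod C w = P" "\<And>J. J \<in> \<J> \<Longrightarrow> null C (kill C I Ob u P J \<cdot> w)"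
          "\<And>i. i \<in> F0 \<Longrightarrow> kill C I Ob u P {i} \<cdot> w = w" "kill C I Ob u P {d} \<cdot> w = w"
        show "f \<cdot> w = g \<cdot> w"
        proof (rule insert.IH[rule_format, of \<J> "insert d F0"])
          fix K F v assume v: "K \<union> F = D" "base \<J> (insert d F0) v" "\<And>i. i \<in> K \<Longrightarrow> null C (kill C I Ob u P {i} \<cdot> v)"
            "\<And>i. i \<in> F \<Longrightarrow> kill C I Ob u P {i} \<cdot> v = v"
          show "f \<cdot> v = g \<cdot> v"
            by (rule H[rule_format, of K "insert d F"]) (use v in \<open>auto simp: base_def\<close>)
        qed (use fin w in \<open>auto simp: base_def\<close>)
      qed (use w in \<open>auto simp: base_def\<close>)
    qed
  qed
  from this[rule_format, of \<J> "{}" w] show ?thesis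
    using D(2) w H by (auto simp: base_def)
qed

end

section \<open>Two-nilpotent quotients of a coproduct\<close>

context semi_abelian_category begin

text \<open>\<open>K\<close> stands for the killed positions in a grid with three rows and two
  columns, and \<open>\<beta>\<close> picks a killed position in each row. A column that
  \<open>\<beta>\<close> avoids must not contain killed positions. If it does, moving one row to
  that column repairs the choice: the other rows still use the other column, so that no column is
  avoided any more.\<close>

lemma choose_types:
  assumes K: "\<And>t. t < 3 \<Longrightarrow> \<exists>b < 2. (t, b) \<in> K"
  obtains \<beta> :: "nat \<Rightarrow> nat" where "\<And>t. t < 3 \<Longrightarrow> \<beta> t < 2 \<and> (t, \<beta> t) \<in> K"
    "\<And>b t. b < 2 \<Longrightarrow> b \<notin> \<beta> ` {..<3} \<Longrightarrow> t < 3 \<Longrightarrow> (t, b) \<notin> K"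
proof -
  define P where "P \<beta> \<longleftrightarrow> (\<forall>t<3. \<beta> t < 2 \<and> (t, \<beta> t) \<in> K)" for \<beta> :: "nat \<Rightarrow> nat"
  obtain \<beta> where \<beta>: "P \<beta>" unfolding P_def using K by metis
  show ?thesis
  proof (cases "\<forall>b t. b < 2 \<longrightarrow> b \<notin> \<beta> ` {..<3} \<longrightarrow> t < 3 \<longrightarrow> (t, b) \<notin> K")
    case True
    then show ?thesis using that[of \<beta>] \<beta> unfolding P_def by blast
  next
    case False
    then obtain b t where bt: "b < 2" "b \<notin> \<beta> ` {..<3}" "t < 3" "(t, b) \<in> K" by blast
    define \<beta>' where "\<beta>' = \<beta>(t := b)"
    have P': "P \<beta>'" using \<beta> bt unfolding P_def \<beta>'_def by auto
    have "c \<in> \<beta>' ` {..<3}" if c: "c < 2" for c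
    proof (cases "c = b")
      case True
      then show ?thesis using bt by (auto simp: \<beta>'_def)
    next
      case False
      define r where "r = (if t = 0 then 1 else 0 :: nat)"
      have r: "r < 3" "r \<noteq> t" by (auto simp: r_def)
      have "\<beta> r \<noteq> b" "\<beta> r < 2" using r bt(2) \<beta> unfolding P_def by auto
      then have "\<beta>' r = c" using False c bt(1) r by (simp add: \<beta>'_def)
      then show ?thesis using r by auto
    qed
    then show ?thesis using that[of \<beta>'] P' unfolding P_def by blast
  qed
qed

text \<open>By \<open>kill_split_all\<close> each position of the grid may be taken as killed or
  fixed. A row without killed position forces \<open>w\<close> to be zero, as killing this row both
  preserves and annihilates \<open>w\<close>. Otherwise \<open>choose_types\<close> gives a killed
  position in each row, and the grid is folded onto these three positions, where \<open>cn\<close>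
  applies.\<close>

lemma cross_null_of_sum:
  fixes Z :: "nat \<Rightarrow> 'a" and z :: "nat \<Rightarrow> 'b"
  assumes s: "is_sum C {..<3::nat} (\<lambda>_. S) v P" and s': "is_sum C {..<2} Z s S"
    and \<phi>: "\<phi> \<in> hom C P T" "\<And>t b. t < 3 \<Longrightarrow> b < 2 \<Longrightarrow> \<phi> \<cdot> (v t \<cdot> s b) = z b"
    and cn: "\<And>\<beta>. (\<And>t. t < 3 \<Longrightarrow> \<beta> t < 2) \<Longrightarrow> cross_null C {..<3::nat} (\<lambda>t. Z (\<beta> t)) (\<lambda>t. z (\<beta> t)) T"
    and w: "w \<in> Arr C" "Cod C w = P" "\<And>t. t < 3 \<Longrightarrow> null C (kill C {..<3} (\<lambda>_. S) v P {t} \<cdot> w)"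
  shows "null C (\<phi> \<cdot> w)"
proof -
  define I where "I = {..<3::nat} \<times> {..<2::nat}"
  define Ob where "Ob = (\<lambda>(t::nat, b). Z b)"
  define u where "u = (\<lambda>(t, b). v t \<cdot> s b)"
  have su: "is_sum C I Ob u P" using sum_of_sums[OF s s'] by (simp add: I_def Ob_def u_def)
  have kt: "kill C I Ob u P ({t} \<times> {..<2}) = kill C {..<3} (\<lambda>_. S) v P {t}" for t
    using kill_sum_of_sums[OF s s'] by (simp add: I_def Ob_def u_def)
  note k = kill_props[OF su] and Pobj = sum_obj[OF su]
  have T: "T \<in> Obj C" using \<phi>(1) by auto
  define \<J> where "\<J> = (\<lambda>t. {t} \<times> {..<2::nat}) ` {..<3::nat}"
  have "\<phi> \<cdot> w = zero_arr C P T \<cdot> w"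
  proof (rule kill_split_all[OF su \<phi>(1), of _ I \<J>])
    show "finite I" "finite \<J>" by (simp_all add: I_def \<J>_def)
    show "zero_arr C P T \<in> hom C P T" using Pobj T by simp
    show "null C (kill C I Ob u P J \<cdot> w)" if "J \<in> \<J>" for J
      using that w(3) kt by (auto simp: \<J>_def)
  next
    fix K F w assume KF: "K \<union> F = I" and w: "w \<in> Arr C" "Cod C w = P"
      and wJ: "\<And>J. J \<in> \<J> \<Longrightarrow> null C (kill C I Ob u P J \<cdot> w)"
      and wK: "\<And>i. i \<in> K \<Longrightarrow> null C (kill C I Ob u P {i} \<cdot> w)"
      and wF: "\<And>i. i \<in> F \<Longrightarrow> kill C I Ob u P {i} \<cdot> w = w"
    have "null C (\<phi> \<cdot> w)"
    proof (cases "\<exists>t<3. \<forall>b<2. (t, b) \<notin> K")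
      case True
      then obtain t where t: "t < 3" "\<And>b. b < 2 \<Longrightarrow> (t, b) \<notin> K" by blast
      have "kill C I Ob u P ({t} \<times> {..<2}) \<cdot> w = w"
      proof (rule kill_fixed[OF su w])
        fix i assume "i \<in> {t} \<times> {..<2::nat}"
        then have "i \<in> F" using t KF unfolding I_def by blast
        then show "kill C I Ob u P {i} \<cdot> w = w" by (rule wF)
      qed simp
      moreover have "null C (kill C I Ob u P ({t} \<times> {..<2}) \<cdot> w)"
        by (rule wJ) (use t in \<open>auto simp: \<J>_def\<close>)
      ultimately have "null C w" by simp
      then show ?thesis using \<phi>(1) w by simp
    next
      case False
      then obtain \<beta> where \<beta>: "\<And>t. t < 3 \<Longrightarrow> \<beta> t < 2 \<and> (t, \<beta> t) \<in> K"
        "\<And>b t. b < 2 \<Longrightarrow> b \<notin> \<beta> ` {..<3} \<Longrightarrow> t < 3 \<Longrightarrow> (t, b) \<notin> K"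
        using choose_types[of K] by metis
      define R where "R = \<beta> ` {..<3}"
      \<comment> \<open>All positions in columns avoided by \<open>\<beta>\<close> are fixed, so
        these columns may be sent to zero without changing \<open>w\<close>. They have no place in a
        cross-effect of type \<open>\<beta>\<close>.\<close>
      define J where "J = {..<3::nat} \<times> {b. b < 2 \<and> b \<notin> R}"
      have Jw: "kill C I Ob u P J \<cdot> w = w"
      proof (rule kill_fixed[OF su w])
        show "finite J" by (simp add: J_def)
        fix i assume "i \<in> J"
        then have "i \<in> F" using \<beta>(2) KF unfolding I_def J_def R_def by blast
        then show "kill C I Ob u P {i} \<cdot> w = w" by (rule wF)
      qed
      \<comment> \<open>A position goes to a row whose chosen column is its own; the chosen position
        of a row stays in that row, so the fibre over \<open>t\<close> contains the killed position
        \<open>(t, \<beta> t)\<close>. For columns that \<open>\<beta>\<close> avoids the target is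
        arbitrary, since their component in \<open>g\<close> is zero.\<close>
      define \<gamma> where "\<gamma> = (\<lambda>(t, b). if \<beta> t = b then t else if b \<in> R then (SOME r. r < 3 \<and> \<beta> r = b) else t)"
      define g where "g = (\<lambda>(t, b). if b \<in> R then Id C (Z b) else zero_arr C (Z b) (Z (\<beta> (\<gamma> (t, b)))))"
      have \<gamma>: "\<gamma> (t, b) < 3" "b \<in> R \<Longrightarrow> \<beta> (\<gamma> (t, b)) = b" if "t < 3" for t b
      proof -
        have "(SOME r. r < 3 \<and> \<beta> r = b) < 3 \<and> \<beta> (SOME r. r < 3 \<and> \<beta> r = b) = b" if "b \<in> R"
          by (rule someI_ex) (use that in \<open>auto simp: R_def\<close>)
        then show "\<gamma> (t, b) < 3" "b \<in> R \<Longrightarrow> \<beta> (\<gamma> (t, b)) = b" using \<open>t < 3\<close> by (auto simp: \<gamma>_def)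
      qed
      have Zo: "Z b \<in> Obj C" "z b \<in> hom C (Z b) T" if b: "b < 2" for b
      proof -
        show "Z b \<in> Obj C" using sum_comp_obj[OF s'] b by simp
        show "z b \<in> hom C (Z b) T"
          using \<phi>(2)[of 0 b, symmetric] b \<phi>(1) sum_in[OF s, of 0] sum_in[OF s', of b] by simp
      qed
      have "null C ((\<phi> \<cdot> kill C I Ob u P J) \<cdot> w)"
      proof (rule cross_null_grouping[OF su cn[of \<beta>]])
        show "\<phi> \<cdot> kill C I Ob u P J \<in> hom C P T" using k \<phi>(1) by simp
        fix i assume i: "i \<in> I"
        then obtain t b where tb: "i = (t, b)" "t < 3" "b < 2" by (auto simp: I_def)
        show "\<gamma> i \<in> {..<3}" using \<gamma> tb by simp
        have \<beta>\<gamma>: "\<beta> (\<gamma> (t, b)) < 2" using \<beta>(1) \<gamma>(1)[OF tb(2)] by simp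
        show gi: "g i \<in> hom C (Ob i) (Z (\<beta> (\<gamma> i)))"
          using \<gamma>(2)[OF tb(2)] tb Zo(1)[OF tb(3)] Zo(1)[OF \<beta>\<gamma>] by (simp add: g_def Ob_def)
        have u: "u i \<in> Arr C" "Cod C (u i) = P" "\<phi> \<cdot> u i = z b"
          using sum_in[OF su i] \<phi>(2)[OF tb(2,3)] tb by (simp_all add: u_def)
        show "(\<phi> \<cdot> kill C I Ob u P J) \<cdot> u i = z (\<beta> (\<gamma> i)) \<cdot> g i"
        proof (cases "b \<in> R")
          case True
          then have "i \<notin> J" using tb by (simp add: J_def)
          then show ?thesis
            using k(1-3) k(4)[OF i] u \<phi>(1) True \<gamma>(2)[OF tb(2) True] tb Zo[OF tb(3)] by (simp add: g_def)
        next
          case False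
          then have "i \<in> J" using tb by (simp add: J_def)
          then show ?thesis
            using k(1-3) k(4)[OF i] u \<phi>(1) False tb Zo[OF tb(3)] Zo[OF \<beta>\<gamma>] Pobj by (simp add: g_def Ob_def)
        qed
      next
        fix t assume t: "t \<in> {..<3::nat}"
        show "null C (kill C I Ob u P {i \<in> I. \<gamma> i = t} \<cdot> w)"
        proof (rule kill_null_mono[OF su _ w])
          show "null C (kill C I Ob u P {(t, \<beta> t)} \<cdot> w)" by (rule wK) (use \<beta> t in simp)
          show "{(t, \<beta> t)} \<subseteq> {i \<in> I. \<gamma> i = t}" using \<beta>(1)[of t] t by (simp add: I_def \<gamma>_def)
        qed
      qed (use w \<beta> in simp_all)
      then show ?thesis using k(1-3) \<phi>(1) w Jw by simp
    qed
    then show "\<phi> \<cdot> w = zero_arr C P T \<cdot> w"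
      using w \<phi>(1) Pobj T by (auto simp: null_def)
  qed (rule w(1,2))+
  then show ?thesis using w \<phi>(1) Pobj T by simp
qed

lemma cross_null_rotate:
  assumes "cross_null C {..<3::nat} ((!) [A, B, D]) ((!) [a, b, d]) T"
  shows "cross_null C {..<3::nat} ((!) [B, D, A]) ((!) [b, d, a]) T"
proof -
  have 3: "i = 0 \<or> i = 1 \<or> i = 2" if "i < 3" for i :: nat using that by auto
  have "cross_null C {..<3::nat} ((!) [A, B, D] \<circ> (!) [1, 2, 0]) ((!) [a, b, d] \<circ> (!) [1, 2, 0]) T"
  proof (rule cross_null_reindex[OF assms])
    show "(!) [1, 2, 0] ` {..<3} = {..<3::nat}"
      by (auto simp: image_iff lessThan_Suc numeral_3_eq_3)
    show "inj_on ((!) [1, 2, 0::nat]) {..<3}" by (auto simp: inj_on_def dest!: 3)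
  qed simp
  then show ?thesis by (rule cross_null_cong) (auto dest!: 3)
qed

text \<open>Up to rotation, a triple with entries of two types is determined by how often each type
  occurs. So four hypotheses cover the eight triples.\<close>

lemma cross_null_all_types:
  assumes "cross_null C {..<3::nat} ((!) [X, X, X]) ((!) [x, x, x]) T"
    and "cross_null C {..<3::nat} ((!) [X, X, Y]) ((!) [x, x, y]) T"
    and "cross_null C {..<3::nat} ((!) [X, Y, Y]) ((!) [x, y, y]) T"
    and "cross_null C {..<3::nat} ((!) [Y, Y, Y]) ((!) [y, y, y]) T"
    and \<beta>: "\<And>t. t < 3 \<Longrightarrow> \<beta> t < 2"
  shows "cross_null C {..<3::nat} (\<lambda>t. [X, Y] ! \<beta> t) (\<lambda>t. [x, y] ! \<beta> t) T"
proof -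
  have 3: "i = 0 \<or> i = 1 \<or> i = 2" if "i < 3" for i :: nat using that by auto
  have b: "\<beta> 0 = 0 \<or> \<beta> 0 = 1" "\<beta> 1 = 0 \<or> \<beta> 1 = 1" "\<beta> 2 = 0 \<or> \<beta> 2 = 1"
    using \<beta>[of 0] \<beta>[of 1] \<beta>[of 2] by auto
  have "cross_null C {..<3::nat} ((!) [[X, Y] ! \<beta> 0, [X, Y] ! \<beta> 1, [X, Y] ! \<beta> 2])
      ((!) [[x, y] ! \<beta> 0, [x, y] ! \<beta> 1, [x, y] ! \<beta> 2]) T"
    using b assms(1-4) cross_null_rotate[OF assms(2)] cross_null_rotate[OF cross_null_rotate[OF assms(2)]]
      cross_null_rotate[OF assms(3)] cross_null_rotate[OF cross_null_rotate[OF assms(3)]]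
    by auto
  then show ?thesis by (rule cross_null_cong) (auto dest!: 3)
qed

lemma joint_kernel:
  assumes "finite L" "A \<in> Obj C" "\<And>f. f \<in> L \<Longrightarrow> f \<in> Arr C \<and> Dom C f = A"
  obtains g where "g \<in> Arr C" "Dom C g = A"
    "\<And>w. w \<in> Arr C \<Longrightarrow> Cod C w = A \<Longrightarrow> null C (g \<cdot> w) \<longleftrightarrow> (\<forall>f \<in> L. null C (f \<cdot> w))"
proof -
  have "\<exists>g. g \<in> Arr C \<and> Dom C g = A \<and>
    (\<forall>w. w \<in> Arr C \<longrightarrow> Cod C w = A \<longrightarrow> null C (g \<cdot> w) \<longleftrightarrow> (\<forall>f \<in> L. null C (f \<cdot> w)))"
    using assms(1,3)
  proof (induction L rule: finite_induct)
    case empty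
    show ?case by (rule exI[of _ "zero_arr C A A"]) (use assms(2) in simp)
  next
    case (insert f L)
    then obtain g where g: "g \<in> Arr C" "Dom C g = A"
      "\<And>w. w \<in> Arr C \<Longrightarrow> Cod C w = A \<Longrightarrow> null C (g \<cdot> w) \<longleftrightarrow> (\<forall>f \<in> L. null C (f \<cdot> w))"
      by auto
    have f: "f \<in> Arr C" "Dom C f = A" using insert.prems by auto
    obtain p1 p2 where prod: "is_product C (Cod C f) (Cod C g) p1 p2"
      using product_exists f g obj_simps by metis
    note pD = productD[OF prod]
    obtain h where h: "h \<in> Arr C" "Dom C h = A" "Cod C h = Dom C p1" "p1 \<cdot> h = f" "p2 \<cdot> h = g"
      by (rule product_lift[OF prod, of f A g]) (use f g in simp_all)
    have "null C (h \<cdot> w) \<longleftrightarrow> null C (f \<cdot> w) \<and> null C (g \<cdot> w)" if w: "w \<in> Arr C" "Cod C w = A" for w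
    proof
      assume "null C (h \<cdot> w)"
      then have "null C (p1 \<cdot> (h \<cdot> w))" "null C (p2 \<cdot> (h \<cdot> w))" using w h pD by simp_all
      then show "null C (f \<cdot> w) \<and> null C (g \<cdot> w)"
        using w h(1-3) pD by (simp add: comp_eq[OF h(4)] comp_eq[OF h(5)])
    next
      assume n: "null C (f \<cdot> w) \<and> null C (g \<cdot> w)"
      define z where "z = zero_arr C (Dom C w) (Dom C p1)"
      have z: "z \<in> Arr C" "Dom C z = Dom C w" "Cod C z = Dom C p1" "null C z"
        using w pD by (simp_all add: z_def)
      have n1: "null C (p1 \<cdot> z)" "null C (p2 \<cdot> z)" using z pD by simp_all
      have "h \<cdot> w = z"
      proof (rule product_unique[OF prod])
        have "f \<cdot> w = p1 \<cdot> z" by (rule null_null_eq) (use n n1 w f z pD in simp_all)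
        then show "p1 \<cdot> (h \<cdot> w) = p1 \<cdot> z" using w h(1-3) pD by (simp add: comp_eq[OF h(4)])
        have "g \<cdot> w = p2 \<cdot> z" by (rule null_null_eq) (use n n1 w g z pD in simp_all)
        then show "p2 \<cdot> (h \<cdot> w) = p2 \<cdot> z" using w h(1-3) pD by (simp add: comp_eq[OF h(5)])
      qed (use z h w in simp_all)
      then show "null C (h \<cdot> w)" using z by simp
    qed
    then show ?case using g h by (intro exI[of _ h]) simp
  qed
  then show ?thesis using that by blast
qed

text \<open>The joint kernel of the maps killing one of the first three summands of \<open>X + X + X + Y\<close> is
  normal, and \<open>X + X + X + Y\<close> covers \<open>T\<close>, so its image in \<open>T\<close> is normal. By \<open>cn\<close> the summand
  \<open>Y\<close> does not contribute to this image, which is therefore \<open>[X, X, X]\<close>.\<close>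

lemma quotient_by_ternary_commutator:
  assumes co: "is_coproduct C X Y i j"
    and q: "cover C q" "Dom C q = Cod C i" "Cod C q = T" "q \<cdot> i = x" "q \<cdot> j = y"
    and \<rho>: "\<rho> \<in> hom C T X" "\<rho> \<cdot> x = Id C X"
    and cn: "cross_null C {..<3::nat} ((!) [X, X, Y]) ((!) [x, x, y]) T"
  obtains c where "cover C c" "Dom C c = T"
    "cross_null C {..<3::nat} ((!) [X, X, X]) ((!) [c \<cdot> x, c \<cdot> x, c \<cdot> x]) (Cod C c)"
    "\<And>w. w \<in> Arr C \<Longrightarrow> Cod C w = T \<Longrightarrow> null C (c \<cdot> w) \<Longrightarrow> sub_le C w x"
proof -
  note coD = coproductD[OF co]
  have qa: "q \<in> Arr C" using q by simp
  have x: "x \<in> Arr C" "Dom C x = X" "Cod C x = T" and y: "y \<in> Arr C" "Dom C y = Y" "Cod C y = T"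
    and T: "T \<in> Obj C"
    using qa q coD by auto
  have mx: "monic C x" by (rule split_monic[of x \<rho>]) (use x \<rho> in simp_all)
  have 4: "i = 0 \<or> i = 1 \<or> i = 2 \<or> i = 3" if "i < 4" for i :: nat using that by auto
  have 3: "i = 0 \<or> i = 1 \<or> i = 2" if "i < 3" for i :: nat using that by auto
  define I where "I = {..<4::nat}"
  define Ob where "Ob = (!) [X, X, X, Y]"
  have O_in: "Ob i \<in> Obj C" if "i \<in> I" for i
    using that coD by (auto simp: I_def Ob_def dest!: 4)
  obtain u P where s: "is_sum C I Ob u P" using sum_exists[of I Ob] O_in by (auto simp: I_def)
  note k = kill_props[OF s] and Pobj = sum_obj[OF s]
  have u: "u i \<in> Arr C" "Dom C (u i) = Ob i" "Cod C (u i) = P" if "i < 4" for i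
    using sum_in[OF s] that by (auto simp: I_def)
  have f: "\<forall>i \<in> I. ((!) [x, x, x, y]) i \<in> hom C (Ob i) T"
    using x y by (auto simp: I_def Ob_def dest!: 4)
  define \<phi> where "\<phi> = cotuple C I u P T ((!) [x, x, x, y])"
  have \<phi>: "\<phi> \<in> Arr C" "Dom C \<phi> = P" "Cod C \<phi> = T"
    "\<phi> \<cdot> u 0 = x" "\<phi> \<cdot> u 1 = x" "\<phi> \<cdot> u 2 = x" "\<phi> \<cdot> u 3 = y"
    using cotuple_props[OF s T f] cotuple_props(2)[OF s T f, of 0] cotuple_props(2)[OF s T f, of 1]
      cotuple_props(2)[OF s T f, of 2] cotuple_props(2)[OF s T f, of 3]
    by (simp_all add: \<phi>_def I_def)
  \<comment> \<open>On the first and the last summand \<open>\<phi>\<close> restricts to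
    \<open>q\<close>, which makes \<open>\<phi>\<close> a cover.\<close>
  obtain h where h: "h \<in> Arr C" "Dom C h = Cod C i" "Cod C h = P" "h \<cdot> i = u 0" "h \<cdot> j = u 3"
    by (rule coproduct_lift[OF co, of "u 0" P "u 3"]) (use u[of 0] u[of 3] in \<open>simp_all add: Ob_def\<close>)
  have "\<phi> \<cdot> h = q"
    by (rule coproduct_unique[OF co, of _ T]) (use \<phi> h q(2-5) qa coD in simp_all)
  then have c\<phi>: "cover C \<phi>" using cover_right[of \<phi> h] q \<phi> h by simp
  define \<J> where "\<J> = {{0}, {1}, {2::nat}}"
  obtain g where g: "g \<in> Arr C" "Dom C g = P"
    "\<And>w. w \<in> Arr C \<Longrightarrow> Cod C w = P \<Longrightarrow> null C (g \<cdot> w) \<longleftrightarrow> (\<forall>J \<in> \<J>. null C (kill C I Ob u P J \<cdot> w))"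
    by (rule joint_kernel[of "kill C I Ob u P ` \<J>" P]) (use k Pobj in \<open>auto simp: \<J>_def\<close>)
  obtain l where l: "is_kernel C g l" using kernel_exists g by metis
  note lD = kernelD[OF l]
  have la: "l \<in> Arr C" "Cod C l = P" using lD g by simp_all
  have lk: "null C (kill C I Ob u P J \<cdot> l)" if "J \<in> \<J>" for J
    using g(3)[OF la] lD that by blast
  \<comment> \<open>The element is split along the last summand. If that summand is killed too,
    merging the first two copies of X gives an element of the cross-effect of X, X, Y, on which the
    hypothesis \<open>cn\<close> makes the arrow vanish. If it is fixed, the two sides agree
    trivially.\<close>
  have \<phi>l: "\<phi> \<cdot> l = (\<phi> \<cdot> kill C I Ob u P {3}) \<cdot> l"
  proof (rule kill_split[OF s, where d = 3 and \<J> = \<J> and F = "{}" and T = T])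
    fix w assume w: "w \<in> Arr C" "Cod C w = P" "\<And>J. J \<in> \<J> \<Longrightarrow> null C (kill C I Ob u P J \<cdot> w)"
      "null C (kill C I Ob u P {3} \<cdot> w)"
    have n1: "null C (\<phi> \<cdot> w)"
    proof (rule cross_null_grouping[OF s cn, where \<gamma> = "(!) [0, 0, 1, 2]" and g = "\<lambda>i. Id C (Ob i)"])
      show "\<phi> \<in> hom C P T" using \<phi> by simp
      fix i assume "i \<in> I"
      then have i: "i = 0 \<or> i = 1 \<or> i = 2 \<or> i = 3" using 4 by (simp add: I_def)
      show "\<phi> \<cdot> u i = (!) [x, x, y] ([0, 0, 1, 2] ! i) \<cdot> Id C (Ob i)"
        using i \<phi> x y by (auto simp: Ob_def)
      show "[0, 0, 1, 2] ! i \<in> {..<3::nat}" using i by auto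
      show "Id C (Ob i) \<in> hom C (Ob i) ([X, X, Y] ! ([0, 0, 1, 2] ! i))"
        using i coD by (auto simp: Ob_def)
    next
      fix j assume "j \<in> {..<3::nat}"
      then have j: "j = 0 \<or> j = 1 \<or> j = 2" using 3 by simp
      have "null C (kill C I Ob u P {0} \<cdot> w)" "null C (kill C I Ob u P {2} \<cdot> w)"
        by (rule w(3), simp add: \<J>_def)+
      \<comment> \<open>The list \<open>[0, 2, 3]\<close> names one index in each fibre of
        \<open>\<gamma>\<close>; if killing this index annihilates the element, so does killing the
        whole fibre.\<close>
      with w(4) have "null C (kill C I Ob u P {[0, 2, 3] ! j} \<cdot> w)" using j by (elim disjE) simp_all
      then show "null C (kill C I Ob u P {i \<in> I. [0, 0, 1, 2] ! i = j} \<cdot> w)"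
        by (rule kill_null_mono[OF s _ w(1,2)]) (use j in \<open>auto simp: I_def\<close>)
    qed (rule w(1,2))+
    have n2: "null C ((\<phi> \<cdot> kill C I Ob u P {3}) \<cdot> w)" using w \<phi>(1-3) k by simp
    show "\<phi> \<cdot> w = (\<phi> \<cdot> kill C I Ob u P {3}) \<cdot> w"
      by (rule null_null_eq[OF n1 n2]) (use w \<phi>(1-3) k in simp_all)
  next
    fix w assume w: "w \<in> Arr C" "Cod C w = P" "kill C I Ob u P {3} \<cdot> w = w"
    show "\<phi> \<cdot> w = (\<phi> \<cdot> kill C I Ob u P {3}) \<cdot> w" using w \<phi>(1-3) k by simp
  qed (use la lk \<phi>(1-3) k in \<open>simp_all add: \<J>_def\<close>)
  obtain c m e where c: "cover C c" "is_kernel C c m" "cover C e" "Cod C e = Dom C m" "m \<cdot> e = \<phi> \<cdot> l"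
    using normal_image_cover_kernel[OF l c\<phi>] \<phi> g unfolding normal_image_def by auto
  note mD = kernelD[OF c(2)]
  have ea: "e \<in> Arr C" using c by simp
  have "Cod C (m \<cdot> e) = T" "Dom C (m \<cdot> e) = Dom C l" using c(5) \<phi> la by simp_all
  then have mt: "Cod C m = T" "Dom C c = T" "Dom C e = Dom C l" using mD(3,4) ea c(4) by simp_all
  have t0: "\<forall>i \<in> I. ((!) [Id C X, Id C X, Id C X, zero_arr C Y X]) i \<in> hom C (Ob i) X"
    using coD by (auto simp: I_def Ob_def dest!: 4)
  \<comment> \<open>The arrow \<open>t\<close> folds the three copies of X and kills Y. Hence
    \<open>\<phi>\<close> after killing Y is \<open>x \<cdot> t\<close>, which places the normal
    image inside \<open>x\<close>.\<close>
  define t where "t = cotuple C I u P X ((!) [Id C X, Id C X, Id C X, zero_arr C Y X])"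
  have t: "t \<in> Arr C" "Dom C t = P" "Cod C t = X"
    "t \<cdot> u 0 = Id C X" "t \<cdot> u 1 = Id C X" "t \<cdot> u 2 = Id C X" "t \<cdot> u 3 = zero_arr C Y X"
    using cotuple_props[OF s coD(6) t0] cotuple_props(2)[OF s coD(6) t0, of 0]
      cotuple_props(2)[OF s coD(6) t0, of 1]
      cotuple_props(2)[OF s coD(6) t0, of 2] cotuple_props(2)[OF s coD(6) t0, of 3]
    by (simp_all add: t_def I_def)
  have xt: "\<phi> \<cdot> kill C I Ob u P {3} = x \<cdot> t"
  proof (rule sum_unique[OF s, of _ T])
    fix i assume i: "i \<in> I"
    then have i4: "i < 4" "i = 0 \<or> i = 1 \<or> i = 2 \<or> i = 3" using 4 by (simp_all add: I_def)
    have *: "(\<phi> \<cdot> kill C I Ob u P {3}) \<cdot> u i = \<phi> \<cdot> (if i \<in> {3} then zero_arr C (Ob i) P else u i)"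
      using k(1-3) k(4)[OF i] \<phi>(1-3) u[OF i4(1)] by simp
    have **: "(x \<cdot> t) \<cdot> u i = x \<cdot> (t \<cdot> u i)" using x t(1-3) u[OF i4(1)] by simp
    show "(\<phi> \<cdot> kill C I Ob u P {3}) \<cdot> u i = (x \<cdot> t) \<cdot> u i"
      unfolding * ** using i4(2) \<phi> t x coD Pobj by (auto simp: Ob_def)
  qed (use k \<phi> x t in simp_all)
  have "sub_le C (m \<cdot> e) x"
    by (rule sub_leI[of _ "t \<cdot> l"]) (use x t(1-3) la \<phi>l xt c(5) in simp_all)
  then have mx': "sub_le C m x" by (rule cover_orth[OF c(3) mx, rotated 3]) (use mD c mt x in simp_all)
  have 4: "sub_le C w x" if w: "w \<in> Arr C" "Cod C w = T" "null C (c \<cdot> w)" for w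
    using kernel_sub_le[OF c(2), of w] w mt sub_le_trans[OF _ mx' x(1) mD(3)] by simp
  have ca: "c \<in> Arr C" using c by simp
  have "cross_null C {..<3::nat} ((!) [X, X, X]) ((!) [c \<cdot> x, c \<cdot> x, c \<cdot> x]) (Cod C c)"
  proof -
    define I' where "I' = {..<3::nat}"
    define Ob' where "Ob' = (!) [X, X, X]"
    have O_in': "Ob' i \<in> Obj C" if "i \<in> I'" for i
      using that coD by (auto simp: I'_def Ob'_def dest!: 3)
    have OO: "Ob' i = Ob i" if "i \<in> I'" for i using that by (auto simp: I'_def Ob'_def Ob_def dest!: 3)
    obtain u' P' where s': "is_sum C I' Ob' u' P'" using sum_exists[of I' Ob'] O_in' by (auto simp: I'_def)
    note k' = kill_props[OF s'] and Pobj' = sum_obj[OF s']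
    have uu: "\<forall>i \<in> I'. u i \<in> hom C (Ob' i) P"
      using u OO by (auto simp: I'_def)
    \<comment> \<open>The arrow \<open>\<theta>\<close> sends X + X + X to the first three summands.
      It carries the cross-effect there into the kernel \<open>l\<close>, whose image
      \<open>c\<close> divides out.\<close>
    define \<theta> where "\<theta> = cotuple C I' u' P' P u"
    have \<theta>: "\<theta> \<in> Arr C" "Dom C \<theta> = P'" "Cod C \<theta> = P" "\<And>i. i \<in> I' \<Longrightarrow> \<theta> \<cdot> u' i = u i"
      using cotuple_props[OF s' Pobj uu] by (simp_all add: \<theta>_def)
    have II: "i \<in> I' \<Longrightarrow> i \<in> I" for i by (simp add: I_def I'_def)
    have k\<theta>: "kill C I Ob u P {i} \<cdot> \<theta> = \<theta> \<cdot> kill C I' Ob' u' P' {i}" for i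
    proof (rule sum_unique[OF s', of _ P])
      fix r assume r: "r \<in> I'"
      note ur = sum_in[OF s' r] and o = sum_comp_obj[OF s' r]
      have "(kill C I Ob u P {i} \<cdot> \<theta>) \<cdot> u' r = kill C I Ob u P {i} \<cdot> u r"
        using k(1-3) \<theta> ur r by simp
      also have "\<dots> = \<theta> \<cdot> (kill C I' Ob' u' P' {i} \<cdot> u' r)"
        unfolding k(4)[OF II[OF r]] k'(4)[OF r] using \<theta> r o Pobj Pobj' OO[OF r] by (cases "r = i") simp_all
      finally show "(kill C I Ob u P {i} \<cdot> \<theta>) \<cdot> u' r = (\<theta> \<cdot> kill C I' Ob' u' P' {i}) \<cdot> u' r"
        using k'(1-3) \<theta>(1-3) ur by simp
    qed (use k k' \<theta> in simp_all)
    show ?thesis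
      unfolding I'_def[symmetric] Ob'_def[symmetric]
    proof (rule cross_nullI[OF s', of "c \<cdot> (\<phi> \<cdot> \<theta>)"])
      show "c \<cdot> (\<phi> \<cdot> \<theta>) \<in> hom C P' (Cod C c)" using ca mt \<phi> \<theta> by simp
      fix i assume i: "i \<in> I'"
      then have "i = 0 \<or> i = 1 \<or> i = 2" using 3 by (simp add: I'_def)
      then have "c \<cdot> (\<phi> \<cdot> u i) = [c \<cdot> x, c \<cdot> x, c \<cdot> x] ! i" using \<phi> by auto
      then show "(c \<cdot> (\<phi> \<cdot> \<theta>)) \<cdot> u' i = [c \<cdot> x, c \<cdot> x, c \<cdot> x] ! i"
        using ca mt \<phi>(1-3) \<theta> sum_in[OF s' i] i by simp
    next
      fix w assume w: "w \<in> Arr C" "Cod C w = P'" "\<And>i. i \<in> I' \<Longrightarrow> null C (kill C I' Ob' u' P' {i} \<cdot> w)"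
      have "null C (kill C I Ob u P {i} \<cdot> (\<theta> \<cdot> w))" if i: "i \<in> I'" for i
      proof -
        have "null C (\<theta> \<cdot> (kill C I' Ob' u' P' {i} \<cdot> w))" using w(3)[OF i] w \<theta> k' by simp
        then show ?thesis using w(1,2) \<theta>(1-3) k(1-3) k'(1-3) by (simp add: comp_eq[OF k\<theta>])
      qed
      then have "null C (g \<cdot> (\<theta> \<cdot> w))" using g(3)[of "\<theta> \<cdot> w"] w \<theta> by (auto simp: \<J>_def I'_def)
      then have "sub_le C (\<theta> \<cdot> w) l" using kernel_sub_le[OF l, of "\<theta> \<cdot> w"] w \<theta> g by simp
      then obtain v where "v \<in> Arr C" "Dom C v = Dom C (\<theta> \<cdot> w)" "Cod C v = Dom C l" "l \<cdot> v = \<theta> \<cdot> w"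
        by (rule sub_leE)
      then have v: "v \<in> Arr C" "Dom C v = Dom C w" "Cod C v = Dom C l" "l \<cdot> v = \<theta> \<cdot> w" using w \<theta> by simp_all
      have "null C ((c \<cdot> m) \<cdot> (e \<cdot> v))" by (rule null_precomp[OF mD(5)]) (use v ea c mt mD in simp_all)
      then have "null C (c \<cdot> (\<phi> \<cdot> (l \<cdot> v)))"
        using v(1-3) ea c(4) mt mD ca \<phi>(1-3) la by (simp add: comp_eq[OF c(5)])
      then show "null C ((c \<cdot> (\<phi> \<cdot> \<theta>)) \<cdot> w)" using v w \<theta>(1-3) \<phi>(1-3) ca mt by simp
    qed
  qed
  then show ?thesis using that[of c] c(1) mt 4 by simp
qed

lemma coproduct_swap:
  assumes "is_coproduct C A B i j"
  shows "is_coproduct C B A j i"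
  using assms unfolding is_coproduct_def by (metis in_hom)

lemma null_of_sub_le:
  assumes "sub_le C w x" "x \<in> Arr C" "\<sigma> \<in> Arr C" "Dom C \<sigma> = Cod C x" "null C (\<sigma> \<cdot> x)"
  shows "null C (\<sigma> \<cdot> w)"
proof -
  obtain h where h: "h \<in> Arr C" "Dom C h = Dom C w" "Cod C h = Dom C x" "x \<cdot> h = w"
    using assms(1) by (rule sub_leE)
  have "null C ((\<sigma> \<cdot> x) \<cdot> h)" by (rule null_precomp[OF assms(5)]) (use h assms in simp_all)
  then show ?thesis using h assms by simp
qed

text \<open>The quotient of \<open>X + Y\<close> by the two normal subobjects \<open>f21\<close> and \<open>f12\<close>, and then by the
  ternary commutators of \<open>X\<close> and \<open>Y\<close>, is two-nilpotent; the second step does not affect the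
  image of the cosmash product because it only divides out subobjects of \<open>X\<close> and \<open>Y\<close>.\<close>

lemma nilpotent_quotient:
  assumes co: "is_coproduct C X Y i j" and S: "Cod C i = S"
    and r1: "r1 \<in> hom C S X" "r1 \<cdot> i = Id C X" "r1 \<cdot> j = zero_arr C Y X"
    and r2: "r2 \<in> hom C S Y" "r2 \<cdot> i = zero_arr C X Y" "r2 \<cdot> j = Id C Y"
    and f21: "normal_image C f21" "f21 \<in> Arr C" "Cod C f21 = S" "null C (r1 \<cdot> f21)" "null C (r2 \<cdot> f21)"
    and f12: "normal_image C f12" "f12 \<in> Arr C" "Cod C f12 = S" "null C (r1 \<cdot> f12)" "null C (r2 \<cdot> f12)"
    and cn21: "\<And>q T. q \<in> hom C S T \<Longrightarrow> null C (q \<cdot> f21) \<Longrightarrow>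
      cross_null C {..<3::nat} ((!) [X, X, Y]) ((!) [q \<cdot> i, q \<cdot> i, q \<cdot> j]) T"
    and cn12: "\<And>q T. q \<in> hom C S T \<Longrightarrow> null C (q \<cdot> f12) \<Longrightarrow>
      cross_null C {..<3::nat} ((!) [X, Y, Y]) ((!) [q \<cdot> i, q \<cdot> j, q \<cdot> j]) T"
  obtains p T where "p \<in> hom C S T"
    "\<And>\<beta>. (\<And>t. t < 3 \<Longrightarrow> \<beta> t < 2) \<Longrightarrow>
      cross_null C {..<3::nat} (\<lambda>t. [X, Y] ! \<beta> t) (\<lambda>t. [p \<cdot> i, p \<cdot> j] ! \<beta> t) T"
    "\<And>m w. monic C m \<Longrightarrow> Cod C m = S \<Longrightarrow> sub_le C f21 m \<Longrightarrow> sub_le C f12 m \<Longrightarrow>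
      w \<in> Arr C \<Longrightarrow> Cod C w = S \<Longrightarrow> null C (r1 \<cdot> w) \<Longrightarrow> null C (r2 \<cdot> w) \<Longrightarrow> null C (p \<cdot> w) \<Longrightarrow>
      sub_le C w m"
proof -
  note coD = coproductD[OF co]
  have 3: "i = 0 \<or> i = 1 \<or> i = 2" if "i < 3" for i :: nat using that by auto
  have ij: "i \<in> Arr C" "j \<in> Arr C" "Dom C i = X" "Dom C j = Y" "Cod C i = S" "Cod C j = S"
    using coD S by simp_all
  obtain q where q: "cover C q" "Dom C q = S" "null C (q \<cdot> f21)" "null C (q \<cdot> f12)"
    and qmin: "\<And>m w. monic C m \<Longrightarrow> Cod C m = S \<Longrightarrow> sub_le C f21 m \<Longrightarrow> sub_le C f12 m \<Longrightarrow>
      w \<in> Arr C \<Longrightarrow> Cod C w = S \<Longrightarrow> null C (q \<cdot> w) \<Longrightarrow> sub_le C w m"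
    using normal_image_join[OF f21(1) f12(1) f21(3) f12(3)] by blast
  have qa: "q \<in> Arr C" using q by simp
  define T where "T = Cod C q"
  have qh: "q \<in> hom C S T" using qa q by (simp add: T_def)
  \<comment> \<open>The kernel of \<open>r\<close> contains both images and hence, by minimality,
    the kernel of \<open>q\<close>. So the two retractions of the sum descend to
    \<open>T\<close>.\<close>
  have retract: "\<exists>\<rho>. \<rho> \<in> Arr C \<and> Dom C \<rho> = T \<and> Cod C \<rho> = Cod C r \<and> \<rho> \<cdot> q = r"
    if r: "r \<in> Arr C" "Dom C r = S" "null C (r \<cdot> f21)" "null C (r \<cdot> f12)" for r
  proof -
    obtain k where k: "is_kernel C r k" using kernel_exists r by metis
    note kD = kernelD[OF k]
    obtain \<rho> where "\<rho> \<in> Arr C" "Dom C \<rho> = Cod C q" "Cod C \<rho> = Cod C r" "\<rho> \<cdot> q = r"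
    proof (rule cover_factor[OF q(1), of r])
      fix w assume w: "w \<in> Arr C" "Cod C w = Dom C q" "null C (q \<cdot> w)"
      have "sub_le C w k"
        by (rule qmin) (use w q kD r kernel_sub_le[OF k] f21 f12 in simp_all)
      then show "null C (r \<cdot> w)" using kernel_sub_le[OF k, of w] w q r by simp
    qed (use r q in simp_all)
    then show ?thesis by (auto simp: T_def)
  qed
  obtain \<rho> where \<rho>: "\<rho> \<in> Arr C" "Dom C \<rho> = T" "Cod C \<rho> = X" "\<rho> \<cdot> q = r1"
    using retract[of r1] r1(1) f21(4) f12(4) by auto
  obtain \<sigma> where \<sigma>: "\<sigma> \<in> Arr C" "Dom C \<sigma> = T" "Cod C \<sigma> = Y" "\<sigma> \<cdot> q = r2"
    using retract[of r2] r2(1) f21(5) f12(5) by auto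
  define x y where "x = q \<cdot> i" and "y = q \<cdot> j"
  have x: "x \<in> Arr C" "Dom C x = X" "Cod C x = T" and y: "y \<in> Arr C" "Dom C y = Y" "Cod C y = T"
    using qh ij by (simp_all add: x_def y_def)
  have rx: "\<rho> \<cdot> x = Id C X" "\<rho> \<cdot> y = zero_arr C Y X" "\<sigma> \<cdot> x = zero_arr C X Y" "\<sigma> \<cdot> y = Id C Y"
    using qh ij \<rho>(1-3) \<sigma>(1-3) r1 r2 by (simp_all add: x_def y_def comp_eq[OF \<rho>(4)] comp_eq[OF \<sigma>(4)])
  have cxxy: "cross_null C {..<3::nat} ((!) [X, X, Y]) ((!) [x, x, y]) T"
    using cn21[OF qh q(3)] by (simp add: x_def y_def)
  have cxyy: "cross_null C {..<3::nat} ((!) [X, Y, Y]) ((!) [x, y, y]) T"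
    using cn12[OF qh q(4)] by (simp add: x_def y_def)
  obtain c1 where c1: "cover C c1" "Dom C c1 = T"
    "cross_null C {..<3::nat} ((!) [X, X, X]) ((!) [c1 \<cdot> x, c1 \<cdot> x, c1 \<cdot> x]) (Cod C c1)"
    "\<And>w. w \<in> Arr C \<Longrightarrow> Cod C w = T \<Longrightarrow> null C (c1 \<cdot> w) \<Longrightarrow> sub_le C w x"
  proof (rule quotient_by_ternary_commutator[OF co q(1) _ _ _ _ _ _ cxxy, of \<rho>])
    show "Dom C q = Cod C i" using q S by simp
  qed (use \<rho> rx in \<open>simp_all add: T_def x_def y_def\<close>)
  have c1a: "c1 \<in> Arr C" using c1 by simp
  define T1 where "T1 = Cod C c1"
  have c1h: "c1 \<in> Arr C" "Dom C c1 = T" "Cod C c1 = T1" using c1a c1 by (simp_all add: T1_def)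
  \<comment> \<open>The kernel of \<open>c1\<close> lies in \<open>x\<close>, on which
    \<open>\<sigma>\<close> vanishes; the retraction onto Y therefore survives the first
    division.\<close>
  obtain \<sigma>1 where \<sigma>1: "\<sigma>1 \<in> Arr C" "Dom C \<sigma>1 = T1" "Cod C \<sigma>1 = Y" "\<sigma>1 \<cdot> c1 = \<sigma>"
  proof (rule cover_factor[OF c1(1), of \<sigma>])
    fix w assume w: "w \<in> Arr C" "Cod C w = Dom C c1" "null C (c1 \<cdot> w)"
    have "sub_le C w x" by (rule c1(4)) (use w c1 in simp_all)
    then show "null C (\<sigma> \<cdot> w)"
      by (rule null_of_sub_le) (use x \<sigma> rx coD in simp_all)
  qed (use \<sigma> c1 in \<open>simp_all add: T1_def\<close>)
  define y1 x1 where "y1 = c1 \<cdot> y" and "x1 = c1 \<cdot> x"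
  have y1: "y1 \<in> Arr C" "Dom C y1 = Y" "Cod C y1 = T1" using y c1h by (simp_all add: y1_def)
  have sy1: "\<sigma>1 \<cdot> y1 = Id C Y" using \<sigma>1(1-3) c1h y rx by (simp add: y1_def comp_eq[OF \<sigma>1(4)])
  have cyyx: "cross_null C {..<3::nat} ((!) [Y, Y, X]) ((!) [y1, y1, x1]) T1"
    by (rule cross_null_cong[OF cross_null_post[OF cross_null_rotate[OF cxyy], of c1]])
      (use c1h in \<open>auto simp: x1_def y1_def dest!: 3\<close>)
  \<comment> \<open>The same construction with the roles of X and Y exchanged, now for the cover
    \<open>c1 \<cdot> q\<close>.\<close>
  obtain c2 where c2: "cover C c2" "Dom C c2 = T1"
    "cross_null C {..<3::nat} ((!) [Y, Y, Y]) ((!) [c2 \<cdot> y1, c2 \<cdot> y1, c2 \<cdot> y1]) (Cod C c2)"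
    "\<And>w. w \<in> Arr C \<Longrightarrow> Cod C w = T1 \<Longrightarrow> null C (c2 \<cdot> w) \<Longrightarrow> sub_le C w y1"
  proof (rule quotient_by_ternary_commutator[OF coproduct_swap[OF co] _ _ _ _ _ _ _ cyyx, of "c1 \<cdot> q" \<sigma>1])
    show "cover C (c1 \<cdot> q)" by (rule cover_comp) (use c1h c1 q T_def in simp_all)
    show "(c1 \<cdot> q) \<cdot> j = y1" "(c1 \<cdot> q) \<cdot> i = x1"
      using c1h qh ij by (simp_all add: x1_def y1_def x_def y_def)
  qed (use \<sigma>1 sy1 c1h qh ij in simp_all)
  have c2a: "c2 \<in> Arr C" using c2 by simp
  define T2 where "T2 = Cod C c2"
  have c2h: "c2 \<in> Arr C" "Dom C c2 = T1" "Cod C c2 = T2" using c2a c2 by (simp_all add: T2_def)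
  define p where "p = c2 \<cdot> (c1 \<cdot> q)"
  have p: "p \<in> hom C S T2" using c1h c2h qh by (simp add: p_def)
  have pij: "p \<cdot> i = c2 \<cdot> (c1 \<cdot> x)" "p \<cdot> j = c2 \<cdot> (c1 \<cdot> y)"
    using c1h c2h qh ij by (simp_all add: p_def x_def y_def)
  have cc: "c2 \<cdot> c1 \<in> hom C T T2" using c1h c2h by simp
  \<comment> \<open>The two divisions are undone one after the other. The element
    \<open>c1 \<cdot> v\<close> lies in \<open>y1\<close>, and its coordinate there is
    \<open>\<sigma> \<cdot> v\<close>, which is zero. So \<open>v\<close> lies in \<open>x\<close>,
    and its coordinate there is \<open>\<rho> \<cdot> v\<close>, again zero. Hence
    \<open>q \<cdot> w\<close> is zero, and minimality of \<open>q\<close> applies.\<close>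
  have sub: "sub_le C w m" if m: "monic C m" "Cod C m = S" "sub_le C f21 m" "sub_le C f12 m"
    and w: "w \<in> Arr C" "Cod C w = S" "null C (r1 \<cdot> w)" "null C (r2 \<cdot> w)" "null C (p \<cdot> w)" for m w
  proof -
    define v where "v = q \<cdot> w"
    have v: "v \<in> Arr C" "Dom C v = Dom C w" "Cod C v = T" using w qh by (simp_all add: v_def)
    have nv: "null C (\<rho> \<cdot> v)" "null C (\<sigma> \<cdot> v)"
      using w \<rho>(1-3) \<sigma>(1-3) qh by (simp_all add: v_def comp_eq[OF \<rho>(4)] comp_eq[OF \<sigma>(4)])
    have "null C (c2 \<cdot> (c1 \<cdot> v))" using w c1h c2h qh by (simp add: p_def v_def)
    then have "sub_le C (c1 \<cdot> v) y1" by (intro c2(4)) (use v c1h in simp_all)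
    then obtain h where "h \<in> Arr C" "Dom C h = Dom C (c1 \<cdot> v)" "Cod C h = Dom C y1" "y1 \<cdot> h = c1 \<cdot> v"
      by (rule sub_leE)
    then have h: "h \<in> Arr C" "Dom C h = Dom C v" "Cod C h = Y" "y1 \<cdot> h = c1 \<cdot> v" using v c1h y1 by simp_all
    have "\<sigma>1 \<cdot> (y1 \<cdot> h) = h" using \<sigma>1(1-3) y1 h(1-3) by (simp add: comp_eq[OF sy1])
    moreover have "\<sigma>1 \<cdot> (c1 \<cdot> v) = \<sigma> \<cdot> v" using \<sigma>1(1-3) c1h v by (simp add: comp_eq[OF \<sigma>1(4)])
    ultimately have "h = \<sigma> \<cdot> v" using h(4) by simp
    then have "null C h" using nv by simp
    then have "null C (y1 \<cdot> h)" using y1 h(3) by simp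
    then have "null C (c1 \<cdot> v)" using h(4) by simp
    then have "sub_le C v x" using c1(4) v by simp
    then obtain l where l: "l \<in> Arr C" "Dom C l = Dom C v" "Cod C l = Dom C x" "x \<cdot> l = v"
      by (rule sub_leE)
    have "\<rho> \<cdot> (x \<cdot> l) = l" using \<rho>(1-3) x l(1-3) by (simp add: comp_eq[OF rx(1)])
    then have "null C l" using l(4) nv by simp
    then have "null C (x \<cdot> l)" by (rule null_comp) (use x l in simp_all)
    then have "null C (q \<cdot> w)" using l(4) by (simp add: v_def)
    with m w show ?thesis by (intro qmin[of m w])
  qed
  have types: "cross_null C {..<3::nat} (\<lambda>t. [X, Y] ! \<beta> t) (\<lambda>t. [p \<cdot> i, p \<cdot> j] ! \<beta> t) T2"
    if \<beta>: "\<And>t. t < 3 \<Longrightarrow> \<beta> t < 2" for \<beta>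
  proof (rule cross_null_all_types[OF _ _ _ _ \<beta>])
    show "cross_null C {..<3} ((!) [X, X, X]) ((!) [p \<cdot> i, p \<cdot> i, p \<cdot> i]) T2"
      by (rule cross_null_cong[OF cross_null_post[OF c1(3), of c2]])
        (use c1h c2h in \<open>auto simp: pij dest!: 3\<close>)
    show "cross_null C {..<3} ((!) [X, X, Y]) ((!) [p \<cdot> i, p \<cdot> i, p \<cdot> j]) T2"
      by (rule cross_null_cong[OF cross_null_post[OF cxxy cc]])
        (use c1h c2h x y in \<open>auto simp: pij dest!: 3\<close>)
    show "cross_null C {..<3} ((!) [X, Y, Y]) ((!) [p \<cdot> i, p \<cdot> j, p \<cdot> j]) T2"
      by (rule cross_null_cong[OF cross_null_post[OF cxyy cc]])
        (use c1h c2h x y in \<open>auto simp: pij dest!: 3\<close>)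
    show "cross_null C {..<3} ((!) [Y, Y, Y]) ((!) [p \<cdot> j, p \<cdot> j, p \<cdot> j]) T2"
      by (rule cross_null_cong[OF c2(3)[folded T2_def]]) (auto simp: pij y1_def dest!: 3)
  qed
  show ?thesis using that[OF p types sub] by blast
qed

end

section \<open>Cosmash products and ternary commutators\<close>

context pointed_category begin

lemma null_into_product:
  assumes prod: "is_product C A B p q" and h: "h \<in> Arr C" "Cod C h = Dom C p"
  shows "null C h \<longleftrightarrow> null C (p \<cdot> h) \<and> null C (q \<cdot> h)"
proof
  note pD = productD[OF prod]
  assume "null C h"
  then show "null C (p \<cdot> h) \<and> null C (q \<cdot> h)" using pD h by simp
next
  note pD = productD[OF prod]
  assume n: "null C (p \<cdot> h) \<and> null C (q \<cdot> h)"
  define z where "z = zero_arr C (Dom C h) (Dom C p)"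
  have z: "z \<in> Arr C" "Dom C z = Dom C h" "Cod C z = Dom C p" "null C z"
    using h pD by (simp_all add: z_def)
  have n1: "null C (p \<cdot> z)" "null C (q \<cdot> z)" using z pD by simp_all
  have "h = z"
  proof (rule product_unique[OF prod, of h "Dom C h"])
    show "p \<cdot> h = p \<cdot> z" by (rule null_null_eq) (use n n1 h z pD in simp_all)
    show "q \<cdot> h = q \<cdot> z" by (rule null_null_eq) (use n n1 h z pD in simp_all)
  qed (use h z in simp_all)
  then show "null C h" using z by simp
qed

text \<open>The arrow \<open>\<phi>\<close> absorbs \<open>kill J\<close>, since it vanishes on the
  summands in \<open>J\<close> anyway.\<close>

lemma null_kill_comp:
  assumes s: "is_sum C I Ob u P" and \<phi>: "\<phi> \<in> Arr C" "Dom C \<phi> = P"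
    and J: "\<And>i. i \<in> I \<Longrightarrow> i \<in> J \<Longrightarrow> null C (\<phi> \<cdot> u i)"
    and w: "w \<in> Arr C" "Cod C w = P" "null C (kill C I Ob u P J \<cdot> w)"
  shows "null C (\<phi> \<cdot> w)"
proof -
  note k = kill_props[OF s]
  have e: "\<phi> \<cdot> kill C I Ob u P J = \<phi>"
  proof (rule sum_unique[OF s, of _ "Cod C \<phi>"])
    fix i assume i: "i \<in> I"
    note u = sum_in[OF s i] and o = sum_comp_obj[OF s i]
    have "(\<phi> \<cdot> kill C I Ob u P J) \<cdot> u i = \<phi> \<cdot> (if i \<in> J then zero_arr C (Ob i) P else u i)"
      using k(1-3) k(4)[OF i] \<phi> u by simp
    also have "\<dots> = \<phi> \<cdot> u i"
    proof (cases "i \<in> J")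
      case True
      have "\<phi> \<cdot> u i = zero_arr C (Ob i) (Cod C \<phi>)" using null_eq[OF J[OF i True]] u \<phi> by simp
      then show ?thesis using True \<phi> o by simp
    qed simp
    finally show "(\<phi> \<cdot> kill C I Ob u P J) \<cdot> u i = \<phi> \<cdot> u i" .
  qed (use k \<phi> in simp_all)
  have "null C (\<phi> \<cdot> (kill C I Ob u P J \<cdot> w))" by (rule null_comp[OF w(3)]) (use k \<phi> w in simp_all)
  then show ?thesis using k(1-3) \<phi> w(1,2) by (simp add: comp_eq[OF e])
qed

text \<open>The composite \<open>\<iota> \<cdot> \<rho>\<close> is \<open>kill J\<close>. The
  components defining the ternary cosmash product land in three different sums; this translates them
  into idempotents on a single one.\<close>

lemma null_kill_iff:
  assumes s: "is_sum C I Ob u P" and \<rho>: "\<rho> \<in> Arr C" "Dom C \<rho> = P" and \<iota>: "\<iota> \<in> Arr C" "Dom C \<iota> = Cod C \<rho>" "Cod C \<iota> = P"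
    and J: "\<And>i. i \<in> I \<Longrightarrow> i \<in> J \<Longrightarrow> null C (\<rho> \<cdot> u i)"
    and nJ: "\<And>i. i \<in> I \<Longrightarrow> i \<notin> J \<Longrightarrow> \<iota> \<cdot> (\<rho> \<cdot> u i) = u i"
    and w: "w \<in> Arr C" "Cod C w = P"
  shows "null C (\<rho> \<cdot> w) \<longleftrightarrow> null C (kill C I Ob u P J \<cdot> w)"
proof
  note k = kill_props[OF s]
  have "kill C I Ob u P J = \<iota> \<cdot> \<rho>"
  proof (rule kill_eqI[OF s])
    fix i assume i: "i \<in> I"
    note u = sum_in[OF s i] and o = sum_comp_obj[OF s i]
    show "(\<iota> \<cdot> \<rho>) \<cdot> u i = (if i \<in> J then zero_arr C (Ob i) P else u i)"
    proof (cases "i \<in> J")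
      case True
      have "\<rho> \<cdot> u i = zero_arr C (Ob i) (Cod C \<rho>)" using null_eq[OF J[OF i True]] u \<rho> by simp
      then show ?thesis using True \<rho> \<iota> o u by simp
    next
      case False
      then show ?thesis using nJ[OF i False] \<rho> \<iota> u by simp
    qed
  qed (use \<rho> \<iota> in simp)
  moreover assume "null C (\<rho> \<cdot> w)"
  ultimately show "null C (kill C I Ob u P J \<cdot> w)" using \<rho> \<iota> w by simp
next
  assume "null C (kill C I Ob u P J \<cdot> w)"
  then show "null C (\<rho> \<cdot> w)" using null_kill_comp[OF s \<rho>, of J w] J w by blast
qed

text \<open>Stated with bare existence of the product and the coproduct in a pointed category,
  because it is applied to \<open>Nil2 C\<close> as well as to \<open>C\<close>.\<close>

lemma sum_to_prod_projections:
  fixes X Y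
  assumes pr: "\<exists>p q. is_product C X Y p q" and co: "\<exists>i j. is_coproduct C X Y i j"
  defines "p \<equiv> fst (projs C X Y)" and "q \<equiv> snd (projs C X Y)"
  shows "sum_to_prod C X Y \<in> hom C (cop C X Y) (Dom C p)"
    "(p \<cdot> sum_to_prod C X Y) \<cdot> in1 C X Y = Id C X" "(p \<cdot> sum_to_prod C X Y) \<cdot> in2 C X Y = zero_arr C Y X"
    "(q \<cdot> sum_to_prod C X Y) \<cdot> in1 C X Y = zero_arr C X Y" "(q \<cdot> sum_to_prod C X Y) \<cdot> in2 C X Y = Id C Y"
proof -
  note coD = coproductD[OF in_coproduct[OF co]] and pD = productD[OF projs_product[OF pr], folded p_def q_def]
  have XY: "X \<in> Obj C" "Y \<in> Obj C" using coD by simp_all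
  define a b where "a = pair C (Id C X) (zero_arr C X Y)" and "b = pair C (zero_arr C Y X) (Id C Y)"
  have "a \<in> hom C X (Dom C p)" "p \<cdot> a = Id C X" "q \<cdot> a = zero_arr C X Y"
    using pair_props[OF pr, of "Id C X" X "zero_arr C X Y"] XY by (simp_all add: a_def p_def q_def prd_def)
  moreover have "b \<in> hom C Y (Dom C p)" "p \<cdot> b = zero_arr C Y X" "q \<cdot> b = Id C Y"
    using pair_props[OF pr, of "zero_arr C Y X" Y "Id C Y"] XY by (simp_all add: b_def p_def q_def prd_def)
  moreover note copair_props[OF co calculation(1) calculation(4)]
  ultimately have *: "a \<in> hom C X (Dom C p)" "p \<cdot> a = Id C X" "q \<cdot> a = zero_arr C X Y"
    "b \<in> hom C Y (Dom C p)" "p \<cdot> b = zero_arr C Y X" "q \<cdot> b = Id C Y"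
    "copair C a b \<in> hom C (cop C X Y) (Dom C p)" "copair C a b \<cdot> in1 C X Y = a" "copair C a b \<cdot> in2 C X Y = b"
    by blast+
  have s: "sum_to_prod C X Y = copair C a b" by (simp add: sum_to_prod_def a_def b_def)
  show "sum_to_prod C X Y \<in> hom C (cop C X Y) (Dom C p)" using * s by simp
  show "(p \<cdot> sum_to_prod C X Y) \<cdot> in1 C X Y = Id C X" "(p \<cdot> sum_to_prod C X Y) \<cdot> in2 C X Y = zero_arr C Y X"
    "(q \<cdot> sum_to_prod C X Y) \<cdot> in1 C X Y = zero_arr C X Y" "(q \<cdot> sum_to_prod C X Y) \<cdot> in2 C X Y = Id C Y"
    using * s coD pD by (simp_all add: cop_def)
qed

lemma null_Id_zero:
  assumes "D \<in> Obj C" "null C (Id C D)"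
  shows "is_zero C D"
proof -
  have "is_initial C D"
    unfolding is_initial_def
  proof (intro conjI ballI)
    fix A assume A: "A \<in> Obj C"
    have "f = zero_arr C D A" if "f \<in> Arr C" "Dom C f = D" "Cod C f = A" for f
    proof -
      have "null C (f \<cdot> Id C D)" by (rule null_comp[OF assms(2)]) (use that assms in simp_all)
      then show ?thesis using that null_eq by simp
    qed
    then show "\<exists>!f. f \<in> hom C D A" using A assms by (intro ex1I[of _ "zero_arr C D A"]) auto
  qed (rule assms)
  moreover have "is_terminal C D"
    unfolding is_terminal_def
  proof (intro conjI ballI)
    fix A assume A: "A \<in> Obj C"
    have "f = zero_arr C A D" if "f \<in> Arr C" "Dom C f = A" "Cod C f = D" for f
    proof -
      have "null C (Id C D \<cdot> f)" by (rule null_precomp[OF assms(2)]) (use that assms in simp_all)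
      then show ?thesis using that null_eq by simp
    qed
    then show "\<exists>!f. f \<in> hom C A D" using A assms by (intro ex1I[of _ "zero_arr C A D"]) auto
  qed (rule assms)
  ultimately show ?thesis by (simp add: is_zero_def)
qed

lemma zero_null_Id: "is_zero C D \<Longrightarrow> null C (Id C D)"
proof -
  assume z: "is_zero C D"
  then have D: "D \<in> Obj C" by (simp add: is_zero_def is_initial_def)
  then have "Id C D \<in> hom C D D" "zero_arr C D D \<in> hom C D D" by simp_all
  then have "Id C D = zero_arr C D D" using z D unfolding is_zero_def is_initial_def by blast
  then show ?thesis using D by (simp add: null_def)
qed

end

context semi_abelian_category begin

section \<open>Chosen coproducts, products, kernels and cosmash products\<close>

lemma coproduct_in: "A \<in> Obj C \<Longrightarrow> B \<in> Obj C \<Longrightarrow> is_coproduct C A B (in1 C A B) (in2 C A B)"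
  by (rule in_coproduct[OF coproduct_exists])

lemma cop_obj [simp]: "A \<in> Obj C \<Longrightarrow> B \<in> Obj C \<Longrightarrow> cop C A B \<in> Obj C"
  using coproductD(1)[OF coproduct_in] unfolding cop_def by simp

lemma in_simps [simp]:
  assumes "A \<in> Obj C" "B \<in> Obj C"
  shows "in1 C A B \<in> Arr C" "Dom C (in1 C A B) = A" "Cod C (in1 C A B) = cop C A B"
    "in2 C A B \<in> Arr C" "Dom C (in2 C A B) = B" "Cod C (in2 C A B) = cop C A B"
  using coproductD[OF coproduct_in[OF assms]] by (simp_all add: cop_def)

lemma copair_simps [simp]:
  assumes "f \<in> Arr C" "g \<in> Arr C" "Cod C f = Cod C g"
  shows "copair C f g \<in> Arr C" "Dom C (copair C f g) = cop C (Dom C f) (Dom C g)"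
    "Cod C (copair C f g) = Cod C g"
  using copair_props(1)[OF coproduct_exists, of "Dom C f" "Dom C g" f "Cod C g" g] assms by simp_all

lemma copair_in [simp]:
  assumes "f \<in> Arr C" "g \<in> Arr C" "Cod C f = Cod C g" "Dom C f = A" "Dom C g = B"
  shows "copair C f g \<cdot> in1 C A B = f" "copair C f g \<cdot> in2 C A B = g"
  using copair_props(2,3)[OF coproduct_exists, of A B f "Cod C g" g] assms by auto

lemma copair_in_comp [simp]:
  assumes "f \<in> Arr C" "g \<in> Arr C" "Cod C f = Cod C g" "Dom C f = A" "Dom C g = B"
    "k \<in> Arr C"
  shows "Cod C k = A \<Longrightarrow> copair C f g \<cdot> (in1 C A B \<cdot> k) = f \<cdot> k"
    "Cod C k = B \<Longrightarrow> copair C f g \<cdot> (in2 C A B \<cdot> k) = g \<cdot> k"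
  using comp_eq[OF copair_in(1)[OF assms(1-5)], of k] comp_eq[OF copair_in(2)[OF assms(1-5)], of k] assms
  by auto

lemma pair_simps:
  assumes "f \<in> Arr C" "g \<in> Arr C" "Dom C f = Dom C g"
  shows "pair C f g \<in> Arr C" "Dom C (pair C f g) = Dom C g"
    "Cod C (pair C f g) = Dom C (fst (projs C (Cod C f) (Cod C g)))"
    "fst (projs C (Cod C f) (Cod C g)) \<cdot> pair C f g = f" "snd (projs C (Cod C f) (Cod C g)) \<cdot> pair C f g = g"
  using pair_props[OF product_exists, of "Cod C f" "Cod C g" f "Dom C g" g] assms by (simp_all add: prd_def)

lemma projs_prod: "A \<in> Obj C \<Longrightarrow> B \<in> Obj C \<Longrightarrow> is_product C A B (fst (projs C A B)) (snd (projs C A B))"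
  by (rule projs_product[OF product_exists])

lemma null_pair:
  assumes fg: "f \<in> Arr C" "g \<in> Arr C" "Dom C f = Dom C g" and w: "w \<in> Arr C" "Cod C w = Dom C g"
  shows "null C (pair C f g \<cdot> w) \<longleftrightarrow> null C (f \<cdot> w) \<and> null C (g \<cdot> w)"
proof -
  note p = pair_simps[OF fg] and prod = projs_prod[of "Cod C f" "Cod C g"]
  have pr: "is_product C (Cod C f) (Cod C g) (fst (projs C (Cod C f) (Cod C g))) (snd (projs C (Cod C f) (Cod C g)))"
    using prod fg by simp
  note pD = productD[OF pr]
  show ?thesis
    using null_into_product[OF pr, of "pair C f g \<cdot> w"] p(1-3) w pD
    by (simp add: comp_eq[OF p(4)] comp_eq[OF p(5)])
qed

lemma sum_to_prod_props:
  assumes XY: "X \<in> Obj C" "Y \<in> Obj C"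
  shows "sum_to_prod C X Y \<in> Arr C" "Dom C (sum_to_prod C X Y) = cop C X Y"
    "w \<in> Arr C \<Longrightarrow> Cod C w = cop C X Y \<Longrightarrow> null C (sum_to_prod C X Y \<cdot> w) \<longleftrightarrow>
      null C (copair C (Id C X) (zero_arr C Y X) \<cdot> w) \<and> null C (copair C (zero_arr C X Y) (Id C Y) \<cdot> w)"
proof -
  define p q where "p = fst (projs C X Y)" and "q = snd (projs C X Y)"
  have prod: "is_product C X Y p q" using projs_prod[OF XY] by (simp add: p_def q_def)
  note pD = productD[OF prod]
  note g = sum_to_prod_projections[OF product_exists[OF XY] coproduct_exists[OF XY], folded p_def q_def]
  show t: "sum_to_prod C X Y \<in> Arr C" "Dom C (sum_to_prod C X Y) = cop C X Y" using g(1) by simp_all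
  have t': "Cod C (sum_to_prod C X Y) = Dom C p" using g(1) by simp
  have pa: "p \<cdot> sum_to_prod C X Y = copair C (Id C X) (zero_arr C Y X)"
    using coproduct_unique[OF coproduct_in[OF XY], of "p \<cdot> sum_to_prod C X Y" X "copair C (Id C X) (zero_arr C Y X)"]
      g(2,3) XY pD t t' by simp
  have qa: "q \<cdot> sum_to_prod C X Y = copair C (zero_arr C X Y) (Id C Y)"
    using coproduct_unique[OF coproduct_in[OF XY], of "q \<cdot> sum_to_prod C X Y" Y "copair C (zero_arr C X Y) (Id C Y)"]
      g(4,5) XY pD t t' by simp
  show "null C (sum_to_prod C X Y \<cdot> w) \<longleftrightarrow>
      null C (copair C (Id C X) (zero_arr C Y X) \<cdot> w) \<and> null C (copair C (zero_arr C X Y) (Id C Y) \<cdot> w)"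
    if w: "w \<in> Arr C" "Cod C w = cop C X Y"
    using null_into_product[OF prod, of "sum_to_prod C X Y \<cdot> w"] t t' w pD
    by (simp add: comp_eq[OF pa] comp_eq[OF qa])
qed

lemma ker_kernel: "f \<in> Arr C \<Longrightarrow> is_kernel C f (ker C f)"
  unfolding ker_def by (rule someI_ex) (use kernel_exists in blast)

lemma cosmash_kernel:
  assumes XY: "X \<in> Obj C" "Y \<in> Obj C"
  shows "is_kernel C (sum_to_prod C X Y) (cosmash_incl C X Y)"
  unfolding cosmash_incl_def by (rule ker_kernel) (use sum_to_prod_props[OF XY] in simp)

lemma cosmash_props:
  assumes XY: "X \<in> Obj C" "Y \<in> Obj C"
  shows "monic C (cosmash_incl C X Y)" "Cod C (cosmash_incl C X Y) = cop C X Y"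
    "Dom C (cosmash_incl C X Y) = cosmash C X Y"
    "w \<in> Arr C \<Longrightarrow> Cod C w = cop C X Y \<Longrightarrow> sub_le C w (cosmash_incl C X Y) \<longleftrightarrow>
      null C (copair C (Id C X) (zero_arr C Y X) \<cdot> w) \<and> null C (copair C (zero_arr C X Y) (Id C Y) \<cdot> w)"
  using kernelD[OF cosmash_kernel[OF XY]] sum_to_prod_props[OF XY] kernel_sub_le[OF cosmash_kernel[OF XY], of w]
  by (simp_all add: cosmash_def)

text \<open>The injections of the chosen (X + Y) + Z as a family indexed by 0, 1, 2, which makes the
  results on \<open>is_sum\<close> available.\<close>

definition triple_in :: "'a \<Rightarrow> 'a \<Rightarrow> 'a \<Rightarrow> nat \<Rightarrow> 'b" where
  "triple_in X Y Z = (!) [in1 C (cop C X Y) Z \<cdot> in1 C X Y, in1 C (cop C X Y) Z \<cdot> in2 C X Y, in2 C (cop C X Y) Z]"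

lemma triple_in_simps:
  "triple_in X Y Z 0 = in1 C (cop C X Y) Z \<cdot> in1 C X Y"
  "triple_in X Y Z 1 = in1 C (cop C X Y) Z \<cdot> in2 C X Y"
  "triple_in X Y Z (Suc 0) = in1 C (cop C X Y) Z \<cdot> in2 C X Y"
  "triple_in X Y Z 2 = in2 C (cop C X Y) Z"
  by (simp_all add: triple_in_def)

lemma triple_sum:
  assumes "X \<in> Obj C" "Y \<in> Obj C" "Z \<in> Obj C"
  shows "is_sum C {..<3::nat} ((!) [X, Y, Z]) (triple_in X Y Z) (cop C (cop C X Y) Z)"
proof -
  have "is_coproduct C (Cod C (in1 C X Y)) Z (in1 C (cop C X Y) Z) (in2 C (cop C X Y) Z)"
    using coproduct_in[of "cop C X Y" Z] assms by simp
  from coproduct_sum3[OF coproduct_in[OF assms(1,2)] this] show ?thesis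
    using assms by (simp add: triple_in_def)
qed

lemma copair3_props:
  assumes "f \<in> Arr C" "g \<in> Arr C" "h \<in> Arr C" "Cod C f = T" "Cod C g = T" "Cod C h = T"
    "Dom C f = X" "Dom C g = Y" "Dom C h = Z"
  shows "copair3 C f g h \<in> Arr C" "Dom C (copair3 C f g h) = cop C (cop C X Y) Z"
    "Cod C (copair3 C f g h) = T"
    "copair3 C f g h \<cdot> triple_in X Y Z 0 = f"
    "copair3 C f g h \<cdot> triple_in X Y Z 1 = g"
    "copair3 C f g h \<cdot> triple_in X Y Z 2 = h"
proof -
  have "X \<in> Obj C" "Y \<in> Obj C" "Z \<in> Obj C" using assms by auto
  then show "copair3 C f g h \<in> Arr C" "Dom C (copair3 C f g h) = cop C (cop C X Y) Z"
    "Cod C (copair3 C f g h) = T"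
    "copair3 C f g h \<cdot> triple_in X Y Z 0 = f"
    "copair3 C f g h \<cdot> triple_in X Y Z 1 = g"
    "copair3 C f g h \<cdot> triple_in X Y Z 2 = h"
    using assms by (simp_all add: copair3_def triple_in_simps)
qed

text \<open>Each component of \<open>sum_to_prod3\<close> kills one summand and keeps the other two,
  so \<open>null_kill_iff\<close> applies to it with the copairing of the two remaining injections
  as \<open>\<iota>\<close>.\<close>

lemma cosmash3_props:
  assumes XYZ: "X \<in> Obj C" "Y \<in> Obj C" "Z \<in> Obj C"
  shows "is_kernel C (sum_to_prod3 C X Y Z) (cosmash3_incl C X Y Z)"
    "Cod C (cosmash3_incl C X Y Z) = cop C (cop C X Y) Z"
    "w \<in> Arr C \<Longrightarrow> Cod C w = cop C (cop C X Y) Z \<Longrightarrow> sub_le C w (cosmash3_incl C X Y Z) \<longleftrightarrow>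
      (\<forall>i<3. null C (kill C {..<3} ((!) [X, Y, Z]) (triple_in X Y Z) (cop C (cop C X Y) Z) {i} \<cdot> w))"
proof -
  let ?P = "cop C (cop C X Y) Z" and ?u = "triple_in X Y Z"
  note s = triple_sum[OF XYZ]
  note u = sum_in[OF s, of 0, simplified] sum_in[OF s, of 1, simplified] sum_in[OF s, of 2, simplified]
  have 3: "i = 0 \<or> i = 1 \<or> i = 2" if "i < 3" for i :: nat using that by auto
  define rZ where "rZ = copair3 C (in1 C X Y) (in2 C X Y) (zero_arr C Z (cop C X Y))"
  define rY where "rY = copair3 C (in1 C X Z) (zero_arr C Y (cop C X Z)) (in2 C X Z)"
  define rX where "rX = copair3 C (zero_arr C X (cop C Y Z)) (in1 C Y Z) (in2 C Y Z)"
  have rZ: "rZ \<in> Arr C" "Dom C rZ = ?P" "Cod C rZ = cop C X Y"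
    "rZ \<cdot> ?u 0 = in1 C X Y" "rZ \<cdot> ?u 1 = in2 C X Y" "rZ \<cdot> ?u 2 = zero_arr C Z (cop C X Y)"
    unfolding rZ_def by (rule copair3_props; use XYZ in simp)+
  have rY: "rY \<in> Arr C" "Dom C rY = ?P" "Cod C rY = cop C X Z"
    "rY \<cdot> ?u 0 = in1 C X Z" "rY \<cdot> ?u 1 = zero_arr C Y (cop C X Z)" "rY \<cdot> ?u 2 = in2 C X Z"
    unfolding rY_def by (rule copair3_props; use XYZ in simp)+
  have rX: "rX \<in> Arr C" "Dom C rX = ?P" "Cod C rX = cop C Y Z"
    "rX \<cdot> ?u 0 = zero_arr C X (cop C Y Z)" "rX \<cdot> ?u 1 = in1 C Y Z" "rX \<cdot> ?u 2 = in2 C Y Z"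
    unfolding rX_def by (rule copair3_props; use XYZ in simp)+
  have s3: "sum_to_prod3 C X Y Z = pair C (pair C rZ rY) rX"
    by (simp add: sum_to_prod3_def rZ_def rY_def rX_def)
  have p1: "pair C rZ rY \<in> Arr C" "Dom C (pair C rZ rY) = ?P"
    using pair_simps[of rZ rY] rZ rY by simp_all
  have st: "sum_to_prod3 C X Y Z \<in> Arr C" "Dom C (sum_to_prod3 C X Y Z) = ?P"
    using pair_simps[of "pair C rZ rY" rX] p1 rX by (simp_all add: s3)
  show k: "is_kernel C (sum_to_prod3 C X Y Z) (cosmash3_incl C X Y Z)"
    unfolding cosmash3_incl_def by (rule ker_kernel[OF st(1)])
  show "Cod C (cosmash3_incl C X Y Z) = ?P" using kernelD[OF k] st by simp
  assume w: "w \<in> Arr C" "Cod C w = ?P"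
  have "null C (rZ \<cdot> w) \<longleftrightarrow> null C (kill C {..<3} ((!) [X, Y, Z]) ?u ?P {2} \<cdot> w)"
    by (rule null_kill_iff[OF s rZ(1,2), of "copair C (?u 0) (?u 1)"])
      (use rZ u XYZ w in \<open>auto dest!: 3\<close>)
  moreover have "null C (rY \<cdot> w) \<longleftrightarrow> null C (kill C {..<3} ((!) [X, Y, Z]) ?u ?P {1} \<cdot> w)"
    by (rule null_kill_iff[OF s rY(1,2), of "copair C (?u 0) (?u 2)"])
      (use rY u XYZ w in \<open>auto dest!: 3\<close>)
  moreover have "null C (rX \<cdot> w) \<longleftrightarrow> null C (kill C {..<3} ((!) [X, Y, Z]) ?u ?P {0} \<cdot> w)"
    by (rule null_kill_iff[OF s rX(1,2), of "copair C (?u 1) (?u 2)"])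
      (use rX u XYZ w in \<open>auto dest!: 3\<close>)
  moreover have "sub_le C w (cosmash3_incl C X Y Z) \<longleftrightarrow> null C (rZ \<cdot> w) \<and> null C (rY \<cdot> w) \<and> null C (rX \<cdot> w)"
    using kernel_sub_le[OF k, of w] null_pair[of "pair C rZ rY" rX w] null_pair[of rZ rY w] w st p1 rX rY rZ
    by (simp add: s3)
  moreover have "(\<forall>i<3. Q i) \<longleftrightarrow> Q 2 \<and> Q 1 \<and> Q 0" for Q :: "nat \<Rightarrow> bool" using 3 by auto
  ultimately show "sub_le C w (cosmash3_incl C X Y Z) \<longleftrightarrow>
      (\<forall>i<3. null C (kill C {..<3} ((!) [X, Y, Z]) ?u ?P {i} \<cdot> w))" by simp
qed

text \<open>Since \<open>cross_null\<close> only asserts that a suitable sum exists, one direction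
  moves from that sum to the chosen one, by grouping along the identity of the index set.\<close>

lemma cosmash3_cross_null:
  assumes "f \<in> hom C X T" "g \<in> hom C Y T" "h \<in> hom C Z T"
  shows "cross_null C {..<3::nat} ((!) [X, Y, Z]) ((!) [f, g, h]) T \<longleftrightarrow>
    null C (copair3 C f g h \<cdot> cosmash3_incl C X Y Z)"
proof -
  have XYZ: "X \<in> Obj C" "Y \<in> Obj C" "Z \<in> Obj C" using assms by auto
  have 3: "i = 0 \<or> i = 1 \<or> i = 2" if "i < 3" for i :: nat using that by auto
  note s = triple_sum[OF XYZ] and c3 = cosmash3_props[OF XYZ]
  note kD = kernelD[OF c3(1)]
  have \<phi>: "copair3 C f g h \<in> Arr C" "Dom C (copair3 C f g h) = cop C (cop C X Y) Z"
    "Cod C (copair3 C f g h) = T"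
    "copair3 C f g h \<cdot> triple_in X Y Z 0 = f"
    "copair3 C f g h \<cdot> triple_in X Y Z 1 = g"
    "copair3 C f g h \<cdot> triple_in X Y Z 2 = h"
    by (rule copair3_props; use assms in simp)+
  have T: "T \<in> Obj C" using assms by auto
  show ?thesis
  proof
    assume cn: "cross_null C {..<3::nat} ((!) [X, Y, Z]) ((!) [f, g, h]) T"
    show "null C (copair3 C f g h \<cdot> cosmash3_incl C X Y Z)"
    proof (rule cross_null_grouping[OF s cn, where \<gamma> = id and g = "\<lambda>i. Id C ([X, Y, Z] ! i)"])
      fix j assume j: "j \<in> {..<3::nat}"
      then have "{i \<in> {..<3}. id i = j} = {j}" by auto
      then show "null C (kill C {..<3} ((!) [X, Y, Z]) (triple_in X Y Z) (cop C (cop C X Y) Z)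
            {i \<in> {..<3}. id i = j} \<cdot> cosmash3_incl C X Y Z)"
        using c3(3)[OF kD(3) c3(2)] sub_le_refl[OF kD(3)] j by simp
    qed (use \<phi> kD c3 assms XYZ in \<open>auto dest!: 3\<close>)
  next
    assume n: "null C (copair3 C f g h \<cdot> cosmash3_incl C X Y Z)"
    show "cross_null C {..<3::nat} ((!) [X, Y, Z]) ((!) [f, g, h]) T"
    proof (rule cross_nullI[OF s])
      show "copair3 C f g h \<in> hom C (cop C (cop C X Y) Z) T" using \<phi> by simp
      show "copair3 C f g h \<cdot> triple_in X Y Z i = [f, g, h] ! i" if "i \<in> {..<3}" for i
        using that \<phi> by (auto dest!: 3)
      fix w assume w: "w \<in> Arr C" "Cod C w = cop C (cop C X Y) Z"
        "\<And>i. i \<in> {..<3} \<Longrightarrow> null C (kill C {..<3} ((!) [X, Y, Z]) (triple_in X Y Z) (cop C (cop C X Y) Z) {i} \<cdot> w)"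
      then have "sub_le C w (cosmash3_incl C X Y Z)" using c3(3)[of w] by simp
      then show "null C (copair3 C f g h \<cdot> w)"
        by (rule null_of_sub_le) (use kD c3 \<phi> n in simp_all)
    qed
  qed
qed

section \<open>Chosen images and folding operations\<close>

lemma img_props:
  assumes "f \<in> Arr C"
  shows "monic C (img C f)" "Cod C (img C f) = Cod C f"
    "\<exists>e. cover C e \<and> Dom C e = Dom C f \<and> Cod C e = Dom C (img C f) \<and> img C f \<cdot> e = f"
proof -
  have "\<exists>m. is_image C f m"
    using image_exists[OF assms] unfolding is_image_def by (metis in_hom)
  then have im: "is_image C f (img C f)" unfolding img_def by (rule someI_ex)
  then obtain e where e: "e \<in> Arr C" "Dom C e = Dom C f" "Cod C e = Dom C (img C f)" "regular_epi C e"
    "f = img C f \<cdot> e" unfolding is_image_def by auto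
  show m: "monic C (img C f)" using im by (simp add: is_image_def)
  have "Cod C (img C f \<cdot> e) = Cod C (img C f)" using m e(1-3) by simp
  then show "Cod C (img C f) = Cod C f" using e(5) by simp
  show "\<exists>e. cover C e \<and> Dom C e = Dom C f \<and> Cod C e = Dom C (img C f) \<and> img C f \<cdot> e = f"
    using e regular_epi_cover by metis
qed

lemma sub_le_img:
  assumes f: "f \<in> Arr C" and m: "monic C m" "Cod C m = Cod C f"
  shows "sub_le C (img C f) m \<longleftrightarrow> sub_le C f m"
proof -
  note i = img_props[OF f]
  obtain e where e: "cover C e" "Dom C e = Dom C f" "Cod C e = Dom C (img C f)" "img C f \<cdot> e = f" using i(3) by blast
  show ?thesis
  proof
    assume "sub_le C (img C f) m"
    then have "sub_le C (img C f \<cdot> e) m" by (rule sub_le_comp) (use i e m in simp_all)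
    then show "sub_le C f m" using e by simp
  next
    assume "sub_le C f m"
    then show "sub_le C (img C f) m"
      by (intro cover_orth[OF e(1) m(1), of "img C f"]) (use e i m in simp_all)
  qed
qed

lemma null_img:
  assumes f: "f \<in> Arr C" and q: "q \<in> Arr C" "Dom C q = Cod C f"
  shows "null C (q \<cdot> img C f) \<longleftrightarrow> null C (q \<cdot> f)"
proof -
  note i = img_props[OF f]
  obtain e where e: "cover C e" "Dom C e = Dom C f" "Cod C e = Dom C (img C f)" "img C f \<cdot> e = f" using i(3) by blast
  show ?thesis
  proof
    assume "null C (q \<cdot> img C f)"
    then have "null C ((q \<cdot> img C f) \<cdot> e)" by (rule null_precomp) (use i e q in simp_all)
    then show "null C (q \<cdot> f)" using i(1,2) e q by simp
  next
    assume n: "null C (q \<cdot> f)"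
    show "null C (q \<cdot> img C f)"
      by (rule null_cover[OF e(1)]) (use n i(1,2) e q in simp_all)
  qed
qed

lemma copair3_post:
  assumes "f \<in> hom C X T" "g \<in> hom C Y T" "h \<in> hom C Z T" "q \<in> hom C T T'"
  shows "q \<cdot> copair3 C f g h = copair3 C (q \<cdot> f) (q \<cdot> g) (q \<cdot> h)"
proof -
  have XYZ: "X \<in> Obj C" "Y \<in> Obj C" "Z \<in> Obj C" using assms by auto
  have 3: "i = 0 \<or> i = 1 \<or> i = 2" if "i < 3" for i :: nat using that by auto
  note s = triple_sum[OF XYZ]
  note u = sum_in[OF s, of 0, simplified] sum_in[OF s, of 1, simplified] sum_in[OF s, of 2, simplified]
  have 1: "copair3 C f g h \<in> Arr C" "Dom C (copair3 C f g h) = cop C (cop C X Y) Z"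
    "Cod C (copair3 C f g h) = T"
    "copair3 C f g h \<cdot> triple_in X Y Z 0 = f"
    "copair3 C f g h \<cdot> triple_in X Y Z 1 = g"
    "copair3 C f g h \<cdot> triple_in X Y Z 2 = h"
    by (rule copair3_props; use assms in simp)+
  let ?c = "copair3 C (q \<cdot> f) (q \<cdot> g) (q \<cdot> h)"
  have 2: "?c \<in> Arr C" "Dom C ?c = cop C (cop C X Y) Z"
    "Cod C ?c = T'"
    "?c \<cdot> triple_in X Y Z 0 = q \<cdot> f"
    "?c \<cdot> triple_in X Y Z 1 = q \<cdot> g"
    "?c \<cdot> triple_in X Y Z 2 = q \<cdot> h"
    by (rule copair3_props; use assms in simp)+
  show ?thesis
  proof (rule sum_unique[OF s, of _ T'])
    fix i assume "i \<in> {..<3::nat}"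
    then have "i = 0 \<or> i = 1 \<or> i = 2" using 3 by simp
    then show "(q \<cdot> copair3 C f g h) \<cdot> triple_in X Y Z i = ?c \<cdot> triple_in X Y Z i"
      by (elim disjE) (use 1 2 assms(4) u in simp_all)
  qed (use 1 2 assms(4) in simp_all)
qed

text \<open>This treats both folding operations at once: the middle component \<open>b\<close> will be either
  injection.\<close>

lemma fold_props:
  assumes XY: "X \<in> Obj C" "Y \<in> Obj C"
    and A: "A \<in> Obj C" "B \<in> Obj C" "D \<in> Obj C"
    and abc: "a \<in> hom C A (cop C X Y)" "b \<in> hom C B (cop C X Y)" "c \<in> hom C D (cop C X Y)"
    and f: "f = copair3 C a b c \<cdot> cosmash3_incl C A B D"
    and a: "a = in1 C X Y" "A = X" and c: "c = in2 C X Y" "D = Y"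
  shows "f \<in> hom C (cosmash3 C A B D) (cop C X Y)" "normal_image C f"
    "null C (copair C (Id C X) (zero_arr C Y X) \<cdot> f)" "null C (copair C (zero_arr C X Y) (Id C Y) \<cdot> f)"
    "\<exists>!s. s \<in> hom C (cosmash3 C A B D) (cosmash C X Y) \<and> cosmash_incl C X Y \<cdot> s = f"
    "\<And>q T. q \<in> hom C (cop C X Y) T \<Longrightarrow> null C (q \<cdot> f) \<Longrightarrow>
      cross_null C {..<3::nat} ((!) [A, B, D]) ((!) [q \<cdot> a, q \<cdot> b, q \<cdot> c]) T"
proof -
  note c3 = cosmash3_props[OF A] and s = triple_sum[OF A]
  note kD = kernelD[OF c3(1)]
  note u = sum_in[OF s, of 0, simplified] sum_in[OF s, of 1, simplified] sum_in[OF s, of 2, simplified]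
  let ?\<phi> = "copair3 C a b c"
  have \<phi>: "?\<phi> \<in> Arr C" "Dom C ?\<phi> = cop C (cop C A B) D" "Cod C ?\<phi> = cop C X Y"
    "?\<phi> \<cdot> triple_in A B D 0 = a" "?\<phi> \<cdot> triple_in A B D 1 = b" "?\<phi> \<cdot> triple_in A B D 2 = c"
    by (rule copair3_props; use abc in simp)+
  have ia: "cosmash3_incl C A B D \<in> Arr C" "Cod C (cosmash3_incl C A B D) = cop C (cop C A B) D"
    using kD c3 by simp_all
  show fh: "f \<in> hom C (cosmash3 C A B D) (cop C X Y)"
    unfolding f using \<phi> ia by (simp add: cosmash3_def)
  have kills: "null C (kill C {..<3} ((!) [A, B, D]) (triple_in A B D) (cop C (cop C A B) D) {i} \<cdot> cosmash3_incl C A B D)"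
    if "i < 3" for i using c3(3)[OF ia] sub_le_refl[OF ia(1)] that by simp
  \<comment> \<open>The outer components \<open>a\<close> and \<open>c\<close> are the two
    injections of X + Y, so the outer summands provide a section of the folding arrow.\<close>
  have "?\<phi> \<cdot> copair C (triple_in A B D 0) (triple_in A B D 2) = Id C (cop C X Y)"
    by (rule coproduct_unique[OF coproduct_in[OF XY], of _ "cop C X Y"])
      (use u \<phi> a c XY in simp_all)
  then have c\<phi>: "cover C ?\<phi>"
    using split_epi_cover[of ?\<phi> "copair C (triple_in A B D 0) (triple_in A B D 2)"] u \<phi> a c by simp
  show "normal_image C f"
    unfolding f by (rule normal_image_cover_kernel[OF c3(1) c\<phi>]) (use kD \<phi> c3 in simp)
  \<comment> \<open>After folding, the retraction onto X vanishes on the third summand. It therefore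
    absorbs \<open>kill {2}\<close>, which is zero on the ternary cosmash product. The retraction
    onto Y is treated in the same way with the first summand.\<close>
  show n1: "null C (copair C (Id C X) (zero_arr C Y X) \<cdot> f)"
  proof -
    have "null C ((copair C (Id C X) (zero_arr C Y X) \<cdot> ?\<phi>) \<cdot> cosmash3_incl C A B D)"
      by (rule null_kill_comp[OF s, where J = "{2}"]) (use \<phi> u a c XY ia kills[of 2] in simp_all)
    then show ?thesis using XY \<phi> ia by (simp add: f)
  qed
  show n2: "null C (copair C (zero_arr C X Y) (Id C Y) \<cdot> f)"
  proof -
    have "null C ((copair C (zero_arr C X Y) (Id C Y) \<cdot> ?\<phi>) \<cdot> cosmash3_incl C A B D)"
      by (rule null_kill_comp[OF s, where J = "{0}"]) (use \<phi> u a c XY ia kills[of 0] in simp_all)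
    then show ?thesis using XY \<phi> ia by (simp add: f)
  qed
  note cos = cosmash_props[OF XY]
  have "sub_le C f (cosmash_incl C X Y)" using cos(4)[of f] n1 n2 fh by simp
  then obtain t where t: "t \<in> Arr C" "Dom C t = Dom C f" "Cod C t = Dom C (cosmash_incl C X Y)"
    "cosmash_incl C X Y \<cdot> t = f" by (rule sub_leE)
  show "\<exists>!s. s \<in> hom C (cosmash3 C A B D) (cosmash C X Y) \<and> cosmash_incl C X Y \<cdot> s = f"
  proof (rule ex1I[of _ t])
    show "t \<in> hom C (cosmash3 C A B D) (cosmash C X Y) \<and> cosmash_incl C X Y \<cdot> t = f"
      using t fh cos by simp
    fix r assume "r \<in> hom C (cosmash3 C A B D) (cosmash C X Y) \<and> cosmash_incl C X Y \<cdot> r = f"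
    then show "r = t" using monicD[OF cos(1), of r t] t fh cos by simp
  qed
  fix q T assume q: "q \<in> hom C (cop C X Y) T" "null C (q \<cdot> f)"
  have "null C ((q \<cdot> ?\<phi>) \<cdot> cosmash3_incl C A B D)" using q \<phi> ia by (simp add: f)
  then have "null C (copair3 C (q \<cdot> a) (q \<cdot> b) (q \<cdot> c) \<cdot> cosmash3_incl C A B D)"
    using copair3_post[OF abc q(1)] by simp
  then show "cross_null C {..<3::nat} ((!) [A, B, D]) ((!) [q \<cdot> a, q \<cdot> b, q \<cdot> c]) T"
    using cosmash3_cross_null[of "q \<cdot> a" A T "q \<cdot> b" B "q \<cdot> c" D] abc q by simp
qed

lemma fold21_props:
  assumes XY: "X \<in> Obj C" "Y \<in> Obj C"
  shows "fold21 C X Y \<in> hom C (cosmash3 C X X Y) (cosmash C X Y)"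
    "cosmash_incl C X Y \<cdot> fold21 C X Y =
      copair3 C (in1 C X Y) (in1 C X Y) (in2 C X Y) \<cdot> cosmash3_incl C X X Y"
  using theI'[OF fold_props(5)[OF XY XY(1) XY(1) XY(2) _ _ _ refl refl refl refl refl, of "in1 C X Y"]] XY
  unfolding fold21_def by simp_all

lemma fold12_props:
  assumes XY: "X \<in> Obj C" "Y \<in> Obj C"
  shows "fold12 C X Y \<in> hom C (cosmash3 C X Y Y) (cosmash C X Y)"
    "cosmash_incl C X Y \<cdot> fold12 C X Y =
      copair3 C (in1 C X Y) (in2 C X Y) (in2 C X Y) \<cdot> cosmash3_incl C X Y Y"
  using theI'[OF fold_props(5)[OF XY XY(1) XY(2) XY(2) _ _ _ refl refl refl refl refl, of "in2 C X Y"]] XY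
  unfolding fold12_def by simp_all

text \<open>The chosen \<open>coker\<close> is known only by its universal property. Here
  \<open>k\<close> is the kernel of a cover \<open>c\<close>, so \<open>c\<close> and
  \<open>q\<close> factor through each other, and \<open>q\<close> inherits from \<open>c\<close>
  that it is a cover with kernel \<open>k\<close>.\<close>

lemma cokernel_kernel:
  assumes c: "cover C c" "is_kernel C c k" and q: "is_cokernel C k q"
  shows "cover C q" "is_kernel C q k"
proof -
  note kD = kernelD[OF c(2)]
  have ca: "c \<in> Arr C" using c by simp
  have qt: "q \<in> Arr C" "Dom C q = Cod C k" "q \<cdot> k = zero_arr C (Dom C k) (Cod C q)"
    using q unfolding is_cokernel_def by auto
  have nqk: "null C (q \<cdot> k)" using qt kD by simp
  obtain h where h: "h \<in> Arr C" "Dom C h = Cod C c" "Cod C h = Cod C q" "h \<cdot> c = q"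
  proof (rule cover_factor[OF c(1), of q])
    fix w assume w: "w \<in> Arr C" "Cod C w = Dom C c" "null C (c \<cdot> w)"
    then have "sub_le C w k" using kernel_sub_le[OF c(2), of w] by simp
    then show "null C (q \<cdot> w)" by (rule null_of_sub_le) (use qt kD nqk in simp_all)
  qed (use qt kD in simp_all)
  have "c \<cdot> k = zero_arr C (Dom C k) (Cod C c)" using null_eq[OF kD(5)] kD by simp
  moreover have "c \<in> hom C (Cod C k) (Cod C c)" using ca kD by simp
  ultimately obtain h' where h': "h' \<in> Arr C" "Dom C h' = Cod C q" "Cod C h' = Cod C c" "h' \<cdot> q = c"
    using q unfolding is_cokernel_def by (metis in_hom)
  have "q \<in> hom C (Cod C k) (Cod C q)" using qt by simp
  then have "\<exists>!t. t \<in> hom C (Cod C q) (Cod C q) \<and> t \<cdot> q = q"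
    using q qt(3) unfolding is_cokernel_def by blast
  moreover have "(h \<cdot> h') \<cdot> q = q" using h h' qt by simp
  ultimately have hh: "h \<cdot> h' = Id C (Cod C q)" using h h' qt by (metis (no_types, lifting) Id_simps(1-3) comp_simps(1-3) id_comp in_hom obj_simps(2))
  have "cover C h" by (rule split_epi_cover[of h h']) (use h h' hh in simp_all)
  then have "cover C (h \<cdot> c)" using c(1) h(2) by (rule cover_comp)
  then show "cover C q" using h by simp
  show "is_kernel C q k"
  proof (rule kernelI)
    fix w assume w: "w \<in> Arr C" "Cod C w = Dom C q"
    show "sub_le C w k \<longleftrightarrow> null C (q \<cdot> w)"
    proof
      assume "sub_le C w k"
      then show "null C (q \<cdot> w)" by (rule null_of_sub_le) (use qt kD nqk in simp_all)
    next
      assume "null C (q \<cdot> w)"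
      then have "null C (h' \<cdot> (q \<cdot> w))" by (rule null_comp) (use h' qt w in simp_all)
      then have "null C (c \<cdot> w)" using h'(1-3) qt w by (simp add: comp_eq[OF h'(4)])
      then show "sub_le C w k" using kernel_sub_le[OF c(2), of w] w qt kD by simp
    qed
  qed (use qt kD in simp_all)
qed

lemma coker_cokernel:
  assumes "cover C c" "is_kernel C c k"
  shows "cover C (coker C k)" "is_kernel C (coker C k) k" "is_cokernel C k (coker C k)"
proof -
  show "is_cokernel C k (coker C k)"
    unfolding coker_def by (rule someI_ex) (use cover_cokernel[OF assms] in blast)
  then show "cover C (coker C k)" "is_kernel C (coker C k) k" using cokernel_kernel[OF assms] by blast+
qed

text \<open>The codiagonal is split by an injection, so \<open>normal_image_cover_kernel\<close>
  makes the ternary commutator the kernel of a cover. The last clause converts factoring through the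
  reflection into a condition on cross-effects.\<close>

lemma commutator_props:
  assumes A: "A \<in> Obj C"
  shows "\<exists>c. cover C c \<and> is_kernel C c (commutator3_incl C A)"
    "monic C (commutator3_incl C A)" "Cod C (commutator3_incl C A) = A"
    "q \<in> hom C A B \<Longrightarrow> null C (q \<cdot> commutator3_incl C A) \<longleftrightarrow>
      cross_null C {..<3::nat} ((!) [A, A, A]) ((!) [q, q, q]) B"
proof -
  let ?d = "copair3 C (Id C A) (Id C A) (Id C A)" and ?k = "cosmash3_incl C A A A"
  note c3 = cosmash3_props[OF A A A] and s = triple_sum[OF A A A]
  note kD = kernelD[OF c3(1)]
  have d: "?d \<in> Arr C" "Dom C ?d = cop C (cop C A A) A" "Cod C ?d = A" "?d \<cdot> triple_in A A A 0 = Id C A"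
    by (rule copair3_props; use A in simp)+
  have cd: "cover C ?d"
    by (rule split_epi_cover[of _ "triple_in A A A 0"]) (use d sum_in[OF s, of 0] in simp_all)
  have dk: "?d \<cdot> ?k \<in> Arr C" "Cod C (?d \<cdot> ?k) = A" using d kD c3 by simp_all
  note i = img_props[OF dk(1)]
  have cm: "commutator3_incl C A = img C (?d \<cdot> ?k)" by (simp add: commutator3_incl_def)
  show mono: "monic C (commutator3_incl C A)" and cod: "Cod C (commutator3_incl C A) = A"
    using i dk by (simp_all add: cm)
  obtain c m e where c: "cover C c" "is_kernel C c m" "cover C e" "Cod C e = Dom C m" "m \<cdot> e = ?d \<cdot> ?k"
    using normal_image_cover_kernel[OF c3(1) cd] d kD c3 unfolding normal_image_def by auto
  note mD = kernelD[OF c(2)]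
  have ea: "e \<in> Arr C" using c by simp
  have "Cod C (m \<cdot> e) = A" using c(5) dk by simp
  then have mA: "Cod C m = A" using mD(3) ea c(4) by simp
  have "is_kernel C c (commutator3_incl C A)"
  proof (rule kernelI)
    fix w assume w: "w \<in> Arr C" "Cod C w = Dom C c"
    have "sub_le C (?d \<cdot> ?k) m" by (rule sub_leI[of _ e]) (use mD ea c in simp_all)
    then have 1: "sub_le C (commutator3_incl C A) m"
      using sub_le_img[OF dk(1) mD(2)] mA dk cm by simp
    have "sub_le C (m \<cdot> e) (commutator3_incl C A)"
      using sub_le_img[OF dk(1) i(1)] i dk sub_le_refl cm c(5) by simp
    then have 2: "sub_le C m (commutator3_incl C A)"
      by (rule cover_orth[OF c(3) mono, rotated 3]) (use mD mA c cod in simp_all)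
    show "sub_le C w (commutator3_incl C A) \<longleftrightarrow> null C (c \<cdot> w)"
      using kernel_sub_le[OF c(2) w] sub_le_trans[OF _ 1] sub_le_trans[OF _ 2] mono mD by auto
  qed (use c mono cod mD mA in simp_all)
  then show "\<exists>c. cover C c \<and> is_kernel C c (commutator3_incl C A)" using c(1) by blast
  assume q: "q \<in> hom C A B"
  have "null C (q \<cdot> commutator3_incl C A) \<longleftrightarrow> null C ((q \<cdot> ?d) \<cdot> ?k)"
    unfolding cm using null_img[OF dk(1), of q] q dk d kD c3 by simp
  also have "q \<cdot> ?d = copair3 C q q q" using copair3_post[of "Id C A" A A "Id C A" A "Id C A" A q B] A q by simp
  finally show "null C (q \<cdot> commutator3_incl C A) \<longleftrightarrow>
      cross_null C {..<3::nat} ((!) [A, A, A]) ((!) [q, q, q]) B"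
    using cosmash3_cross_null[OF q q q] by simp
qed

lemma two_nilpotent_iff:
  assumes A: "A \<in> Obj C"
  shows "two_nilpotent C A \<longleftrightarrow> cross_null C {..<3::nat} ((!) [A, A, A]) ((!) [Id C A, Id C A, Id C A]) A"
proof -
  note cp = commutator_props[OF A]
  let ?c = "commutator3_incl C A"
  have ca: "?c \<in> Arr C" using cp by simp
  have "is_zero C (Dom C ?c) \<longleftrightarrow> null C (Id C A \<cdot> ?c)"
  proof
    assume "is_zero C (Dom C ?c)"
    then have "null C (?c \<cdot> Id C (Dom C ?c))" by (intro null_comp zero_null_Id) (use ca in simp_all)
    then show "null C (Id C A \<cdot> ?c)" using ca cp by simp
  next
    assume "null C (Id C A \<cdot> ?c)"
    then have "null C (?c \<cdot> Id C (Dom C ?c))" using ca cp by simp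
    then have "null C (Id C (Dom C ?c))" by (rule null_monic[OF cp(2)]) (use ca in simp_all)
    then show "is_zero C (Dom C ?c)" using null_Id_zero[of "Dom C ?c"] ca by simp
  qed
  then show ?thesis unfolding two_nilpotent_def using cp(4)[of "Id C A" A] A by simp
qed

section \<open>The reflection onto two-nilpotent objects\<close>

lemma nil2_unit_props:
  assumes A: "A \<in> Obj C"
  shows "cover C (nil2_unit C A)" "Dom C (nil2_unit C A) = A" "Cod C (nil2_unit C A) = nil2 C A"
    "is_kernel C (nil2_unit C A) (commutator3_incl C A)"
  using commutator_props[OF A] coker_cokernel kernelD(4)
  unfolding nil2_unit_def nil2_def by metis+

lemma cross_null_precomp:
  assumes cn: "cross_null C I Ob' f' T" and fin: "finite I" and g: "\<And>i. i \<in> I \<Longrightarrow> g i \<in> hom C (Ob i) (Ob' i)"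
  shows "cross_null C I Ob (\<lambda>i. f' i \<cdot> g i) T"
proof -
  have T: "T \<in> Obj C" and f: "\<forall>i \<in> I. f' i \<in> hom C (Ob' i) T"
    using cn unfolding cross_null_def by blast+
  have o: "Ob i \<in> Obj C" if "i \<in> I" for i
    using g[OF that] obj_simps(1)[of "g i"] by simp
  obtain u P where s: "is_sum C I Ob u P" using sum_exists[OF fin, of Ob] o by blast
  have fg: "\<forall>i \<in> I. f' i \<cdot> g i \<in> hom C (Ob i) T" using f g by simp
  note c = cotuple_props[OF s T fg]
  show ?thesis
  proof (rule cross_nullI[OF s c])
    fix w assume w: "w \<in> Arr C" "Cod C w = P" "\<And>i. i \<in> I \<Longrightarrow> null C (kill C I Ob u P {i} \<cdot> w)"
    show "null C (cotuple C I u P T (\<lambda>i. f' i \<cdot> g i) \<cdot> w)"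
    proof (rule cross_null_grouping[OF s cn c(1), where \<gamma> = "\<lambda>i. i" and g = g])
      fix j assume j: "j \<in> I"
      then have "{i \<in> I. i = j} = {j}" by auto
      then show "null C (kill C I Ob u P {i \<in> I. i = j} \<cdot> w)" using w(3)[OF j] by simp
    qed (use c(2) g w in auto)
  qed
qed

text \<open>Precomposing the three identities of \<open>B\<close> with \<open>g\<close> preserves
  the vanishing of the cross-effect. This is the functoriality of ternary commutators that the
  universal property of \<open>nil2\<close> rests on.\<close>

lemma two_nilpotent_null:
  assumes "B \<in> Obj C" "two_nilpotent C B" "g \<in> hom C A B"
  shows "null C (g \<cdot> commutator3_incl C A)"
proof -
  have A: "A \<in> Obj C" using assms by auto
  have 3: "i = 0 \<or> i = 1 \<or> i = 2" if "i < 3" for i :: nat using that by auto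
  have cn: "cross_null C {..<3::nat} ((!) [B, B, B]) ((!) [Id C B, Id C B, Id C B]) B"
    using two_nilpotent_iff assms by blast
  have "cross_null C {..<3::nat} ((!) [A, A, A]) (\<lambda>i. [Id C B, Id C B, Id C B] ! i \<cdot> g) B"
    by (rule cross_null_precomp[OF cn]) (use assms in \<open>auto dest!: 3\<close>)
  then have "cross_null C {..<3::nat} ((!) [A, A, A]) ((!) [g, g, g]) B"
    by (rule cross_null_cong) (use assms in \<open>auto dest!: 3\<close>)
  then show ?thesis using commutator_props(4)[OF A assms(3)] by simp
qed

lemma nil2_factor:
  assumes g: "g \<in> hom C A B" and n: "null C (g \<cdot> commutator3_incl C A)"
  obtains h where "h \<in> hom C (nil2 C A) B" "h \<cdot> nil2_unit C A = g"
proof -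
  have A: "A \<in> Obj C" using assms by auto
  note u = nil2_unit_props[OF A] and cp = commutator_props[OF A]
  obtain h where h: "h \<in> Arr C" "Dom C h = Cod C (nil2_unit C A)" "Cod C h = Cod C g" "h \<cdot> nil2_unit C A = g"
  proof (rule cover_factor[OF u(1), of g])
    fix w assume w: "w \<in> Arr C" "Cod C w = Dom C (nil2_unit C A)" "null C (nil2_unit C A \<cdot> w)"
    then have "sub_le C w (commutator3_incl C A)" using kernel_sub_le[OF u(4), of w] by simp
    then show "null C (g \<cdot> w)" by (rule null_of_sub_le) (use g n cp in simp_all)
  qed (use g u in simp_all)
  then show ?thesis using that[of h] u g by simp
qed

text \<open>Dividing by the commutator of \<open>A\<close> must not leave a new commutator in the
  quotient \<open>N\<close>. Elements of the cross-effect of N, N, N lift, after a cover, along the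
  sum \<open>f\<close> of three copies of \<open>\<eta>\<close> to the cross-effect of A, A, A; this
  is \<open>lift_through_kernels\<close> for the three idempotents that kill one summand. On the
  lifts the fold with components \<open>\<eta>\<close> vanishes.\<close>

lemma nil2_two_nilpotent:
  assumes A: "A \<in> Obj C"
  shows "nil2 C A \<in> Obj C" "two_nilpotent C (nil2 C A)"
proof -
  define N where "N = nil2 C A"
  define \<eta> where "\<eta> = nil2_unit C A"
  have \<eta>: "cover C \<eta>" "\<eta> \<in> Arr C" "Dom C \<eta> = A" "Cod C \<eta> = N"
    using nil2_unit_props[OF A] by (simp_all add: N_def \<eta>_def)
  have N: "N \<in> Obj C" using \<eta> by auto
  then show "nil2 C A \<in> Obj C" by (simp add: N_def)
  have 3: "i = 0 \<or> i = 1 \<or> i = 2" if "i < 3" for i :: nat using that by auto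
  let ?I = "{..<3::nat}"
  have "null C (\<eta> \<cdot> commutator3_incl C A)" using kernelD(5)[OF nil2_unit_props(4)[OF A]] by (simp add: \<eta>_def)
  then have "cross_null C ?I ((!) [A, A, A]) ((!) [\<eta>, \<eta>, \<eta>]) N"
    using commutator_props(4)[OF A, of \<eta> N] \<eta> by simp
  then have cn: "cross_null C ?I (\<lambda>_. A) (\<lambda>_. \<eta>) N"
    by (rule cross_null_cong) (auto dest!: 3)
  obtain v P where s: "is_sum C ?I (\<lambda>_. A) v P" using sum_exists[of ?I "\<lambda>_. A"] A by blast
  obtain v' P' where s': "is_sum C ?I (\<lambda>_. N) v' P'" using sum_exists[of ?I "\<lambda>_. N"] N by blast
  note k = kill_props[OF s] and k' = kill_props[OF s'] and P = sum_obj[OF s] and P' = sum_obj[OF s']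
  have fin: "\<forall>i \<in> ?I. v' i \<cdot> \<eta> \<in> hom C A P'" using sum_in[OF s'] \<eta> by simp
  define f where "f = cotuple C ?I v P P' (\<lambda>i. v' i \<cdot> \<eta>)"
  have f: "f \<in> Arr C" "Dom C f = P" "Cod C f = P'" "\<And>i. i \<in> ?I \<Longrightarrow> f \<cdot> v i = v' i \<cdot> \<eta>"
    using cotuple_props[OF s P' fin] by (simp_all add: f_def)
  \<comment> \<open>A subobject that contains the image of \<open>f\<close> contains
    \<open>v' i \<cdot> \<eta>\<close> for every \<open>i\<close>, hence each injection
    \<open>v' i\<close>, since \<open>\<eta>\<close> is a cover.\<close>
  have cf: "cover C f"
  proof (rule coverI)
    fix m assume m: "monic C m" "Cod C m = Cod C f" "sub_le C f m"
    have "\<exists>h. h \<in> hom C N (Dom C m) \<and> m \<cdot> h = v' i" if i: "i \<in> ?I" for i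
    proof -
      have "sub_le C (f \<cdot> v i) m" by (rule sub_le_comp[OF m(3)]) (use m f sum_in[OF s i] in simp_all)
      then have "sub_le C (v' i \<cdot> \<eta>) m" using f(4)[OF i] by simp
      then have "sub_le C (v' i) m"
        by (rule cover_orth[OF \<eta>(1) m(1), rotated 3]) (use m f \<eta> sum_in[OF s' i] in simp_all)
      then show ?thesis using sum_in[OF s' i] by (auto elim: sub_leE)
    qed
    then obtain h where h: "\<And>i. i \<in> ?I \<Longrightarrow> h i \<in> hom C N (Dom C m) \<and> m \<cdot> h i = v' i" by metis
    then have hI: "\<forall>i \<in> ?I. h i \<in> hom C N (Dom C m)" by blast
    have "Dom C m \<in> Obj C" using m by simp
    note H = cotuple_props[OF s' this hI]
    define H' where "H' = cotuple C ?I v' P' (Dom C m) h"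
    have H': "H' \<in> Arr C" "Dom C H' = P'" "Cod C H' = Dom C m" "\<And>i. i \<in> ?I \<Longrightarrow> H' \<cdot> v' i = h i"
      using H by (simp_all add: H'_def)
    have "m \<cdot> H' = Id C P'"
      by (rule sum_unique[OF s', of _ P']) (use m f H' h P' sum_in[OF s'] in simp_all)
    then show "sub_le C (Id C (Cod C f)) m" using sub_leI[of m H' "Id C P'"] m f H' by simp
  qed (rule f)
  have kf: "f \<cdot> kill C ?I (\<lambda>_. A) v P {i} = kill C ?I (\<lambda>_. N) v' P' {i} \<cdot> f" for i
  proof (rule sum_unique[OF s, of _ P'])
    fix r assume r: "r \<in> ?I"
    have "f \<cdot> (kill C ?I (\<lambda>_. A) v P {i} \<cdot> v r) = (kill C ?I (\<lambda>_. N) v' P' {i} \<cdot> v' r) \<cdot> \<eta>"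
      unfolding k(4)[OF r] k'(4)[OF r] using f r sum_in[OF s r] sum_in[OF s' r] A N P P' \<eta> by (cases "r = i") simp_all
    then show "(f \<cdot> kill C ?I (\<lambda>_. A) v P {i}) \<cdot> v r = (kill C ?I (\<lambda>_. N) v' P' {i} \<cdot> f) \<cdot> v r"
      using f r k(1-3) k'(1-3) sum_in[OF s r] sum_in[OF s' r] \<eta> by simp
  qed (use f k k' in simp_all)
  have idI: "\<forall>i \<in> ?I. (\<lambda>_. Id C N) i \<in> hom C N N" using N by simp
  define \<delta> where "\<delta> = cotuple C ?I v' P' N (\<lambda>_. Id C N)"
  have \<delta>: "\<delta> \<in> Arr C" "Dom C \<delta> = P'" "Cod C \<delta> = N" "\<And>i. i \<in> ?I \<Longrightarrow> \<delta> \<cdot> v' i = Id C N"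
    using cotuple_props[OF s' N idI] by (simp_all add: \<delta>_def)
  have "cross_null C ?I (\<lambda>_. N) (\<lambda>_. Id C N) N"
  proof (rule cross_nullI[OF s'])
    show "\<delta> \<in> hom C P' N" "\<And>i. i \<in> ?I \<Longrightarrow> \<delta> \<cdot> v' i = Id C N" using \<delta> by simp_all
    fix w assume w: "w \<in> Arr C" "Cod C w = P'" "\<And>i. i \<in> ?I \<Longrightarrow> null C (kill C ?I (\<lambda>_. N) v' P' {i} \<cdot> w)"
    define es where "es = map (\<lambda>i. (kill C ?I (\<lambda>_. A) v P {i}, kill C ?I (\<lambda>_. N) v' P' {i})) [0, 1, 2]"
    have "\<exists>c a. cover C c \<and> Cod C c = Dom C w \<and> a \<in> Arr C \<and> Dom C a = Dom C c \<and> Cod C a = Dom C f \<and>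
      f \<cdot> a = w \<cdot> c \<and> (\<forall>(e, e') \<in> set es. null C (e \<cdot> a))"
    proof (rule lift_through_kernels[OF cf])
      fix e e' assume "(e, e') \<in> set es"
      then obtain i where e: "e = kill C ?I (\<lambda>_. A) v P {i}" "e' = kill C ?I (\<lambda>_. N) v' P' {i}" "i \<in> ?I"
        by (auto simp: es_def)
      show "idempotent_on C (Dom C f) e \<and> idempotent_on C (Cod C f) e' \<and> f \<cdot> e = e' \<cdot> f"
        using e kf kill_idempotent[OF s] kill_idempotent[OF s'] f by simp
      show "null C (e' \<cdot> w)" using e w by simp
    next
      fix e e' d d' assume "(e, e') \<in> set es" "(d, d') \<in> set es"
      then show "e \<cdot> d = d \<cdot> e \<and> e' \<cdot> d' = d' \<cdot> e'"
        using kill_commute[OF s] kill_commute[OF s'] by (auto simp: es_def)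
    qed (use w f in simp_all)
    then obtain c a where ca: "cover C c" "Cod C c = Dom C w" "a \<in> Arr C" "Dom C a = Dom C c" "Cod C a = P"
      "f \<cdot> a = w \<cdot> c" and es: "\<forall>(e, e') \<in> set es. null C (e \<cdot> a)"
      using f(2) by metis
    have ka: "null C (kill C ?I (\<lambda>_. A) v P {i} \<cdot> a)" if "i \<in> ?I" for i
    proof -
      have "i \<in> set [0, 1, 2]" using 3[of i] that by auto
      then have "(kill C ?I (\<lambda>_. A) v P {i}, kill C ?I (\<lambda>_. N) v' P' {i}) \<in> set es"
        unfolding es_def by (auto simp del: insert_iff simp: image_iff)
      then show ?thesis using es by auto
    qed
    have "null C ((\<delta> \<cdot> f) \<cdot> a)"
    proof (rule cross_null_grouping[OF s cn, where \<gamma> = "\<lambda>i. i" and g = "\<lambda>_. Id C A"])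
      show "\<delta> \<cdot> f \<in> hom C P N" using f \<delta> by simp
      show "(\<delta> \<cdot> f) \<cdot> v i = \<eta> \<cdot> Id C A" if "i \<in> ?I" for i
        using f \<delta>(1-3) sum_in[OF s that] sum_in[OF s' that] \<eta> that by (simp add: comp_eq[OF \<delta>(4)])
      show "null C (kill C ?I (\<lambda>_. A) v P {i \<in> ?I. i = j} \<cdot> a)" if "j \<in> ?I" for j
      proof -
        have "{i \<in> ?I. i = j} = {j}" using that by auto
        then show ?thesis using ka[OF that] by simp
      qed
    qed (use ca A in simp_all)
    then have "null C (\<delta> \<cdot> (f \<cdot> a))" using f \<delta>(1-3) ca by simp
    then have "null C ((\<delta> \<cdot> w) \<cdot> c)" using ca \<delta>(1-3) w by simp
    then show "null C (\<delta> \<cdot> w)" by (rule null_cover[OF ca(1)]) (use ca \<delta>(1-3) w in simp_all)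
  qed
  then have "cross_null C ?I ((!) [N, N, N]) ((!) [Id C N, Id C N, Id C N]) N"
    by (rule cross_null_cong) (auto dest!: 3)
  then show "two_nilpotent C (nil2 C A)" using two_nilpotent_iff[OF N] by (simp add: N_def)
qed

lemma commutator_null_of_types:
  assumes co: "is_coproduct C X Y i j" and S: "Cod C i = S" and p: "p \<in> hom C S T"
    and cn: "\<And>\<beta>. (\<And>t. t < 3 \<Longrightarrow> \<beta> t < 2) \<Longrightarrow>
      cross_null C {..<3::nat} (\<lambda>t. [X, Y] ! \<beta> t) (\<lambda>t. [p \<cdot> i, p \<cdot> j] ! \<beta> t) T"
  shows "null C (p \<cdot> commutator3_incl C S)"
proof -
  have So: "S \<in> Obj C" and T: "T \<in> Obj C" using p by auto
  have 3: "i = 0 \<or> i = 1 \<or> i = 2" if "i < 3" for i :: nat using that by auto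
  have 2: "i = 0 \<or> i = 1" if "i < 2" for i :: nat using that by auto
  note coD = coproductD[OF co]
  let ?I = "{..<3::nat}"
  obtain v P where s: "is_sum C ?I (\<lambda>_. S) v P" using sum_exists[of ?I "\<lambda>_. S"] So by blast
  have s': "is_sum C {..<2} ((!) [X, Y]) ((!) [i, j]) S" using coproduct_sum[OF co] S by simp
  have pI: "\<forall>i \<in> ?I. (\<lambda>_. p) i \<in> hom C S T" using p by simp
  define \<phi> where "\<phi> = cotuple C ?I v P T (\<lambda>_. p)"
  have \<phi>: "\<phi> \<in> Arr C" "Dom C \<phi> = P" "Cod C \<phi> = T" "\<And>i. i \<in> ?I \<Longrightarrow> \<phi> \<cdot> v i = p"
    using cotuple_props[OF s T pI] by (simp_all add: \<phi>_def)
  have "cross_null C ?I (\<lambda>_. S) (\<lambda>_. p) T"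
  proof (rule cross_nullI[OF s])
    show "\<phi> \<in> hom C P T" "\<And>i. i \<in> ?I \<Longrightarrow> \<phi> \<cdot> v i = p" using \<phi> by simp_all
    fix w assume w: "w \<in> Arr C" "Cod C w = P" "\<And>i. i \<in> ?I \<Longrightarrow> null C (kill C ?I (\<lambda>_. S) v P {i} \<cdot> w)"
    show "null C (\<phi> \<cdot> w)"
    proof (rule cross_null_of_sum[OF s s', where z = "(!) [p \<cdot> i, p \<cdot> j]"])
      show "\<phi> \<in> hom C P T" using \<phi> by simp
      show "\<phi> \<cdot> (v t \<cdot> [i, j] ! b) = [p \<cdot> i, p \<cdot> j] ! b" if "t < 3" "b < 2" for t b
      proof -
        have t: "t \<in> ?I" using that by simp
        have "[i, j] ! b \<in> Arr C" "Cod C ([i, j] ! b) = S" using 2[OF that(2)] coD S by auto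
        then have "\<phi> \<cdot> (v t \<cdot> [i, j] ! b) = p \<cdot> [i, j] ! b"
          using \<phi>(1-3) sum_in[OF s t] by (simp add: comp_eq[OF \<phi>(4)[OF t]])
        then show ?thesis using 2[OF that(2)] by auto
      qed
    qed (use cn w in simp_all)
  qed
  then have "cross_null C ?I ((!) [S, S, S]) ((!) [p, p, p]) T"
    by (rule cross_null_cong) (auto dest!: 3)
  then show ?thesis using commutator_props(4)[OF So p] by simp
qed

end

section \<open>The subcategory of two-nilpotent objects\<close>

lemma Nil2_simps [simp]:
  "X \<in> Obj (Nil2 C) \<longleftrightarrow> X \<in> Obj C \<and> two_nilpotent C X"
  "f \<in> Arr (Nil2 C) \<longleftrightarrow> f \<in> Arr C \<and> two_nilpotent C (Dom C f) \<and> two_nilpotent C (Cod C f)"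
  "Dom (Nil2 C) = Dom C" "Cod (Nil2 C) = Cod C" "Id (Nil2 C) = Id C" "Comp (Nil2 C) = Comp C"
  by (simp_all add: Nil2_def)

lemma Nil2_hom: "f \<in> hom (Nil2 C) A B \<longleftrightarrow> f \<in> hom C A B \<and> two_nilpotent C A \<and> two_nilpotent C B"
  by (auto simp: hom_def)

context semi_abelian_category begin

section \<open>Closure properties of two-nilpotent objects\<close>

lemma two_nilpotent_null_iff:
  "A \<in> Obj C \<Longrightarrow> two_nilpotent C A \<longleftrightarrow> null C (commutator3_incl C A)"
  using commutator_props(4)[of A "Id C A" A] commutator_props(2,3)[of A] two_nilpotent_iff[of A] by simp

lemma zero_two_nilpotent:
  assumes "is_zero C Z"
  shows "two_nilpotent C Z"
proof -
  have Z: "Z \<in> Obj C" using assms by (simp add: is_zero_def is_initial_def)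
  note cp = commutator_props(2,3)[OF Z]
  have "null C (Id C Z \<cdot> commutator3_incl C Z)"
    by (rule null_precomp[OF zero_null_Id[OF assms]]) (use cp Z in simp_all)
  then show ?thesis using two_nilpotent_null_iff[OF Z] cp by simp
qed

lemma sub_two_nilpotent:
  assumes "monic C m" "two_nilpotent C (Cod C m)"
  shows "two_nilpotent C (Dom C m)"
proof -
  have m: "m \<in> Arr C" using assms by simp
  have "null C (m \<cdot> commutator3_incl C (Dom C m))"
    by (rule two_nilpotent_null[OF _ assms(2)]) (use m in simp_all)
  then have "null C (commutator3_incl C (Dom C m))"
    by (rule null_monic[OF assms(1)]) (use m commutator_props(2,3)[of "Dom C m"] in simp_all)
  then show ?thesis using two_nilpotent_null_iff[of "Dom C m"] m by simp
qed

lemma product_two_nilpotent: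
  assumes "is_product C A B p q" "two_nilpotent C A" "two_nilpotent C B"
  shows "two_nilpotent C (Dom C p)"
proof -
  note pD = productD[OF assms(1)]
  have D: "Dom C p \<in> Obj C" using pD by simp
  have "null C (p \<cdot> commutator3_incl C (Dom C p))"
    by (rule two_nilpotent_null[OF _ assms(2)]) (use pD in simp_all)
  moreover have "null C (q \<cdot> commutator3_incl C (Dom C p))"
    by (rule two_nilpotent_null[OF _ assms(3)]) (use pD in simp_all)
  ultimately have "null C (commutator3_incl C (Dom C p))"
    using null_into_product[OF assms(1), of "commutator3_incl C (Dom C p)"] commutator_props(2,3)[OF D] by simp
  then show ?thesis using two_nilpotent_null_iff[OF D] by simp
qed

lemma Nil2_zero:
  assumes "is_zero C Z"
  shows "is_zero (Nil2 C) Z"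
  using assms zero_two_nilpotent[OF assms]
  unfolding is_zero_def is_initial_def is_terminal_def by (auto simp: Nil2_hom simp del: in_hom)

lemma Nil2_pointed: "pointed_category (Nil2 C)"
proof unfold_locales
  show "pointed (Nil2 C)" using Nil2_zero zero_exists unfolding pointed_def by metis
qed (auto simp: Nil2_hom)

text \<open>Zero objects of \<open>C\<close> are two-nilpotent, so one and the same factorization
  serves both categories.\<close>

lemma Nil2_zero_arr:
  assumes "A \<in> Obj C" "B \<in> Obj C" "two_nilpotent C A" "two_nilpotent C B"
  shows "zero_arr (Nil2 C) A B = zero_arr C A B"
proof -
  obtain Z g h where z: "is_zero C Z" "g \<in> hom C A Z" "h \<in> hom C Z B" "zero_arr C A B = h \<cdot> g"
    using zero_factor[OF assms(1,2)] .
  have "zero_arr (Nil2 C) A B = Comp (Nil2 C) h g"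
    by (rule pointed_category.zero_arr_eq[OF Nil2_pointed Nil2_zero[OF z(1)]])
      (use z assms zero_two_nilpotent[OF z(1)] in \<open>simp_all add: Nil2_hom\<close>)
  then show ?thesis using z(4) by simp
qed

lemma Nil2_product_exists:
  assumes "A \<in> Obj (Nil2 C)" "B \<in> Obj (Nil2 C)"
  shows "\<exists>p q. is_product (Nil2 C) A B p q"
proof -
  obtain p q where pr: "is_product C A B p q" using product_exists assms by (metis Nil2_simps(1))
  have "two_nilpotent C (Dom C p)" using product_two_nilpotent[OF pr] assms by simp
  then have "is_product (Nil2 C) A B p q"
    using pr assms unfolding is_product_def by (auto simp: Nil2_hom simp del: in_hom)
  then show ?thesis by blast
qed

text \<open>The kernel \<open>k0\<close> taken in \<open>C\<close> is a subobject of a two-nilpotent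
  object and so lies in the subcategory; the kernel chosen there is isomorphic to it. This extends
  the universal property of the chosen kernel to test objects that need not be
  two-nilpotent.\<close>

lemma Nil2_kernel:
  assumes f: "f \<in> Arr (Nil2 C)"
  shows "is_kernel C f (ker (Nil2 C) f)"
proof -
  interpret N: pointed_category "Nil2 C" by (rule Nil2_pointed)
  have ft: "f \<in> Arr C" "two_nilpotent C (Dom C f)" "two_nilpotent C (Cod C f)" using f by simp_all
  obtain k0 where k0: "is_kernel C f k0" using kernel_exists ft by blast
  note k0D = kernelD[OF k0]
  have n0: "two_nilpotent C (Dom C k0)" using sub_two_nilpotent[OF k0D(2)] k0D ft by simp
  have "is_kernel (Nil2 C) f k0"
    unfolding is_kernel_def
  proof (intro conjI allI ballI impI)
    fix T g assume g: "g \<in> hom (Nil2 C) T (Dom (Nil2 C) f)"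
      "Comp (Nil2 C) f g = zero_arr (Nil2 C) T (Cod (Nil2 C) f)"
    have gt: "g \<in> Arr C" "Dom C g = T" "Cod C g = Dom C f" "two_nilpotent C T" using g(1) by (auto simp: Nil2_hom)
    have T: "T \<in> Obj C" using gt by auto
    have "f \<cdot> g = zero_arr C T (Cod C f)" using g(2) Nil2_zero_arr[OF T _ gt(4) ft(3)] ft by simp
    then have "\<exists>!h. h \<in> hom C T (Dom C k0) \<and> k0 \<cdot> h = g"
      using k0 gt unfolding is_kernel_def by (metis in_hom)
    then show "\<exists>!h. h \<in> hom (Nil2 C) T (Dom (Nil2 C) k0) \<and> Comp (Nil2 C) k0 h = g"
      using gt(4) n0 by (simp only: Nil2_hom Nil2_simps simp_thms)
  next
    show "Comp (Nil2 C) f k0 = zero_arr (Nil2 C) (Dom (Nil2 C) k0) (Cod (Nil2 C) f)"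
      using null_eq[OF k0D(5)] k0D ft Nil2_zero_arr[of "Dom C k0" "Cod C f"] n0 by simp
  qed (use f k0D n0 in \<open>simp_all add: Nil2_hom\<close>)
  then have k: "is_kernel (Nil2 C) f (ker (Nil2 C) f)"
    unfolding ker_def by (rule someI)
  define k where "k = ker (Nil2 C) f"
  note kk = k[folded k_def]
  note kD = N.kernelD[OF kk]
  have kt: "k \<in> Arr C" "Cod C k = Dom C f" "two_nilpotent C (Dom C k)" using kD by simp_all
  have "Comp (Nil2 C) f k = zero_arr (Nil2 C) (Dom (Nil2 C) k) (Cod (Nil2 C) f)"
    using kk unfolding is_kernel_def by blast
  then have "f \<cdot> k = zero_arr C (Dom C k) (Cod C f)"
    using Nil2_zero_arr[of "Dom C k" "Cod C f"] kt ft by simp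
  then have "null C (f \<cdot> k)" using kt ft by simp
  then have "sub_le C k k0" using kernel_sub_le[OF k0, of k] kt by simp
  then obtain t where t: "t \<in> Arr C" "Dom C t = Dom C k" "Cod C t = Dom C k0" "k0 \<cdot> t = k" by (rule sub_leE)
  have "null (Nil2 C) (Comp (Nil2 C) f k0)"
    using N.kernelD(5)[OF \<open>is_kernel (Nil2 C) f k0\<close>] .
  then have "sub_le (Nil2 C) k0 k"
    using N.kernel_sub_le[OF kk, of k0] k0D n0 ft by simp
  then obtain s where s: "s \<in> Arr C" "Dom C s = Dom C k0" "Cod C s = Dom C k" "k \<cdot> s = k0"
    by (rule N.sub_leE) auto
  \<comment> \<open>Monicity of \<open>k\<close> is so far known for two-nilpotent test objects
    only. It suffices to show that \<open>t\<close> is split, because then \<open>k\<close> is a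
    composite of monomorphisms of \<open>C\<close>.\<close>
  have "k \<cdot> (s \<cdot> t) = k \<cdot> Id C (Dom C k)" using s(1-3) t kt by (simp add: comp_eq[OF s(4)])
  then have st: "s \<cdot> t = Id C (Dom C k)"
    using N.monicD[OF kD(2), of "s \<cdot> t" "Id C (Dom C k)"] s t kt n0 ft k0D by simp
  have "monic C t" by (rule split_monic[of t s]) (use s t st in simp_all)
  then have "monic C (k0 \<cdot> t)" using k0D(2) t by (intro monic_comp) simp_all
  then have mk: "monic C k" using t by simp
  have "is_kernel C f k"
  proof (rule kernelI)
    fix w assume w: "w \<in> Arr C" "Cod C w = Dom C f"
    have "sub_le C w k \<longleftrightarrow> sub_le C w k0"
      using sub_le_trans[of w k k0] sub_le_trans[of w k0 k] \<open>sub_le C k k0\<close> sub_leI[of k s k0] s k0D kt by auto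
    then show "sub_le C w k \<longleftrightarrow> null C (f \<cdot> w)" using kernel_sub_le[OF k0 w] by simp
  qed (use ft mk kt in simp_all)
  then show ?thesis by (simp add: k_def)
qed

lemma nil2_map_props:
  assumes f: "f \<in> hom C A B"
  shows "nil2_map C f \<in> hom C (nil2 C A) (nil2 C B)"
    "nil2_map C f \<cdot> nil2_unit C A = nil2_unit C B \<cdot> f"
proof -
  have AB: "A \<in> Obj C" "B \<in> Obj C" using f by auto
  note uA = nil2_unit_props[OF AB(1)] and uB = nil2_unit_props[OF AB(2)]
  have uf: "nil2_unit C B \<cdot> f \<in> hom C A (nil2 C B)" using uB f by simp
  obtain h where h: "h \<in> hom C (nil2 C A) (nil2 C B)" "h \<cdot> nil2_unit C A = nil2_unit C B \<cdot> f"
    by (rule nil2_factor[OF uf two_nilpotent_null[OF nil2_two_nilpotent[OF AB(2)] uf]])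
  have "\<exists>!g. g \<in> hom C (nil2 C A) (nil2 C B) \<and> g \<cdot> nil2_unit C A = nil2_unit C B \<cdot> f"
  proof (rule ex1I[of _ h])
    fix g assume "g \<in> hom C (nil2 C A) (nil2 C B) \<and> g \<cdot> nil2_unit C A = nil2_unit C B \<cdot> f"
    then show "g = h" using cover_epi[OF uA(1), of g h] h uA by simp
  qed (use h in simp)
  from theI'[OF this] show "nil2_map C f \<in> hom C (nil2 C A) (nil2 C B)"
    "nil2_map C f \<cdot> nil2_unit C A = nil2_unit C B \<cdot> f"
    using f unfolding nil2_map_def by simp_all
qed

text \<open>A reflector preserves coproducts: \<open>char\<close> matches the extensions of
  \<open>f\<close> and \<open>g\<close> to \<open>nil2 (X + Y)\<close> with the factorizations of
  their copairing on X + Y through the unit.\<close>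

lemma Nil2_coproduct:
  assumes XY: "X \<in> Obj C" "Y \<in> Obj C"
  shows "is_coproduct (Nil2 C) (nil2 C X) (nil2 C Y) (nil2_map C (in1 C X Y)) (nil2_map C (in2 C X Y))"
    "nil2_map C (in1 C X Y) \<in> hom C (nil2 C X) (nil2 C (cop C X Y))"
    "nil2_map C (in2 C X Y) \<in> hom C (nil2 C Y) (nil2 C (cop C X Y))"
proof -
  let ?S = "cop C X Y"
  have S: "?S \<in> Obj C" using XY by simp
  note uX = nil2_unit_props[OF XY(1)] and uY = nil2_unit_props[OF XY(2)] and uS = nil2_unit_props[OF S]
  note nX = nil2_two_nilpotent[OF XY(1)] and nY = nil2_two_nilpotent[OF XY(2)] and nS = nil2_two_nilpotent[OF S]
  have ih: "in1 C X Y \<in> hom C X ?S" "in2 C X Y \<in> hom C Y ?S" using XY by simp_all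
  define i j where "i = nil2_map C (in1 C X Y)" and "j = nil2_map C (in2 C X Y)"
  have i: "i \<in> Arr C" "Dom C i = nil2 C X" "Cod C i = nil2 C ?S" "i \<cdot> nil2_unit C X = nil2_unit C ?S \<cdot> in1 C X Y"
    using nil2_map_props[OF ih(1)] by (simp_all add: i_def)
  have j: "j \<in> Arr C" "Dom C j = nil2 C Y" "Cod C j = nil2 C ?S" "j \<cdot> nil2_unit C Y = nil2_unit C ?S \<cdot> in2 C X Y"
    using nil2_map_props[OF ih(2)] by (simp_all add: j_def)
  have "is_coproduct (Nil2 C) (nil2 C X) (nil2 C Y) i j"
    unfolding is_coproduct_def
  proof (intro conjI allI ballI)
    fix T f g assume "f \<in> hom (Nil2 C) (nil2 C X) T" "g \<in> hom (Nil2 C) (nil2 C Y) T"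
    then have f: "f \<in> Arr C" "Dom C f = nil2 C X" "Cod C f = T" and g: "g \<in> Arr C" "Dom C g = nil2 C Y" "Cod C g = T"
      and nT: "two_nilpotent C T" by (auto simp: Nil2_hom)
    have T: "T \<in> Obj C" using f by auto
    let ?\<phi> = "copair C (f \<cdot> nil2_unit C X) (g \<cdot> nil2_unit C Y)"
    have \<phi>: "?\<phi> \<in> hom C ?S T" using f g uX uY by simp
    obtain h where h: "h \<in> hom C (nil2 C ?S) T" "h \<cdot> nil2_unit C ?S = ?\<phi>"
      by (rule nil2_factor[OF \<phi> two_nilpotent_null[OF T nT \<phi>]])
    have char: "h' \<cdot> i = f \<and> h' \<cdot> j = g \<longleftrightarrow> h' \<cdot> nil2_unit C ?S = ?\<phi>" if h': "h' \<in> hom C (nil2 C ?S) T" for h'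
    proof -
      have "h' \<cdot> (i \<cdot> nil2_unit C X) = (h' \<cdot> nil2_unit C ?S) \<cdot> in1 C X Y"
        "h' \<cdot> (j \<cdot> nil2_unit C Y) = (h' \<cdot> nil2_unit C ?S) \<cdot> in2 C X Y"
        unfolding i(4) j(4) using h' uS XY by simp_all
      note e = this
      show ?thesis
      proof
        assume "h' \<cdot> i = f \<and> h' \<cdot> j = g"
        then have "(h' \<cdot> nil2_unit C ?S) \<cdot> in1 C X Y = f \<cdot> nil2_unit C X"
          "(h' \<cdot> nil2_unit C ?S) \<cdot> in2 C X Y = g \<cdot> nil2_unit C Y"
          using e h' i(1-3) j(1-3) uX uY by (simp_all add: comp_eq)
        then show "h' \<cdot> nil2_unit C ?S = ?\<phi>"
          using coproduct_unique[OF coproduct_in[OF XY], of "h' \<cdot> nil2_unit C ?S" T ?\<phi>] h' uS XY f g uX uY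
          by simp
      next
        assume a: "h' \<cdot> nil2_unit C ?S = ?\<phi>"
        have "(h' \<cdot> i) \<cdot> nil2_unit C X = f \<cdot> nil2_unit C X" "(h' \<cdot> j) \<cdot> nil2_unit C Y = g \<cdot> nil2_unit C Y"
          using e[unfolded a] h' i(1-3) j(1-3) uX uY f g by simp_all
        then show "h' \<cdot> i = f \<and> h' \<cdot> j = g"
          using cover_epi[OF uX(1), of "h' \<cdot> i" f] cover_epi[OF uY(1), of "h' \<cdot> j" g] h' i j f g uX uY by simp
      qed
    qed
    show "\<exists>!h. h \<in> hom (Nil2 C) (Cod (Nil2 C) i) T \<and> Comp (Nil2 C) h i = f \<and> Comp (Nil2 C) h j = g"
    proof (rule ex1I[of _ h])
      show "h \<in> hom (Nil2 C) (Cod (Nil2 C) i) T \<and> Comp (Nil2 C) h i = f \<and> Comp (Nil2 C) h j = g"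
        using char[OF h(1)] h i nS nT by (simp add: Nil2_hom)
      fix h' assume "h' \<in> hom (Nil2 C) (Cod (Nil2 C) i) T \<and> Comp (Nil2 C) h' i = f \<and> Comp (Nil2 C) h' j = g"
      then have h': "h' \<in> hom C (nil2 C ?S) T" "h' \<cdot> i = f \<and> h' \<cdot> j = g" using i by (auto simp: Nil2_hom)
      then have "h' \<cdot> nil2_unit C ?S = h \<cdot> nil2_unit C ?S" using char[OF h'(1)] h by simp
      then show "h' = h" using cover_epi[OF uS(1), of h' h] h h' uS by simp
    qed
  qed (use i j nX nY nS in \<open>simp_all add: Nil2_hom\<close>)
  then show "is_coproduct (Nil2 C) (nil2 C X) (nil2 C Y) (nil2_map C (in1 C X Y)) (nil2_map C (in2 C X Y))"
    "nil2_map C (in1 C X Y) \<in> hom C (nil2 C X) (nil2 C (cop C X Y))"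
    "nil2_map C (in2 C X Y) \<in> hom C (nil2 C Y) (nil2 C (cop C X Y))"
    using i j by (simp_all add: i_def j_def)
qed

end

section \<open>The bilinear product\<close>

context semi_abelian_category begin

lemma cokernels_isomorphic:
  assumes e: "cover C e" "is_kernel C e k" and q: "cover C q" "is_kernel C q k"
  shows "isomorphic C (Cod C e) (Cod C q)"
proof -
  note eD = kernelD[OF e(2)] and qD = kernelD[OF q(2)]
  have eq: "null C (e \<cdot> w) \<longleftrightarrow> null C (q \<cdot> w)" if "w \<in> Arr C" "Cod C w = Dom C e" for w
    using kernel_sub_le[OF e(2), of w] kernel_sub_le[OF q(2), of w] that eD qD by simp
  have d: "Dom C e = Dom C q" using eD qD by simp
  obtain h where h: "h \<in> Arr C" "Dom C h = Cod C e" "Cod C h = Cod C q" "h \<cdot> e = q"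
    by (rule cover_factor[OF e(1), of q]) (use eq d q in simp_all)
  obtain h' where h': "h' \<in> Arr C" "Dom C h' = Cod C q" "Cod C h' = Cod C e" "h' \<cdot> q = e"
    by (rule cover_factor[OF q(1), of e]) (use eq d e in simp_all)
  have "(h' \<cdot> h) \<cdot> e = Id C (Cod C e) \<cdot> e" "(h \<cdot> h') \<cdot> q = Id C (Cod C q) \<cdot> q"
    using h h' e q d by simp_all
  then have "h' \<cdot> h = Id C (Cod C e)" "h \<cdot> h' = Id C (Cod C q)"
    using cover_epi[OF e(1), of "h' \<cdot> h" "Id C (Cod C e)"] cover_epi[OF q(1), of "h \<cdot> h'" "Id C (Cod C q)"]
      h h' e q d by simp_all
  then have "is_iso C h" by (intro isoI[of h h']) (use h h' in simp_all)
  then show ?thesis unfolding isomorphic_def using h by auto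
qed

text \<open>The bilinear product, as a subobject of \<open>nil2 (X + Y)\<close>, is the joint kernel of the
  two retractions onto \<open>nil2 X\<close> and \<open>nil2 Y\<close>.\<close>

lemma bilinear_product_embedding:
  assumes XY: "X \<in> Obj C" "Y \<in> Obj C"
  defines "v \<equiv> nil2_coproduct C X Y \<cdot> bilinear_incl C X Y"
    and "i \<equiv> nil2_map C (in1 C X Y)" and "j \<equiv> nil2_map C (in2 C X Y)"
  shows "monic C v" "Dom C v = bilinear_product C X Y" "Cod C v = nil2 C (cop C X Y)"
    "bilinear_incl C X Y \<in> Arr C" "nil2_coproduct C X Y \<in> Arr C"
    "Dom C (nil2_coproduct C X Y) = Cod C (bilinear_incl C X Y)"
    "Dom C (bilinear_incl C X Y) = bilinear_product C X Y"
    "\<exists>r s. r \<in> hom C (nil2 C (cop C X Y)) (nil2 C X) \<and> s \<in> hom C (nil2 C (cop C X Y)) (nil2 C Y) \<and>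
      r \<cdot> i = Id C (nil2 C X) \<and> r \<cdot> j = zero_arr C (nil2 C Y) (nil2 C X) \<and>
      s \<cdot> i = zero_arr C (nil2 C X) (nil2 C Y) \<and> s \<cdot> j = Id C (nil2 C Y) \<and>
      (\<forall>w \<in> Arr C. Cod C w = nil2 C (cop C X Y) \<longrightarrow> sub_le C w v \<longleftrightarrow> null C (r \<cdot> w) \<and> null C (s \<cdot> w))"
proof -
  interpret N: pointed_category "Nil2 C" by (rule Nil2_pointed)
  define A B S where "A = nil2 C X" and "B = nil2 C Y" and "S = nil2 C (cop C X Y)"
  have So: "cop C X Y \<in> Obj C" using XY by simp
  have A: "A \<in> Obj C" "two_nilpotent C A" and B: "B \<in> Obj C" "two_nilpotent C B"
    and S: "S \<in> Obj C" "two_nilpotent C S"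
    using nil2_two_nilpotent XY So by (simp_all add: A_def B_def S_def)
  note co = Nil2_coproduct[OF XY, folded A_def B_def S_def i_def j_def]
  have ij: "i \<in> Arr C" "Dom C i = A" "Cod C i = S" "j \<in> Arr C" "Dom C j = B" "Cod C j = S" using co by simp_all
  have exc: "\<exists>i j. is_coproduct (Nil2 C) A B i j" using co(1) by blast
  have exp: "\<exists>p q. is_product (Nil2 C) A B p q" using Nil2_product_exists A B by simp
  note inN = N.in_coproduct[OF exc]
  define a b D where "a = in1 (Nil2 C) A B" and "b = in2 (Nil2 C) A B" and "D = cop (Nil2 C) A B"
  note inN' = inN[folded a_def b_def]
  have ab: "a \<in> Arr C" "Dom C a = A" "Cod C a = D" "b \<in> Arr C" "Dom C b = B" "Cod C b = D"
    "two_nilpotent C D" "D \<in> Obj C"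
    using N.coproductD[OF inN'] obj_simps(2)[of a] by (auto simp: D_def cop_def a_def)
  define m where "m = nil2_coproduct C X Y"
  have iN: "i \<in> hom (Nil2 C) A S" "j \<in> hom (Nil2 C) B S" using ij A B S by (simp_all add: Nil2_hom)
  have m_eq: "m = copair (Nil2 C) i j" by (simp add: m_def nil2_coproduct_def i_def j_def)
  have m: "m \<in> Arr C" "Dom C m = D" "Cod C m = S" "m \<cdot> a = i" "m \<cdot> b = j"
    using N.copair_props[OF exc iN] by (simp_all add: m_eq a_def b_def D_def Nil2_hom)
  have abN: "a \<in> hom (Nil2 C) A D" "b \<in> hom (Nil2 C) B D" using ab A B by (simp_all add: Nil2_hom)
  \<comment> \<open>The arrow \<open>d\<close> is the inverse of \<open>m\<close>, which compares
    two coproducts of \<open>A\<close> and \<open>B\<close> in the subcategory.\<close>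
  obtain d where "d \<in> Arr (Nil2 C)" "Dom (Nil2 C) d = Cod (Nil2 C) i" "Cod (Nil2 C) d = D"
    "Comp (Nil2 C) d i = a" "Comp (Nil2 C) d j = b"
    using N.coproduct_lift[OF co(1) abN] by blast
  then have d: "d \<in> Arr C" "Dom C d = S" "Cod C d = D" "d \<cdot> i = a" "d \<cdot> j = b" using ij by simp_all
  have dm: "d \<cdot> m = Id C D"
  proof -
    have "Comp (Nil2 C) (d \<cdot> m) a = Comp (Nil2 C) (Id C D) a" "Comp (Nil2 C) (d \<cdot> m) b = Comp (Nil2 C) (Id C D) b"
      using d m ab by simp_all
    then show ?thesis
      using N.coproduct_unique[OF inN', of "d \<cdot> m" D "Id C D"] d m ab by simp
  qed
  have md: "m \<cdot> d = Id C S"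
  proof -
    have "Comp (Nil2 C) (m \<cdot> d) i = Comp (Nil2 C) (Id C S) i" "Comp (Nil2 C) (m \<cdot> d) j = Comp (Nil2 C) (Id C S) j"
      using d m ij S by simp_all
    then show ?thesis
      using N.coproduct_unique[OF co(1), of "m \<cdot> d" S "Id C S"] d m ij S by simp
  qed
  have mm: "monic C m" by (rule split_monic[of m d]) (use d m dm in simp_all)
  define \<sigma> where "\<sigma> = sum_to_prod (Nil2 C) A B"
  define p q where "p = fst (projs (Nil2 C) A B)" and "q = snd (projs (Nil2 C) A B)"
  note prod = N.projs_product[OF exp, folded p_def q_def]
  have pq: "p \<in> Arr C" "Cod C p = A" "q \<in> Arr C" "Cod C q = B" "Dom C q = Dom C p" "two_nilpotent C (Dom C p)"
    using N.productD[OF prod] by simp_all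
  note g = N.sum_to_prod_projections[OF exp exc, folded p_def q_def \<sigma>_def a_def b_def D_def]
  have \<sigma>: "\<sigma> \<in> Arr C" "Dom C \<sigma> = D" "Cod C \<sigma> = Dom C p" using g(1) by (simp_all add: Nil2_hom)
  have z: "zero_arr (Nil2 C) B A = zero_arr C B A" "zero_arr (Nil2 C) A B = zero_arr C A B"
    using Nil2_zero_arr A B by simp_all
  have ps: "p \<cdot> (\<sigma> \<cdot> a) = Id C A" "p \<cdot> (\<sigma> \<cdot> b) = zero_arr C B A"
    "q \<cdot> (\<sigma> \<cdot> a) = zero_arr C A B" "q \<cdot> (\<sigma> \<cdot> b) = Id C B"
    using g(2-5) \<sigma> pq ab z by simp_all
  define k where "k = bilinear_incl C X Y"
  have k: "is_kernel C \<sigma> k"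
    unfolding k_def bilinear_incl_def cosmash_incl_def \<sigma>_def A_def B_def
    by (rule Nil2_kernel) (use \<sigma> pq ab in \<open>simp add: \<sigma>_def A_def B_def\<close>)
  note kD = kernelD[OF k]
  have kd: "Dom C k = bilinear_product C X Y"
    by (simp add: k_def bilinear_incl_def bilinear_product_def cosmash_def)
  have v: "v = m \<cdot> k" by (simp add: v_def m_def k_def)
  have kt: "k \<in> Arr C" "Cod C k = D" using kD \<sigma> by simp_all
  show "monic C v" unfolding v by (rule monic_comp[OF mm kD(2)]) (use m kt in simp)
  show "Dom C v = bilinear_product C X Y" "Cod C v = nil2 C (cop C X Y)"
    using m kt kd S_def by (simp_all add: v)
  show "bilinear_incl C X Y \<in> Arr C" "nil2_coproduct C X Y \<in> Arr C"
    "Dom C (nil2_coproduct C X Y) = Cod C (bilinear_incl C X Y)"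
    "Dom C (bilinear_incl C X Y) = bilinear_product C X Y"
    using kt m kd by (simp_all add: m_def k_def)
  \<comment> \<open>The two components of the canonical arrow from sum to product, transported along
    \<open>d\<close> to the reflection of X + Y.\<close>
  define r s where "r = p \<cdot> (\<sigma> \<cdot> d)" and "s = q \<cdot> (\<sigma> \<cdot> d)"
  have r: "r \<in> hom C S A" "s \<in> hom C S B" using pq \<sigma> d by (simp_all add: r_def s_def)
  have rs: "r \<cdot> i = Id C A" "r \<cdot> j = zero_arr C B A" "s \<cdot> i = zero_arr C A B" "s \<cdot> j = Id C B"
    using pq \<sigma> d ij ps by (simp_all add: r_def s_def)
  have sub: "sub_le C w v \<longleftrightarrow> null C (r \<cdot> w) \<and> null C (s \<cdot> w)" if w: "w \<in> Arr C" "Cod C w = S" for w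
  proof
    assume "sub_le C w v"
    then obtain h where h: "h \<in> Arr C" "Dom C h = Dom C w" "Cod C h = Dom C v" "v \<cdot> h = w" by (rule sub_leE)
    have hk: "Cod C h = Dom C k" using h(3) v m kt by simp
    have "d \<cdot> (m \<cdot> (k \<cdot> h)) = k \<cdot> h" using d(1-3) m h(1) hk kt by (simp add: comp_eq[OF dm])
    then have dw: "d \<cdot> w = k \<cdot> h" using h v m kt hk by simp
    have "null C ((\<sigma> \<cdot> k) \<cdot> h)" by (rule null_precomp[OF kD(5)]) (use h hk kt \<sigma> in simp_all)
    then have "null C (\<sigma> \<cdot> (d \<cdot> w))" unfolding dw using h hk kt \<sigma> by simp
    then have "null C (p \<cdot> (\<sigma> \<cdot> (d \<cdot> w)))" "null C (q \<cdot> (\<sigma> \<cdot> (d \<cdot> w)))" using pq \<sigma> d w by simp_all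
    then show "null C (r \<cdot> w) \<and> null C (s \<cdot> w)" using w pq \<sigma> d by (simp add: r_def s_def)
  next
    assume n: "null C (r \<cdot> w) \<and> null C (s \<cdot> w)"
    \<comment> \<open>The pair \<open>p\<close>, \<open>q\<close> is a product in the subcategory,
      so it detects zero only for elements with two-nilpotent domain. The domain of \<open>w\<close>
      is arbitrary; its image in \<open>S\<close> is two-nilpotent as a subobject, and the test is
      carried out on the image.\<close>
    obtain e n' where im: "regular_epi C e" "monic C n'" "e \<in> Arr C" "Dom C e = Dom C w"
      "Cod C e = Dom C n'" "Cod C n' = Cod C w" "n' \<cdot> e = w"
      using image_exists[OF w(1)] .
    note ce = regular_epi_cover[OF im(1)]
    have n'a: "n' \<in> Arr C" using im by simp
    have I: "two_nilpotent C (Dom C n')" using sub_two_nilpotent[OF im(2)] im w S by simp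
    have "null C (r \<cdot> n')" "null C (s \<cdot> n')"
      by (rule null_cover[OF ce]; use n im(3-7) n'a w r in simp)+
    then have nn: "null C (p \<cdot> (\<sigma> \<cdot> (d \<cdot> n')))" "null C (q \<cdot> (\<sigma> \<cdot> (d \<cdot> n')))"
      using n'a im w pq \<sigma> d by (simp_all add: r_def s_def)
    have null_N: "null (Nil2 C) f \<longleftrightarrow> null C f" if "f \<in> Arr (Nil2 C)" for f
      using that Nil2_zero_arr[of "Dom C f" "Cod C f"] by (simp add: null_def)
    have "null (Nil2 C) (\<sigma> \<cdot> (d \<cdot> n'))"
      using N.null_into_product[OF prod, of "\<sigma> \<cdot> (d \<cdot> n')"] nn null_N n'a im w pq \<sigma> d I A B by simp
    then have "null C (\<sigma> \<cdot> (d \<cdot> n'))" using null_N n'a im w pq \<sigma> d I by simp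
    then have "null C ((\<sigma> \<cdot> (d \<cdot> n')) \<cdot> e)" by (rule null_precomp) (use im n'a w \<sigma> d in simp_all)
    then have "null C (\<sigma> \<cdot> (d \<cdot> w))" using im n'a w \<sigma> d by simp
    then have "sub_le C (d \<cdot> w) k" using kernel_sub_le[OF k, of "d \<cdot> w"] w d \<sigma> by simp
    then obtain h where "h \<in> Arr C" "Dom C h = Dom C (d \<cdot> w)" "Cod C h = Dom C k" "k \<cdot> h = d \<cdot> w" by (rule sub_leE)
    note h = this
    have "v \<cdot> h = m \<cdot> (d \<cdot> w)" using h v m kt by simp
    also have "\<dots> = w" using m(1-3) d(1-3) w by (simp add: comp_eq[OF md])
    finally show "sub_le C w v" using sub_leI[of v h w] h v m kt by simp
  qed
  show "\<exists>r s. r \<in> hom C (nil2 C (cop C X Y)) (nil2 C X) \<and> s \<in> hom C (nil2 C (cop C X Y)) (nil2 C Y) \<and>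
      r \<cdot> i = Id C (nil2 C X) \<and> r \<cdot> j = zero_arr C (nil2 C Y) (nil2 C X) \<and>
      s \<cdot> i = zero_arr C (nil2 C X) (nil2 C Y) \<and> s \<cdot> j = Id C (nil2 C Y) \<and>
      (\<forall>w \<in> Arr C. Cod C w = nil2 C (cop C X Y) \<longrightarrow> sub_le C w v \<longleftrightarrow> null C (r \<cdot> w) \<and> null C (s \<cdot> w))"
    unfolding A_def[symmetric] B_def[symmetric] S_def[symmetric]
    by (rule exI[of _ r], rule exI[of _ s]) (use r rs sub in blast)
qed

lemma eta_props:
  assumes XY: "X \<in> Obj C" "Y \<in> Obj C"
  shows "eta C X Y \<in> hom C (cosmash C X Y) (bilinear_product C X Y)" "cover C (eta C X Y)"
    "w \<in> Arr C \<Longrightarrow> Cod C w = cosmash C X Y \<Longrightarrow>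
      null C (eta C X Y \<cdot> w) \<longleftrightarrow> null C (nil2_unit C (cop C X Y) \<cdot> (cosmash_incl C X Y \<cdot> w))"
proof -
  define S where "S = cop C X Y"
  have So: "S \<in> Obj C" using XY by (simp add: S_def)
  define \<iota> where "\<iota> = cosmash_incl C X Y"
  define \<eta> where "\<eta> = nil2_unit C S"
  define A B where "A = nil2 C X" and "B = nil2 C Y"
  define \<eta>X \<eta>Y where "\<eta>X = nil2_unit C X" and "\<eta>Y = nil2_unit C Y"
  have A: "A \<in> Obj C" and B: "B \<in> Obj C" using nil2_two_nilpotent XY by (simp_all add: A_def B_def)
  note cos = cosmash_props[OF XY, folded \<iota>_def S_def]
  note uX = nil2_unit_props[OF XY(1), folded \<eta>X_def A_def] and uY = nil2_unit_props[OF XY(2), folded \<eta>Y_def B_def]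
    and uS = nil2_unit_props[OF So, folded \<eta>_def]
  have ia: "\<iota> \<in> Arr C" using cos by simp
  have \<eta>: "\<eta> \<in> Arr C" "Dom C \<eta> = S" "Cod C \<eta> = nil2 C S" using uS by simp_all
  have N: "nil2 C S \<in> Obj C" using nil2_two_nilpotent[OF So] by simp
  define i1 i2 where "i1 = in1 C X Y" and "i2 = in2 C X Y"
  have in12: "i1 \<in> hom C X S" "i2 \<in> hom C Y S" using XY by (simp_all add: i1_def i2_def S_def)
  define i j where "i = nil2_map C i1" and "j = nil2_map C i2"
  have i: "i \<in> Arr C" "Dom C i = A" "Cod C i = nil2 C S" "i \<cdot> \<eta>X = \<eta> \<cdot> i1"
    using nil2_map_props[OF in12(1)] by (simp_all add: i_def A_def \<eta>X_def \<eta>_def)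
  have j: "j \<in> Arr C" "Dom C j = B" "Cod C j = nil2 C S" "j \<cdot> \<eta>Y = \<eta> \<cdot> i2"
    using nil2_map_props[OF in12(2)] by (simp_all add: j_def B_def \<eta>Y_def \<eta>_def)
  define m b where "m = nil2_coproduct C X Y" and "b = bilinear_incl C X Y"
  define v where "v = m \<cdot> b"
  note em = bilinear_product_embedding[OF XY, folded m_def b_def v_def i1_def i2_def i_def j_def A_def B_def S_def]
  obtain r s where rs: "r \<in> Arr C" "Dom C r = nil2 C S" "Cod C r = A" "s \<in> Arr C" "Dom C s = nil2 C S" "Cod C s = B"
    "r \<cdot> i = Id C A" "r \<cdot> j = zero_arr C B A" "s \<cdot> i = zero_arr C A B" "s \<cdot> j = Id C B"
    and sub: "\<And>w. w \<in> Arr C \<Longrightarrow> Cod C w = nil2 C S \<Longrightarrow> sub_le C w v \<longleftrightarrow> null C (r \<cdot> w) \<and> null C (s \<cdot> w)"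
    using em(8) by auto
  have va: "v \<in> Arr C" using em by simp
  define r1 where "r1 = copair C (Id C X) (zero_arr C Y X)"
  define r2 where "r2 = copair C (zero_arr C X Y) (Id C Y)"
  have r12: "r1 \<in> Arr C" "Dom C r1 = S" "Cod C r1 = X" "r2 \<in> Arr C" "Dom C r2 = S" "Cod C r2 = Y"
    "r1 \<cdot> i1 = Id C X" "r1 \<cdot> i2 = zero_arr C Y X" "r2 \<cdot> i1 = zero_arr C X Y" "r2 \<cdot> i2 = Id C Y"
    using XY by (simp_all add: r1_def r2_def S_def i1_def i2_def)
  have inc: "is_coproduct C X Y i1 i2" using coproduct_in[OF XY] by (simp add: i1_def i2_def)
  \<comment> \<open>The retractions of X + Y and of its reflection correspond under the units, as is
    checked on the two injections; hence \<open>\<eta>\<close> maps the cosmash product into the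
    bilinear product.\<close>
  have r\<eta>: "r \<cdot> \<eta> = \<eta>X \<cdot> r1"
  proof (rule coproduct_unique[OF inc, of _ A])
    have "r \<cdot> (\<eta> \<cdot> i1) = \<eta>X" "r \<cdot> (\<eta> \<cdot> i2) = zero_arr C Y A"
      using rs i j uX uY A B by (simp_all add: comp_eq[OF rs(7)] comp_eq[OF rs(8)] flip: i(4) j(4))
    then show "(r \<cdot> \<eta>) \<cdot> i1 = (\<eta>X \<cdot> r1) \<cdot> i1" "(r \<cdot> \<eta>) \<cdot> i2 = (\<eta>X \<cdot> r1) \<cdot> i2"
      using rs(1-6) \<eta> in12 uX r12 XY by simp_all
  qed (use rs \<eta> uX r12 in12 in simp_all)
  have s\<eta>: "s \<cdot> \<eta> = \<eta>Y \<cdot> r2"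
  proof (rule coproduct_unique[OF inc, of _ B])
    have "s \<cdot> (\<eta> \<cdot> i1) = zero_arr C X B" "s \<cdot> (\<eta> \<cdot> i2) = \<eta>Y"
      using rs i j uX uY A B by (simp_all add: comp_eq[OF rs(9)] comp_eq[OF rs(10)] flip: i(4) j(4))
    then show "(s \<cdot> \<eta>) \<cdot> i1 = (\<eta>Y \<cdot> r2) \<cdot> i1" "(s \<cdot> \<eta>) \<cdot> i2 = (\<eta>Y \<cdot> r2) \<cdot> i2"
      using rs(1-6) \<eta> in12 uY r12 XY by simp_all
  qed (use rs \<eta> uY r12 in12 in simp_all)
  have "null C (r1 \<cdot> \<iota>)" "null C (r2 \<cdot> \<iota>)"
    using cos(4)[OF ia cos(2)] sub_le_refl[OF ia] by (simp_all add: r1_def r2_def)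
  then have "null C (\<eta>X \<cdot> (r1 \<cdot> \<iota>))" "null C (\<eta>Y \<cdot> (r2 \<cdot> \<iota>))" using uX uY r12 ia cos by simp_all
  then have "null C (r \<cdot> (\<eta> \<cdot> \<iota>))" "null C (s \<cdot> (\<eta> \<cdot> \<iota>))"
    using rs(1-6) \<eta> ia cos(2) uX uY r12 by (simp_all add: comp_eq[OF r\<eta>] comp_eq[OF s\<eta>])
  then have "sub_le C (\<eta> \<cdot> \<iota>) v" using sub[of "\<eta> \<cdot> \<iota>"] \<eta> ia cos by simp
  then obtain e where "e \<in> Arr C" "Dom C e = Dom C (\<eta> \<cdot> \<iota>)" "Cod C e = Dom C v" "v \<cdot> e = \<eta> \<cdot> \<iota>" by (rule sub_leE)
  then have e: "e \<in> Arr C" "Dom C e = cosmash C X Y" "Cod C e = Dom C v" "v \<cdot> e = \<eta> \<cdot> \<iota>"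
    using \<eta> ia cos by simp_all
  have mb: "m \<cdot> (b \<cdot> t) = v \<cdot> t" if "t \<in> Arr C" "Cod C t = bilinear_product C X Y" for t
    using that em(4-7) by (simp add: v_def)
  have eta: "eta C X Y = e"
    unfolding eta_def m_def[symmetric] b_def[symmetric] S_def[symmetric] \<eta>_def[symmetric] \<iota>_def[symmetric]
  proof (rule the_equality)
    show "e \<in> hom C (cosmash C X Y) (bilinear_product C X Y) \<and> m \<cdot> (b \<cdot> e) = \<eta> \<cdot> \<iota>"
      using e em(2) mb by simp
    fix t assume "t \<in> hom C (cosmash C X Y) (bilinear_product C X Y) \<and> m \<cdot> (b \<cdot> t) = \<eta> \<cdot> \<iota>"
    then have t: "t \<in> Arr C" "Dom C t = cosmash C X Y" "Cod C t = bilinear_product C X Y" "v \<cdot> t = \<eta> \<cdot> \<iota>"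
      using mb[of t] by simp_all
    show "t = e" by (rule monicD[OF em(1)]) (use t e em(2) in simp_all)
  qed
  show "eta C X Y \<in> hom C (cosmash C X Y) (bilinear_product C X Y)" using eta e em by simp
  show "null C (eta C X Y \<cdot> w) \<longleftrightarrow> null C (nil2_unit C (cop C X Y) \<cdot> (cosmash_incl C X Y \<cdot> w))"
    if w: "w \<in> Arr C" "Cod C w = cosmash C X Y"
    unfolding eta S_def[symmetric] \<eta>_def[symmetric] \<iota>_def[symmetric]
  proof -
    have "\<eta> \<cdot> (\<iota> \<cdot> w) = v \<cdot> (e \<cdot> w)" using w e(1-3) va \<eta> ia cos(2,3) by (simp add: comp_eq[OF e(4)])
    then show "null C (e \<cdot> w) \<longleftrightarrow> null C (\<eta> \<cdot> (\<iota> \<cdot> w))"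
      using null_monic[OF em(1), of "e \<cdot> w"] null_comp[of "e \<cdot> w" v] w e va by auto
  qed
  \<comment> \<open>Each idempotent kills one summand: \<open>kX\<close> retracts onto Y and injects
    back, so it kills X, and \<open>kY\<close> kills Y. The primed versions are their counterparts
    on the reflection.\<close>
  define kX kY kX' kY' where "kX = i2 \<cdot> r2" and "kY = i1 \<cdot> r1" and "kX' = j \<cdot> s" and "kY' = i \<cdot> r"
  have kt: "kX \<in> Arr C" "Dom C kX = S" "Cod C kX = S" "kY \<in> Arr C" "Dom C kY = S" "Cod C kY = S"
    "kX' \<in> Arr C" "Dom C kX' = nil2 C S" "Cod C kX' = nil2 C S" "kY' \<in> Arr C" "Dom C kY' = nil2 C S" "Cod C kY' = nil2 C S"
    using in12 r12(1-6) i(1-3) j(1-3) rs(1-6) by (simp_all add: kX_def kY_def kX'_def kY'_def)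
  have k\<eta>: "\<eta> \<cdot> kX = kX' \<cdot> \<eta>" "\<eta> \<cdot> kY = kY' \<cdot> \<eta>"
  proof -
    have "\<eta> \<cdot> (i2 \<cdot> r2) = j \<cdot> (\<eta>Y \<cdot> r2)" "\<eta> \<cdot> (i1 \<cdot> r1) = i \<cdot> (\<eta>X \<cdot> r1)"
      using in12 r12(1-6) i(1-3) j(1-3) \<eta> uX uY by (simp_all add: comp_eq[OF i(4)] comp_eq[OF j(4)])
    then show "\<eta> \<cdot> kX = kX' \<cdot> \<eta>" "\<eta> \<cdot> kY = kY' \<cdot> \<eta>"
      using rs(1-6) \<eta> i(1-3) j(1-3) by (simp_all add: kX_def kY_def kX'_def kY'_def r\<eta> s\<eta>)
  qed
  have kk: "kX \<cdot> kX = kX" "kY \<cdot> kY = kY" "kX' \<cdot> kX' = kX'" "kY' \<cdot> kY' = kY'"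
    "kX \<cdot> kY = kY \<cdot> kX" "kX' \<cdot> kY' = kY' \<cdot> kX'"
    using in12 r12(1-6) i(1-3) j(1-3) rs(1-6) XY A B So N
    by (simp_all add: kX_def kY_def kX'_def kY'_def comp_eq[OF r12(7)] comp_eq[OF r12(8)] comp_eq[OF r12(9)]
        comp_eq[OF r12(10)] comp_eq[OF rs(7)] comp_eq[OF rs(8)] comp_eq[OF rs(9)] comp_eq[OF rs(10)])
  have "null C (r \<cdot> v)" "null C (s \<cdot> v)" using sub[of v] sub_le_refl[OF va] va em(3) by simp_all
  then have nv: "null C (kX' \<cdot> v)" "null C (kY' \<cdot> v)"
    using va em(3) i(1-3) j(1-3) rs(1-6) by (simp_all add: kX'_def kY'_def)
  \<comment> \<open>The element to be lifted is the inclusion \<open>v\<close> of the whole bilinear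
    product. Its local lift \<open>a\<close> is killed by both idempotents and hence lies in the
    cosmash product.\<close>
  have "\<exists>c a. cover C c \<and> Cod C c = Dom C v \<and> a \<in> Arr C \<and> Dom C a = Dom C c \<and> Cod C a = Dom C \<eta> \<and>
    \<eta> \<cdot> a = v \<cdot> c \<and> (\<forall>(e, e') \<in> set [(kX, kX'), (kY, kY')]. null C (e \<cdot> a))"
    by (rule lift_through_kernels) (use uS kt k\<eta> kk nv va em(3) \<eta> in \<open>auto simp: idempotent_on_def\<close>)
  then obtain c a where ca: "cover C c" "Cod C c = Dom C v" "a \<in> Arr C" "Dom C a = Dom C c" "Cod C a = S"
    "\<eta> \<cdot> a = v \<cdot> c" "null C (kX \<cdot> a)" "null C (kY \<cdot> a)"
    using \<eta> by auto
  have "null C (r2 \<cdot> (kX \<cdot> a))" "null C (r1 \<cdot> (kY \<cdot> a))"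
    using ca(7,8) r12(1-6) kt ca(3,5) by simp_all
  then have "null C (r2 \<cdot> a)" "null C (r1 \<cdot> a)"
    using ca(3,5) r12(1-6) in12 by (simp_all add: kX_def kY_def comp_eq[OF r12(7)] comp_eq[OF r12(10)])
  then have "sub_le C a \<iota>" using cos(4)[OF ca(3,5)] by (simp add: r1_def r2_def)
  then obtain a' where a': "a' \<in> Arr C" "Dom C a' = Dom C a" "Cod C a' = Dom C \<iota>" "\<iota> \<cdot> a' = a" by (rule sub_leE)
  have cc: "c \<in> Arr C" using ca by simp
  have "v \<cdot> (e \<cdot> a') = \<eta> \<cdot> (\<iota> \<cdot> a')" using e(1-3) va \<eta> ia cos(2,3) a'(1-3) by (simp add: comp_eq[OF e(4)])
  also have "\<dots> = v \<cdot> c" using a'(4) ca(6) by simp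
  finally have "e \<cdot> a' = c"
    by (rule monicD[OF em(1)]) (use e(1-3) a'(1-3) ca(2,4) cc cos(3) in simp_all)
  then show "cover C (eta C X Y)" using cover_right[of e a'] ca(1) e a' cos(3) by (simp add: eta)
qed

text \<open>The inclusion of N is a chosen join, and existence of a join has to be shown first. The
  kernel \<open>k\<close> of \<open>eta\<close> is shown to be one; as two joins contain each other,
  the chosen one is a kernel of \<open>eta\<close> too.\<close>

lemma N_incl_kernel:
  assumes XY: "X \<in> Obj C" "Y \<in> Obj C"
  shows "is_kernel C (eta C X Y) (N_incl C X Y)"
proof -
  define S where "S = cop C X Y"
  define \<iota> where "\<iota> = cosmash_incl C X Y"
  define \<eta> where "\<eta> = nil2_unit C S"
  define i j where "i = in1 C X Y" and "j = in2 C X Y"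
  define e where "e = eta C X Y"
  define r1 where "r1 = copair C (Id C X) (zero_arr C Y X)"
  define r2 where "r2 = copair C (zero_arr C X Y) (Id C Y)"
  have So: "S \<in> Obj C" using XY by (simp add: S_def)
  have ij: "i \<in> hom C X S" "j \<in> hom C Y S" using XY by (simp_all add: i_def j_def S_def)
  have r1: "r1 \<in> hom C S X" "r1 \<cdot> i = Id C X" "r1 \<cdot> j = zero_arr C Y X"
    and r2: "r2 \<in> hom C S Y" "r2 \<cdot> i = zero_arr C X Y" "r2 \<cdot> j = Id C Y"
    using XY by (simp_all add: r1_def r2_def S_def i_def j_def)
  note cos = cosmash_props[OF XY, folded \<iota>_def S_def r1_def r2_def]
  have ia: "\<iota> \<in> Arr C" using cos by simp
  note ep = eta_props[OF XY, folded e_def S_def \<eta>_def \<iota>_def]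
  have et: "e \<in> Arr C" "Dom C e = cosmash C X Y" "Cod C e = bilinear_product C X Y" using ep by simp_all
  define t21 t12 where "t21 = fold21 C X Y" and "t12 = fold12 C X Y"
  define f21 f12 where "f21 = \<iota> \<cdot> t21" and "f12 = \<iota> \<cdot> t12"
  have t21: "t21 \<in> Arr C" "Dom C t21 = cosmash3 C X X Y" "Cod C t21 = cosmash C X Y"
    "f21 = copair3 C i i j \<cdot> cosmash3_incl C X X Y"
    using fold21_props[OF XY] by (simp_all add: t21_def f21_def i_def j_def \<iota>_def)
  have t12: "t12 \<in> Arr C" "Dom C t12 = cosmash3 C X Y Y" "Cod C t12 = cosmash C X Y"
    "f12 = copair3 C i j j \<cdot> cosmash3_incl C X Y Y"
    using fold12_props[OF XY] by (simp_all add: t12_def f12_def i_def j_def \<iota>_def)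
  note p21 = fold_props[OF XY XY(1) XY(1) XY(2), folded S_def i_def j_def r1_def r2_def,
      OF ij(1) ij(1) ij(2) t21(4) refl refl refl refl]
  note p12 = fold_props[OF XY XY(1) XY(2) XY(2), folded S_def i_def j_def r1_def r2_def,
      OF ij(1) ij(2) ij(2) t12(4) refl refl refl refl]
  have co: "is_coproduct C X Y i j" "Cod C i = S" using coproduct_in[OF XY] ij by (simp_all add: i_def j_def)
  have ft: "f21 \<in> Arr C" "Cod C f21 = S" "f12 \<in> Arr C" "Cod C f12 = S" using p21(1) p12(1) by simp_all
  obtain p T where p: "p \<in> hom C S T"
    "\<And>\<beta>. (\<And>t. t < 3 \<Longrightarrow> \<beta> t < 2) \<Longrightarrow>
      cross_null C {..<3::nat} (\<lambda>t. [X, Y] ! \<beta> t) (\<lambda>t. [p \<cdot> i, p \<cdot> j] ! \<beta> t) T"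
    "\<And>m w. monic C m \<Longrightarrow> Cod C m = S \<Longrightarrow> sub_le C f21 m \<Longrightarrow> sub_le C f12 m \<Longrightarrow>
      w \<in> Arr C \<Longrightarrow> Cod C w = S \<Longrightarrow> null C (r1 \<cdot> w) \<Longrightarrow> null C (r2 \<cdot> w) \<Longrightarrow> null C (p \<cdot> w) \<Longrightarrow>
      sub_le C w m"
  proof (rule nilpotent_quotient[OF co r1 r2 p21(2) ft(1,2) p21(3,4) p12(2) ft(3,4) p12(3,4) p21(6) p12(6)])
    fix p T assume a: "p \<in> hom C S T"
      "\<And>\<beta>. (\<And>t. t < 3 \<Longrightarrow> \<beta> t < 2) \<Longrightarrow>
        cross_null C {..<3::nat} (\<lambda>t. [X, Y] ! \<beta> t) (\<lambda>t. [p \<cdot> i, p \<cdot> j] ! \<beta> t) T"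
      "\<And>m w. monic C m \<Longrightarrow> Cod C m = S \<Longrightarrow> sub_le C f21 m \<Longrightarrow> sub_le C f12 m \<Longrightarrow>
        w \<in> Arr C \<Longrightarrow> Cod C w = S \<Longrightarrow> null C (r1 \<cdot> w) \<Longrightarrow> null C (r2 \<cdot> w) \<Longrightarrow> null C (p \<cdot> w) \<Longrightarrow>
        sub_le C w m"
    show thesis using that[OF a] by blast
  qed
  \<comment> \<open>All triples of summands vanish under \<open>p\<close>, hence so does the ternary
    commutator of \<open>S\<close>. Thus \<open>p\<close> factors through \<open>\<eta>\<close>, and
    whatever vanishes in the reflection vanishes under \<open>p\<close>.\<close>
  obtain h where h: "h \<in> hom C (nil2 C S) T" "h \<cdot> \<eta> = p"
    using nil2_factor[OF p(1) commutator_null_of_types[OF co p(1,2)]] unfolding \<eta>_def by blast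
  have \<eta>: "\<eta> \<in> hom C S (nil2 C S)" using nil2_unit_props[OF So] by (simp add: \<eta>_def)
  obtain k where k: "is_kernel C e k" using kernel_exists et by blast
  note kD = kernelD[OF k]
  have kt: "k \<in> Arr C" "Cod C k = cosmash C X Y" using kD et by simp_all
  \<comment> \<open>The reflection is two-nilpotent, so the cross-effect of three identities on it
    vanishes, and with it that of any three arrows into it. Applied to the injections, this shows
    that both foldings die in \<open>nil2 S\<close>.\<close>
  have \<eta>f: "null C (\<eta> \<cdot> copair3 C a b c \<cdot> cosmash3_incl C A B D)"
    if abc: "a \<in> hom C A S" "b \<in> hom C B S" "c \<in> hom C D S" for a b c A B D
  proof -
    have 3: "i = 0 \<or> i = 1 \<or> i = 2" if "i < 3" for i :: nat using that by auto
    let ?N = "nil2 C S"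
    note nN = nil2_two_nilpotent[OF So]
    have ABD: "A \<in> Obj C" "B \<in> Obj C" "D \<in> Obj C" using abc by auto
    have cn: "cross_null C {..<3::nat} ((!) [?N, ?N, ?N]) ((!) [Id C ?N, Id C ?N, Id C ?N]) ?N"
      using two_nilpotent_iff nN by blast
    have "cross_null C {..<3::nat} ((!) [A, B, D])
        (\<lambda>i. [Id C ?N, Id C ?N, Id C ?N] ! i \<cdot> [\<eta> \<cdot> a, \<eta> \<cdot> b, \<eta> \<cdot> c] ! i) ?N"
      by (rule cross_null_precomp[OF cn]) (use abc \<eta> in \<open>auto dest!: 3\<close>)
    then have "cross_null C {..<3::nat} ((!) [A, B, D]) ((!) [\<eta> \<cdot> a, \<eta> \<cdot> b, \<eta> \<cdot> c]) ?N"
      by (rule cross_null_cong) (use abc \<eta> in \<open>auto dest!: 3\<close>)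
    then have "null C (copair3 C (\<eta> \<cdot> a) (\<eta> \<cdot> b) (\<eta> \<cdot> c) \<cdot> cosmash3_incl C A B D)"
      using cosmash3_cross_null[of "\<eta> \<cdot> a" A ?N "\<eta> \<cdot> b" B "\<eta> \<cdot> c" D] abc \<eta> by simp
    then have "null C ((\<eta> \<cdot> copair3 C a b c) \<cdot> cosmash3_incl C A B D)"
      using copair3_post[OF abc \<eta>] by simp
    then show ?thesis
      using abc \<eta> copair3_props(1-3)[of a b c S A B D] cosmash3_props(2)[OF ABD] kernelD(3)[OF cosmash3_props(1)[OF ABD]]
      by simp
  qed
  have "null C (e \<cdot> t21)" "null C (e \<cdot> t12)"
    using ep(3)[of t21] ep(3)[of t12] t21 t12 \<eta>f[OF ij(1) ij(1) ij(2)] \<eta>f[OF ij(1) ij(2) ij(2)]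
    by (simp_all add: f21_def f12_def)
  then have tk: "sub_le C t21 k" "sub_le C t12 k"
    using kernel_sub_le[OF k, of t21] kernel_sub_le[OF k, of t12] t21 t12 et by simp_all
  have join: "is_join C (img C t12) (img C t21) k"
    unfolding is_join_def
  proof (intro conjI allI impI)
    show "monic C k" by (rule kD)
    show "sub_le C (img C t12) k" "sub_le C (img C t21) k"
      using sub_le_img[of t12 k] sub_le_img[of t21 k] tk kD kt t21 t12 by simp_all
    fix M assume M: "monic C M" "sub_le C (img C t12) M" "sub_le C (img C t21) M"
    have Ma: "M \<in> Arr C" using M by simp
    obtain x where x: "x \<in> Arr C" "Dom C x = Dom C (img C t12)" "Cod C x = Dom C M" "M \<cdot> x = img C t12"
      using M(2) by (rule sub_leE)
    have "Cod C (M \<cdot> x) = Cod C M" using x(1-3) Ma by simp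
    then have Mc: "Cod C M = cosmash C X Y" using x(4) img_props(2)[OF t12(1)] t12 by simp
    have tM: "sub_le C t12 M" "sub_le C t21 M"
      using sub_le_img[of t12 M] sub_le_img[of t21 M] M Mc t21 t12 by simp_all
    have \<iota>M: "monic C (\<iota> \<cdot> M)" by (rule monic_comp) (use cos M Mc in simp_all)
    have post: "sub_le C (\<iota> \<cdot> t) (\<iota> \<cdot> M)" if t: "t \<in> Arr C" "Cod C t = cosmash C X Y" "sub_le C t M" for t
    proof -
      obtain y where y: "y \<in> Arr C" "Dom C y = Dom C t" "Cod C y = Dom C M" "M \<cdot> y = t" using t(3) by (rule sub_leE)
      show ?thesis by (rule sub_leI[of _ y]) (use y Ma Mc ia cos in simp_all)
    qed
    have "null C (\<eta> \<cdot> (\<iota> \<cdot> k))" using ep(3)[OF kt] kD by simp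
    then have "null C (h \<cdot> (\<eta> \<cdot> (\<iota> \<cdot> k)))" by (rule null_comp) (use h \<eta> ia cos kt in simp_all)
    then have pk: "null C (p \<cdot> (\<iota> \<cdot> k))" using h(1) \<eta> ia cos kt by (simp add: comp_eq[OF h(2)])
    have "sub_le C (\<iota> \<cdot> k) \<iota>" by (rule sub_leI[of _ k]) (use ia cos kt in simp_all)
    then have rk: "null C (r1 \<cdot> (\<iota> \<cdot> k))" "null C (r2 \<cdot> (\<iota> \<cdot> k))"
      using cos(4)[of "\<iota> \<cdot> k"] ia cos kt by simp_all
    \<comment> \<open>The minimality clause for \<open>p\<close> concerns subobjects of
      \<open>S\<close>. Therefore \<open>k\<close> and \<open>M\<close> are pushed forward along
      \<open>\<iota>\<close>, and monicity of \<open>\<iota>\<close> brings the inclusion back to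
      the cosmash product.\<close>
    have "sub_le C (\<iota> \<cdot> k) (\<iota> \<cdot> M)"
      by (rule p(3)[OF \<iota>M _ _ _ _ _ rk pk])
        (use post tM t21(1,3) t12(1,3) f21_def f12_def ia cos kt Ma Mc in simp_all)
    then obtain y where "y \<in> Arr C" "Dom C y = Dom C (\<iota> \<cdot> k)" "Cod C y = Dom C (\<iota> \<cdot> M)" "(\<iota> \<cdot> M) \<cdot> y = \<iota> \<cdot> k"
      by (rule sub_leE)
    then have y: "y \<in> Arr C" "Dom C y = Dom C k" "Cod C y = Dom C M" "\<iota> \<cdot> (M \<cdot> y) = \<iota> \<cdot> k"
      using ia cos kt Ma Mc by simp_all
    have "M \<cdot> y = k" by (rule monicD[OF cos(1) y(4)]) (use y(1-3) Ma Mc kt cos in simp_all)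
    then show "sub_le C k M" using sub_leI[of M y k] y Ma by simp
  qed
  define n where "n = N_incl C X Y"
  have n: "is_join C (img C t12) (img C t21) n"
    unfolding n_def N_incl_def join_def t12_def[symmetric] t21_def[symmetric] by (rule someI, rule join)
  have nk: "sub_le C n k" "sub_le C k n" "monic C n"
    using n join unfolding is_join_def by blast+
  have na: "n \<in> Arr C" using nk by simp
  obtain x where x: "x \<in> Arr C" "Dom C x = Dom C n" "Cod C x = Dom C k" "k \<cdot> x = n" using nk(1) by (rule sub_leE)
  have "Cod C (k \<cdot> x) = Cod C k" using x(1-3) kt by simp
  then have nc: "Cod C n = cosmash C X Y" using x(4) kt by simp
  show ?thesis
    unfolding e_def[symmetric] n_def[symmetric]
  proof (rule kernelI)
    fix w assume w: "w \<in> Arr C" "Cod C w = Dom C e"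
    show "sub_le C w n \<longleftrightarrow> null C (e \<cdot> w)"
      using kernel_sub_le[OF k w] sub_le_trans[OF _ nk(1)] sub_le_trans[OF _ nk(2)] na kt by auto
  qed (use et nk nc in simp_all)
qed

end

theorem proposition4p2:
  fixes C :: "('o, 'a) category" and X Y :: 'o
  assumes "semi_abelian C"
    and "X \<in> Obj C" and "Y \<in> Obj C"
  shows "isomorphic C (bilinear_product C X Y) (Cod C (coker C (N_incl C X Y))) \<and>
    eta C X Y \<in> hom C (cosmash C X Y) (bilinear_product C X Y) \<and>
    short_exact C (N_incl C X Y) (eta C X Y)"
proof -
  interpret semi_abelian_category C
    using assms(1) unfolding semi_abelian_def
    by (simp add: semi_abelian_category_def pointed_category_def pointed_category_axioms_def
        semi_abelian_category_axioms_def)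
  note e = eta_props[OF assms(2,3)] and k = N_incl_kernel[OF assms(2,3)]
  have "isomorphic C (Cod C (eta C X Y)) (Cod C (coker C (N_incl C X Y)))"
    using cokernels_isomorphic[OF e(2) k] coker_cokernel[OF e(2) k] by blast
  moreover have "short_exact C (N_incl C X Y) (eta C X Y)"
    unfolding short_exact_def using k cover_cokernel[OF e(2) k] by blast
  ultimately show ?thesis using e(1) by simp
qed

end
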